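(* Consider the problem $\inf_{\mu\in\mathcal{M}(\Omega)}J(\mu)$, $J(\mu)=F(K\mu)+\|\mu\|_{\mathrm{KR}_p^{\alpha,\beta}}$, and let Assumptions (B1)--(B5) stated in the context hold. Then the accelerated generalized conditional gradient (AGCG) algorithm described in the context either terminates after a finite number of steps outputting a minimizer of $J$, or, denoting by $\mu_k$ the sequence generated by it, there exist constants $C>0$ and $\zeta\in(0,1)$ such that $$J(\mu_k)-\min_{\mu\in\mathcal{M}(\Omega)}J(\mu)\le C\zeta^k$$ for all $k\in\mathbb{N}$ large enough. Moreover, $\mu_k$ converges weakly* to $\bar\mu$, the unique minimizer of $J$.
   Context: Standing assumptions: $\Omega\subset\mathbb{R}^n$ is convex and compact, $p\in(0,1]$, $\alpha>0$, $\beta>0$, $2\alpha-\beta>0$. $\mathcal{M}(\Omega)=\mathcal{C}(\Omega)^*$ is the space of finite signed Radon measures. $Y$ is a Hilbert space, $K:\mathcal{M}(\Omega)\to Y$ is linear and weak*-to-strong continuous, $F:Y\to\mathbb{R}$ is strictly convex, bounded from below, Fr\'echet differentiable, and $\nabla F$ is Lipschitz continuous on compact sets. $K_*:Y\to\mathcal{C}(\Omega)$ is the pre-adjoint: $\langle K_*v,\mu\rangle=(v,K\mu)_Y$. $W_p(\mu,\nu):=\inf\{\int|x-y|^p\,d\gamma:\gamma\in\Pi(\mu,\nu)\}$ for nonnegative measures (no $1/p$-th power), with $\Pi(\mu,\nu)$ the nonnegative measures on $\Omega\times\Omega$ with marginals $\mu,\nu$. $\|\mu\|_{\mathrm{KR}_p^{\alpha,\beta}}:=\inf\{W_p(\nu_+,\nu_-)+\frac\beta2|\nu|(\Omega)+\alpha|\mu-\nu|(\Omega):\nu\in\mathcal{M}(\Omega),\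 \nu(\Omega)=0\}$, with $\nu_\pm$ the positive/negative parts of $\nu$. $B:=\{\mu:\|\mu\|_{\mathrm{KR}_p^{\alpha,\beta}}\le1\}$, $\operatorname{Ext}(B)$ is its set of extremal points, and $\mathcal{D}_\beta(x,y):=\frac{1}{\beta+|x-y|^p}(\delta_x-\delta_y)$ for $x\ne y$. For $q\in\mathcal{C}(\Omega)$, $\Psi_q(x,y):=\frac{q(x)-q(y)}{|x-y|^p+\beta}$ on $\Omega\times\Omega$. Since $F$ is strictly convex, $\bar y:=K\bar\mu$ is the same for all minimizers $\bar\mu$ of $J$ (the unique optimal observation); put $\bar q:=-K_*\nabla F(\bar y)$. $\operatorname{Lip}(\Omega)$ is the Banach space of Lipschitz functions on $\Omega$. (B1) $F$ is strongly convex around $\bar y$: there are a neighborhood $\mathcal{N}(\bar y)$ and $\theta>0$ with $(\nabla F(y_1)-\nabla F(y_2),y_1-y_2)\ge\theta\|y_1-y_2\|_Y^2$ for all $y_1,y_2\in\mathcal{N}(\bar y)$. (B2) There are $\bar N_1,\bar N_2\in\mathbb{N}$ (including zero) with $\bar N_1+\bar N_2>0$ and finite sets of points $\{\bar z_i\}_{i=1}^{\bar N_1}\subset\operatorname{int}\Omega$, $\{(\bar x_j,\bar y_j)\}_{j=1}^{\bar N_2}\subset\operatorname{int}\Omega\times\operatorname{int}\Omega$ with $\{z\in\Omega:\bar q(z)=\pm\alpha\}=\{\bar z_i\}_{i=1}^{\bar N_1}$ (i.e. $|\bar q(z)|=\alpha$), $\{(x,y)\in\Omega\times\Omega:\Psi_{\bar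 q}(x,y)=1\}=\{(\bar x_j,\bar y_j)\}_{j=1}^{\bar N_2}$, and $0<|\bar x_j-\bar y_j|^p<2\alpha-\beta$. (B3) For every $y\in Y$, $K_*y\in\operatorname{Lip}(\Omega)$ and $K_*:Y\to\operatorname{Lip}(\Omega)$ is continuous. Moreover $\bar q\in\mathcal{C}^2(\Omega)$ and $\det(\nabla^2\bar q(\bar z_i))\ne0$, $\det(\nabla^2\Psi_{\bar q}(\bar x_j,\bar y_j))\ne0$ for all $i=1,\dots,\bar N_1$, $j=1,\dots,\bar N_2$. (B4) The set $\{K(\delta_{\bar z_i})\}_{i=1}^{\bar N_1}\cup\{K(\mathcal{D}_\beta(\bar x_j,\bar y_j))\}_{j=1}^{\bar N_2}$ is linearly independent. Under (B2) and (B4) the minimizer $\bar\mu$ of $J$ is unique and has the form $\bar\mu=\sum_{i=1}^{\bar N_1}(\bar q(\bar z_i)/\alpha)\bar\zeta_i\delta_{\bar z_i}+\sum_{j=1}^{\bar N_2}\bar\lambda_j\mathcal{D}_\beta(\bar x_j,\bar y_j)$ with (unique) $\bar\zeta_i,\bar\lambda_j\ge0$. (B5) $\bar\zeta_i>0$ and $\bar\lambda_j>0$ for all $i=1,\dots,\bar N_1$, $j=1,\dots,\bar N_2$. For a finite set $\mathcal{A}=\{\mu_j\}_{j=1}^N\subset\operatorname{Ext}(B)$ let $(\mathcal{P}(\mathcal{A}))$ be the problem $\min_{\lambda\in\mathbb{R}_+^N}F\big(\sum_{j=1}^N\lambda_jK\mu_j\big)+\sum_{j=1}^N\lambda_j$,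 where $\mathbb{R}_+^N$ is the set of componentwise nonnegative vectors. AGCG algorithm. Input: a finite set $\mathcal{A}_0=\{\mu_j^0\}_{j=1}^{N_0}\subset\operatorname{Ext}(B)$. Initialization: let $\lambda^0$ solve $(\mathcal{P}(\mathcal{A}_0))$, set $\mu_1:=\sum_j\lambda_j^0\mu_j^0$ and $\mathcal{A}_1:=\mathcal{A}_0\setminus\{\mu_j^0:\lambda_j^0=0\}$. For $k=1,2,\dots$: (i) compute $q_k=-K_*\nabla F(K\mu_k)$, $\Psi_{q_k}$, and $z_k\in\arg\max_{z\in\Omega}|q_k(z)|$, $(x_k,y_k)\in\arg\max_{(x,y)\in\Omega\times\Omega}\Psi_{q_k}(x,y)$. (ii) If $\max_z|q_k(z)|\le\alpha$ and $\max_{(x,y)}\Psi_{q_k}(x,y)\le1$, terminate with output $\mu_k$. Otherwise, if $\max_z|q_k(z)|/\alpha\ge\max_{(x,y)}\Psi_{q_k}(x,y)$, set $\widehat\mu_k=\operatorname{sign}(q_k(z_k))\delta_{z_k}/\alpha$; else set $\widehat\mu_k=\mathcal{D}_\beta(x_k,y_k)$. (iii) Set $\mathcal{A}_k^+:=\mathcal{A}_k\cup\{\widehat\mu_k\}=\{\mu_j^{k,+}\}_{j=1}^{N_k^+}$, let $\lambda^{k,+}$ solve $(\mathcal{P}(\mathcal{A}_k^+))$, and set $\mu_{k+1}:=\sum_j\lambda_j^{k,+}\mu_j^{k,+}$, $\mathcal{A}_{k+1}:=\mathcal{A}_k^+\setminus\{\mu_j^{k,+}:\lambda_j^{k,+}=0\}$.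 *)

theory Defs
  imports "HOL-Analysis.Analysis"
begin

section \<open>Finite signed Borel measures\<close>

text \<open>
  A finite signed measure is a real-valued countably additive function on the Borel sets, extended
  by 0 to the non-Borel sets so that equality of measures is equality in HOL. On a compact subset
  of a Euclidean space every such measure is automatically Radon.
\<close>

definition is_signed_measure :: "('a::topological_space set \<Rightarrow> real) \<Rightarrow> bool" where
  "is_signed_measure m \<longleftrightarrow>
     (\<forall>A. A \<notin> sets borel \<longrightarrow> m A = 0) \<and>
     (\<forall>A::nat \<Rightarrow> 'a set. range A \<subseteq> sets borel \<longrightarrow> disjoint_family A \<longrightarrow>
        (\<lambda>i. m (A i)) sums m (\<Union>i. A i))"

lemma is_signed_measure_zero: "is_signed_measure (\<lambda>_. 0)"
  by (simp add: is_signed_measure_def)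

typedef (overloaded) ('a::topological_space) signed_measure =
    "{m :: 'a set \<Rightarrow> real. is_signed_measure m}"
  morphisms smeasure Abs_signed_measure
  using is_signed_measure_zero by blast

setup_lifting type_definition_signed_measure

instantiation signed_measure :: (topological_space) real_vector
begin

lift_definition zero_signed_measure :: "'a signed_measure" is "\<lambda>_. 0"
  by (rule is_signed_measure_zero)

lift_definition plus_signed_measure ::
  "'a signed_measure \<Rightarrow> 'a signed_measure \<Rightarrow> 'a signed_measure" is "\<lambda>m n A. m A + n A"
  by (auto simp: is_signed_measure_def intro: sums_add)

lift_definition uminus_signed_measure ::
  "'a signed_measure \<Rightarrow> 'a signed_measure" is "\<lambda>m A. - m A"
  by (auto simp: is_signed_measure_def intro: sums_minus)

lift_definition minus_signed_measure ::
  "'a signed_measure \<Rightarrow> 'a signed_measure \<Rightarrow> 'a signed_measure" is "\<lambda>m n A. m A - n A"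
  by (auto simp: is_signed_measure_def intro: sums_diff)

lift_definition scaleR_signed_measure ::
  "real \<Rightarrow> 'a signed_measure \<Rightarrow> 'a signed_measure" is "\<lambda>c m A. c * m A"
  by (auto simp: is_signed_measure_def intro: sums_mult)

instance
  by standard (transfer; simp add: algebra_simps fun_eq_iff)+

end

lift_definition dirac :: "'a::topological_space \<Rightarrow> 'a signed_measure"
  is "\<lambda>x A. if A \<in> sets borel \<and> x \<in> A then 1 else 0"
proof -
  fix x :: 'a
  have sums: "(\<lambda>i. if A i \<in> sets borel \<and> x \<in> A i then 1 else 0) sums
          (if (\<Union>i. A i) \<in> sets borel \<and> x \<in> (\<Union>i. A i) then 1 else (0::real))"
    if A: "range A \<subseteq> sets borel" "disjoint_family A" for A :: "nat \<Rightarrow> 'a set"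
  proof (cases "x \<in> (\<Union>i. A i)")
    case True
    then obtain k where k: "x \<in> A k" by blast
    have iff: "A i \<in> sets borel \<and> x \<in> A i \<longleftrightarrow> i = k" for i
      using A(1) k disjoint_family_onD[OF A(2), of i k] by blast
    have "(\<Union>i. A i) \<in> sets borel"
      using A(1) by (rule sets.countable_UN)
    with True have "(\<Union>i. A i) \<in> sets borel \<and> x \<in> (\<Union>i. A i)" by blast
    with sums_single[of k "\<lambda>_. 1::real"] show ?thesis
      by (simp only: iff simp_thms if_True)
  next
    case False
    then have "\<not> (A i \<in> sets borel \<and> x \<in> A i)" for i by blast
    with False show ?thesis by (simp only: simp_thms if_False sums_zero)
  qed
  show "is_signed_measure (\<lambda>A. if A \<in> sets borel \<and> x \<in> A then 1 else (0::real))"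
    unfolding is_signed_measure_def
  proof (intro conjI allI impI)
    fix A :: "'a set"
    assume "A \<notin> sets borel"
    then show "(if A \<in> sets borel \<and> x \<in> A then 1 else (0::real)) = 0" by (simp only: simp_thms if_False)
  qed (rule sums)
qed

text \<open>The space of finite signed measures on \<open>\<Omega>\<close>, as the measures carried by \<open>\<Omega>\<close>.\<close>

definition measures_on :: "'a::topological_space set \<Rightarrow> 'a signed_measure set" where
  "measures_on \<Omega> = {\<mu>. \<forall>A\<in>sets borel. smeasure \<mu> A = smeasure \<mu> (A \<inter> \<Omega>)}"

text \<open>
  Jordan decomposition: \<open>\<mu>\<^sub>+(A) = sup {\<mu>(B) | B \<subseteq> A Borel}\<close> and \<open>\<mu>\<^sub>- = (-\<mu>)\<^sub>+\<close>, as measures of the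
  library.
\<close>

definition pos_part :: "'a::topological_space signed_measure \<Rightarrow> 'a measure" where
  "pos_part \<mu> = measure_of UNIV (sets borel)
     (\<lambda>A. ennreal (SUP B\<in>{B \<in> sets borel. B \<subseteq> A}. smeasure \<mu> B))"

definition neg_part :: "'a::topological_space signed_measure \<Rightarrow> 'a measure" where
  "neg_part \<mu> = pos_part (- \<mu>)"

definition variation :: "'a::topological_space signed_measure \<Rightarrow> 'a set \<Rightarrow> real" where
  "variation \<mu> A = measure (pos_part \<mu>) A + measure (neg_part \<mu>) A"

text \<open>The integral is restricted to \<open>\<Omega>\<close> because the values of \<open>f\<close> outside \<open>\<Omega>\<close> are irrelevant.\<close>

definition pairing :: "'a::topological_space set \<Rightarrow> ('a \<Rightarrow> real) \<Rightarrow> 'a signed_measure \<Rightarrow> real" where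
  "pairing \<Omega> f \<mu> = (LINT x:\<Omega>|pos_part \<mu>. f x) - (LINT x:\<Omega>|neg_part \<mu>. f x)"

definition weak_star_converges ::
  "'a::topological_space set \<Rightarrow> (nat \<Rightarrow> 'a signed_measure) \<Rightarrow> 'a signed_measure \<Rightarrow> bool" where
  "weak_star_converges \<Omega> \<mu>s \<mu> \<longleftrightarrow>
     (\<forall>f. continuous_on \<Omega> f \<longrightarrow> (\<lambda>k. pairing \<Omega> f (\<mu>s k)) \<longlonglongrightarrow> pairing \<Omega> f \<mu>)"


section \<open>The Kantorovich--Rubinstein norm\<close>

text \<open>
  No restriction to \<open>\<Omega> \<times> \<Omega>\<close> is needed: couplings of measures carried by \<open>\<Omega>\<close> are carried by
  \<open>\<Omega> \<times> \<Omega>\<close>. The infimum \<open>wasserstein\<close> is only used for marginals of equal finite mass on a compact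
  set, where the set of couplings is nonempty and the cost is integrable.
\<close>

definition couplings ::
  "'a::topological_space measure \<Rightarrow> 'a measure \<Rightarrow> ('a \<times> 'a) measure set" where
  "couplings M N = {\<gamma>. sets \<gamma> = sets borel \<and> distr \<gamma> borel fst = M \<and> distr \<gamma> borel snd = N}"

definition wasserstein :: "real \<Rightarrow> 'a::euclidean_space measure \<Rightarrow> 'a measure \<Rightarrow> real" where
  "wasserstein p M N = (INF \<gamma>\<in>couplings M N. LINT w|\<gamma>. norm (fst w - snd w) powr p)"

definition KR_norm ::
  "'a::euclidean_space set \<Rightarrow> real \<Rightarrow> real \<Rightarrow> real \<Rightarrow> 'a signed_measure \<Rightarrow> real" where
  "KR_norm \<Omega> p \<alpha> \<beta> \<mu> = (INF \<nu>\<in>{\<nu> \<in> measures_on \<Omega>. smeasure \<nu> \<Omega> = 0}.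
     wasserstein p (pos_part \<nu>) (neg_part \<nu>) + \<beta> / 2 * variation \<nu> \<Omega> + \<alpha> * variation (\<mu> - \<nu>) \<Omega>)"

definition KR_ball ::
  "'a::euclidean_space set \<Rightarrow> real \<Rightarrow> real \<Rightarrow> real \<Rightarrow> 'a signed_measure set" where
  "KR_ball \<Omega> p \<alpha> \<beta> = {\<mu> \<in> measures_on \<Omega>. KR_norm \<Omega> p \<alpha> \<beta> \<mu> \<le> 1}"

definition dipole :: "real \<Rightarrow> real \<Rightarrow> 'a::euclidean_space \<Rightarrow> 'a \<Rightarrow> 'a signed_measure" where
  "dipole p \<beta> x y = (1 / (\<beta> + norm (x - y) powr p)) *\<^sub>R (dirac x - dirac y)"

definition Psi :: "real \<Rightarrow> real \<Rightarrow> ('a::euclidean_space \<Rightarrow> real) \<Rightarrow> 'a \<times> 'a \<Rightarrow> real" where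
  "Psi p \<beta> q = (\<lambda>(x, y). (q x - q y) / (norm (x - y) powr p + \<beta>))"


section \<open>The minimization problem\<close>

definition linear_on_measures ::
  "'a::topological_space set \<Rightarrow> ('a signed_measure \<Rightarrow> 'y::real_vector) \<Rightarrow> bool" where
  "linear_on_measures \<Omega> K \<longleftrightarrow>
     (\<forall>\<mu>\<in>measures_on \<Omega>. \<forall>\<nu>\<in>measures_on \<Omega>. K (\<mu> + \<nu>) = K \<mu> + K \<nu>) \<and>
     (\<forall>c. \<forall>\<mu>\<in>measures_on \<Omega>. K (c *\<^sub>R \<mu>) = c *\<^sub>R K \<mu>)"

text \<open>
  Weak*-to-strong continuity is sequential, as usual for such operators: a linear map that is
  continuous for the full weak* topology has finite rank.
\<close>

definition weak_star_to_strong_continuous ::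
  "'a::topological_space set \<Rightarrow> ('a signed_measure \<Rightarrow> 'y::real_normed_vector) \<Rightarrow> bool" where
  "weak_star_to_strong_continuous \<Omega> K \<longleftrightarrow>
     (\<forall>\<mu>s. \<forall>\<mu>\<in>measures_on \<Omega>. range \<mu>s \<subseteq> measures_on \<Omega> \<longrightarrow> weak_star_converges \<Omega> \<mu>s \<mu> \<longrightarrow>
        (\<lambda>k. K (\<mu>s k)) \<longlonglongrightarrow> K \<mu>)"

definition is_preadjoint ::
  "'a::topological_space set \<Rightarrow> ('a signed_measure \<Rightarrow> 'y::real_inner) \<Rightarrow> ('y \<Rightarrow> 'a \<Rightarrow> real) \<Rightarrow> bool"
  where
  "is_preadjoint \<Omega> K Kstar \<longleftrightarrow>
     (\<forall>v. continuous_on \<Omega> (Kstar v) \<and> (\<forall>\<mu>\<in>measures_on \<Omega>. pairing \<Omega> (Kstar v) \<mu> = v \<bullet> K \<mu>))"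

definition strictly_convex :: "('y::real_vector \<Rightarrow> real) \<Rightarrow> bool" where
  "strictly_convex F \<longleftrightarrow>
     (\<forall>x y t. x \<noteq> y \<longrightarrow> 0 < t \<longrightarrow> t < 1 \<longrightarrow>
        F ((1 - t) *\<^sub>R x + t *\<^sub>R y) < (1 - t) * F x + t * F y)"

definition objective ::
  "'a::euclidean_space set \<Rightarrow> real \<Rightarrow> real \<Rightarrow> real \<Rightarrow> ('a signed_measure \<Rightarrow> 'y) \<Rightarrow> ('y \<Rightarrow> real) \<Rightarrow>
   'a signed_measure \<Rightarrow> real" where
  "objective \<Omega> p \<alpha> \<beta> K F \<mu> = F (K \<mu>) + KR_norm \<Omega> p \<alpha> \<beta> \<mu>"

definition is_minimizer ::
  "'a::euclidean_space set \<Rightarrow> real \<Rightarrow> real \<Rightarrow> real \<Rightarrow> ('a signed_measure \<Rightarrow> 'y) \<Rightarrow> ('y \<Rightarrow> real) \<Rightarrow>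
   'a signed_measure \<Rightarrow> bool" where
  "is_minimizer \<Omega> p \<alpha> \<beta> K F \<mu> \<longleftrightarrow>
     is_arg_min (objective \<Omega> p \<alpha> \<beta> K F) (\<lambda>\<mu>. \<mu> \<in> measures_on \<Omega>) \<mu>"

definition optimal_observation ::
  "'a::euclidean_space set \<Rightarrow> real \<Rightarrow> real \<Rightarrow> real \<Rightarrow> ('a signed_measure \<Rightarrow> 'y) \<Rightarrow> ('y \<Rightarrow> real) \<Rightarrow> 'y"
  where
  "optimal_observation \<Omega> p \<alpha> \<beta> K F = (THE y. \<exists>\<mu>. is_minimizer \<Omega> p \<alpha> \<beta> K F \<mu> \<and> y = K \<mu>)"

definition dual_variable :: "('y::real_vector \<Rightarrow> 'a \<Rightarrow> real) \<Rightarrow> ('y \<Rightarrow> 'y) \<Rightarrow> 'y \<Rightarrow> 'a \<Rightarrow> real" where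
  "dual_variable Kstar gradF y = (\<lambda>x. - Kstar (gradF y) x)"


section \<open>Regularity notions\<close>

text \<open>\<open>L-lipschitz_on\<close> includes \<open>0 \<le> L\<close>, so the infimum is the best Lipschitz constant.\<close>

definition Lip_norm :: "'a::metric_space set \<Rightarrow> ('a \<Rightarrow> real) \<Rightarrow> real" where
  "Lip_norm \<Omega> f = (SUP x\<in>\<Omega>. \<bar>f x\<bar>) + Inf {L. L-lipschitz_on \<Omega> f}"

definition continuous_into_Lip ::
  "'a::metric_space set \<Rightarrow> ('y::real_normed_vector \<Rightarrow> 'a \<Rightarrow> real) \<Rightarrow> bool" where
  "continuous_into_Lip \<Omega> T \<longleftrightarrow>
     (\<forall>y. \<exists>L. L-lipschitz_on \<Omega> (T y)) \<and>
     (\<forall>y. ((\<lambda>v. Lip_norm \<Omega> (\<lambda>x. T v x - T y x)) \<longlongrightarrow> 0) (at y))"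

text \<open>
  \<open>C\<^sup>2\<close> on the closure of an open set: twice continuously differentiable in the interior, with
  all derivatives up to order two extending continuously to \<open>\<Omega>\<close>.
\<close>

definition C2_on :: "(real^'n) set \<Rightarrow> (real^'n \<Rightarrow> real) \<Rightarrow> bool" where
  "C2_on \<Omega> f \<longleftrightarrow> continuous_on \<Omega> f \<and>
     (\<exists>(g :: real^'n \<Rightarrow> real^'n) (H :: real^'n \<Rightarrow> real^'n^'n).
        continuous_on \<Omega> g \<and> continuous_on \<Omega> H \<and>
        (\<forall>x\<in>interior \<Omega>. GDERIV f x :> g x \<and> (g has_derivative (\<lambda>h. H x *v h)) (at x)))"

definition partial_deriv :: "'n::finite \<Rightarrow> (real^'n \<Rightarrow> real) \<Rightarrow> real^'n \<Rightarrow> real" where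
  "partial_deriv i f x = deriv (\<lambda>t. f (x + t *\<^sub>R axis i 1)) 0"

definition hessian :: "(real^'n::finite \<Rightarrow> real) \<Rightarrow> real^'n \<Rightarrow> real^'n^'n" where
  "hessian f x = (\<chi> i j. partial_deriv i (partial_deriv j f) x)"

text \<open>
  Identification of \<open>\<real>\<^sup>n \<times> \<real>\<^sup>n\<close> with \<open>\<real>\<^sup>2\<^sup>n\<close>, indexed by \<open>'n + 'n\<close>, so that a function of two points
  has a \<open>2n \<times> 2n\<close> Hessian matrix.
\<close>

definition vec_join :: "(real^'n::finite) \<times> (real^'n) \<Rightarrow> real^('n + 'n)" where
  "vec_join w = (\<chi> k. case k of Inl i \<Rightarrow> fst w $ i | Inr i \<Rightarrow> snd w $ i)"

definition vec_split :: "real^('n + 'n) \<Rightarrow> (real^'n::finite) \<times> (real^'n)" where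
  "vec_split v = ((\<chi> i. v $ Inl i), (\<chi> i. v $ Inr i))"

definition hessian2 ::
  "((real^'n::finite) \<times> (real^'n) \<Rightarrow> real) \<Rightarrow> (real^'n) \<times> (real^'n) \<Rightarrow> real^('n + 'n)^('n + 'n)" where
  "hessian2 f w = hessian (\<lambda>v. f (vec_split v)) (vec_join w)"

text \<open>Linear independence of a family; in particular its members are pairwise distinct.\<close>

definition independent_family :: "'i set \<Rightarrow> ('i \<Rightarrow> 'y::real_vector) \<Rightarrow> bool" where
  "independent_family I v \<longleftrightarrow> inj_on v I \<and> independent (v ` I)"


section \<open>The algorithm\<close>

text \<open>
  The weights of a finite set \<open>A\<close> of measures are indexed by the measures themselves; values of
  \<open>l\<close> outside \<open>A\<close> are irrelevant.
\<close>

definition solves_P ::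
  "('a::topological_space signed_measure \<Rightarrow> 'y::real_vector) \<Rightarrow> ('y \<Rightarrow> real) \<Rightarrow>
   'a signed_measure set \<Rightarrow> ('a signed_measure \<Rightarrow> real) \<Rightarrow> bool" where
  "solves_P K F A l \<longleftrightarrow>
     is_arg_min (\<lambda>l. F (\<Sum>m\<in>A. l m *\<^sub>R K m) + (\<Sum>m\<in>A. l m)) (\<lambda>l. \<forall>m\<in>A. 0 \<le> l m) l"

text \<open>\<open>A'\<close> and \<open>\<mu>'\<close> arise from the active set \<open>A\<close> by solving the problem above and pruning.\<close>

definition resolve ::
  "('a::topological_space signed_measure \<Rightarrow> 'y::real_vector) \<Rightarrow> ('y \<Rightarrow> real) \<Rightarrow>
   'a signed_measure set \<Rightarrow> 'a signed_measure set \<Rightarrow> 'a signed_measure \<Rightarrow> bool" where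
  "resolve K F A A' \<mu>' \<longleftrightarrow>
     (\<exists>l. solves_P K F A l \<and> \<mu>' = (\<Sum>m\<in>A. l m *\<^sub>R m) \<and> A' = A - {m \<in> A. l m = 0})"

definition AGCG_stops ::
  "'a::euclidean_space set \<Rightarrow> real \<Rightarrow> real \<Rightarrow> real \<Rightarrow> ('a \<Rightarrow> real) \<Rightarrow> bool" where
  "AGCG_stops \<Omega> p \<alpha> \<beta> q \<longleftrightarrow>
     (SUP z\<in>\<Omega>. \<bar>q z\<bar>) \<le> \<alpha> \<and> (SUP w\<in>\<Omega> \<times> \<Omega>. Psi p \<beta> q w) \<le> 1"

definition AGCG_atom ::
  "'a::euclidean_space set \<Rightarrow> real \<Rightarrow> real \<Rightarrow> real \<Rightarrow> ('a \<Rightarrow> real) \<Rightarrow> 'a signed_measure \<Rightarrow> bool" where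
  "AGCG_atom \<Omega> p \<alpha> \<beta> q \<mu>hat \<longleftrightarrow>
     (\<exists>z x y.
        is_arg_max (\<lambda>z. \<bar>q z\<bar>) (\<lambda>z. z \<in> \<Omega>) z \<and>
        is_arg_max (Psi p \<beta> q) (\<lambda>w. w \<in> \<Omega> \<times> \<Omega>) (x, y) \<and>
        \<mu>hat = (if (SUP z\<in>\<Omega>. \<bar>q z\<bar>) / \<alpha> \<ge> (SUP w\<in>\<Omega> \<times> \<Omega>. Psi p \<beta> q w)
                then (sgn (q z) / \<alpha>) *\<^sub>R dirac z
                else dipole p \<beta> x y))"

text \<open>
  A run of the algorithm from the input \<open>A 0\<close>, with active sets \<open>A k\<close> and iterates \<open>\<mu> k\<close>
  (\<open>\<mu> 0\<close> is not used). Iteration \<open>k\<close> is constrained only if the stopping test has failed at all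
  steps \<open>1, \<dots>, k\<close>; thus both finite and infinite runs are covered, and the entries after
  termination are arbitrary.
\<close>

definition AGCG_run ::
  "'a::euclidean_space set \<Rightarrow> real \<Rightarrow> real \<Rightarrow> real \<Rightarrow>
   ('a signed_measure \<Rightarrow> 'y::real_vector) \<Rightarrow> ('y \<Rightarrow> 'a \<Rightarrow> real) \<Rightarrow> ('y \<Rightarrow> real) \<Rightarrow> ('y \<Rightarrow> 'y) \<Rightarrow>
   (nat \<Rightarrow> 'a signed_measure set) \<Rightarrow> (nat \<Rightarrow> 'a signed_measure) \<Rightarrow> bool" where
  "AGCG_run \<Omega> p \<alpha> \<beta> K Kstar F gradF A \<mu> \<longleftrightarrow>
     finite (A 0) \<and> A 0 \<subseteq> {m. m extreme_point_of (KR_ball \<Omega> p \<alpha> \<beta>)} \<and>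
     resolve K F (A 0) (A 1) (\<mu> 1) \<and>
     (\<forall>k\<ge>1. (\<forall>j\<in>{1..k}. \<not> AGCG_stops \<Omega> p \<alpha> \<beta> (dual_variable Kstar gradF (K (\<mu> j)))) \<longrightarrow>
        (\<exists>\<mu>hat. AGCG_atom \<Omega> p \<alpha> \<beta> (dual_variable Kstar gradF (K (\<mu> k))) \<mu>hat \<and>
                resolve K F (A k \<union> {\<mu>hat}) (A (k + 1)) (\<mu> (k + 1))))"

definition AGCG_terminates_at ::
  "'a::euclidean_space set \<Rightarrow> real \<Rightarrow> real \<Rightarrow> real \<Rightarrow>
   ('a signed_measure \<Rightarrow> 'y::real_vector) \<Rightarrow> ('y \<Rightarrow> 'a \<Rightarrow> real) \<Rightarrow> ('y \<Rightarrow> 'y) \<Rightarrow>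
   (nat \<Rightarrow> 'a signed_measure) \<Rightarrow> nat \<Rightarrow> bool" where
  "AGCG_terminates_at \<Omega> p \<alpha> \<beta> K Kstar gradF \<mu> k \<longleftrightarrow>
     1 \<le> k \<and> AGCG_stops \<Omega> p \<alpha> \<beta> (dual_variable Kstar gradF (K (\<mu> k))) \<and>
     (\<forall>j\<in>{1..<k}. \<not> AGCG_stops \<Omega> p \<alpha> \<beta> (dual_variable Kstar gradF (K (\<mu> j))))"

end

theory Submission
  imports Defs "HOL-Probability.Helly_Selection"
begin

text \<open>
  The measures produced by the algorithm are combinations of two kinds of elementary measures: a signed
  point mass \<open>\<plusminus>\<delta>\<^sub>x\<close>, of cost \<open>\<alpha>\<close>, and a dipole \<open>\<delta>\<^sub>x - \<delta>\<^sub>y\<close>, of cost \<open>|x - y|\<^sup>p + \<beta>\<close>. They are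
  parametrized by a compact set \<open>params\<close>, and a positive measure \<open>\<tau>\<close> on \<open>params\<close> yields a measure
  \<open>superpose \<tau>\<close> together with a cost \<open>tcost \<tau>\<close>, both linear in \<open>\<tau>\<close>. Every measure \<open>\<mu>\<close> is a superposition
  of cost at most its Kantorovich--Rubinstein norm (\<open>kr_attained\<close>). Conversely the cost bounds the norm
  as soon as no point is both a source and a sink of dipoles (\<open>kr_superpose_le\<close>). As \<open>\<beta> > 0\<close>, a
  feasible dual variable that is tight on the dipoles used excludes such points
  (\<open>kr_le_tcost_if_complementary\<close>).

  In terms of \<open>\<tau>\<close> the problem is to minimize the smooth function \<open>F \<circ> K \<circ> superpose\<close> plus a linear cost.
  Weak* compactness of bounded sets of positive measures gives a minimizer, and its first-order conditions
  are feasibility of \<open>q = - K\<^sub>* \<nabla>F\<close> (namely \<open>|q| \<le> \<alpha>\<close> and \<open>\<Psi>\<^sub>q \<le> 1\<close>) and complementarity. Together they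
  certify a minimizer of \<open>J\<close> (\<open>certificate\<close>). The stopping test is feasibility, while complementarity
  holds for every iterate by optimality of its weights; hence termination yields a minimizer. At the
  optimum, complementarity confines the minimizers to combinations of the finitely many contact atoms, and
  linear independence of their observations singles out \<open>\<mu>bar\<close> (\<open>minimizer_iff\<close>).

  For an infinite run only the observations \<open>K m\<close> of the active measures matter, so that the rate is
  proved for an abstract scheme in \<open>Y\<close> (locale \<open>corrective_scheme\<close>). Let \<open>r\<close> be the optimality gap, with the
  norm replaced by the sum of the weights \<open>\<lambda>\<^sub>m\<close>. It splits into the Bregman distance of \<open>F\<close> between the
  current and the optimal observation, and the sum of \<open>\<lambda>\<^sub>m (1 - \<langle>qbar, m\<rangle>)\<close> (\<open>r_decomp\<close>). By strong
  convexity the first part controls the squared error of the observation. By nondegeneracy of the Hessians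
  the second part controls the weighted squared distances of the active observations to those of the
  contact atoms (\<open>growth_At\<close>). The active measures therefore form clusters around the contact atoms, and
  each cluster keeps a mass bounded away from zero, because the optimal weights are positive. The new atom
  lies within \<open>O(\<surd>r)\<close> of its contact atom. Moving a fixed small fraction of the mass of that cluster onto
  the new atom changes the observation by \<open>O(\<surd>r)\<close> and leaves the sum of the weights unchanged; it lowers
  the objective to first order by a multiple of \<open>r\<close>, since the dual violation at the new atom bounds \<open>r\<close>. As
  the algorithm re-optimizes all weights, it does at least as well, and \<open>r\<close> contracts by a fixed factor
  (\<open>linear_rate\<close>).

  Finally, for large \<open>k\<close> no two active dipoles are chained, again because \<open>\<beta> > 0\<close>; thus the sum of the
  weights bounds the norm of the iterate (\<open>kr_le_W\<close>), and the rate passes to \<open>J\<close>. Weak* convergence follows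
  from compactness and uniqueness of the minimizer (\<open>weak_star_limit\<close>).
\<close>

section \<open>Jordan decomposition of signed measures\<close>

lemma smeasure_signed: "is_signed_measure (smeasure \<mu>)"
  using smeasure[of \<mu>] by simp

lemma smeasure_notin: "A \<notin> sets borel \<Longrightarrow> smeasure \<mu> A = 0"
  using smeasure_signed[of \<mu>] by (simp add: is_signed_measure_def)

lemma smeasure_sums:
  "range A \<subseteq> sets borel \<Longrightarrow> disjoint_family A \<Longrightarrow> (\<lambda>i::nat. smeasure \<mu> (A i)) sums smeasure \<mu> (\<Union>i. A i)"
  using smeasure_signed[of \<mu>] by (simp add: is_signed_measure_def)

lemma smeasure_eqI:
  assumes "\<And>A. A \<in> sets borel \<Longrightarrow> smeasure \<mu> A = smeasure \<nu> A"
  shows "\<mu> = \<nu>"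
proof -
  have "smeasure \<mu> = smeasure \<nu>"
    by (rule ext) (metis assms smeasure_notin)
  then show ?thesis by (simp add: smeasure_inject)
qed

lemma smeasure_Abs: "is_signed_measure m \<Longrightarrow> smeasure (Abs_signed_measure m) = m"
  by (simp add: Abs_signed_measure_inverse)

lemmas smeasure_simps = zero_signed_measure.rep_eq plus_signed_measure.rep_eq
  minus_signed_measure.rep_eq uminus_signed_measure.rep_eq scaleR_signed_measure.rep_eq

lemma smeasure_sum: "smeasure (\<Sum>i\<in>I. \<mu> i) A = (\<Sum>i\<in>I. smeasure (\<mu> i) A)"
  by (induction I rule: infinite_finite_induct) (simp_all add: smeasure_simps)

lemma smeasure_empty [simp]: "smeasure \<mu> {} = 0"
proof -
  have "(\<lambda>i::nat. smeasure \<mu> {}) sums smeasure \<mu> (\<Union>i::nat. {})"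
    by (rule smeasure_sums) (auto simp: disjoint_family_on_def)
  then have "(\<lambda>i::nat. smeasure \<mu> {}) \<longlonglongrightarrow> 0" by (rule sums_summable[THEN summable_LIMSEQ_zero])
  then show ?thesis by (simp add: LIMSEQ_const_iff)
qed

lemma smeasure_Un:
  assumes "A \<in> sets borel" "B \<in> sets borel" "A \<inter> B = {}"
  shows "smeasure \<mu> (A \<union> B) = smeasure \<mu> A + smeasure \<mu> B"
proof -
  have "(\<lambda>i. smeasure \<mu> (binaryset A B i)) sums smeasure \<mu> (\<Union>i. binaryset A B i)"
    using assms by (intro smeasure_sums)
      (auto simp: range_binaryset_eq disjoint_family_on_def binaryset_def)
  moreover have "(\<lambda>i. smeasure \<mu> (binaryset A B i)) sums (smeasure \<mu> A + smeasure \<mu> B)"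
    by (rule binaryset_sums) simp
  ultimately show ?thesis by (simp add: UN_binaryset_eq sums_unique2)
qed

lemma smeasure_Diff:
  assumes "A \<in> sets borel" "B \<in> sets borel" "B \<subseteq> A"
  shows "smeasure \<mu> (A - B) = smeasure \<mu> A - smeasure \<mu> B"
  using smeasure_Un[of B "A - B" \<mu>] assms by (simp add: Un_absorb1 sets.Diff)

lemma smeasure_split:
  assumes "A \<in> sets borel" "B \<in> sets borel"
  shows "smeasure \<mu> A = smeasure \<mu> (A \<inter> B) + smeasure \<mu> (A - B)"
  using smeasure_Un[of "A \<inter> B" "A - B" \<mu>] assms by (simp add: Int_Diff_Un sets.Diff sets.Int Int_Diff_disjoint)

lemma smeasure_incseq:
  assumes "range A \<subseteq> sets borel" "incseq A"
  shows "(\<lambda>n. smeasure \<mu> (A n)) \<longlonglongrightarrow> smeasure \<mu> (\<Union>n. A n)"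
proof -
  let ?D = "disjointed A"
  have D: "range ?D \<subseteq> sets borel" using assms(1) by (intro sets.range_disjointed_sets) auto
  have "(\<lambda>i. smeasure \<mu> (?D i)) sums smeasure \<mu> (\<Union>n. ?D n)"
    using D by (intro smeasure_sums) (auto simp: disjoint_family_disjointed)
  then have lim: "(\<lambda>n. \<Sum>i<Suc n. smeasure \<mu> (?D i)) \<longlonglongrightarrow> smeasure \<mu> (\<Union>n. A n)"
    unfolding sums_def UN_disjointed_eq by (rule LIMSEQ_Suc)
  have "(\<Sum>i<Suc n. smeasure \<mu> (?D i)) = smeasure \<mu> (A n)" for n
  proof (induction n)
    case 0 then show ?case by (simp add: disjointed_def)
  next
    case (Suc n)
    have "?D (Suc n) = A (Suc n) - A n"
      using disjointed_mono[of A n] assms(2) by (auto simp: mono_def)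
    then have "smeasure \<mu> (?D (Suc n)) = smeasure \<mu> (A (Suc n)) - smeasure \<mu> (A n)"
      using assms by (auto simp: smeasure_Diff incseq_Suc_iff)
    then show ?case using Suc by simp
  qed
  then show ?thesis using lim by simp
qed

lemma smeasure_decseq:
  assumes A: "range A \<subseteq> sets borel" and dec: "decseq A"
  shows "(\<lambda>n. smeasure \<mu> (A n)) \<longlonglongrightarrow> smeasure \<mu> (\<Inter>n. A n)"
proof -
  have "(\<lambda>n. smeasure \<mu> (UNIV - A n)) \<longlonglongrightarrow> smeasure \<mu> (\<Union>n. UNIV - A n)"
    using A dec by (intro smeasure_incseq) (auto simp: monotone_def)
  moreover have "(\<Union>n. UNIV - A n) = UNIV - (\<Inter>n. A n)" by auto
  moreover have "(\<Inter>n. A n) \<in> sets borel" using A by (intro sets.countable_INT) auto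
  ultimately have "(\<lambda>n. smeasure \<mu> UNIV - smeasure \<mu> (A n)) \<longlonglongrightarrow> smeasure \<mu> UNIV - smeasure \<mu> (\<Inter>n. A n)"
    using A by (simp add: smeasure_Diff range_subsetD)
  from tendsto_diff[OF tendsto_const[of "smeasure \<mu> UNIV"] this] show ?thesis by simp
qed

text \<open>
  A Borel set on whose subsets the measure is unbounded above contains one of arbitrarily large absolute
  measure with the same defect: split it by a subset of large measure. Iterating gives a decreasing
  sequence of sets of unbounded measure, against continuity from above.
\<close>

lemma smeasure_bdd_above: "bdd_above (smeasure \<mu> ` {B \<in> sets borel. B \<subseteq> A})"
proof -
  define unb where "unb E \<longleftrightarrow> E \<in> sets borel \<and> \<not> bdd_above (smeasure \<mu> ` {B \<in> sets borel. B \<subseteq> E})" for E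
  have step: "\<exists>E'. unb E' \<and> E' \<subseteq> E \<and> real n \<le> \<bar>smeasure \<mu> E'\<bar>" if E: "unb E" for E n
  proof -
    have EB: "E \<in> sets borel" using E by (simp add: unb_def)
    obtain B where B: "B \<in> sets borel" "B \<subseteq> E" "\<bar>smeasure \<mu> E\<bar> + real n < smeasure \<mu> B"
      using E unfolding unb_def bdd_above_def by (fastforce simp: not_le)
    have D: "smeasure \<mu> (E - B) = smeasure \<mu> E - smeasure \<mu> B" using EB B by (simp add: smeasure_Diff)
    have "unb B \<or> unb (E - B)"
    proof (rule ccontr)
      assume "\<not> ?thesis"
      then have "bdd_above (smeasure \<mu> ` {C \<in> sets borel. C \<subseteq> B})" "bdd_above (smeasure \<mu> ` {C \<in> sets borel. C \<subseteq> E - B})"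
        using EB B by (auto simp: unb_def)
      then obtain M1 M2 where M: "\<And>C. C \<in> sets borel \<Longrightarrow> C \<subseteq> B \<Longrightarrow> smeasure \<mu> C \<le> M1"
        "\<And>C. C \<in> sets borel \<Longrightarrow> C \<subseteq> E - B \<Longrightarrow> smeasure \<mu> C \<le> M2"
        unfolding bdd_above_def by fastforce
      have "smeasure \<mu> C \<le> M1 + M2" if "C \<in> sets borel" "C \<subseteq> E" for C
      proof -
        have "smeasure \<mu> (C \<inter> B) \<le> M1" "smeasure \<mu> (C - B) \<le> M2"
          using that B by (auto intro!: M)
        then show ?thesis using smeasure_split[OF that(1) B(1)] by (metis add_mono)
      qed
      then show False using E unfolding unb_def bdd_above_def by auto
    qed
    then show ?thesis using B D by (auto intro: exI[of _ B] exI[of _ "E - B"])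
  qed
  show ?thesis
  proof (rule ccontr)
    assume "\<not> ?thesis"
    then have "unb UNIV" unfolding unb_def bdd_above_def by fastforce
    have "\<exists>E. \<forall>n. (unb (E n) \<and> (0 < n \<longrightarrow> real n \<le> \<bar>smeasure \<mu> (E n)\<bar>)) \<and> E (Suc n) \<subseteq> E n"
    proof (rule dependent_nat_choice)
      show "\<exists>E. unb E \<and> (0 < (0::nat) \<longrightarrow> real 0 \<le> \<bar>smeasure \<mu> E\<bar>)" using \<open>unb UNIV\<close> by auto
    next
      fix E n assume "unb E \<and> (0 < n \<longrightarrow> real n \<le> \<bar>smeasure \<mu> E\<bar>)"
      then show "\<exists>E'. (unb E' \<and> (0 < Suc n \<longrightarrow> real (Suc n) \<le> \<bar>smeasure \<mu> E'\<bar>)) \<and> E' \<subseteq> E"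
        using step[of E "Suc n"] by blast
    qed
    then obtain E where E: "\<And>n. unb (E n)" "\<And>n. E (Suc n) \<subseteq> E n"
      "\<And>n. 0 < n \<Longrightarrow> real n \<le> \<bar>smeasure \<mu> (E n)\<bar>" by blast
    have "(\<lambda>n. smeasure \<mu> (E n)) \<longlonglongrightarrow> smeasure \<mu> (\<Inter>n. E n)"
      using E by (intro smeasure_decseq) (auto simp: unb_def decseq_Suc_iff)
    then have "Bseq (\<lambda>n. smeasure \<mu> (E n))" by (rule convergentI[THEN convergent_imp_Bseq])
    then obtain M where M: "\<And>n. \<bar>smeasure \<mu> (E n)\<bar> \<le> M" by (auto simp: Bseq_def)
    obtain n where "M < real n" using reals_Archimedean2 by blast
    then show False using E(3)[of "Suc n"] M[of "Suc n"] by simp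
  qed
qed

definition jpos_fun :: "'a::topological_space signed_measure \<Rightarrow> 'a set \<Rightarrow> real" where
  "jpos_fun \<mu> A = (SUP B\<in>{B \<in> sets borel. B \<subseteq> A}. smeasure \<mu> B)"

lemma jpos_fun_upper: "B \<in> sets borel \<Longrightarrow> B \<subseteq> A \<Longrightarrow> smeasure \<mu> B \<le> jpos_fun \<mu> A"
  unfolding jpos_fun_def by (rule cSUP_upper) (auto simp: smeasure_bdd_above)

lemma jpos_fun_least: "(\<And>B. B \<in> sets borel \<Longrightarrow> B \<subseteq> A \<Longrightarrow> smeasure \<mu> B \<le> c) \<Longrightarrow> jpos_fun \<mu> A \<le> c"
  unfolding jpos_fun_def by (rule cSUP_least) auto

lemma jpos_fun_nonneg: "0 \<le> jpos_fun \<mu> A"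
  using jpos_fun_upper[of "{}" A \<mu>] by simp

lemma jpos_fun_mono: "A \<subseteq> A' \<Longrightarrow> jpos_fun \<mu> A \<le> jpos_fun \<mu> A'"
  by (rule jpos_fun_least) (auto intro: jpos_fun_upper)

lemma jpos_fun_superadditive:
  assumes "A \<inter> B = {}" shows "jpos_fun \<mu> A + jpos_fun \<mu> B \<le> jpos_fun \<mu> (A \<union> B)"
proof -
  have "jpos_fun \<mu> A \<le> jpos_fun \<mu> (A \<union> B) - jpos_fun \<mu> B"
  proof (rule jpos_fun_least)
    fix C assume C: "C \<in> sets borel" "C \<subseteq> A"
    have "jpos_fun \<mu> B \<le> jpos_fun \<mu> (A \<union> B) - smeasure \<mu> C"
    proof (rule jpos_fun_least)
      fix D assume D: "D \<in> sets borel" "D \<subseteq> B"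
      have "smeasure \<mu> (C \<union> D) \<le> jpos_fun \<mu> (A \<union> B)" using C D by (intro jpos_fun_upper) auto
      moreover have "smeasure \<mu> (C \<union> D) = smeasure \<mu> C + smeasure \<mu> D"
        using C D assms by (intro smeasure_Un) auto
      ultimately show "smeasure \<mu> D \<le> jpos_fun \<mu> (A \<union> B) - smeasure \<mu> C" by simp
    qed
    then show "smeasure \<mu> C \<le> jpos_fun \<mu> (A \<union> B) - jpos_fun \<mu> B" by simp
  qed
  then show ?thesis by simp
qed

lemma jpos_fun_sums:
  assumes A: "range A \<subseteq> sets borel" "disjoint_family A"
  shows "(\<lambda>i::nat. jpos_fun \<mu> (A i)) sums jpos_fun \<mu> (\<Union>i. A i)"
proof -
  have fin: "(\<Sum>i<n. jpos_fun \<mu> (A i)) \<le> jpos_fun \<mu> (\<Union>i<n. A i)" for n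
  proof (induction n)
    case 0 then show ?case using jpos_fun_nonneg by simp
  next
    case (Suc n)
    have "A i \<inter> A n = {}" if "i < n" for i using A(2) that by (simp add: disjoint_family_on_def)
    then have "(\<Union>i<n. A i) \<inter> A n = {}" by blast
    from jpos_fun_superadditive[OF this, of \<mu>] Suc show ?case
      by (simp add: lessThan_Suc Un_commute add.commute)
  qed
  have fin': "(\<Sum>i<n. jpos_fun \<mu> (A i)) \<le> jpos_fun \<mu> (\<Union>i. A i)" for n
    using fin[of n] jpos_fun_mono[of "\<Union>i<n. A i" "\<Union>i. A i" \<mu>] by (auto intro: order_trans)
  have s: "summable (\<lambda>i. jpos_fun \<mu> (A i))"
    by (rule summableI_nonneg_bounded[OF jpos_fun_nonneg fin'])
  have "jpos_fun \<mu> (\<Union>i. A i) \<le> (\<Sum>i. jpos_fun \<mu> (A i))"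
  proof (rule jpos_fun_least)
    fix B assume B: "B \<in> sets borel" "B \<subseteq> (\<Union>i. A i)"
    have "(\<lambda>i. smeasure \<mu> (B \<inter> A i)) sums smeasure \<mu> (\<Union>i. B \<inter> A i)"
      using A B by (intro smeasure_sums) (auto simp: disjoint_family_on_def)
    moreover have "(\<Union>i. B \<inter> A i) = B" using B by auto
    ultimately have sB: "(\<lambda>i. smeasure \<mu> (B \<inter> A i)) sums smeasure \<mu> B" by simp
    show "smeasure \<mu> B \<le> (\<Sum>i. jpos_fun \<mu> (A i))"
      using A B by (intro sums_le[OF _ sB summable_sums[OF s]] jpos_fun_upper) auto
  qed
  moreover have "(\<Sum>i. jpos_fun \<mu> (A i)) \<le> jpos_fun \<mu> (\<Union>i. A i)"
    using s fin' by (rule suminf_le_const)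
  ultimately show ?thesis using s by (metis antisym summable_sums)
qed

text \<open>
  The positive part once more, now as an element of the vector space of signed measures.
\<close>

definition jpos :: "'a::topological_space signed_measure \<Rightarrow> 'a signed_measure" where
  "jpos \<mu> = Abs_signed_measure (\<lambda>A. if A \<in> sets borel then jpos_fun \<mu> A else 0)"

lemma smeasure_jpos: "smeasure (jpos \<mu>) A = (if A \<in> sets borel then jpos_fun \<mu> A else 0)"
proof -
  have "is_signed_measure (\<lambda>A. if A \<in> sets borel then jpos_fun \<mu> A else 0)"
    unfolding is_signed_measure_def
  proof (intro conjI allI impI)
    fix A :: "nat \<Rightarrow> 'a set" assume A: "range A \<subseteq> sets borel" "disjoint_family A"
    then have "(\<Union>i. A i) \<in> sets borel" by (intro sets.countable_UN) auto
    then show "(\<lambda>i. if A i \<in> sets borel then jpos_fun \<mu> (A i) else 0) sums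
        (if (\<Union>i. A i) \<in> sets borel then jpos_fun \<mu> (\<Union>i. A i) else 0)"
      using jpos_fun_sums[OF A] A(1) by (simp add: range_subsetD)
  qed auto
  then show ?thesis by (simp add: jpos_def smeasure_Abs)
qed

text \<open>
  If \<open>B\<close> runs over the Borel subsets of \<open>A\<close>, then so does \<open>A - B\<close>, and \<open>-\<mu>(B) = \<mu>(A - B) - \<mu>(A)\<close>.
\<close>

lemma jpos_uminus: "jpos (- \<mu>) = jpos \<mu> - \<mu>"
proof (rule smeasure_eqI)
  fix A :: "'a set" assume A: "A \<in> sets borel"
  have "jpos_fun (- \<mu>) A \<le> jpos_fun \<mu> A - smeasure \<mu> A"
  proof (rule jpos_fun_least)
    fix B assume B: "B \<in> sets borel" "B \<subseteq> A"
    have "smeasure \<mu> (A - B) \<le> jpos_fun \<mu> A" using A B by (intro jpos_fun_upper sets.Diff) auto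
    then show "smeasure (- \<mu>) B \<le> jpos_fun \<mu> A - smeasure \<mu> A"
      using A B by (simp add: smeasure_Diff smeasure_simps)
  qed
  moreover have "jpos_fun \<mu> A \<le> jpos_fun (- \<mu>) A + smeasure \<mu> A"
  proof (rule jpos_fun_least)
    fix B assume B: "B \<in> sets borel" "B \<subseteq> A"
    have "smeasure (- \<mu>) (A - B) \<le> jpos_fun (- \<mu>) A" using A B by (intro jpos_fun_upper sets.Diff) auto
    then show "smeasure \<mu> B \<le> jpos_fun (- \<mu>) A + smeasure \<mu> A"
      using A B by (simp add: smeasure_Diff smeasure_simps)
  qed
  ultimately show "smeasure (jpos (- \<mu>)) A = smeasure (jpos \<mu> - \<mu>) A"
    using A by (simp add: smeasure_jpos smeasure_simps)
qed

definition positive_measure :: "'a::topological_space signed_measure \<Rightarrow> bool" where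
  "positive_measure \<mu> \<longleftrightarrow> (\<forall>A. 0 \<le> smeasure \<mu> A)"

lemma positive_jpos: "positive_measure (jpos \<mu>)"
  by (simp add: positive_measure_def smeasure_jpos jpos_fun_nonneg)

lemma positive_measure_mono:
  assumes "positive_measure \<mu>" "A \<in> sets borel" "B \<in> sets borel" "A \<subseteq> B"
  shows "smeasure \<mu> A \<le> smeasure \<mu> B"
proof -
  have "0 \<le> smeasure \<mu> (B - A)" using assms(1) by (simp add: positive_measure_def)
  then show ?thesis using smeasure_Diff[OF assms(3,2,4), of \<mu>] by simp
qed

lemma jpos_positive: "positive_measure \<mu> \<Longrightarrow> jpos \<mu> = \<mu>"
proof (rule smeasure_eqI)
  fix A :: "'a set" assume p: "positive_measure \<mu>" and A: "A \<in> sets borel"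
  have "jpos_fun \<mu> A \<le> smeasure \<mu> A" using p A by (intro jpos_fun_least positive_measure_mono)
  moreover have "smeasure \<mu> A \<le> jpos_fun \<mu> A" using A by (intro jpos_fun_upper) auto
  ultimately show "smeasure (jpos \<mu>) A = smeasure \<mu> A" using A by (simp add: smeasure_jpos)
qed

lemma sets_pos_part [simp, measurable_cong]: "sets (pos_part \<mu>) = sets borel"
  by (simp add: pos_part_def sets_measure_of_conv sets.sigma_sets_eq[of borel, simplified])

lemma space_pos_part [simp]: "space (pos_part \<mu>) = UNIV"
  by (simp add: pos_part_def space_measure_of_conv)

lemma sets_neg_part [simp, measurable_cong]: "sets (neg_part \<mu>) = sets borel"
  and space_neg_part [simp]: "space (neg_part \<mu>) = UNIV"
  by (simp_all add: neg_part_def)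

lemma emeasure_pos_part:
  assumes A: "A \<in> sets borel"
  shows "emeasure (pos_part \<mu>) A = ennreal (smeasure (jpos \<mu>) A)"
proof -
  have "emeasure (pos_part \<mu>) A = ennreal (jpos_fun \<mu> A)"
  proof (rule emeasure_measure_of[of "pos_part \<mu>" UNIV "sets borel" "\<lambda>A. ennreal (jpos_fun \<mu> A)"])
    show "pos_part \<mu> = measure_of UNIV (sets borel) (\<lambda>A. ennreal (jpos_fun \<mu> A))"
      by (simp add: pos_part_def jpos_fun_def)
    show "positive (sets (pos_part \<mu>)) (\<lambda>A. ennreal (jpos_fun \<mu> A))"
      using smeasure_jpos[of \<mu> "{}"] by (simp add: positive_def)
    show "countably_additive (sets (pos_part \<mu>)) (\<lambda>A. ennreal (jpos_fun \<mu> A))"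
      unfolding countably_additive_def
    proof (intro allI impI)
      fix A :: "nat \<Rightarrow> 'a set" assume A: "range A \<subseteq> sets (pos_part \<mu>)" "disjoint_family A"
      then have s: "(\<lambda>i. jpos_fun \<mu> (A i)) sums jpos_fun \<mu> (\<Union>i. A i)" by (intro jpos_fun_sums) auto
      show "(\<Sum>i. ennreal (jpos_fun \<mu> (A i))) = ennreal (jpos_fun \<mu> (\<Union> (range A)))"
        using s jpos_fun_nonneg by (intro sums_unique[symmetric]) (simp add: sums_ennreal jpos_fun_nonneg)
    qed
  qed (use A in auto)
  then show ?thesis using A by (simp add: smeasure_jpos)
qed

lemma emeasure_neg_part:
  "A \<in> sets borel \<Longrightarrow> emeasure (neg_part \<mu>) A = ennreal (smeasure (jpos (- \<mu>)) A)"
  by (simp add: neg_part_def emeasure_pos_part)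

lemma measure_pos_part: "measure (pos_part \<mu>) A = smeasure (jpos \<mu>) A"
  and measure_neg_part: "measure (neg_part \<mu>) A = smeasure (jpos (- \<mu>)) A"
  using positive_jpos[of \<mu>] positive_jpos[of "- \<mu>"]
  by (cases "A \<in> sets borel"; force simp: measure_def emeasure_pos_part emeasure_neg_part
      positive_measure_def emeasure_notin_sets smeasure_notin)+

lemma finite_measure_pos_part [simp]: "finite_measure (pos_part \<mu>)"
  and finite_measure_neg_part [simp]: "finite_measure (neg_part \<mu>)"
  by (auto intro!: finite_measureI simp: emeasure_pos_part emeasure_neg_part)

section \<open>Integrals of bounded Borel functions\<close>

definition bdd_borel :: "('a::topological_space \<Rightarrow> real) \<Rightarrow> bool" where
  "bdd_borel f \<longleftrightarrow> f \<in> borel_measurable borel \<and> (\<exists>B. \<forall>x. \<bar>f x\<bar> \<le> B)"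

lemma bdd_borelI: "f \<in> borel_measurable borel \<Longrightarrow> (\<And>x. \<bar>f x\<bar> \<le> B) \<Longrightarrow> bdd_borel f"
  by (auto simp: bdd_borel_def)

lemma bdd_borel_measurable: "bdd_borel f \<Longrightarrow> f \<in> borel_measurable borel"
  by (simp add: bdd_borel_def)

lemma bdd_borel_indicator: "A \<in> sets borel \<Longrightarrow> bdd_borel (indicator A)"
  by (rule bdd_borelI[of _ 1]) (auto simp: indicator_def)

lemma bdd_borel_cmult: "bdd_borel f \<Longrightarrow> bdd_borel (\<lambda>x. c * f x)"
  unfolding bdd_borel_def by (auto simp: abs_mult) (meson abs_ge_zero mult_left_mono)

lemma bdd_borel_add: "bdd_borel f \<Longrightarrow> bdd_borel g \<Longrightarrow> bdd_borel (\<lambda>x. f x + g x)"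
proof -
  assume "bdd_borel f" "bdd_borel g"
  then obtain B C where "\<And>x. \<bar>f x\<bar> \<le> B" "\<And>x. \<bar>g x\<bar> \<le> C" "f \<in> borel_measurable borel" "g \<in> borel_measurable borel"
    by (auto simp: bdd_borel_def)
  then show ?thesis by (intro bdd_borelI[of _ "B + C"]) (auto intro: order_trans[OF abs_triangle_ineq] add_mono)
qed

lemma bdd_borel_diff: "bdd_borel f \<Longrightarrow> bdd_borel g \<Longrightarrow> bdd_borel (\<lambda>x. f x - g x)"
  using bdd_borel_add[of f "\<lambda>x. -1 * g x"] bdd_borel_cmult[of g "-1"] by simp

lemma bdd_borel_mult: "bdd_borel f \<Longrightarrow> bdd_borel g \<Longrightarrow> bdd_borel (\<lambda>x. f x * g x)"
proof -
  assume "bdd_borel f" "bdd_borel g"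
  then obtain B C where "\<And>x. \<bar>f x\<bar> \<le> B" "\<And>x. \<bar>g x\<bar> \<le> C" "f \<in> borel_measurable borel" "g \<in> borel_measurable borel"
    by (auto simp: bdd_borel_def)
  then show ?thesis
    by (intro bdd_borelI[of _ "B * C"]) (auto simp: abs_mult intro!: mult_mono intro: order_trans[OF abs_ge_zero])
qed

lemma bdd_borel_const: "bdd_borel (\<lambda>x. c)"
  by (rule bdd_borelI[of _ "\<bar>c\<bar>"]) auto

lemma bdd_borel_compose: "bdd_borel f \<Longrightarrow> h \<in> borel_measurable borel \<Longrightarrow> bdd_borel (\<lambda>x. f (h x))"
  unfolding bdd_borel_def using measurable_compose[of h borel borel f borel] by auto

lemma bdd_borel_continuous:
  fixes f :: "'a::t2_space \<Rightarrow> real"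
  assumes "compact \<Omega>" "continuous_on \<Omega> f"
  shows "bdd_borel (\<lambda>x. indicator \<Omega> x * f x)"
proof -
  have "compact (f ` \<Omega>)" using assms by (rule compact_continuous_image[rotated])
  then obtain B where "\<And>x. x \<in> \<Omega> \<Longrightarrow> \<bar>f x\<bar> \<le> B"
    using compact_imp_bounded[of "f ` \<Omega>"] by (auto simp: bounded_iff)
  then have "\<bar>indicator \<Omega> x * f x\<bar> \<le> max 0 B" for x by (auto simp: indicator_def le_max_iff_disj)
  moreover have "(\<lambda>x. indicator \<Omega> x * f x) \<in> borel_measurable borel"
    using borel_measurable_continuous_on_indicator[OF _ assms(2)] compact_imp_closed[OF assms(1)] by simp
  ultimately show ?thesis by (rule bdd_borelI[rotated])
qed

definition sint :: "('a::topological_space \<Rightarrow> real) \<Rightarrow> 'a signed_measure \<Rightarrow> real" where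
  "sint f \<mu> = (LINT x|pos_part \<mu>. f x) - (LINT x|neg_part \<mu>. f x)"

lemma pairing_sint: "pairing \<Omega> f \<mu> = sint (\<lambda>x. indicator \<Omega> x * f x) \<mu>"
  by (simp add: pairing_def sint_def set_lebesgue_integral_def)

text \<open>
  Linear functionals to which bounded convergence applies. Such a functional is determined by its values on
  indicators (\<open>bdd_linear_eq\<close>), which reduces every identity between integrals below to one between measures
  of sets.
\<close>

definition bdd_linear :: "(('a::topological_space \<Rightarrow> real) \<Rightarrow> real) \<Rightarrow> bool" where
  "bdd_linear \<Phi> \<longleftrightarrow>
    (\<forall>f g. bdd_borel f \<longrightarrow> bdd_borel g \<longrightarrow> \<Phi> (\<lambda>x. f x + g x) = \<Phi> f + \<Phi> g) \<and>
    (\<forall>c f. bdd_borel f \<longrightarrow> \<Phi> (\<lambda>x. c * f x) = c * \<Phi> f) \<and>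
    (\<forall>u f B. (\<forall>n::nat. u n \<in> borel_measurable borel) \<longrightarrow> (\<forall>n x. \<bar>u n x\<bar> \<le> B) \<longrightarrow> (\<forall>x. (\<lambda>n. u n x) \<longlonglongrightarrow> f x) \<longrightarrow>
       (\<lambda>n. \<Phi> (u n)) \<longlonglongrightarrow> \<Phi> f)"

lemma bdd_linearI:
  assumes "\<And>f g. bdd_borel f \<Longrightarrow> bdd_borel g \<Longrightarrow> \<Phi> (\<lambda>x. f x + g x) = \<Phi> f + \<Phi> g"
    and "\<And>c f. bdd_borel f \<Longrightarrow> \<Phi> (\<lambda>x. c * f x) = c * \<Phi> f"
    and "\<And>u f B. (\<And>n::nat. u n \<in> borel_measurable borel) \<Longrightarrow> (\<And>n x. \<bar>u n x\<bar> \<le> B) \<Longrightarrow>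
      (\<And>x. (\<lambda>n. u n x) \<longlonglongrightarrow> f x) \<Longrightarrow> (\<lambda>n. \<Phi> (u n)) \<longlonglongrightarrow> \<Phi> f"
  shows "bdd_linear \<Phi>"
  unfolding bdd_linear_def using assms by blast

lemma bdd_linearD:
  assumes "bdd_linear \<Phi>"
  shows "bdd_borel f \<Longrightarrow> bdd_borel g \<Longrightarrow> \<Phi> (\<lambda>x. f x + g x) = \<Phi> f + \<Phi> g"
    and "bdd_borel f \<Longrightarrow> \<Phi> (\<lambda>x. c * f x) = c * \<Phi> f"
    and "(\<And>n::nat. u n \<in> borel_measurable borel) \<Longrightarrow> (\<And>n x. \<bar>u n x\<bar> \<le> B) \<Longrightarrow>
      (\<And>x. (\<lambda>n. u n x) \<longlonglongrightarrow> f x) \<Longrightarrow> (\<lambda>n. \<Phi> (u n)) \<longlonglongrightarrow> \<Phi> f"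
  using assms unfolding bdd_linear_def by blast+

text \<open>
  Induction from indicators over nonnegative functions. A function with values in \<open>[-B, B]\<close> is made
  nonnegative by adding \<open>B\<close>.
\<close>

lemma bdd_linear_eq:
  assumes P: "bdd_linear \<Phi>" and Q: "bdd_linear \<Psi>"
    and ind: "\<And>A. A \<in> sets borel \<Longrightarrow> \<Phi> (indicator A) = \<Psi> (indicator A)" and f: "bdd_borel f"
  shows "\<Phi> f = \<Psi> f"
proof -
  have adds: "\<Phi> (\<lambda>x. f x + g x) = \<Psi> (\<lambda>x. f x + g x)" if "bdd_borel f" "bdd_borel g" "\<Phi> f = \<Psi> f" "\<Phi> g = \<Psi> g" for f g
    using that bdd_linearD(1)[OF P] bdd_linearD(1)[OF Q] by simp
  have cm: "\<Phi> (\<lambda>x. c * f x) = \<Psi> (\<lambda>x. c * f x)" if "bdd_borel f" "\<Phi> f = \<Psi> f" for f c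
    using that bdd_linearD(2)[OF P] bdd_linearD(2)[OF Q] by simp
  have nn: "(\<exists>B. \<forall>x. u x \<le> B) \<longrightarrow> \<Phi> u = \<Psi> u" if "u \<in> borel_measurable borel" "\<And>x. 0 \<le> u x" for u
    using that
  proof (induction rule: borel_measurable_induct_real)
    case (set A) then show ?case using ind by simp
  next
    case (mult u c)
    show ?case
    proof (cases "c = 0")
      case True
      have "\<Phi> (\<lambda>x. 0 * (\<lambda>_. 0) x) = \<Psi> (\<lambda>x. 0 * (\<lambda>_. 0) x)"
        using bdd_linearD(2)[OF P bdd_borel_const, of 0 0] bdd_linearD(2)[OF Q bdd_borel_const, of 0 0] by simp
      then show ?thesis using True by simp
    next
      case False
      then have c: "0 < c" using mult by simp
      show ?thesis
      proof
        assume "\<exists>B. \<forall>x. c * u x \<le> B"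
        then obtain B where B: "\<And>x. u x \<le> B / c" using c by (auto simp: field_simps)
        have "bdd_borel u" using B mult.hyps by (intro bdd_borelI[of _ "B / c"]) auto
        moreover have "\<Phi> u = \<Psi> u" using B mult.IH by blast
        ultimately show "\<Phi> (\<lambda>x. c * u x) = \<Psi> (\<lambda>x. c * u x)" by (rule cm)
      qed
    qed
  next
    case (add u v)
    show ?case
    proof
      assume "\<exists>B. \<forall>x. v x + u x \<le> B"
      then obtain B where B: "\<And>x. v x + u x \<le> B" by auto
      have le: "u x \<le> B" "v x \<le> B" for x using B[of x] \<open>\<And>x. 0 \<le> u x\<close>[of x] \<open>\<And>x. 0 \<le> v x\<close>[of x] by auto
      have "bdd_borel u" "bdd_borel v"
        using le add.hyps by (auto intro!: bdd_borelI[of _ B])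
      moreover have "\<Phi> u = \<Psi> u" "\<Phi> v = \<Psi> v" using le add.IH by blast+
      ultimately show "\<Phi> (\<lambda>x. v x + u x) = \<Psi> (\<lambda>x. v x + u x)" by (intro adds)
    qed
  next
    case (seq U)
    show ?case
    proof
      assume "\<exists>B. \<forall>x. u x \<le> B"
      then obtain B where B: "\<And>x. u x \<le> B" by auto
      have le: "U i x \<le> u x" for i x
        using \<open>incseq U\<close> \<open>\<And>x. x \<in> space borel \<Longrightarrow> (\<lambda>i. U i x) \<longlonglongrightarrow> u x\<close>
        by (intro incseq_le[of "\<lambda>i. U i x"]) (auto simp: incseq_def le_fun_def)
      have U: "\<bar>U i x\<bar> \<le> B" for i x using le[of i x] B[of x] \<open>\<And>i x. 0 \<le> U i x\<close>[of i x] by simp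
      have eq: "\<Phi> (U i) = \<Psi> (U i)" for i using \<open>\<And>i. (\<exists>B. \<forall>x. U i x \<le> B) \<longrightarrow> \<Phi> (U i) = \<Psi> (U i)\<close> abs_le_D1[OF U] by blast
      have "(\<lambda>i. \<Phi> (U i)) \<longlonglongrightarrow> \<Phi> u" "(\<lambda>i. \<Psi> (U i)) \<longlonglongrightarrow> \<Psi> u"
        using \<open>\<And>x. x \<in> space borel \<Longrightarrow> (\<lambda>i. U i x) \<longlonglongrightarrow> u x\<close> \<open>\<And>i. U i \<in> borel_measurable borel\<close>
        by (auto intro!: bdd_linearD(3)[OF P, of U B u] bdd_linearD(3)[OF Q, of U B u] U)
      then show "\<Phi> u = \<Psi> u" unfolding eq by (rule LIMSEQ_unique)
    qed
  qed
  obtain B where B: "\<And>x. \<bar>f x\<bar> \<le> B" and fm: "f \<in> borel_measurable borel" using f by (auto simp: bdd_borel_def)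
  have fB: "bdd_borel (\<lambda>x. f x + B)" using f by (intro bdd_borel_add bdd_borel_const)
  have "\<Phi> (\<lambda>x. f x + B) = \<Psi> (\<lambda>x. f x + B)"
  proof (rule nn[rule_format])
    show "\<exists>C. \<forall>x. f x + B \<le> C" using B by (intro exI[of _ "2 * B"]) (auto simp: abs_le_iff)
    show "0 \<le> f x + B" for x using B[of x] by (simp add: abs_le_iff)
    show "(\<lambda>x. f x + B) \<in> borel_measurable borel" using fm by (rule borel_measurable_add) simp
  qed
  moreover have "\<Phi> (\<lambda>x. - B) = \<Psi> (\<lambda>x. - B)"
  proof -
    have "\<Phi> (\<lambda>x. (- B) * indicator UNIV x) = \<Psi> (\<lambda>x. (- B) * indicator UNIV x)"
      by (intro cm bdd_borel_indicator ind) auto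
    then show ?thesis by simp
  qed
  ultimately have "\<Phi> (\<lambda>x. (f x + B) + - B) = \<Psi> (\<lambda>x. (f x + B) + - B)"
    by (rule adds[OF fB bdd_borel_const])
  moreover have "(\<lambda>x. (f x + B) + - B) = f" by (simp add: fun_eq_iff)
  ultimately show ?thesis by (simp only:)
qed

lemma bdd_borel_integrable:
  assumes "bdd_borel f" "finite_measure M" "sets M = sets borel" shows "integrable M f"
proof -
  obtain B where "\<And>x. \<bar>f x\<bar> \<le> B" "f \<in> borel_measurable borel" using assms by (auto simp: bdd_borel_def)
  then show ?thesis using assms
    by (intro finite_measure.integrable_const_bound[of M f B]) (auto cong: measurable_cong_sets)
qed

lemma bdd_linear_integral:
  fixes M :: "'a::topological_space measure"
  assumes M: "finite_measure M" "sets M = sets borel"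
  shows "bdd_linear (\<lambda>f. LINT x|M. f x)"
proof (rule bdd_linearI, goal_cases)
  case (1 f g)
  show ?case by (rule Bochner_Integration.integral_add) (rule bdd_borel_integrable[OF _ M], fact)+
next
  case (2 c f)
  show ?case by (rule integral_mult_right_zero)
next
  case (3 u f B)
  have meas: "h \<in> borel_measurable M" if "h \<in> borel_measurable borel" for h :: "'a \<Rightarrow> real"
    using that M(2) by (simp cong: measurable_cong_sets)
  have fm: "f \<in> borel_measurable borel" 
    by (rule borel_measurable_LIMSEQ_metric[of u]) (rule 3(1), rule 3(3))
  show ?case
  proof (rule integral_dominated_convergence[where w = "\<lambda>_. B"])
    show "f \<in> borel_measurable M" by (rule meas[OF fm])
    show "u n \<in> borel_measurable M" for n by (rule meas[OF 3(1)])
    show "integrable M (\<lambda>_. B)" by (rule finite_measure.integrable_const[OF M(1)])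
    show "AE x in M. (\<lambda>n. u n x) \<longlonglongrightarrow> f x" by (rule AE_I2) (rule 3(3))
    show "AE x in M. norm (u n x) \<le> B" for n by (rule AE_I2) (simp only: real_norm_def, rule 3(2))
  qed
qed

lemma bdd_linear_add:
  assumes P: "bdd_linear \<Phi>" and Q: "bdd_linear \<Psi>" shows "bdd_linear (\<lambda>f. \<Phi> f + \<Psi> f)"
proof (rule bdd_linearI)
  fix u :: "nat \<Rightarrow> 'a \<Rightarrow> real" and f B assume "\<And>n. u n \<in> borel_measurable borel" "\<And>n x. \<bar>u n x\<bar> \<le> B" "\<And>x. (\<lambda>n. u n x) \<longlonglongrightarrow> f x"
  note u = this
  show "(\<lambda>n. \<Phi> (u n) + \<Psi> (u n)) \<longlonglongrightarrow> \<Phi> f + \<Psi> f"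
    by (intro tendsto_add bdd_linearD(3)[OF P, of u B f] bdd_linearD(3)[OF Q, of u B f] u)
next
  fix f g :: "'a \<Rightarrow> real" assume "bdd_borel f" "bdd_borel g"
  from bdd_linearD(1)[OF P this] bdd_linearD(1)[OF Q this]
  show "\<Phi> (\<lambda>x. f x + g x) + \<Psi> (\<lambda>x. f x + g x) = \<Phi> f + \<Psi> f + (\<Phi> g + \<Psi> g)" by linarith
next
  fix c and f :: "'a \<Rightarrow> real" assume "bdd_borel f"
  from bdd_linearD(2)[OF P this, of c] bdd_linearD(2)[OF Q this, of c]
  show "\<Phi> (\<lambda>x. c * f x) + \<Psi> (\<lambda>x. c * f x) = c * (\<Phi> f + \<Psi> f)" by (metis distrib_left)
qed

lemma bdd_linear_cmult:
  assumes P: "bdd_linear \<Phi>" shows "bdd_linear (\<lambda>f. c * \<Phi> f)"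
proof (rule bdd_linearI)
  fix u :: "nat \<Rightarrow> 'a \<Rightarrow> real" and f B assume "\<And>n. u n \<in> borel_measurable borel" "\<And>n x. \<bar>u n x\<bar> \<le> B" "\<And>x. (\<lambda>n. u n x) \<longlonglongrightarrow> f x"
  note u = this
  show "(\<lambda>n. c * \<Phi> (u n)) \<longlonglongrightarrow> c * \<Phi> f"
    by (intro tendsto_mult tendsto_const bdd_linearD(3)[OF P, of u B f] u)
next
  fix f g :: "'a \<Rightarrow> real" assume "bdd_borel f" "bdd_borel g"
  from bdd_linearD(1)[OF P this]
  show "c * \<Phi> (\<lambda>x. f x + g x) = c * \<Phi> f + c * \<Phi> g" by (metis distrib_left)
next
  fix d and f :: "'a \<Rightarrow> real" assume "bdd_borel f"
  from bdd_linearD(2)[OF P this, of d]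
  show "c * \<Phi> (\<lambda>x. d * f x) = d * (c * \<Phi> f)" by (metis mult.left_commute)
qed

lemma bdd_linear_sint: "bdd_linear (\<lambda>f. sint f \<mu>)"
proof -
  have "(\<lambda>f. sint f \<mu>) = (\<lambda>f. (LINT x|pos_part \<mu>. f x) + -1 * (LINT x|neg_part \<mu>. f x))"
    by (simp add: sint_def fun_eq_iff)
  moreover have "bdd_linear (\<lambda>f. (LINT x|pos_part \<mu>. f x) + -1 * (LINT x|neg_part \<mu>. f x))"
    by (intro bdd_linear_add bdd_linear_cmult bdd_linear_integral) simp_all
  ultimately show ?thesis by (simp only:)
qed

lemma bdd_linear_compose:
  fixes h :: "'a::topological_space \<Rightarrow> 'b::topological_space"
  assumes P: "bdd_linear \<Phi>" and h: "h \<in> borel_measurable borel"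
  shows "bdd_linear (\<lambda>f. \<Phi> (\<lambda>x. f (h x)))"
proof (rule bdd_linearI, goal_cases)
  case (1 f g)
  show ?case by (rule bdd_linearD(1)[OF P 1[THEN bdd_borel_compose, OF h]])
next
  case (2 c f)
  show ?case by (rule bdd_linearD(2)[OF P bdd_borel_compose[OF 2 h]])
next
  case (3 u f B)
  show ?case
    by (rule bdd_linearD(3)[OF P, of "\<lambda>n x. u n (h x)" B "\<lambda>x. f (h x)"])
      (rule measurable_compose[OF h 3(1)], rule 3(2), rule 3(3))
qed

lemma bdd_linear_mult:
  fixes g :: "'a::topological_space \<Rightarrow> real"
  assumes P: "bdd_linear \<Phi>" and g: "bdd_borel g" shows "bdd_linear (\<lambda>f. \<Phi> (\<lambda>x. g x * f x))"
proof (rule bdd_linearI, goal_cases)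
  case (1 f f')
  show ?case
    unfolding distrib_left by (rule bdd_linearD(1)[OF P 1[THEN bdd_borel_mult[OF g]]])
next
  case (2 c f)
  show ?case
    unfolding mult.left_commute[of _ c] by (rule bdd_linearD(2)[OF P bdd_borel_mult[OF g 2]])
next
  case (3 u f B)
  obtain C where C: "\<And>x. \<bar>g x\<bar> \<le> C" and gm: "g \<in> borel_measurable borel" using g by (auto simp: bdd_borel_def)
  have le: "\<bar>g x * u n x\<bar> \<le> C * B" for n x
    unfolding abs_mult using C 3(2) by (intro mult_mono) (auto intro: order_trans[OF abs_ge_zero])
  show ?case
    by (rule bdd_linearD(3)[OF P, of "\<lambda>n x. g x * u n x" "C * B" "\<lambda>x. g x * f x"])
      (rule borel_measurable_times[OF gm 3(1)], rule le, rule tendsto_mult[OF tendsto_const 3(3)])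
qed

lemma bdd_linear_eval: "bdd_linear (\<lambda>f. f x)"
proof (rule bdd_linearI, goal_cases)
  case (3 u f B) show ?case by (rule 3(3))
qed (rule refl)+

lemma sint_indicator:
  assumes "A \<in> sets borel" shows "sint (indicator A) \<mu> = smeasure \<mu> A"
proof -
  have "sint (indicator A) \<mu> = measure (pos_part \<mu>) A - measure (neg_part \<mu>) A"
    using assms by (simp add: sint_def)
  also have "\<dots> = smeasure \<mu> A"
    by (simp only: measure_pos_part measure_neg_part jpos_uminus smeasure_simps)
  finally show ?thesis .
qed

lemma sint_add_fun: "bdd_borel f \<Longrightarrow> bdd_borel g \<Longrightarrow> sint (\<lambda>x. f x + g x) \<mu> = sint f \<mu> + sint g \<mu>"
  using bdd_linearD(1)[OF bdd_linear_sint[of \<mu>], of f g] .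

lemma sint_cmult_fun: "bdd_borel f \<Longrightarrow> sint (\<lambda>x. c * f x) \<mu> = c * sint f \<mu>"
  using bdd_linearD(2)[OF bdd_linear_sint[of \<mu>], of f c] .

lemma sint_diff_fun: "bdd_borel f \<Longrightarrow> bdd_borel g \<Longrightarrow> sint (\<lambda>x. f x - g x) \<mu> = sint f \<mu> - sint g \<mu>"
  using sint_add_fun[of f "\<lambda>x. -1 * g x" \<mu>] sint_cmult_fun[of g "-1" \<mu>] bdd_borel_cmult[of g "-1"] by simp

lemma sint_plus:
  assumes "bdd_borel f" shows "sint f (\<mu> + \<nu>) = sint f \<mu> + sint f \<nu>"
proof (rule bdd_linear_eq[OF bdd_linear_sint[of "\<mu> + \<nu>"] bdd_linear_add[OF bdd_linear_sint[of \<mu>] bdd_linear_sint[of \<nu>]] _ assms])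
  fix A :: "'a set" assume "A \<in> sets borel"
  then show "sint (indicator A) (\<mu> + \<nu>) = sint (indicator A) \<mu> + sint (indicator A) \<nu>"
    by (simp only: sint_indicator smeasure_simps)
qed

lemma sint_scaleR:
  assumes "bdd_borel f" shows "sint f (c *\<^sub>R \<mu>) = c * sint f \<mu>"
proof (rule bdd_linear_eq[OF bdd_linear_sint[of "c *\<^sub>R \<mu>"] bdd_linear_cmult[OF bdd_linear_sint[of \<mu>]] _ assms])
  fix A :: "'a set" assume "A \<in> sets borel"
  then show "sint (indicator A) (c *\<^sub>R \<mu>) = c * sint (indicator A) \<mu>"
    by (simp only: sint_indicator smeasure_simps)
qed

lemma sint_minus: "bdd_borel f \<Longrightarrow> sint f (\<mu> - \<nu>) = sint f \<mu> - sint f \<nu>"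
  using sint_plus[of f \<mu> "(-1) *\<^sub>R \<nu>"] sint_scaleR[of f "-1" \<nu>] by simp

lemma sint_zero: "bdd_borel f \<Longrightarrow> sint f 0 = 0"
  using sint_scaleR[of f 0 0] by simp

lemma sint_dirac:
  assumes "bdd_borel f" shows "sint f (dirac x) = f x"
proof (rule bdd_linear_eq[OF bdd_linear_sint[of "dirac x"] bdd_linear_eval[of x] _ assms])
  fix A :: "'a set" assume "A \<in> sets borel"
  then show "sint (indicator A) (dirac x) = indicator A x"
    by (simp add: sint_indicator dirac.rep_eq)
qed

lemma sint_sum: "bdd_borel f \<Longrightarrow> sint f (\<Sum>i\<in>I. \<mu> i) = (\<Sum>i\<in>I. sint f (\<mu> i))"
  by (induction I rule: infinite_finite_induct) (simp_all add: sint_plus sint_zero)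

section \<open>Images, restrictions and measures on a set\<close>

definition push :: "('a::topological_space \<Rightarrow> 'b::topological_space) \<Rightarrow> 'a signed_measure \<Rightarrow> 'b signed_measure" where
  "push h \<mu> = Abs_signed_measure (\<lambda>A. if A \<in> sets borel then smeasure \<mu> (h -` A) else 0)"

lemma smeasure_push:
  assumes h: "h \<in> borel_measurable borel" and A: "A \<in> sets borel"
  shows "smeasure (push h \<mu>) A = smeasure \<mu> (h -` A)"
proof -
  have m: "h -` A \<in> sets borel" if "A \<in> sets borel" for A
    using measurable_sets[OF h that] by simp
  have "is_signed_measure (\<lambda>A. if A \<in> sets borel then smeasure \<mu> (h -` A) else 0)"
    unfolding is_signed_measure_def
  proof (intro conjI allI impI)
    fix A :: "nat \<Rightarrow> 'b set" assume A: "range A \<subseteq> sets borel" "disjoint_family A"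
    then have U: "(\<Union>i. A i) \<in> sets borel" by (intro sets.countable_UN) auto
    have "(\<lambda>i. smeasure \<mu> (h -` A i)) sums smeasure \<mu> (\<Union>i. h -` A i)"
      using A m by (intro smeasure_sums) (auto simp: disjoint_family_on_def)
    then show "(\<lambda>i. if A i \<in> sets borel then smeasure \<mu> (h -` A i) else 0) sums
        (if (\<Union>i. A i) \<in> sets borel then smeasure \<mu> (h -` (\<Union>i. A i)) else 0)"
      using U A(1) by (simp add: range_subsetD vimage_UN)
  qed auto
  then show ?thesis using A by (simp add: push_def smeasure_Abs)
qed

definition restr :: "'a::topological_space set \<Rightarrow> 'a signed_measure \<Rightarrow> 'a signed_measure" where
  "restr S \<mu> = Abs_signed_measure (\<lambda>A. if A \<in> sets borel then smeasure \<mu> (A \<inter> S) else 0)"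

lemma smeasure_restr:
  assumes S: "S \<in> sets borel" and A: "A \<in> sets borel"
  shows "smeasure (restr S \<mu>) A = smeasure \<mu> (A \<inter> S)"
proof -
  have "is_signed_measure (\<lambda>A. if A \<in> sets borel then smeasure \<mu> (A \<inter> S) else 0)"
    unfolding is_signed_measure_def
  proof (intro conjI allI impI)
    fix A :: "nat \<Rightarrow> 'a set" assume A: "range A \<subseteq> sets borel" "disjoint_family A"
    then have U: "(\<Union>i. A i) \<in> sets borel" by (intro sets.countable_UN) auto
    have "(\<lambda>i. smeasure \<mu> (A i \<inter> S)) sums smeasure \<mu> (\<Union>i. A i \<inter> S)"
      using A S by (intro smeasure_sums) (auto simp: disjoint_family_on_def)
    then show "(\<lambda>i. if A i \<in> sets borel then smeasure \<mu> (A i \<inter> S) else 0) sums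
        (if (\<Union>i. A i) \<in> sets borel then smeasure \<mu> ((\<Union>i. A i) \<inter> S) else 0)"
      using U A(1) by (simp add: range_subsetD)
  qed auto
  then show ?thesis using A by (simp add: restr_def smeasure_Abs)
qed

lemma sint_push:
  fixes h :: "'a::topological_space \<Rightarrow> 'b::topological_space"
  assumes f: "bdd_borel f" and h: "h \<in> borel_measurable borel"
  shows "sint f (push h \<mu>) = sint (\<lambda>x. f (h x)) \<mu>"
proof (rule bdd_linear_eq[OF bdd_linear_sint[of "push h \<mu>"] bdd_linear_compose[OF bdd_linear_sint[of \<mu>] h] _ f])
  fix A :: "'b set" assume A: "A \<in> sets borel"
  have B: "h -` A \<in> sets borel" using measurable_sets[OF h A] by simp
  have "(\<lambda>x. indicator A (h x)) = (indicator (h -` A) :: 'a \<Rightarrow> real)" by (auto simp: indicator_def)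
  then show "sint (indicator A) (push h \<mu>) = sint (\<lambda>x. indicator A (h x)) \<mu>"
    by (simp only: sint_indicator[OF A] sint_indicator[OF B] smeasure_push[OF h A])
qed

lemma sint_restr:
  fixes f :: "'a::topological_space \<Rightarrow> real"
  assumes f: "bdd_borel f" and S: "S \<in> sets borel"
  shows "sint f (restr S \<mu>) = sint (\<lambda>x. indicator S x * f x) \<mu>"
proof (rule bdd_linear_eq[OF bdd_linear_sint[of "restr S \<mu>"]
      bdd_linear_mult[OF bdd_linear_sint[of \<mu>] bdd_borel_indicator[OF S]] _ f])
  fix A :: "'a set" assume A: "A \<in> sets borel"
  have B: "A \<inter> S \<in> sets borel" using A S by (rule sets.Int)
  have "(\<lambda>x. indicator S x * indicator A x) = (indicator (A \<inter> S) :: 'a \<Rightarrow> real)" by (auto simp: indicator_def)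
  then show "sint (indicator A) (restr S \<mu>) = sint (\<lambda>x. indicator S x * indicator A x) \<mu>"
    by (simp only: sint_indicator[OF A] sint_indicator[OF B] smeasure_restr[OF S A])
qed

lemma measures_onI:
  "(\<And>A. A \<in> sets borel \<Longrightarrow> smeasure \<mu> A = smeasure \<mu> (A \<inter> \<Omega>)) \<Longrightarrow> \<mu> \<in> measures_on \<Omega>"
  unfolding measures_on_def by blast

lemma measures_onD: "\<mu> \<in> measures_on \<Omega> \<Longrightarrow> A \<in> sets borel \<Longrightarrow> smeasure \<mu> A = smeasure \<mu> (A \<inter> \<Omega>)"
  unfolding measures_on_def by blast

lemma measures_on_restr: "\<Omega> \<in> sets borel \<Longrightarrow> \<mu> \<in> measures_on \<Omega> \<longleftrightarrow> restr \<Omega> \<mu> = \<mu>"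
proof
  assume O: "\<Omega> \<in> sets borel" and m: "\<mu> \<in> measures_on \<Omega>"
  show "restr \<Omega> \<mu> = \<mu>"
  proof (rule smeasure_eqI)
    fix A :: "'a set" assume "A \<in> sets borel"
    from smeasure_restr[OF O this, of \<mu>] measures_onD[OF m this]
    show "smeasure (restr \<Omega> \<mu>) A = smeasure \<mu> A" by (rule trans[OF _ sym])
  qed
next
  assume O: "\<Omega> \<in> sets borel" and m: "restr \<Omega> \<mu> = \<mu>"
  show "\<mu> \<in> measures_on \<Omega>"
  proof (rule measures_onI)
    fix A :: "'a set" assume "A \<in> sets borel"
    from smeasure_restr[OF O this, of \<mu>] show "smeasure \<mu> A = smeasure \<mu> (A \<inter> \<Omega>)" unfolding m .
  qed
qed

lemma pairing_eq_sint:
  "\<Omega> \<in> sets borel \<Longrightarrow> \<mu> \<in> measures_on \<Omega> \<Longrightarrow> bdd_borel f \<Longrightarrow> pairing \<Omega> f \<mu> = sint f \<mu>"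
  using sint_restr[of f \<Omega> \<mu>] by (simp add: pairing_sint measures_on_restr)

lemma measures_on_zero: "0 \<in> measures_on \<Omega>"
  by (rule measures_onI) (simp only: smeasure_simps)

lemma measures_on_plus: "\<mu> \<in> measures_on \<Omega> \<Longrightarrow> \<nu> \<in> measures_on \<Omega> \<Longrightarrow> \<mu> + \<nu> \<in> measures_on \<Omega>"
  by (rule measures_onI, unfold smeasure_simps, rule arg_cong2[where f = "(+)"]; rule measures_onD)

lemma measures_on_minus: "\<mu> \<in> measures_on \<Omega> \<Longrightarrow> \<nu> \<in> measures_on \<Omega> \<Longrightarrow> \<mu> - \<nu> \<in> measures_on \<Omega>"
  by (rule measures_onI, unfold smeasure_simps, rule arg_cong2[where f = "(-)"]; rule measures_onD)

lemma measures_on_uminus: "\<mu> \<in> measures_on \<Omega> \<Longrightarrow> - \<mu> \<in> measures_on \<Omega>"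
  by (rule measures_onI, unfold smeasure_simps, rule arg_cong[where f = uminus]; rule measures_onD)

lemma measures_on_scaleR: "\<mu> \<in> measures_on \<Omega> \<Longrightarrow> c *\<^sub>R \<mu> \<in> measures_on \<Omega>"
  by (rule measures_onI, unfold smeasure_simps, rule arg_cong[where f = "(*) c"]; rule measures_onD)

lemmas measures_on_lin = measures_on_zero measures_on_plus measures_on_minus measures_on_uminus measures_on_scaleR

lemma measures_on_sum: "(\<And>i. i \<in> I \<Longrightarrow> \<mu> i \<in> measures_on \<Omega>) \<Longrightarrow> (\<Sum>i\<in>I. \<mu> i) \<in> measures_on \<Omega>"
  by (induction I rule: infinite_finite_induct) (auto intro: measures_on_lin)

lemma dirac_measures_on: "\<Omega> \<in> sets borel \<Longrightarrow> x \<in> \<Omega> \<Longrightarrow> dirac x \<in> measures_on \<Omega>"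
  by (rule measures_onI) (simp add: dirac.rep_eq sets.Int)

lemma jpos_measures_on:
  assumes O: "\<Omega> \<in> sets borel" and m: "\<mu> \<in> measures_on \<Omega>"
  shows "jpos \<mu> \<in> measures_on \<Omega>"
proof (rule measures_onI)
  fix A :: "'a set" assume A: "A \<in> sets borel"
  have "jpos_fun \<mu> A = jpos_fun \<mu> (A \<inter> \<Omega>)"
  proof (rule antisym[OF jpos_fun_least jpos_fun_mono])
    fix B assume B: "B \<in> sets borel" "B \<subseteq> A"
    have "smeasure \<mu> B = smeasure \<mu> (B \<inter> \<Omega>)" using m B(1) by (rule measures_onD)
    also have "\<dots> \<le> jpos_fun \<mu> (A \<inter> \<Omega>)" using B O by (intro jpos_fun_upper sets.Int) auto
    finally show "smeasure \<mu> B \<le> jpos_fun \<mu> (A \<inter> \<Omega>)" .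
  qed auto
  then show "smeasure (jpos \<mu>) A = smeasure (jpos \<mu>) (A \<inter> \<Omega>)"
    using A O by (simp only: smeasure_jpos sets.Int if_True)
qed

lemma jordan: "\<mu> = jpos \<mu> - jpos (- \<mu>)"
  by (simp add: jpos_uminus)

lemma sint_positive: "positive_measure \<mu> \<Longrightarrow> bdd_borel f \<Longrightarrow> sint f \<mu> = (LINT x|pos_part \<mu>. f x)"
proof -
  assume p: "positive_measure \<mu>" and f: "bdd_borel f"
  have "emeasure (neg_part \<mu>) UNIV = 0" using p by (simp add: emeasure_neg_part jpos_uminus jpos_positive smeasure_simps)
  then have "AE x in neg_part \<mu>. f x = 0" by (intro AE_I[of _ _ UNIV]) auto
  then have "(LINT x|neg_part \<mu>. f x) = 0" by (rule integral_eq_zero_AE)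
  then show ?thesis by (simp add: sint_def)
qed

lemma sint_nonneg:
  assumes "positive_measure \<mu>" "bdd_borel f" "\<And>x. 0 \<le> f x" shows "0 \<le> sint f \<mu>"
  using assms by (simp add: sint_positive)

lemma sint_mono_on:
  assumes p: "positive_measure \<mu>" and O: "\<Omega> \<in> sets borel" "\<mu> \<in> measures_on \<Omega>"
    and f: "bdd_borel f" and g: "bdd_borel g" and le: "\<And>x. x \<in> \<Omega> \<Longrightarrow> f x \<le> g x"
  shows "sint f \<mu> \<le> sint g \<mu>"
proof -
  have "0 \<le> sint (\<lambda>x. indicator \<Omega> x * (g x - f x)) \<mu>"
    using p f g O(1) le by (intro sint_nonneg bdd_borel_mult bdd_borel_diff bdd_borel_indicator)
      (auto simp: indicator_def)
  also have "\<dots> = sint g \<mu> - sint f \<mu>"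
    using sint_restr[OF bdd_borel_diff[OF g f] O(1), of \<mu>] O f g by (simp add: measures_on_restr sint_diff_fun)
  finally show ?thesis by simp
qed

lemma sint_eq_0_imp_null:
  assumes p: "positive_measure \<mu>" and O: "\<Omega> \<in> sets borel" "\<mu> \<in> measures_on \<Omega>"
    and f: "bdd_borel f" and nn: "\<And>x. x \<in> \<Omega> \<Longrightarrow> 0 \<le> f x" and z: "sint f \<mu> \<le> 0"
    and A: "A \<in> sets borel" and pos: "\<And>x. x \<in> A \<inter> \<Omega> \<Longrightarrow> 0 < f x"
  shows "smeasure \<mu> A = 0"
proof -
  let ?f = "\<lambda>x. indicator \<Omega> x * f x"
  have bf: "bdd_borel ?f" using f O(1) by (intro bdd_borel_mult bdd_borel_indicator)
  have "sint f \<mu> = sint ?f \<mu>" using sint_restr[OF f O(1), of \<mu>] O by (simp add: measures_on_restr)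
  then have "(LINT x|pos_part \<mu>. ?f x) \<le> 0" using z p bf by (simp add: sint_positive)
  moreover have nn': "0 \<le> ?f x" for x using nn by (auto simp: indicator_def)
  then have "0 \<le> (LINT x|pos_part \<mu>. ?f x)" by (rule Bochner_Integration.integral_nonneg)
  moreover have i: "integrable (pos_part \<mu>) ?f" by (rule bdd_borel_integrable[OF bf]) auto
  ultimately have "AE x in pos_part \<mu>. ?f x = 0"
    using integral_nonneg_eq_0_iff_AE[OF i] nn' by simp
  then have "AE x in pos_part \<mu>. x \<notin> A \<inter> \<Omega>"
    by eventually_elim (use pos in \<open>force simp: indicator_def\<close>)
  then have "emeasure (pos_part \<mu>) (A \<inter> \<Omega>) = 0"
    using A O(1) by (subst (asm) AE_iff_measurable[of "A \<inter> \<Omega>"]) auto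
  then have "smeasure \<mu> (A \<inter> \<Omega>) \<le> 0" using A O(1) p by (simp add: emeasure_pos_part jpos_positive ennreal_eq_0_iff)
  moreover have "0 \<le> smeasure \<mu> (A \<inter> \<Omega>)" using p by (simp add: positive_measure_def)
  ultimately show ?thesis using measures_onD[OF O(2) A] by simp
qed

lemma positive_lin:
  "positive_measure 0"
  "positive_measure \<mu> \<Longrightarrow> positive_measure \<nu> \<Longrightarrow> positive_measure (\<mu> + \<nu>)"
  "0 \<le> c \<Longrightarrow> positive_measure \<mu> \<Longrightarrow> positive_measure (c *\<^sub>R \<mu>)"
  "positive_measure (dirac x)"
  by (auto simp: positive_measure_def smeasure_simps dirac.rep_eq)

lemma positive_sum: "(\<And>i. i \<in> I \<Longrightarrow> positive_measure (\<mu> i)) \<Longrightarrow> positive_measure (\<Sum>i\<in>I. \<mu> i)"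
  by (induction I rule: infinite_finite_induct) (auto intro: positive_lin)

lemma positive_push: "h \<in> borel_measurable borel \<Longrightarrow> positive_measure \<mu> \<Longrightarrow> positive_measure (push h \<mu>)"
  unfolding positive_measure_def by (metis order_refl smeasure_notin smeasure_push)

lemma positive_restr: "S \<in> sets borel \<Longrightarrow> positive_measure \<mu> \<Longrightarrow> positive_measure (restr S \<mu>)"
  unfolding positive_measure_def by (metis order_refl smeasure_notin smeasure_restr)

definition signed_of :: "'a::topological_space measure \<Rightarrow> 'a signed_measure" where
  "signed_of M = Abs_signed_measure (measure M)"

lemma smeasure_signed_of:
  assumes "finite_measure M" "sets M = sets borel" shows "smeasure (signed_of M) = measure M"
proof -
  interpret finite_measure M by fact
  have "is_signed_measure (measure M)"
    unfolding is_signed_measure_def using assms(2)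
    by (auto simp: measure_notin_sets intro!: finite_measure_UNION)
  then show ?thesis by (simp add: signed_of_def smeasure_Abs)
qed

lemma positive_signed_of: "finite_measure M \<Longrightarrow> sets M = sets borel \<Longrightarrow> positive_measure (signed_of M)"
  by (simp add: positive_measure_def smeasure_signed_of)

lemma sint_signed_of:
  assumes M: "finite_measure M" "sets M = sets borel" and f: "bdd_borel f"
  shows "sint f (signed_of M) = (LINT x|M. f x)"
proof (rule bdd_linear_eq[OF bdd_linear_sint[of "signed_of M"] bdd_linear_integral[OF M] _ f])
  fix A :: "'a set" assume A: "A \<in> sets borel"
  have "A \<subseteq> space M" using sets_eq_imp_space_eq[OF M(2)] by simp
  then have "(LINT x|M. indicator A x) = measure M A" by (simp add: Int_absorb2)
  then show "sint (indicator A) (signed_of M) = (LINT x|M. indicator A x)"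
    by (simp only: sint_indicator[OF A] smeasure_signed_of[OF M])
qed

text \<open>
  The closed sets form an intersection-stable generator, and the indicator of a closed set \<open>C\<close> is the
  bounded limit of the continuous functions \<open>max 0 (1 - n * dist(x, C))\<close>.
\<close>

lemma signed_measure_eqI_continuous:
  fixes \<mu> \<nu> :: "'a::metric_space signed_measure"
  assumes O: "compact \<Omega>" and mu: "\<mu> \<in> measures_on \<Omega>" and nu: "\<nu> \<in> measures_on \<Omega>"
    and eq: "\<And>f. continuous_on \<Omega> f \<Longrightarrow> pairing \<Omega> f \<mu> = pairing \<Omega> f \<nu>"
  shows "\<mu> = \<nu>"
proof (rule smeasure_eqI)
  have OB: "\<Omega> \<in> sets borel" using O by (rule borel_compact)
  have closed: "smeasure \<mu> C = smeasure \<nu> C" if C: "closed C" for C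
  proof (cases "C = {}")
    case False
    define f where "f n x = max 0 (1 - real n * infdist x C)" for n x
    have f1: "\<bar>f n x\<bar> \<le> 1" for n x by (auto simp: f_def infdist_nonneg)
    have fc: "continuous_on S (f n)" for n S unfolding f_def by (intro continuous_intros)
    have lim: "(\<lambda>n. f n x) \<longlonglongrightarrow> indicator C x" for x
    proof (cases "x \<in> C")
      case True then show ?thesis by (simp add: f_def infdist_zero)
    next
      case False
      then have p: "0 < infdist x C" using C \<open>C \<noteq> {}\<close> 
        using in_closed_iff_infdist_zero[OF C \<open>C \<noteq> {}\<close>, of x] infdist_nonneg[of x C] by linarith
      obtain N where N: "1 / infdist x C < real N" using reals_Archimedean2 by blast
      have "f n x = 0" if "N \<le> n" for n
      proof -
        have "1 / infdist x C \<le> real n" using N that by linarith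
        then show ?thesis using p by (simp add: f_def field_simps)
      qed
      then have "\<forall>\<^sub>F n in sequentially. f n x = indicator C x"
        using False by (auto simp: eventually_sequentially)
      then show ?thesis by (rule tendsto_eventually)
    qed
    have L: "(\<lambda>n. pairing \<Omega> (f n) \<xi>) \<longlonglongrightarrow> smeasure \<xi> C" if xi: "\<xi> \<in> measures_on \<Omega>" for \<xi> :: "'a signed_measure"
    proof -
      have "(\<lambda>n. sint (f n) \<xi>) \<longlonglongrightarrow> sint (indicator C) \<xi>"
        using f1 lim fc[of UNIV]
        by (intro bdd_linearD(3)[OF bdd_linear_sint, of f 1 "indicator C"]) (auto intro: borel_measurable_continuous_onI)
      moreover have "pairing \<Omega> (f n) \<xi> = sint (f n) \<xi>" for n
        using f1 fc[of UNIV] by (intro pairing_eq_sint[OF OB xi] bdd_borelI[of _ 1]) (auto intro: borel_measurable_continuous_onI)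
      ultimately show ?thesis using C by (simp add: sint_indicator)
    qed
    show ?thesis using LIMSEQ_unique[OF L[OF mu]] L[OF nu] eq fc by simp
  qed simp
  fix A :: "'a set" assume "A \<in> sets borel"
  then have A: "A \<in> sigma_sets UNIV {S. closed S}" by (simp add: borel_eq_closed)
  have st: "Int_stable {S::'a set. closed S}" and sub: "{S::'a set. closed S} \<subseteq> Pow UNIV"
    by (auto simp: Int_stable_def)
  from st sub A show "smeasure \<mu> A = smeasure \<nu> A"
  proof (induction rule: sigma_sets_induct_disjoint)
    case (basic A) then show ?case using closed by simp
  next
    case empty then show ?case by simp
  next
    case (compl A)
    then have "A \<in> sets borel" by (simp add: borel_eq_closed)
    then show ?case using compl(2) closed[of UNIV] by (simp add: smeasure_Diff)
  next
    case (union A)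
    then have "range A \<subseteq> sets borel" by (simp add: borel_eq_closed image_subset_iff)
    then have "(\<lambda>i. smeasure \<mu> (A i)) sums smeasure \<mu> (\<Union>i. A i)" "(\<lambda>i. smeasure \<nu> (A i)) sums smeasure \<nu> (\<Union>i. A i)"
      using union(1) by (auto intro!: smeasure_sums)
    then show ?case using union(3) by (simp add: sums_unique2)
  qed
qed

section \<open>Weak* compactness of positive measures\<close>

text \<open>
  A continuous function of period 2 which vanishes on \<open>[0, 1/3]\<close> and equals 1 on \<open>[2/3, 1]\<close>: on the Cantor
  set it reads the leading ternary digit.
\<close>

definition wave :: "real \<Rightarrow> real" where
  "wave t = max 0 (min 1 (1/2 - cos (pi * t)))"

lemma wave_bounds: "0 \<le> wave t" "wave t \<le> 1"
  by (auto simp: wave_def)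

lemma continuous_wave: "continuous_on S (\<lambda>t. wave (c * t))"
  unfolding wave_def by (intro continuous_intros)

lemma wave_digit:
  assumes "c = 0 \<or> c = 1" "0 \<le> r" "r \<le> 1"
  shows "wave (2 * real N + (2 * c + r) / 3) = c"
proof -
  define u where "u = (2 * c + r) / 3"
  have "cos (pi * (2 * real N + u)) = cos (pi * u + 2 * real N * pi)"
    by (simp add: algebra_simps)
  also have "\<dots> = cos (pi * u)" by (simp add: cos_add cos_2npi sin_2npi)
  finally have w: "wave (2 * real N + u) = max 0 (min 1 (1/2 - cos (pi * u)))" by (simp add: wave_def)
  show ?thesis
  proof (cases "c = 0")
    case True
    then have u: "0 \<le> u" "u \<le> 1/3" using assms by (auto simp: u_def)
    have "pi * u \<le> pi * (1/3)" using u pi_ge_zero by (intro mult_left_mono) auto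
    then have "cos (pi / 3) \<le> cos (pi * u)"
      using u by (intro cos_monotone_0_pi_le) auto
    then show ?thesis using w True by (simp add: cos_60 u_def)
  next
    case False
    then have u: "2/3 \<le> u" "u \<le> 1" using assms by (auto simp: u_def)
    have "pi * (2/3) \<le> pi * u" using u pi_ge_zero by (intro mult_left_mono) auto
    moreover have "pi * u \<le> pi * 1" using u pi_ge_zero by (intro mult_left_mono) auto
    ultimately have "cos (pi * u) \<le> cos (pi * (2/3))"
      by (intro cos_monotone_0_pi_le) auto
    moreover have "cos (pi * (2/3)) = - 1/2" using cos_120 by (simp add: mult.commute)
    ultimately show ?thesis using w False assms by (auto simp: u_def)
  qed
qed

text \<open>
  The point of the Cantor set with ternary digits \<open>2 c\<^sub>0, 2 c\<^sub>1, \<dots>\<close>.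
\<close>

definition ternary :: "(nat \<Rightarrow> real) \<Rightarrow> real" where
  "ternary c = (\<Sum>j. 2 * c j / 3 ^ Suc j)"

lemma ternary_props:
  assumes c: "\<And>j. c j = 0 \<or> c j = 1"
  shows "0 \<le> ternary c" "ternary c \<le> 1" "3 * ternary c = 2 * c 0 + ternary (\<lambda>j. c (Suc j))"
proof -
  have gs: "(\<lambda>j. 2 / 3 * (1 / 3) ^ j :: real) sums (2 / 3 * (1 / (1 - 1 / 3)))"
    by (intro sums_mult geometric_sums) auto
  then have g: "(\<lambda>j. 2 / 3 ^ Suc j :: real) sums 1"
    by (simp add: power_divide)
  have le: "2 * c j / 3 ^ Suc j \<le> 2 / 3 ^ Suc j" "0 \<le> 2 * c j / 3 ^ Suc j"
    if "\<And>j. c j = 0 \<or> c j = 1" for j and c :: "nat \<Rightarrow> real"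
    using that[of j] by auto
  have s: "summable (\<lambda>j. 2 * c j / 3 ^ Suc j)" if "\<And>j. c j = 0 \<or> c j = 1" for c :: "nat \<Rightarrow> real"
  proof (rule summable_comparison_test'[OF sums_summable[OF g], of 0])
    show "norm (2 * c n / 3 ^ Suc n) \<le> 2 / 3 ^ Suc n" for n
      using that[of n] by (elim disjE) simp_all
  qed
  show "0 \<le> ternary c" unfolding ternary_def using le(2)[OF c] by (intro suminf_nonneg s c) auto
  show "ternary c \<le> 1" unfolding ternary_def sums_unique[OF g] using le(1)[OF c]
    by (intro suminf_le s c sums_summable[OF g]) auto
  have "ternary c - 2 * c 0 / 3 ^ Suc 0 = (\<Sum>j. 2 * c (Suc j) / 3 ^ Suc (Suc j))"
    unfolding ternary_def by (rule suminf_split_head[OF s[OF c], symmetric])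
  also have "(\<Sum>j. 2 * c (Suc j) / 3 ^ Suc (Suc j)) = (\<Sum>j. (1/3) * (2 * c (Suc j) / 3 ^ Suc j))"
    by (rule suminf_cong) simp
  also have "\<dots> = 1/3 * ternary (\<lambda>j. c (Suc j))"
    unfolding ternary_def using c by (intro suminf_mult s) auto
  finally show "3 * ternary c = 2 * c 0 + ternary (\<lambda>j. c (Suc j))" by simp
qed

text \<open>
  Multiplication by \<open>3 ^ k\<close> shifts the ternary digits by \<open>k\<close> places. The integer part produced is even, since
  all digits are even, and so it does not affect \<open>wave\<close>.
\<close>

lemma wave_ternary:
  assumes c: "\<And>j. c j = 0 \<or> c j = 1"
  shows "wave (3 ^ k * ternary c) = c k"
proof -
  have "\<exists>N::nat. 3 ^ k * ternary c = 2 * real N + ternary (\<lambda>j. c (j + k))" for k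
  proof (induction k)
    case 0 then show ?case by (intro exI[of _ 0]) simp
  next
    case (Suc k)
    then obtain N :: nat where N: "3 ^ k * ternary c = 2 * real N + ternary (\<lambda>j. c (j + k))" by blast
    have "3 * ternary (\<lambda>j. c (j + k)) = 2 * c k + ternary (\<lambda>j. c (j + Suc k))"
      using ternary_props(3)[of "\<lambda>j. c (j + k)"] c by simp
    then have "3 ^ Suc k * ternary c = 6 * real N + 2 * c k + ternary (\<lambda>j. c (j + Suc k))"
      using N by simp
    then show ?case using c[of k]
      by (elim disjE; intro exI[of _ "3 * N + (if c k = 1 then 1 else 0)"]) auto
  qed
  then obtain N :: nat where N: "3 ^ k * ternary c = 2 * real N + ternary (\<lambda>j. c (j + k))" by blast
  define r where "r = ternary (\<lambda>j. c (Suc j + k))"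
  have "3 * ternary (\<lambda>j. c (j + k)) = 2 * c k + r"
    using ternary_props(3)[of "\<lambda>j. c (j + k)"] c by (simp add: r_def)
  then have "3 ^ k * ternary c = 2 * real N + (2 * c k + r) / 3" using N by simp
  moreover have "0 \<le> r" "r \<le> 1" unfolding r_def using c by (intro ternary_props; simp)+
  ultimately show ?thesis using wave_digit[OF c[of k]] by simp
qed

lemma binary_digits:
  assumes x: "0 \<le> x" "x \<le> (1::real)"
  shows "\<exists>c. (\<forall>k. c k = 0 \<or> c k = 1) \<and> (\<lambda>k. c k / 2 ^ Suc k) sums x"
proof -
  define r where "r = rec_nat x (\<lambda>_ r. 2 * r - (if 1/2 \<le> r then 1 else 0))"
  define c where "c k = (if 1/2 \<le> r k then 1 else 0 :: real)" for k
  have r0: "r 0 = x" and rS: "r (Suc k) = 2 * r k - c k" for k by (simp_all add: r_def c_def)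
  have rb: "0 \<le> r k \<and> r k \<le> 1" for k
    by (induction k) (use x in \<open>auto simp: r0 rS c_def\<close>)
  have part: "(\<Sum>j<k. c j / 2 ^ Suc j) = x - r k / 2 ^ k" for k
    by (induction k) (simp_all add: r0 rS field_simps)
  have "(\<lambda>k. r k / 2 ^ k) \<longlonglongrightarrow> 0"
  proof (rule tendsto_sandwich[of "\<lambda>_. 0" _ _ "\<lambda>k. (1/2) ^ k"])
    show "(\<lambda>k. (1 / 2 :: real) ^ k) \<longlonglongrightarrow> 0" by (intro LIMSEQ_power_zero) auto
  qed (use rb in \<open>auto simp: power_divide divide_right_mono\<close>)
  then have "(\<lambda>k. x - r k / 2 ^ k) \<longlonglongrightarrow> x - 0" by (intro tendsto_intros)
  then have "(\<lambda>k. c k / 2 ^ Suc k) sums x" unfolding sums_def part by simp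
  then show ?thesis by (intro exI[of _ c]) (auto simp: c_def)
qed

text \<open>
  Reads the bits at the positions congruent to \<open>i\<close> modulo \<open>n\<close> as a binary expansion.
\<close>

definition coord :: "nat \<Rightarrow> nat \<Rightarrow> real \<Rightarrow> real" where
  "coord n i t = (\<Sum>k. wave (3 ^ (n * k + i) * t) / 2 ^ Suc k)"

lemma continuous_coord: "continuous_on UNIV (coord n i)"
proof -
  have g: "summable (\<lambda>k. 1 / 2 ^ Suc k :: real)"
    using summable_mult[OF summable_geometric[of "1/2::real"], of "1/2"] by (simp add: power_divide)
  have "uniform_limit UNIV (\<lambda>m t. \<Sum>k<m. wave (3 ^ (n * k + i) * t) / 2 ^ Suc k) (coord n i) sequentially"
    unfolding coord_def[abs_def]
    by (rule Weierstrass_m_test[OF _ g]) (use wave_bounds in \<open>simp add: divide_right_mono\<close>)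
  then show ?thesis
    by (rule uniform_limit_theorem[rotated])
      (auto intro!: always_eventually continuous_intros continuous_wave)
qed

text \<open>
  Schoenberg's curve. The bits of the \<open>n\<close> coordinates of a given point are interleaved into a single
  sequence, and the Cantor point with these digits is mapped to the given point.
\<close>

lemma space_filling_curve:
  fixes P :: "'a::euclidean_space set"
  assumes "bounded P"
  shows "\<exists>\<phi>. continuous_on UNIV \<phi> \<and> P \<subseteq> \<phi> ` {0..1::real}"
proof -
  obtain R where R: "0 < R" "\<And>x. x \<in> P \<Longrightarrow> norm x \<le> R" using assms by (auto simp: bounded_pos)
  define n where "n = DIM('a)"
  have n: "0 < n" by (simp add: n_def)
  obtain e :: "'a \<Rightarrow> nat" where e: "bij_betw e Basis {0..<n}"
    using ex_bij_betw_finite_nat[OF finite_Basis] by (auto simp: n_def)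
  define \<phi> where "\<phi> t = (\<Sum>b\<in>Basis. (2 * R * coord n (e b) t - R) *\<^sub>R (b::'a))" for t
  have "continuous_on UNIV \<phi>"
    unfolding \<phi>_def by (intro continuous_intros continuous_coord)
  moreover have "x \<in> \<phi> ` {0..1}" if x: "x \<in> P" for x
  proof -
    have "\<exists>c. (\<forall>k. c k = 0 \<or> c k = 1) \<and> (\<lambda>k. c k / 2 ^ Suc k) sums ((x \<bullet> b + R) / (2 * R))" if "b \<in> Basis" for b
      using Basis_le_norm[OF that, of x] R(2)[OF x] R(1) by (intro binary_digits) (auto simp: field_simps)
    then obtain d where d: "\<And>b k. b \<in> Basis \<Longrightarrow> d b k = 0 \<or> d b k = 1"
      "\<And>b. b \<in> Basis \<Longrightarrow> (\<lambda>k. d b k / 2 ^ Suc k) sums ((x \<bullet> b + R) / (2 * R))"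
      by metis
    define e' where "e' = inv_into Basis e"
    have e': "e' i \<in> Basis" if "i < n" for i
      using e that by (auto simp: e'_def bij_betw_def intro!: inv_into_into)
    define c where "c j = d (e' (j mod n)) (j div n)" for j
    have c: "c j = 0 \<or> c j = 1" for j unfolding c_def using n by (intro d e') auto
    have co: "coord n (e b) (ternary c) = (x \<bullet> b + R) / (2 * R)" if b: "b \<in> Basis" for b
    proof -
      have eb: "e b < n" "e' (e b) = b" using e b by (auto simp: bij_betw_def e'_def)
      have "c (n * k + e b) = d b k" for k using eb by (simp add: c_def)
      then show ?thesis
        using sums_unique[OF d(2)[OF b]] by (simp add: coord_def wave_ternary[OF c])
    qed
    have "\<phi> (ternary c) = (\<Sum>b\<in>Basis. (x \<bullet> b) *\<^sub>R b)"
      unfolding \<phi>_def using R(1) by (intro sum.cong) (auto simp: co field_simps)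
    then have "\<phi> (ternary c) = x" by (simp add: euclidean_representation)
    then show ?thesis using ternary_props(1,2)[OF c] by force
  qed
  ultimately show ?thesis by blast
qed

text \<open>
  The section takes the least preimage, so that for \<open>a < 2\<close> the set \<open>{s \<le> a}\<close> is the trace on \<open>P\<close> of the
  compact image of \<open>{0..1} \<inter> {..a}\<close>. The value 2 keeps the points outside \<open>P\<close> out of these sets.
\<close>

lemma measurable_section:
  fixes \<phi> :: "real \<Rightarrow> 'a::t2_space"
  assumes cont: "continuous_on UNIV \<phi>" and P: "closed P" "P \<subseteq> \<phi> ` {0..1}"
  shows "\<exists>s. s \<in> borel_measurable borel \<and> (\<forall>x\<in>P. s x \<in> {0..1} \<and> \<phi> (s x) = x) \<and> (\<forall>x. x \<notin> P \<longrightarrow> s x = 2)"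
proof -
  define s where "s x = (if x \<in> P then Inf {t\<in>{0..1}. \<phi> t = x} else 2)" for x
  have least: "s x \<in> {0..1} \<and> \<phi> (s x) = x \<and> (\<forall>t\<in>{0..1}. \<phi> t = x \<longrightarrow> s x \<le> t)" if x: "x \<in> P" for x
  proof -
    have cl: "closed {t\<in>{0..1}. \<phi> t = x}"
    proof -
      have "closed (\<phi> -` {x})" using cont by (intro closed_vimage) auto
      then have "closed ({0..1} \<inter> \<phi> -` {x})" by (intro closed_Int) auto
      moreover have "{t\<in>{0..1}. \<phi> t = x} = {0..1} \<inter> \<phi> -` {x}" by auto
      ultimately show ?thesis by simp
    qed
    have ne: "{t\<in>{0..1}. \<phi> t = x} \<noteq> {}" using P(2) x by force
    have bd: "bdd_below {t\<in>{0..1}. \<phi> t = x}" by (rule bdd_belowI[of _ 0]) auto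
    have "Inf {t\<in>{0..1}. \<phi> t = x} \<in> {t\<in>{0..1}. \<phi> t = x}"
      by (rule closed_contains_Inf[OF ne bd cl])
    moreover have "Inf {t\<in>{0..1}. \<phi> t = x} \<le> t" if "t \<in> {0..1}" "\<phi> t = x" for t
      using that by (intro cInf_lower bd) auto
    ultimately show ?thesis using x by (simp add: s_def)
  qed
  have "{x. s x \<le> a} \<in> sets borel" for a
  proof (cases "2 \<le> a")
    case True
    have "s x \<le> a" for x using least[of x] True by (cases "x \<in> P") (auto simp: s_def)
    then show ?thesis by simp
  next
    case False
    have "{x. s x \<le> a} = P \<inter> \<phi> ` ({0..1} \<inter> {..a})"
    proof safe
      fix x assume sx: "s x \<le> a"
      then show xP: "x \<in> P" using False by (auto simp: s_def split: if_splits)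
      then show "x \<in> \<phi> ` ({0..1} \<inter> {..a})" using least[OF xP] sx by (intro image_eqI[of _ _ "s x"]) auto
    next
      fix t assume "t \<in> {0..1}" "t \<le> a" "\<phi> t \<in> P"
      then show "s (\<phi> t) \<le> a" using least[of "\<phi> t"] by force
    qed
    moreover have "compact (\<phi> ` ({0..1} \<inter> {..a}))"
      using cont by (intro compact_continuous_image compact_Int_closed) (auto intro: continuous_on_subset)
    then have "closed (P \<inter> \<phi> ` ({0..1} \<inter> {..a}))"
      using P(1) by (intro closed_Int) (auto intro: compact_imp_closed)
    ultimately show ?thesis by (simp add: borel_closed)
  qed
  then have "s \<in> borel_measurable borel" by (simp add: borel_measurable_iff_le)
  then show ?thesis using least by (intro exI[of _ s]) (auto simp: s_def)
qed

text \<open>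
  Weak* convergence tests functions on \<open>P\<close>; by Tietze's theorem these extend to bounded continuous functions
  on the whole space.
\<close>

lemma weak_star_convergesI_continuous_extension:
  fixes P :: "'a::euclidean_space set"
  assumes P: "compact P" and on: "\<And>n. \<tau> n \<in> measures_on P" "\<tau>' \<in> measures_on P"
    and lim: "\<And>g B. continuous_on UNIV g \<Longrightarrow> (\<And>x. \<bar>g x\<bar> \<le> B) \<Longrightarrow> (\<lambda>n. sint g (\<tau> n)) \<longlonglongrightarrow> sint g \<tau>'"
  shows "weak_star_converges P \<tau> \<tau>'"
  unfolding weak_star_converges_def
proof (intro allI impI)
  fix f :: "'a \<Rightarrow> real" assume f: "continuous_on P f"
  have "bounded (f ` P)" using compact_continuous_image[OF f P] by (rule compact_imp_bounded)
  then obtain B where B: "0 < B" "\<And>x. x \<in> P \<Longrightarrow> norm (f x) \<le> B" unfolding bounded_pos by auto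
  have cl: "closedin (top_of_set UNIV) P" using compact_imp_closed[OF P] by simp
  obtain g where g: "continuous_on UNIV g" "\<And>x. x \<in> P \<Longrightarrow> g x = f x" "\<And>x. x \<in> UNIV \<Longrightarrow> norm (g x) \<le> B"
    using Tietze[OF f cl less_imp_le[OF B(1)] B(2)] by blast
  have gb: "bdd_borel g" using g(1,3) by (intro bdd_borelI[of _ B] borel_measurable_continuous_onI) auto
  have "pairing P f \<nu> = sint g \<nu>" if "\<nu> \<in> measures_on P" for \<nu>
  proof -
    have "(\<lambda>x. indicator P x * f x) = (\<lambda>x. indicator P x * g x)"
      using g(2) by (auto simp: indicator_def)
    then have "pairing P f \<nu> = pairing P g \<nu>" by (simp only: pairing_sint)
    also have "\<dots> = sint g \<nu>" by (rule pairing_eq_sint[OF borel_compact[OF P] that gb])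
    finally show ?thesis .
  qed
  then show "(\<lambda>n. pairing P f (\<tau> n)) \<longlonglongrightarrow> pairing P f \<tau>'"
    using lim[OF g(1), of B] g(3) on by simp
qed

lemma sint_le_mass:
  assumes p: "positive_measure \<mu>" and f: "f \<in> borel_measurable borel" "\<And>x. \<bar>f x\<bar> \<le> B"
  shows "\<bar>sint f \<mu>\<bar> \<le> B * smeasure \<mu> UNIV"
proof -
  have fb: "bdd_borel f" using f by (rule bdd_borelI)
  have i: "sint (\<lambda>x. c) \<mu> = c * smeasure \<mu> UNIV" for c
    using sint_cmult_fun[OF bdd_borel_indicator[of UNIV], of c \<mu>] sint_indicator[of UNIV \<mu>] by simp
  have O: "UNIV \<in> sets borel" "\<mu> \<in> measures_on UNIV" by (auto intro: measures_onI)
  have "sint f \<mu> \<le> sint (\<lambda>x. B) \<mu>" 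
    by (rule sint_mono_on[OF p O fb bdd_borel_const]) (use f(2) abs_le_D1 in blast)
  moreover have "sint (\<lambda>x. - B) \<mu> \<le> sint f \<mu>"
    by (rule sint_mono_on[OF p O bdd_borel_const fb]) (use f(2) in \<open>auto simp: abs_le_iff minus_le_iff\<close>)
  ultimately show ?thesis by (simp add: i abs_le_iff)
qed

text \<open>
  On the real line this is Helly's selection theorem. It is transported by a curve \<open>\<phi>\<close> that covers \<open>P\<close>: a
  Borel section \<open>s\<close> of \<open>\<phi>\<close> pushes the measures to the interval \<open>[0, 1]\<close>, a limit is taken there and pushed
  back by \<open>\<phi>\<close>. Since \<open>\<phi> \<circ> s\<close> is the identity on \<open>P\<close> and \<open>\<phi>\<close> is continuous, integrals of continuous
  functions pass to the limit although \<open>s\<close> may be discontinuous.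
\<close>

lemma prob_measures_weakly_compact:
  fixes P :: "'a::euclidean_space set"
  assumes P: "compact P" and pos: "\<And>n. positive_measure (\<rho> n)" and on: "\<And>n. \<rho> n \<in> measures_on P"
    and mass: "\<And>n::nat. smeasure (\<rho> n) UNIV = 1"
  shows "\<exists>r \<rho>'. strict_mono (r :: nat \<Rightarrow> nat) \<and> positive_measure \<rho>' \<and>
    (\<forall>g B. continuous_on UNIV g \<longrightarrow> (\<forall>x. \<bar>g x\<bar> \<le> B) \<longrightarrow> (\<lambda>n. sint g (\<rho> (r n))) \<longlonglongrightarrow> sint g \<rho>')"
proof -
  have PB: "P \<in> sets borel" using P by (rule borel_compact)
  obtain \<phi> where \<phi>: "continuous_on UNIV \<phi>" "P \<subseteq> \<phi> ` {0..1::real}"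
    using space_filling_curve[OF compact_imp_bounded[OF P]] by blast
  obtain s where s: "s \<in> borel_measurable borel" "\<And>x. x \<in> P \<Longrightarrow> s x \<in> {0..1} \<and> \<phi> (s x) = x"
    using measurable_section[OF \<phi>(1) compact_imp_closed[OF P] \<phi>(2)] by blast
  have \<phi>m: "\<phi> \<in> borel_measurable borel" using \<phi>(1) by (rule borel_measurable_continuous_onI)
  define \<sigma> where "\<sigma> n = push s (\<rho> n)" for n
  define N where "N n = pos_part (\<sigma> n)" for n
  have posS: "positive_measure (\<sigma> n)" for n unfolding \<sigma>_def by (rule positive_push[OF s(1) pos])
  have emN: "emeasure (N n) A = ennreal (smeasure (\<rho> n) (s -` A))" if "A \<in> sets borel" for A n
    using that posS[of n] by (simp add: N_def emeasure_pos_part jpos_positive) (simp add: \<sigma>_def smeasure_push[OF s(1)])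
  have setsN: "sets (N n) = sets borel" "space (N n) = UNIV" for n by (simp_all add: N_def)
  have rd: "real_distribution (N n)" for n
  proof -
    have "prob_space (N n)" by (rule prob_spaceI) (simp add: setsN emN mass)
    then show ?thesis by (simp add: real_distribution_def real_distribution_axioms_def setsN)
  qed
  have tight: "tight N"
    unfolding tight_def
  proof (intro conjI allI impI)
    fix e :: real assume e: "0 < e"
    have "measure (N n) {-1<..1} = 1" for n
    proof -
      have m: "s -` {-1<..1} \<in> sets borel" using measurable_sets[OF s(1), of "{-1<..1}"] by simp
      have "smeasure (\<rho> n) (s -` {-1<..1}) = smeasure (\<rho> n) (s -` {-1<..1} \<inter> P)" by (rule measures_onD[OF on m])
      also have "s -` {-1<..1} \<inter> P = UNIV \<inter> P" using s(2) by fastforce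
      also have "smeasure (\<rho> n) (UNIV \<inter> P) = 1" using measures_onD[OF on[of n], of UNIV] mass[of n] by simp
      finally show ?thesis by (simp add: measure_def emN)
    qed
    then show "\<exists>a b. a < b \<and> (\<forall>n. 1 - e < measure (N n) {a<..b})"
      using e by (intro exI[of _ "-1"] exI[of _ "1"]) auto
  qed (rule rd)
  have "strict_mono (id :: nat \<Rightarrow> nat)" by (simp add: strict_mono_def)
  from tight_imp_convergent_subsubsequence[OF tight this]
  obtain r M where r: "strict_mono (r :: nat \<Rightarrow> nat)" and M: "real_distribution M" "weak_conv_m (N \<circ> id \<circ> r) M"
    by blast
  interpret M: real_distribution M by fact
  have Mf: "finite_measure M" "sets M = sets borel" by (auto intro: M.finite_measure_axioms)
  define \<rho>' where "\<rho>' = push \<phi> (signed_of M)"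
  have "(\<lambda>n. sint g (\<rho> (r n))) \<longlonglongrightarrow> sint g \<rho>'"
    if g: "continuous_on UNIV g" and B: "\<And>x. \<bar>g x\<bar> \<le> B" for g B
  proof -
    have gb: "bdd_borel g" using B by (intro bdd_borelI[of _ B] borel_measurable_continuous_onI g)
    have gp: "bdd_borel (\<lambda>t. g (\<phi> t))" by (rule bdd_borel_compose[OF gb \<phi>m])
    have gps: "bdd_borel (\<lambda>x. g (\<phi> (s x)))" by (rule bdd_borel_compose[OF gp s(1)])
    have cont: "continuous_on UNIV (\<lambda>t. g (\<phi> t))"
      using continuous_on_compose2[OF g \<phi>(1)] by simp
    have "(\<lambda>n. integral\<^sup>L ((N \<circ> id \<circ> r) n) (\<lambda>t. g (\<phi> t))) \<longlonglongrightarrow> integral\<^sup>L M (\<lambda>t. g (\<phi> t))"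
      by (rule weak_conv_imp_integral_bdd_continuous_conv[OF _ M, of _ B])
        (use rd cont B in \<open>auto simp: continuous_on_eq_continuous_at\<close>)
    moreover have "integral\<^sup>L ((N \<circ> id \<circ> r) n) (\<lambda>t. g (\<phi> t)) = sint g (\<rho> (r n))" for n
    proof -
      have eq: "(\<lambda>x. indicator P x * g x) = (\<lambda>x. indicator P x * g (\<phi> (s x)))"
        using s(2) by (auto simp: indicator_def)
      have "integral\<^sup>L (N (r n)) (\<lambda>t. g (\<phi> t)) = sint (\<lambda>t. g (\<phi> t)) (\<sigma> (r n))"
        unfolding N_def by (rule sint_positive[OF posS gp, symmetric])
      also have "\<dots> = sint (\<lambda>x. g (\<phi> (s x))) (\<rho> (r n))" unfolding \<sigma>_def by (rule sint_push[OF gp s(1)])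
      also have "\<dots> = pairing P (\<lambda>x. g (\<phi> (s x))) (\<rho> (r n))" by (rule pairing_eq_sint[OF PB on gps, symmetric])
      also have "\<dots> = pairing P g (\<rho> (r n))" unfolding pairing_sint eq ..
      also have "\<dots> = sint g (\<rho> (r n))" by (rule pairing_eq_sint[OF PB on gb])
      finally show ?thesis by simp
    qed
    moreover have "integral\<^sup>L M (\<lambda>t. g (\<phi> t)) = sint g \<rho>'"
      unfolding \<rho>'_def sint_push[OF gb \<phi>m] by (rule sint_signed_of[OF Mf gp, symmetric])
    ultimately show ?thesis by simp
  qed
  moreover have "positive_measure \<rho>'" unfolding \<rho>'_def by (intro positive_push[OF \<phi>m] positive_signed_of Mf)
  ultimately show ?thesis using r by blast
qed

text \<open>
  After passing to a subsequence the masses converge. If they tend to zero, so do the measures; otherwise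
  the normalized measures are probability measures. The limit is carried by \<open>P\<close> because it annihilates the
  truncated distance to \<open>P\<close>.
\<close>

lemma positive_measures_weak_star_compact:
  fixes P :: "'a::euclidean_space set"
  assumes P: "compact P" and pos: "\<And>n. positive_measure (\<tau> n)" and on: "\<And>n. \<tau> n \<in> measures_on P"
    and mass: "\<And>n::nat. smeasure (\<tau> n) UNIV \<le> R"
  shows "\<exists>r \<tau>'. strict_mono (r :: nat \<Rightarrow> nat) \<and> positive_measure \<tau>' \<and> \<tau>' \<in> measures_on P \<and>
    weak_star_converges P (\<lambda>n. \<tau> (r n)) \<tau>'"
proof -
  have PB: "P \<in> sets borel" using P by (rule borel_compact)
  define m where "m n = smeasure (\<tau> n) UNIV" for n
  have m: "0 \<le> m n" "m n \<le> R" for n using pos[of n] mass[of n] by (auto simp: m_def positive_measure_def)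
  have "\<forall>n. m n \<in> {0..R}" using m by simp
  then obtain m' r1 where r1: "strict_mono (r1 :: nat \<Rightarrow> nat)" "(\<lambda>n. m (r1 n)) \<longlonglongrightarrow> m'"
    using compact_Icc[of 0 R] unfolding compact_def by (metis (no_types, lifting) comp_def ext)
  have m'0: "0 \<le> m'" by (rule LIMSEQ_le_const[OF r1(2)]) (use m(1) in auto)
  show ?thesis
  proof (cases "m' = 0")
    case True
    have l0: "(\<lambda>n. sint g (\<tau> (r1 n))) \<longlonglongrightarrow> sint g 0" if g: "continuous_on UNIV g" "\<And>x. \<bar>g x\<bar> \<le> B" for g B
    proof -
      have gm: "g \<in> borel_measurable borel" using g(1) by (rule borel_measurable_continuous_onI)
      have "(\<lambda>n. B * m (r1 n)) \<longlonglongrightarrow> B * 0" using r1(2) True by (intro tendsto_intros) simp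
      then have l: "(\<lambda>n. B * m (r1 n)) \<longlonglongrightarrow> 0" by simp
      have "(\<lambda>n. sint g (\<tau> (r1 n))) \<longlonglongrightarrow> 0"
        by (rule Lim_null_comparison[OF _ l])
          (use sint_le_mass[OF pos gm g(2)] in \<open>simp add: m_def\<close>)
      then show ?thesis using sint_zero[OF bdd_borelI[OF gm g(2)]] by simp
    qed
    have "weak_star_converges P (\<lambda>n. \<tau> (r1 n)) 0"
      by (rule weak_star_convergesI_continuous_extension[OF P on measures_on_zero l0])
    then show ?thesis using r1(1) positive_lin(1) measures_on_zero by blast
  next
    case False
    then have m'p: "0 < m'" using m'0 by simp
    then have "\<forall>\<^sub>F n in sequentially. 0 < m (r1 n)" using r1(2) by (rule order_tendstoD(1)[rotated])
    then obtain k where k: "\<And>n. k \<le> n \<Longrightarrow> 0 < m (r1 n)" by (auto simp: eventually_sequentially)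
    define q where "q n = r1 (n + k)" for n
    have q: "strict_mono q" "\<And>n. 0 < m (q n)" "(\<lambda>n. m (q n)) \<longlonglongrightarrow> m'"
      using r1 k LIMSEQ_ignore_initial_segment[OF r1(2), of k] by (auto simp: q_def strict_mono_def)
    define \<rho> where "\<rho> n = (1 / m (q n)) *\<^sub>R \<tau> (q n)" for n
    have \<tau>: "\<tau> (q n) = m (q n) *\<^sub>R \<rho> n" for n using q(2)[of n] by (simp add: \<rho>_def)
    have "\<And>n. positive_measure (\<rho> n)" "\<And>n. \<rho> n \<in> measures_on P" "\<And>n. smeasure (\<rho> n) UNIV = 1"
      using q(2) less_imp_neq[OF q(2)] m(1)
      by (auto simp: \<rho>_def smeasure_simps m_def[symmetric] intro!: positive_lin pos measures_on_scaleR on)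
    from prob_measures_weakly_compact[OF P, of \<rho>, OF this] obtain r2 \<rho>' where r2: "strict_mono (r2 :: nat \<Rightarrow> nat)"
      "positive_measure \<rho>'" "\<And>g B. continuous_on UNIV g \<Longrightarrow> (\<And>x. \<bar>g x\<bar> \<le> B) \<Longrightarrow> (\<lambda>n. sint g (\<rho> (r2 n))) \<longlonglongrightarrow> sint g \<rho>'"
      by blast
    define \<tau>' where "\<tau>' = m' *\<^sub>R \<rho>'"
    have pos': "positive_measure \<tau>'" unfolding \<tau>'_def using m'0 r2(2) by (intro positive_lin)
    have lim: "(\<lambda>n. sint g (\<tau> (q (r2 n)))) \<longlonglongrightarrow> sint g \<tau>'"
      if g: "continuous_on UNIV g" "\<And>x. \<bar>g x\<bar> \<le> B" for g B
    proof -
      have gb: "bdd_borel g" using g by (intro bdd_borelI[of _ B] borel_measurable_continuous_onI)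
      have "(\<lambda>n. m (q (r2 n)) * sint g (\<rho> (r2 n))) \<longlonglongrightarrow> m' * sint g \<rho>'"
        using LIMSEQ_subseq_LIMSEQ[OF q(3) r2(1)] by (intro tendsto_mult r2(3)[OF g]) (simp add: o_def)
      then show ?thesis by (simp add: \<tau> \<tau>'_def sint_scaleR[OF gb])
    qed
    have on': "\<tau>' \<in> measures_on P"
    proof (cases "P = {}")
      case True
      have "smeasure (\<tau> n) UNIV = 0" for n using measures_onD[OF on[of n], of UNIV] True by simp
      then show ?thesis using q(2)[of 0] by (simp add: m_def)
    next
      case False
      define h where "h x = min 1 (infdist x P)" for x
      have h: "continuous_on UNIV h" "\<And>x. \<bar>h x\<bar> \<le> 1"
        unfolding h_def by (auto intro!: continuous_intros simp: infdist_nonneg)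
      have hb: "bdd_borel h" using h by (intro bdd_borelI[of _ 1] borel_measurable_continuous_onI)
      have "sint h (\<tau> n) = 0" for n
      proof -
        have "(\<lambda>x. indicator P x * h x) = (\<lambda>x. 0)" by (auto simp: indicator_def h_def)
        then have "pairing P h (\<tau> n) = sint (\<lambda>x. 0) (\<tau> n)" by (simp only: pairing_sint)
        also have "\<dots> = 0" by (simp add: sint_def)
        finally show ?thesis using pairing_eq_sint[OF PB on hb, of n] by simp
      qed
      then have "sint h \<tau>' = 0" using lim[OF h] by (simp add: LIMSEQ_const_iff)
      have null: "smeasure \<tau>' (- P) = 0"
      proof (rule sint_eq_0_imp_null[OF pos' _ _ hb, of UNIV])
        show "\<tau>' \<in> measures_on UNIV" by (rule measures_onI) simp
        show "0 < h x" if "x \<in> - P \<inter> UNIV" for x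
          using that in_closed_iff_infdist_zero[OF compact_imp_closed[OF P] False, of x] infdist_nonneg[of x P]
          by (auto simp: h_def)
      qed (use PB \<open>sint h \<tau>' = 0\<close> in \<open>auto simp: h_def infdist_nonneg\<close>)
      show ?thesis
      proof (rule measures_onI)
        fix A :: "'a set" assume A: "A \<in> sets borel"
        have "smeasure \<tau>' (A - P) \<le> smeasure \<tau>' (- P)"
          using A PB by (intro positive_measure_mono[OF pos']) auto
        then have "smeasure \<tau>' (A - P) = 0" using null pos' by (simp add: positive_measure_def antisym)
        then show "smeasure \<tau>' A = smeasure \<tau>' (A \<inter> P)" using smeasure_split[OF A PB, of \<tau>'] by simp
      qed
    qed
    have "weak_star_converges P (\<lambda>n. \<tau> (q (r2 n))) \<tau>'"
      by (rule weak_star_convergesI_continuous_extension[OF P on on' lim])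
    moreover have "strict_mono (\<lambda>n. q (r2 n))" using q(1) r2(1) by (simp add: strict_mono_def)
    ultimately show ?thesis using pos' on' by blast
  qed
qed

section \<open>Superpositions of signed points and dipoles\<close>

text \<open>
  \<open>t \<le> t powr p\<close> on \<open>[0, 1]\<close>, applied to \<open>a / (a + b)\<close> and \<open>b / (a + b)\<close>.
\<close>

lemma powr_subadditive:
  assumes "0 < p" "p \<le> 1" "0 \<le> a" "0 \<le> (b::real)"
  shows "(a + b) powr p \<le> a powr p + b powr p"
proof (cases "a + b = 0")
  case True
  then show ?thesis using assms by simp
next
  case False
  then have s: "0 < a + b" using assms by simp
  have le: "c / (a + b) \<le> (c / (a + b)) powr p" if "0 \<le> c" "c \<le> a + b" for c
  proof (cases "c = 0")
    case False
    then have "(c / (a + b)) powr 1 \<le> (c / (a + b)) powr p"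
      using that s assms by (intro powr_mono') auto
    then show ?thesis using that s by simp
  qed simp
  have "1 = a / (a + b) + b / (a + b)" using s by (simp add: add_divide_distrib[symmetric])
  also have "\<dots> \<le> (a / (a + b)) powr p + (b / (a + b)) powr p"
    using assms by (intro add_mono le) auto
  also have "\<dots> = (a powr p + b powr p) / (a + b) powr p"
    using assms s by (simp add: powr_divide add_divide_distrib)
  finally show ?thesis using s by (simp add: field_simps)
qed

lemma pairing_cong: "(\<And>x. x \<in> S \<Longrightarrow> f x = g x) \<Longrightarrow> pairing S f \<mu> = pairing S g \<mu>"
proof -
  assume "\<And>x. x \<in> S \<Longrightarrow> f x = g x"
  then have "(\<lambda>x. indicator S x * f x) = (\<lambda>x. indicator S x * g x)" by (auto simp: indicator_def)
  then show ?thesis by (simp only: pairing_sint)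
qed

lemma push_measures_on:
  assumes h: "h \<in> borel_measurable borel" and S: "S \<in> sets borel" and S': "S' \<in> sets borel"
    and m: "\<mu> \<in> measures_on S" and hS: "h ` S \<subseteq> S'"
  shows "push h \<mu> \<in> measures_on S'"
proof (rule measures_onI)
  fix A :: "'b set" assume A: "A \<in> sets borel"
  have m1: "h -` A \<in> sets borel" "h -` (A \<inter> S') \<in> sets borel"
    using measurable_sets[OF h A] measurable_sets[OF h sets.Int[OF A S']] by simp_all
  have "smeasure (push h \<mu>) A = smeasure \<mu> (h -` A \<inter> S)"
    unfolding smeasure_push[OF h A] by (rule measures_onD[OF m m1(1)])
  also have "h -` A \<inter> S = h -` (A \<inter> S') \<inter> S" using hS by auto
  also have "smeasure \<mu> (h -` (A \<inter> S') \<inter> S) = smeasure (push h \<mu>) (A \<inter> S')"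
    unfolding smeasure_push[OF h sets.Int[OF A S']] by (rule measures_onD[OF m m1(2), symmetric])
  finally show "smeasure (push h \<mu>) A = smeasure (push h \<mu>) (A \<inter> S')" .
qed

lemma restr_measures_on:
  assumes T: "T \<in> sets borel" and S: "S \<in> sets borel" and m: "\<mu> \<in> measures_on S"
  shows "restr T \<mu> \<in> measures_on S"
proof (rule measures_onI)
  fix A :: "'a set" assume A: "A \<in> sets borel"
  have "smeasure (restr T \<mu>) A = smeasure \<mu> (A \<inter> T \<inter> S)"
    unfolding smeasure_restr[OF T A] by (rule measures_onD[OF m sets.Int[OF A T]])
  also have "A \<inter> T \<inter> S = A \<inter> S \<inter> T" by auto
  also have "smeasure \<mu> (A \<inter> S \<inter> T) = smeasure (restr T \<mu>) (A \<inter> S)"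
    unfolding smeasure_restr[OF T sets.Int[OF A S]] ..
  finally show "smeasure (restr T \<mu>) A = smeasure (restr T \<mu>) (A \<inter> S)" .
qed

lemma pairing_push:
  fixes h :: "'a::t2_space \<Rightarrow> 'b::t2_space"
  assumes h: "h \<in> borel_measurable borel" and S: "compact S" and S': "compact S'"
    and m: "\<mu> \<in> measures_on S" and hS: "h ` S \<subseteq> S'" and f: "continuous_on S' f"
  shows "pairing S' f (push h \<mu>) = pairing S (\<lambda>x. f (h x)) \<mu>"
proof -
  let ?f = "\<lambda>y. indicator S' y * f y"
  have fb: "bdd_borel ?f" by (rule bdd_borel_continuous[OF S' f])
  have fh: "bdd_borel (\<lambda>x. ?f (h x))" by (rule bdd_borel_compose[OF fb h])
  have "pairing S' f (push h \<mu>) = sint (\<lambda>x. ?f (h x)) \<mu>"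
    unfolding pairing_sint by (rule sint_push[OF fb h])
  also have "\<dots> = pairing S (\<lambda>x. ?f (h x)) \<mu>"
    by (rule pairing_eq_sint[OF borel_compact[OF S] m fh, symmetric])
  also have "\<dots> = pairing S (\<lambda>x. f (h x)) \<mu>" using hS by (intro pairing_cong) (auto simp: indicator_def)
  finally show ?thesis .
qed

lemma pairing_plus:
  fixes f :: "'a::t2_space \<Rightarrow> real"
  assumes "compact S" "continuous_on S f"
  shows "pairing S f (\<mu> + \<nu>) = pairing S f \<mu> + pairing S f \<nu>"
    and "pairing S f (\<mu> - \<nu>) = pairing S f \<mu> - pairing S f \<nu>"
    and "pairing S f (c *\<^sub>R \<mu>) = c * pairing S f \<mu>"
    and "pairing S f 0 = 0"
    and "pairing S f (\<Sum>i\<in>I. \<mu>' i) = (\<Sum>i\<in>I. pairing S f (\<mu>' i))"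
    and "x \<in> S \<Longrightarrow> pairing S f (dirac x) = f x"
  using bdd_borel_continuous[OF assms]
  by (simp_all add: pairing_sint sint_plus sint_minus sint_scaleR sint_zero sint_sum sint_dirac)

lemma pairing_const:
  assumes S: "S \<in> sets borel" and m: "\<mu> \<in> measures_on S"
  shows "pairing S (\<lambda>x. c) \<mu> = c * smeasure \<mu> UNIV"
proof -
  have "pairing S (\<lambda>x. c) \<mu> = sint (\<lambda>x. c * indicator UNIV x) \<mu>"
    using pairing_eq_sint[OF S m bdd_borel_const] by simp
  also have "\<dots> = c * smeasure \<mu> UNIV"
    unfolding sint_cmult_fun[OF bdd_borel_indicator[OF sets.top[of borel, unfolded space_borel]]]
      sint_indicator[OF sets.top[of borel, unfolded space_borel]] ..
  finally show ?thesis .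
qed

lemma pairing_mono:
  fixes f :: "'a::t2_space \<Rightarrow> real"
  assumes S: "compact S" and f: "continuous_on S f" and g: "continuous_on S g"
    and pos: "positive_measure \<mu>" and le: "\<And>x. x \<in> S \<Longrightarrow> f x \<le> g x"
  shows "pairing S f \<mu> \<le> pairing S g \<mu>"
proof -
  have "UNIV \<in> sets borel" "\<mu> \<in> measures_on UNIV" by (auto intro: measures_onI)
  then show ?thesis unfolding pairing_sint
    using le by (intro sint_mono_on[OF pos, of UNIV] bdd_borel_continuous S f g) (auto simp: indicator_def)
qed

lemma jpos_diff_le:
  assumes a: "positive_measure a" and b: "positive_measure b" and A: "A \<in> sets borel"
  shows "smeasure (jpos (a - b)) A \<le> smeasure a A"
proof -
  have "jpos_fun (a - b) A \<le> smeasure a A"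
  proof (rule jpos_fun_least)
    fix B assume B: "B \<in> sets borel" "B \<subseteq> A"
    have "0 \<le> smeasure b B" using b by (simp add: positive_measure_def)
    then show "smeasure (a - b) B \<le> smeasure a A"
      using positive_measure_mono[OF a B(1) A B(2)] by (simp add: smeasure_simps)
  qed
  then show ?thesis using A by (simp add: smeasure_jpos)
qed

text \<open>
  \<open>X\<close> is a Hahn set for \<open>a - b\<close>, so that no cancellation takes place.
\<close>

lemma jpos_of_diff:
  assumes a: "positive_measure a" and b: "positive_measure b" and X: "X \<in> sets borel"
    and aX: "smeasure a (- X) = 0" and bX: "smeasure b X = 0"
  shows "jpos (a - b) = a" "jpos (- (a - b)) = b"
proof -
  show j: "jpos (a - b) = a"
  proof (rule smeasure_eqI)
    fix A :: "'a set" assume A: "A \<in> sets borel"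
    have "jpos_fun (a - b) A \<le> smeasure a A"
      using jpos_diff_le[OF a b A] A by (simp add: smeasure_jpos)
    moreover have "smeasure a A \<le> jpos_fun (a - b) A"
    proof -
      have "smeasure a (A - X) \<le> smeasure a (- X)" using A X by (intro positive_measure_mono[OF a]) auto
      then have "smeasure a (A - X) \<le> 0" using aX by simp
      moreover have "smeasure b (A \<inter> X) \<le> smeasure b X" using A X by (intro positive_measure_mono[OF b]) auto
      then have "smeasure b (A \<inter> X) \<le> 0" using bX by simp
      moreover have "smeasure (a - b) (A \<inter> X) \<le> jpos_fun (a - b) A" using A X by (intro jpos_fun_upper) auto
      ultimately show ?thesis using smeasure_split[OF A X, of a] by (simp add: smeasure_simps)
    qed
    ultimately show "smeasure (jpos (a - b)) A = smeasure a A" using A by (simp add: smeasure_jpos)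
  qed
  show "jpos (- (a - b)) = b" unfolding jpos_uminus j by simp
qed

lemma variation_jpos: "variation \<mu> A = smeasure (jpos \<mu>) A + smeasure (jpos (- \<mu>)) A"
  by (simp add: variation_def measure_pos_part measure_neg_part)

locale kr_setting =
  fixes \<Omega> :: "'a::euclidean_space set" and p \<alpha> \<beta> :: real
  assumes compact_Om: "compact \<Omega>" and p: "0 < p" "p \<le> 1" and \<alpha>: "0 < \<alpha>" and \<beta>: "0 < \<beta>"
begin

lemma Om_borel: "\<Omega> \<in> sets borel"
  using compact_Om by (rule borel_compact)

text \<open>
  The triple \<open>(x, y, 0)\<close> stands for the dipole from \<open>x\<close> to \<open>y\<close>, and \<open>(x, x, s)\<close> with \<open>s = \<plusminus>1\<close> for the signed
  point mass at \<open>x\<close>. Repeating \<open>x\<close> in the second case puts both kinds into one compact subset of a Euclidean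
  space.
\<close>

definition params :: "('a \<times> 'a \<times> real) set" where
  "params = {(x, y, s). x \<in> \<Omega> \<and> y \<in> \<Omega> \<and> (s = 0 \<or> (s = 1 \<or> s = -1) \<and> x = y)}"

text \<open>
  The integral of \<open>f\<close> against the elementary measure with parameter \<open>w\<close>: \<open>f x - f y\<close> for a dipole,
  \<open>\<plusminus>f x\<close> for a point mass.
\<close>

definition lift :: "('a \<Rightarrow> real) \<Rightarrow> 'a \<times> 'a \<times> real \<Rightarrow> real" where
  "lift f = (\<lambda>(x, y, s). (if 0 \<le> s then f x else 0) - (if s \<le> 0 then f y else 0))"

text \<open>
  On \<open>params\<close> the distance vanishes for point masses, whose cost is therefore \<open>\<alpha>\<close>.
\<close>

definition cost :: "'a \<times> 'a \<times> real \<Rightarrow> real" where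
  "cost = (\<lambda>(x, y, s). norm (x - y) powr p + (if s = 0 then \<beta> else \<alpha>))"

abbreviation "midx \<equiv> (\<lambda>w. fst (snd w)) :: 'a \<times> 'a \<times> real \<Rightarrow> 'a"
abbreviation "sgnp \<equiv> (\<lambda>w. snd (snd w)) :: 'a \<times> 'a \<times> real \<Rightarrow> real"

text \<open>
  The integral of the elementary measures against \<open>\<tau>\<close>: the image of \<open>\<tau>\<close> under the positive end, minus its
  image under the negative end. Triples with \<open>s = 1\<close> lack a negative end, those with \<open>s = -1\<close> a positive one.
\<close>

definition superpose :: "('a \<times> 'a \<times> real) signed_measure \<Rightarrow> 'a signed_measure" where
  "superpose \<tau> = push fst (restr {w. 0 \<le> sgnp w} \<tau>) - push midx (restr {w. sgnp w \<le> 0} \<tau>)"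

lemma meas_fst: "fst \<in> borel_measurable (borel :: ('a \<times> 'a \<times> real) measure)"
  and meas_midx: "midx \<in> borel_measurable borel"
  by (intro borel_measurable_continuous_onI continuous_intros)+

lemma sgn_sets: "{w :: 'a \<times> 'a \<times> real. 0 \<le> sgnp w} \<in> sets borel" "{w :: 'a \<times> 'a \<times> real. sgnp w \<le> 0} \<in> sets borel"
   "{w :: 'a \<times> 'a \<times> real. sgnp w = 0} \<in> sets borel"
  by (intro borel_closed closed_Collect_le closed_Collect_eq continuous_intros)+

lemma compact_params: "compact params"
proof -
  have "params = (\<Omega> \<times> \<Omega> \<times> {0}) \<union> (\<lambda>x. (x, x, 1)) ` \<Omega> \<union> (\<lambda>x. (x, x, -1)) ` \<Omega>"
    by (auto simp: params_def)
  moreover have "compact (\<Omega> \<times> \<Omega> \<times> {0::real})" by (intro compact_Times compact_Om) auto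
  moreover have "compact ((\<lambda>x. (x, x, 1::real)) ` \<Omega>)" "compact ((\<lambda>x. (x, x, -1::real)) ` \<Omega>)"
    by (intro compact_continuous_image compact_Om continuous_intros)+
  ultimately show ?thesis by (simp add: compact_Un)
qed

lemma params_borel: "params \<in> sets borel"
  using compact_params by (rule borel_compact)

lemma continuous_dist_powr:
  assumes "continuous_on S f" "continuous_on S g"
  shows "continuous_on S (\<lambda>w. norm (f w - g w :: 'a) powr p)"
  using assms p(1) by (intro continuous_on_powr' continuous_intros) auto

lemma continuous_cost: "continuous_on params cost"
proof -
  have "continuous_on params (\<lambda>w. norm (fst w - midx w) powr p + (\<beta> * (1 - sgnp w * sgnp w) + \<alpha> * (sgnp w * sgnp w)))"
    by (intro continuous_on_add continuous_dist_powr continuous_intros)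
  then show ?thesis
    by (rule continuous_on_eq) (auto simp: cost_def params_def)
qed

lemma continuous_lift:
  assumes f: "continuous_on \<Omega> f" shows "continuous_on params (lift f)"
proof -
  have "continuous_on params (\<lambda>w. f (fst w))" "continuous_on params (\<lambda>w. f (midx w))"
    by (rule continuous_on_compose2[OF f]; auto intro!: continuous_intros simp: params_def)+
  then have "continuous_on params (\<lambda>w. f (fst w) * ((1 + sgnp w) * (2 - sgnp w) / 2) -
      f (midx w) * ((1 - sgnp w) * (2 + sgnp w) / 2))"
    by (intro continuous_intros) auto
  then show ?thesis
    by (rule continuous_on_eq) (auto simp: lift_def params_def)
qed

lemma smeasure_superpose:
  assumes A: "A \<in> sets borel"
  shows "smeasure (superpose \<tau>) A =
    smeasure \<tau> {w. fst w \<in> A \<and> 0 \<le> sgnp w} - smeasure \<tau> {w. midx w \<in> A \<and> sgnp w \<le> 0}"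
proof -
  have m: "fst -` A \<in> sets (borel :: ('a \<times> 'a \<times> real) measure)" "midx -` A \<in> sets borel"
    using measurable_sets[OF meas_fst A] measurable_sets[OF meas_midx A] by simp_all
  have e: "fst -` A \<inter> {w. 0 \<le> sgnp w} = {w. fst w \<in> A \<and> 0 \<le> sgnp w}"
    "midx -` A \<inter> {w. sgnp w \<le> 0} = {w. midx w \<in> A \<and> sgnp w \<le> 0}" by auto
  show ?thesis
    unfolding superpose_def smeasure_simps smeasure_push[OF meas_fst A] smeasure_push[OF meas_midx A]
      smeasure_restr[OF sgn_sets(1) m(1)] smeasure_restr[OF sgn_sets(2) m(2)] e ..
qed

lemma superpose_plus: "superpose (\<tau> + \<tau>') = superpose \<tau> + superpose \<tau>'"
  by (rule smeasure_eqI) (simp add: smeasure_superpose smeasure_simps)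

lemma superpose_scaleR: "superpose (c *\<^sub>R \<tau>) = c *\<^sub>R superpose \<tau>"
  by (rule smeasure_eqI) (simp add: smeasure_superpose smeasure_simps right_diff_distrib)

lemma superpose_zero: "superpose 0 = 0"
  using superpose_scaleR[of 0 0] by simp

lemma superpose_sum: "superpose (\<Sum>i\<in>I. \<tau> i) = (\<Sum>i\<in>I. superpose (\<tau> i))"
  by (induction I rule: infinite_finite_induct) (simp_all add: superpose_plus superpose_zero)

lemma superpose_dirac:
  "superpose (dirac (x, y, s)) = (if 0 \<le> s then dirac x else 0) - (if s \<le> 0 then dirac y else 0)"
proof (rule smeasure_eqI)
  fix A :: "'a set" assume A: "A \<in> sets borel"
  define S1 S2 :: "('a \<times> 'a \<times> real) set"
    where "S1 = {w. fst w \<in> A \<and> 0 \<le> sgnp w}" and "S2 = {w. midx w \<in> A \<and> sgnp w \<le> 0}"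
  have "S1 = fst -` A \<inter> {w. 0 \<le> sgnp w}" "S2 = midx -` A \<inter> {w. sgnp w \<le> 0}"
    by (auto simp: S1_def S2_def)
  moreover have "fst -` A \<in> sets (borel :: ('a \<times> 'a \<times> real) measure)" "midx -` A \<in> sets borel"
    using measurable_sets[OF meas_fst A] measurable_sets[OF meas_midx A] by simp_all
  ultimately have S: "S1 \<in> sets borel" "S2 \<in> sets borel"
    using sgn_sets(1,2) by (metis sets.Int)+
  have e: "smeasure (dirac (x, y, s)) S1 = (if x \<in> A \<and> 0 \<le> s then 1 else 0)"
    "smeasure (dirac (x, y, s)) S2 = (if y \<in> A \<and> s \<le> 0 then 1 else 0)"
    unfolding dirac.rep_eq using S by (simp_all) (simp_all add: S1_def S2_def)
  show "smeasure (superpose (dirac (x, y, s))) A =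
      smeasure ((if 0 \<le> s then dirac x else 0) - (if s \<le> 0 then dirac y else 0)) A"
    unfolding smeasure_superpose[OF A] S1_def[symmetric] S2_def[symmetric] e
    using A by (cases "0 \<le> s"; cases "s \<le> 0"; simp add: smeasure_simps dirac.rep_eq)
qed

lemma superpose_measures_on:
  assumes "\<tau> \<in> measures_on params" shows "superpose \<tau> \<in> measures_on \<Omega>"
  unfolding superpose_def
  by (intro measures_on_minus push_measures_on[OF _ params_borel Om_borel]
      restr_measures_on params_borel assms sgn_sets meas_fst meas_midx) (auto simp: params_def)

lemma pairing_superpose:
  assumes t: "\<tau> \<in> measures_on params" and f: "continuous_on \<Omega> f"
  shows "pairing \<Omega> f (superpose \<tau>) = pairing params (lift f) \<tau>"
proof -
  let ?F = "\<lambda>x. indicator \<Omega> x * f x"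
  have F: "bdd_borel ?F" by (rule bdd_borel_continuous[OF compact_Om f])
  let ?g1 = "\<lambda>w. indicator {w. 0 \<le> sgnp w} w * ?F (fst w)" and ?g2 = "\<lambda>w. indicator {w. sgnp w \<le> 0} w * ?F (midx w)"
  have F1: "bdd_borel (\<lambda>w :: 'a \<times> 'a \<times> real. ?F (fst w))" by (rule bdd_borel_compose[OF F meas_fst])
  have F2: "bdd_borel (\<lambda>w. ?F (midx w))" by (rule bdd_borel_compose[OF F meas_midx])
  have b1: "bdd_borel ?g1" and b2: "bdd_borel ?g2"
    by (intro bdd_borel_mult bdd_borel_indicator sgn_sets F1 F2)+
  have "pairing \<Omega> f (superpose \<tau>) = sint ?g1 \<tau> - sint ?g2 \<tau>"
    unfolding pairing_sint superpose_def sint_minus[OF F] sint_push[OF F meas_fst] sint_push[OF F meas_midx]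
      sint_restr[OF F1 sgn_sets(1)] sint_restr[OF F2 sgn_sets(2)] ..
  also have "\<dots> = sint (\<lambda>w. ?g1 w - ?g2 w) \<tau>" by (rule sint_diff_fun[OF b1 b2, symmetric])
  also have "\<dots> = pairing params (\<lambda>w. ?g1 w - ?g2 w) \<tau>"
    by (rule pairing_eq_sint[OF params_borel t bdd_borel_diff[OF b1 b2], symmetric])
  also have "\<dots> = pairing params (lift f) \<tau>"
    by (rule pairing_cong) (auto simp: params_def lift_def indicator_def)
  finally show ?thesis .
qed

definition admissible :: "('a \<times> 'a \<times> real) signed_measure \<Rightarrow> bool" where
  "admissible \<tau> \<longleftrightarrow> positive_measure \<tau> \<and> \<tau> \<in> measures_on params"

definition tcost :: "('a \<times> 'a \<times> real) signed_measure \<Rightarrow> real" where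
  "tcost \<tau> = pairing params cost \<tau>"

lemma tcost_lin:
  "tcost (\<tau> + \<tau>') = tcost \<tau> + tcost \<tau>'" "tcost (c *\<^sub>R \<tau>) = c * tcost \<tau>" "tcost 0 = 0"
  "tcost (\<Sum>i\<in>I. \<sigma> i) = (\<Sum>i\<in>I. tcost (\<sigma> i))" "w \<in> params \<Longrightarrow> tcost (dirac w) = cost w"
  unfolding tcost_def by (simp_all add: pairing_plus[OF compact_params continuous_cost])

lemma admissible_lin:
  "admissible 0" "admissible \<tau> \<Longrightarrow> admissible \<tau>' \<Longrightarrow> admissible (\<tau> + \<tau>')"
  "0 \<le> c \<Longrightarrow> admissible \<tau> \<Longrightarrow> admissible (c *\<^sub>R \<tau>)"
  "w \<in> params \<Longrightarrow> admissible (dirac w)"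
  by (auto simp: admissible_def intro: positive_lin measures_on_lin dirac_measures_on params_borel)

lemma admissible_sum: "(\<And>i. i \<in> I \<Longrightarrow> admissible (\<tau> i)) \<Longrightarrow> admissible (\<Sum>i\<in>I. \<tau> i)"
  by (auto simp: admissible_def intro: positive_sum measures_on_sum)

lemma cost_ge: "w \<in> params \<Longrightarrow> min \<alpha> \<beta> \<le> cost w"
proof -
  obtain x y s where w: "w = (x, y, s)" by (cases w)
  define n where "n = norm (x - y) powr p"
  have "0 \<le> n" by (simp add: n_def)
  moreover have "cost w = n + (if s = 0 then \<beta> else \<alpha>)" by (simp add: w cost_def n_def)
  ultimately show ?thesis by (auto simp: min_def)
qed

lemma cost_pos: "w \<in> params \<Longrightarrow> 0 < cost w"
  using cost_ge[of w] \<alpha> \<beta> by linarith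

lemma mass_le_tcost:
  assumes "admissible \<tau>" shows "min \<alpha> \<beta> * smeasure \<tau> UNIV \<le> tcost \<tau>"
proof -
  have "pairing params (\<lambda>_. min \<alpha> \<beta>) \<tau> \<le> tcost \<tau>"
    unfolding tcost_def using assms cost_ge
    by (intro pairing_mono compact_params continuous_cost) (auto simp: admissible_def)
  then show ?thesis using assms pairing_const[OF params_borel] by (simp add: admissible_def)
qed

lemma tcost_nonneg: "admissible \<tau> \<Longrightarrow> 0 \<le> tcost \<tau>"
  using mass_le_tcost[of \<tau>] \<alpha> \<beta> unfolding admissible_def positive_measure_def
  by (smt (verit) mult_nonneg_nonneg)

text \<open>
  The cost bounds the mass, because \<open>cost\<close> is bounded below by a positive number; and it is weak* continuous,
  because \<open>cost\<close> is continuous.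
\<close>

lemma admissible_compact:
  assumes adm: "\<And>n. admissible (\<tau> n)" and bd: "\<And>n::nat. tcost (\<tau> n) \<le> R"
  shows "\<exists>r \<tau>'. strict_mono (r :: nat \<Rightarrow> nat) \<and> admissible \<tau>' \<and> (\<lambda>n. tcost (\<tau> (r n))) \<longlonglongrightarrow> tcost \<tau>' \<and>
    weak_star_converges \<Omega> (\<lambda>n. superpose (\<tau> (r n))) (superpose \<tau>')"
proof -
  have mass: "smeasure (\<tau> n) UNIV \<le> R / min \<alpha> \<beta>" for n
    using mass_le_tcost[OF adm[of n]] bd[of n] \<alpha> \<beta> by (simp add: pos_le_divide_eq mult.commute)
  have pos: "\<And>n. positive_measure (\<tau> n)" and on: "\<And>n. \<tau> n \<in> measures_on params"
    using adm by (auto simp: admissible_def)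
  obtain r \<tau>' where
    r: "strict_mono (r :: nat \<Rightarrow> nat)" and \<tau>': "positive_measure \<tau>'" "\<tau>' \<in> measures_on params"
    and conv: "weak_star_converges params (\<lambda>n. \<tau> (r n)) \<tau>'"
    using positive_measures_weak_star_compact[of params \<tau>, OF compact_params pos on mass]
    by (elim exE conjE) (rule that)
  have "(\<lambda>n. tcost (\<tau> (r n))) \<longlonglongrightarrow> tcost \<tau>'"
    unfolding tcost_def by (rule conv[unfolded weak_star_converges_def, rule_format, OF continuous_cost])
  moreover have "weak_star_converges \<Omega> (\<lambda>n. superpose (\<tau> (r n))) (superpose \<tau>')"
    unfolding weak_star_converges_def
  proof (intro allI impI)
    fix f :: "'a \<Rightarrow> real" assume f: "continuous_on \<Omega> f"
    have "(\<lambda>n. pairing params (lift f) (\<tau> (r n))) \<longlonglongrightarrow> pairing params (lift f) \<tau>'"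
      by (rule conv[unfolded weak_star_converges_def, rule_format, OF continuous_lift[OF f]])
    then show "(\<lambda>n. pairing \<Omega> f (superpose (\<tau> (r n)))) \<longlonglongrightarrow> pairing \<Omega> f (superpose \<tau>')"
      by (simp only: pairing_superpose[OF on f] pairing_superpose[OF \<tau>'(2) f])
  qed
  moreover have "admissible \<tau>'" using \<tau>' by (simp add: admissible_def)
  ultimately show ?thesis using r by (intro exI conjI)
qed

section \<open>The norm as a minimal cost of superposition\<close>

lemma coupling_facts:
  fixes \<gamma> :: "('a \<times> 'a) measure"
  assumes g: "\<gamma> \<in> couplings (pos_part \<nu>) (neg_part \<nu>)"
  shows "sets \<gamma> = sets borel" "space \<gamma> = UNIV" "finite_measure \<gamma>"
    "A \<in> sets borel \<Longrightarrow> measure \<gamma> (fst -` A) = smeasure (jpos \<nu>) A"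
    "A \<in> sets borel \<Longrightarrow> measure \<gamma> (snd -` A) = smeasure (jpos (- \<nu>)) A"
proof -
  show s: "sets \<gamma> = sets borel" using g by (simp add: couplings_def)
  then show sp: "space \<gamma> = UNIV" using sets_eq_imp_space_eq by fastforce
  have mf: "fst \<in> measurable \<gamma> borel" "snd \<in> measurable \<gamma> borel"
    unfolding measurable_cong_sets[OF s refl]
    by (intro borel_measurable_continuous_onI continuous_intros)+
  have d: "distr \<gamma> borel fst = pos_part \<nu>" "distr \<gamma> borel snd = neg_part \<nu>"
    using g by (simp_all add: couplings_def)
  have e1: "emeasure \<gamma> (fst -` A) = emeasure (pos_part \<nu>) A" if "A \<in> sets borel" for A
    using emeasure_distr[OF mf(1) that] by (simp add: d sp)
  have e2: "emeasure \<gamma> (snd -` A) = emeasure (neg_part \<nu>) A" if "A \<in> sets borel" for A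
    using emeasure_distr[OF mf(2) that] by (simp add: d sp)
  show "measure \<gamma> (fst -` A) = smeasure (jpos \<nu>) A" if "A \<in> sets borel"
    using e1[OF that] measure_pos_part[of \<nu> A] by (simp add: measure_def)
  show "measure \<gamma> (snd -` A) = smeasure (jpos (- \<nu>)) A" if "A \<in> sets borel"
    using e2[OF that] measure_neg_part[of \<nu> A] by (simp add: measure_def)
  have "emeasure \<gamma> UNIV \<noteq> \<infinity>"
    using e1[of UNIV] by (simp add: emeasure_pos_part)
  then show "finite_measure \<gamma>" by (intro finite_measureI) (simp add: sp)
qed

lemma jpos_masses:
  assumes n: "\<nu> \<in> measures_on \<Omega>" "smeasure \<nu> \<Omega> = 0"
  shows "smeasure (jpos \<nu>) UNIV = smeasure (jpos \<nu>) \<Omega>" "smeasure (jpos (- \<nu>)) UNIV = smeasure (jpos \<nu>) UNIV"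
    "variation \<nu> \<Omega> = 2 * smeasure (jpos \<nu>) UNIV"
proof -
  have U: "UNIV \<in> sets borel" by simp
  have "smeasure \<nu> UNIV = 0" using measures_onD[OF n(1) U] n(2) by simp
  then show a: "smeasure (jpos (- \<nu>)) UNIV = smeasure (jpos \<nu>) UNIV"
    by (simp add: jpos_uminus smeasure_simps)
  show b: "smeasure (jpos \<nu>) UNIV = smeasure (jpos \<nu>) \<Omega>"
    using measures_onD[OF jpos_measures_on[OF Om_borel n(1)] U] by simp
  have "smeasure (jpos (- \<nu>)) UNIV = smeasure (jpos (- \<nu>)) \<Omega>"
    using measures_onD[OF jpos_measures_on[OF Om_borel measures_on_uminus[OF n(1)]] U] by simp
  then show "variation \<nu> \<Omega> = 2 * smeasure (jpos \<nu>) UNIV" using a b by (simp add: variation_jpos)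
qed

text \<open>
  The normalized product measure is a coupling of two measures of equal mass.
\<close>

lemma couplings_nonempty:
  assumes n: "\<nu> \<in> measures_on \<Omega>" "smeasure \<nu> \<Omega> = 0"
  shows "couplings (pos_part \<nu>) (neg_part \<nu>) \<noteq> {}"
proof -
  define m where "m = smeasure (jpos \<nu>) UNIV"
  have m0: "0 \<le> m" using positive_jpos[of \<nu>] by (simp add: m_def positive_measure_def)
  have mp: "emeasure (pos_part \<nu>) UNIV = ennreal m" "emeasure (neg_part \<nu>) UNIV = ennreal m"
    using jpos_masses[OF n] by (simp_all add: emeasure_pos_part emeasure_neg_part m_def)
  let ?M = "pos_part \<nu>" and ?N = "neg_part \<nu>"
  interpret M: finite_measure ?M by simp
  interpret N: finite_measure ?N by simp
  interpret P: pair_sigma_finite ?M ?N ..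
  define \<gamma> where "\<gamma> = scale_measure (ennreal (1 / m)) (?M \<Otimes>\<^sub>M ?N)"
  have s: "sets \<gamma> = sets borel"
  proof -
    have "sets (?M \<Otimes>\<^sub>M ?N) = sets ((borel :: 'a measure) \<Otimes>\<^sub>M (borel :: 'a measure))"
      by (rule sets_pair_measure_cong) simp_all
    also have "\<dots> = sets borel" by (simp only: borel_prod)
    finally show ?thesis by (simp add: \<gamma>_def)
  qed
  have sp: "space \<gamma> = UNIV" by (simp add: \<gamma>_def space_scale_measure space_pair_measure)
  have mf: "fst \<in> measurable \<gamma> borel" "snd \<in> measurable \<gamma> borel"
    unfolding measurable_cong_sets[OF s refl]
    by (intro borel_measurable_continuous_onI continuous_intros)+
  have "\<gamma> \<in> couplings ?M ?N"
    unfolding couplings_def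
  proof (intro CollectI conjI s)
    show "distr \<gamma> borel fst = ?M"
    proof (rule measure_eqI)
      fix A assume "A \<in> sets (distr \<gamma> borel fst)"
      then have A: "A \<in> sets borel" by simp
      have "emeasure (distr \<gamma> borel fst) A = ennreal (1 / m) * emeasure (?M \<Otimes>\<^sub>M ?N) (A \<times> UNIV)"
        using emeasure_distr[OF mf(1) A] sp by (simp add: \<gamma>_def vimage_fst)
      also have "emeasure (?M \<Otimes>\<^sub>M ?N) (A \<times> UNIV) = emeasure ?M A * ennreal m"
        using A by (simp add: N.emeasure_pair_measure_Times mp)
      also have "ennreal (1 / m) * (emeasure ?M A * ennreal m) = emeasure ?M A"
      proof (cases "m = 0")
        case True
        have "emeasure ?M A \<le> emeasure ?M UNIV" using A by (intro emeasure_mono) auto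
        then show ?thesis using True mp by simp
      next
        case False
        then have "ennreal (1 / m) * ennreal m = 1" using m0 by (simp add: ennreal_mult[symmetric])
        then show ?thesis by (metis mult.commute mult.left_commute mult.right_neutral)
      qed
      finally show "emeasure (distr \<gamma> borel fst) A = emeasure ?M A" .
    qed simp
    show "distr \<gamma> borel snd = ?N"
    proof (rule measure_eqI)
      fix A assume "A \<in> sets (distr \<gamma> borel snd)"
      then have A: "A \<in> sets borel" by simp
      have "emeasure (distr \<gamma> borel snd) A = ennreal (1 / m) * emeasure (?M \<Otimes>\<^sub>M ?N) (UNIV \<times> A)"
        using emeasure_distr[OF mf(2) A] sp by (simp add: \<gamma>_def vimage_snd)
      also have "emeasure (?M \<Otimes>\<^sub>M ?N) (UNIV \<times> A) = ennreal m * emeasure ?N A"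
        using A by (simp add: N.emeasure_pair_measure_Times mp)
      also have "ennreal (1 / m) * (ennreal m * emeasure ?N A) = emeasure ?N A"
      proof (cases "m = 0")
        case True
        have "emeasure ?N A \<le> emeasure ?N UNIV" using A by (intro emeasure_mono) auto
        then show ?thesis using True mp by simp
      next
        case False
        then have "ennreal (1 / m) * ennreal m = 1" using m0 by (simp add: ennreal_mult[symmetric])
        then show ?thesis by (metis mult.assoc mult.left_neutral)
      qed
      finally show "emeasure (distr \<gamma> borel snd) A = emeasure ?N A" .
    qed simp
  qed
  then show ?thesis by blast
qed

lemma lint_nonneg: "0 \<le> (LINT w|\<gamma>. norm (fst w - snd w :: 'a) powr p)"
  by (rule Bochner_Integration.integral_nonneg) simp

lemma wasserstein_le: "\<gamma> \<in> couplings M N \<Longrightarrow> wasserstein p M N \<le> (LINT w|\<gamma>. norm (fst w - snd w :: 'a) powr p)"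
  unfolding wasserstein_def by (rule cINF_lower) (auto intro!: bdd_belowI[of _ 0] lint_nonneg)

lemma wasserstein_nonneg: "couplings M N \<noteq> {} \<Longrightarrow> 0 \<le> wasserstein p M (N :: 'a measure)"
  unfolding wasserstein_def by (rule cINF_greatest) (auto intro: lint_nonneg)

abbreviation "kr \<equiv> KR_norm \<Omega> p \<alpha> \<beta>"

text \<open>
  The value of the competitor \<open>\<nu>\<close> in the definition of the norm.
\<close>

definition kr_val :: "'a signed_measure \<Rightarrow> 'a signed_measure \<Rightarrow> real" where
  "kr_val \<mu> \<nu> = wasserstein p (pos_part \<nu>) (neg_part \<nu>) + \<beta> / 2 * variation \<nu> \<Omega> + \<alpha> * variation (\<mu> - \<nu>) \<Omega>"

lemma variation_nonneg: "0 \<le> variation \<mu> A"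
  by (simp add: variation_def)

lemma kr_val_nonneg: "\<nu> \<in> measures_on \<Omega> \<Longrightarrow> smeasure \<nu> \<Omega> = 0 \<Longrightarrow> 0 \<le> kr_val \<mu> \<nu>"
  unfolding kr_val_def using \<alpha> \<beta>
  by (intro add_nonneg_nonneg mult_nonneg_nonneg wasserstein_nonneg couplings_nonempty variation_nonneg) auto

lemma kr_le: "\<nu> \<in> measures_on \<Omega> \<Longrightarrow> smeasure \<nu> \<Omega> = 0 \<Longrightarrow> kr \<mu> \<le> kr_val \<mu> \<nu>"
  unfolding KR_norm_def kr_val_def[symmetric]
  by (rule cINF_lower) (auto intro!: bdd_belowI[of _ 0] kr_val_nonneg)

lemma kr_approx:
  assumes "0 < e" shows "\<exists>\<nu>\<in>measures_on \<Omega>. smeasure \<nu> \<Omega> = 0 \<and> kr_val \<mu> \<nu> < kr \<mu> + e"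
proof -
  let ?S = "{\<nu> \<in> measures_on \<Omega>. smeasure \<nu> \<Omega> = 0}"
  have "0 \<in> ?S" using measures_on_zero by (simp add: smeasure_simps)
  then have ne: "kr_val \<mu> ` ?S \<noteq> {}" by blast
  have "Inf (kr_val \<mu> ` ?S) < kr \<mu> + e" using assms by (simp add: KR_norm_def kr_val_def)
  from cInf_lessD[OF ne this] show ?thesis by blast
qed

definition emb0 :: "'a \<times> 'a \<Rightarrow> 'a \<times> 'a \<times> real" where "emb0 w = (fst w, snd w, 0)"
definition emb :: "real \<Rightarrow> 'a \<Rightarrow> 'a \<times> 'a \<times> real" where "emb s x = (x, x, s)"

lemma emb_meas: "emb0 \<in> borel_measurable borel" "emb s \<in> borel_measurable borel"
  unfolding emb0_def[abs_def] emb_def[abs_def]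
  by (intro borel_measurable_continuous_onI continuous_intros)+

lemma emb_params: "emb0 ` (\<Omega> \<times> \<Omega>) \<subseteq> params" "emb 1 ` \<Omega> \<subseteq> params" "emb (-1) ` \<Omega> \<subseteq> params"
  by (auto simp: emb0_def emb_def params_def)

lemma smeasure_superpose_push:
  assumes h: "h \<in> borel_measurable borel" and A: "A \<in> sets borel"
  shows "smeasure (superpose (push h \<rho>)) A =
    smeasure \<rho> {w. fst (h w) \<in> A \<and> 0 \<le> sgnp (h w)} - smeasure \<rho> {w. midx (h w) \<in> A \<and> sgnp (h w) \<le> 0}"
proof -
  have "{w. fst w \<in> A \<and> 0 \<le> sgnp w} = fst -` A \<inter> {w. 0 \<le> sgnp w}"
    "{w. midx w \<in> A \<and> sgnp w \<le> 0} = midx -` A \<inter> {w. sgnp w \<le> 0}" by auto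
  moreover have "fst -` A \<in> sets (borel :: ('a \<times> 'a \<times> real) measure)" "midx -` A \<in> sets borel"
    using measurable_sets[OF meas_fst A] measurable_sets[OF meas_midx A] by simp_all
  ultimately have S: "{w. fst w \<in> A \<and> 0 \<le> sgnp w} \<in> sets borel" "{w. midx w \<in> A \<and> sgnp w \<le> 0} \<in> sets borel"
    using sgn_sets(1,2) by (metis sets.Int)+
  show ?thesis
    unfolding smeasure_superpose[OF A] smeasure_push[OF h S(1)] smeasure_push[OF h S(2)] vimage_def mem_Collect_eq ..
qed

lemma superpose_emb:
  "superpose (push (emb 1) \<rho>) = \<rho>" "superpose (push (emb (-1)) \<rho>) = - \<rho>"
  by (rule smeasure_eqI; simp only: smeasure_superpose_push[OF emb_meas(2)]; simp add: emb_def smeasure_simps)+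

lemma tcost_push:
  fixes h :: "'b::t2_space \<Rightarrow> 'a \<times> 'a \<times> real"
  assumes h: "h \<in> borel_measurable borel" and S: "compact S" "\<rho> \<in> measures_on S" "h ` S \<subseteq> params"
  shows "tcost (push h \<rho>) = pairing S (\<lambda>x. cost (h x)) \<rho>"
  unfolding tcost_def by (rule pairing_push[OF h S(1) compact_params S(2,3) continuous_cost])

text \<open>
  A competitor \<open>\<nu>\<close> and a coupling of its parts are turned into a superposition of the same value: the
  coupling becomes a distribution of dipoles, whose mass is half the variation of \<open>\<nu>\<close> and is charged \<open>\<beta>\<close>,
  and the Jordan parts of \<open>\<mu> - \<nu>\<close> become distributions of positive and negative point masses.
\<close>

lemma kr_near_attained:
  assumes mu: "\<mu> \<in> measures_on \<Omega>" and e: "0 < e"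
  shows "\<exists>\<tau>. admissible \<tau> \<and> superpose \<tau> = \<mu> \<and> tcost \<tau> \<le> kr \<mu> + e"
proof -
  obtain \<nu> where nu: "\<nu> \<in> measures_on \<Omega>" "smeasure \<nu> \<Omega> = 0" and val: "kr_val \<mu> \<nu> < kr \<mu> + e / 2"
    using kr_approx[of "e / 2" \<mu>] e by auto
  let ?I = "\<lambda>\<gamma>. LINT w|\<gamma>. norm (fst w - snd w :: 'a) powr p"
  have "Inf (?I ` couplings (pos_part \<nu>) (neg_part \<nu>)) < wasserstein p (pos_part \<nu>) (neg_part \<nu>) + e / 2"
    using e by (simp add: wasserstein_def)
  from cInf_lessD[OF _ this] obtain \<gamma> where g: "\<gamma> \<in> couplings (pos_part \<nu>) (neg_part \<nu>)"
    and gI: "?I \<gamma> < wasserstein p (pos_part \<nu>) (neg_part \<nu>) + e / 2"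
    using couplings_nonempty[OF nu] by blast
  note gf = coupling_facts[OF g]
  define G where "G = signed_of \<gamma>"
  have smG: "smeasure G = measure \<gamma>" unfolding G_def by (rule smeasure_signed_of[OF gf(3,1)])
  have posG: "positive_measure G" unfolding G_def by (rule positive_signed_of[OF gf(3,1)])
  have OO: "compact (\<Omega> \<times> \<Omega>)" by (intro compact_Times compact_Om)
  have OOb: "\<Omega> \<times> \<Omega> \<in> sets borel" using OO by (rule borel_compact)
  have CO: "- \<Omega> \<in> sets borel" using Om_borel by (metis sets.compl_sets space_borel Compl_eq_Diff_UNIV)
  have null0: "smeasure (jpos \<nu>) (- \<Omega>) = 0" "smeasure (jpos (- \<nu>)) (- \<Omega>) = 0"
    using measures_onD[OF jpos_measures_on[OF Om_borel nu(1)] CO]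
      measures_onD[OF jpos_measures_on[OF Om_borel measures_on_uminus[OF nu(1)]] CO] by simp_all
  have vm: "fst -` A \<in> sets (borel :: ('a \<times> 'a) measure)" "snd -` A \<in> sets (borel :: ('a \<times> 'a) measure)"
    if "A \<in> sets borel" for A :: "'a set"
  proof -
    have f: "fst \<in> borel_measurable (borel :: ('a \<times> 'a) measure)"
      and s: "snd \<in> borel_measurable (borel :: ('a \<times> 'a) measure)"
      by (intro borel_measurable_continuous_onI continuous_intros)+
    show "fst -` A \<in> sets (borel :: ('a \<times> 'a) measure)" using measurable_sets[OF f that] by simp
    show "snd -` A \<in> sets (borel :: ('a \<times> 'a) measure)" using measurable_sets[OF s that] by simp
  qed
  have null: "smeasure G (- (\<Omega> \<times> \<Omega>)) = 0"
  proof -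
    have s1: "smeasure G (fst -` (- \<Omega>)) = 0" and s2: "smeasure G (snd -` (- \<Omega>)) = 0"
      using gf(4,5)[OF CO] null0 by (simp_all add: smG)
    have "- (\<Omega> \<times> \<Omega>) = fst -` (- \<Omega>) \<union> (snd -` (- \<Omega>) - fst -` (- \<Omega>))" by auto
    then have "smeasure G (- (\<Omega> \<times> \<Omega>)) = smeasure G (fst -` (- \<Omega>)) + smeasure G (snd -` (- \<Omega>) - fst -` (- \<Omega>))"
      using smeasure_Un[of "fst -` (- \<Omega>)" "snd -` (- \<Omega>) - fst -` (- \<Omega>)" G] vm[OF CO] by (simp add: sets.Diff)
    also have "\<dots> \<le> smeasure G (fst -` (- \<Omega>)) + smeasure G (snd -` (- \<Omega>))"
      using vm[OF CO] by (intro add_left_mono positive_measure_mono[OF posG]) (auto simp: sets.Diff)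
    finally show ?thesis using s1 s2 posG by (simp add: positive_measure_def antisym)
  qed
  have onG: "G \<in> measures_on (\<Omega> \<times> \<Omega>)"
  proof (rule measures_onI)
    fix A :: "('a \<times> 'a) set" assume A: "A \<in> sets borel"
    have "smeasure G (A - \<Omega> \<times> \<Omega>) \<le> smeasure G (- (\<Omega> \<times> \<Omega>))"
      using A OOb by (intro positive_measure_mono[OF posG]) auto
    then have "smeasure G (A - \<Omega> \<times> \<Omega>) = 0" using null posG by (simp add: positive_measure_def antisym)
    then show "smeasure G A = smeasure G (A \<inter> \<Omega> \<times> \<Omega>)" using smeasure_split[OF A OOb, of G] by simp
  qed
  define a b where "a = jpos (\<mu> - \<nu>)" and "b = jpos (- (\<mu> - \<nu>))"
  have ab5: "a - b = \<mu> - \<nu>" unfolding a_def b_def by (rule jordan[symmetric])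
  have ab: "positive_measure a" "positive_measure b" "a \<in> measures_on \<Omega>" "b \<in> measures_on \<Omega>"
    unfolding a_def b_def
    by (intro positive_jpos jpos_measures_on Om_borel measures_on_minus measures_on_uminus mu nu(1))+
  define \<tau> where "\<tau> = push emb0 G + (push (emb 1) a + push (emb (-1)) b)"
  have adm: "admissible \<tau>"
    unfolding \<tau>_def admissible_def
    by (intro conjI positive_lin measures_on_plus positive_push emb_meas posG ab
        push_measures_on[OF emb_meas(1) OOb params_borel onG emb_params(1)]
        push_measures_on[OF emb_meas(2) Om_borel params_borel ab(3) emb_params(2)]
        push_measures_on[OF emb_meas(2) Om_borel params_borel ab(4) emb_params(3)])
  have "superpose (push emb0 G) = \<nu>"
  proof (rule smeasure_eqI)
    fix A :: "'a set" assume A: "A \<in> sets borel"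
    have "smeasure (superpose (push emb0 G)) A = measure \<gamma> (fst -` A) - measure \<gamma> (snd -` A)"
      unfolding smeasure_superpose_push[OF emb_meas(1) A] smG by (simp add: emb0_def vimage_def)
    also have "\<dots> = smeasure \<nu> A" unfolding gf(4)[OF A] gf(5)[OF A] by (simp add: jpos_uminus smeasure_simps)
    finally show "smeasure (superpose (push emb0 G)) A = smeasure \<nu> A" .
  qed
  then have sup: "superpose \<tau> = \<mu>"
    unfolding \<tau>_def superpose_plus superpose_emb using ab5 by (simp add: algebra_simps)
  have mG: "smeasure G UNIV = smeasure (jpos \<nu>) UNIV" using gf(4)[of UNIV] by (simp add: smG)
  have c0: "tcost (push emb0 G) = ?I \<gamma> + \<beta> * smeasure G UNIV"
  proof -
    let ?D = "\<lambda>w :: 'a \<times> 'a. norm (fst w - snd w) powr p"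
    have Dc: "continuous_on S ?D" for S by (intro continuous_dist_powr continuous_intros)
    have "tcost (push emb0 G) = pairing (\<Omega> \<times> \<Omega>) (\<lambda>w. ?D w + \<beta>) G"
      unfolding tcost_push[OF emb_meas(1) OO onG emb_params(1)]
      by (rule pairing_cong) (simp add: cost_def emb0_def)
    also have "\<dots> = sint (\<lambda>w. indicator (\<Omega> \<times> \<Omega>) w * ?D w + indicator (\<Omega> \<times> \<Omega>) w * \<beta>) G"
      unfolding pairing_sint distrib_left ..
    also have "\<dots> = pairing (\<Omega> \<times> \<Omega>) ?D G + pairing (\<Omega> \<times> \<Omega>) (\<lambda>_. \<beta>) G"
      unfolding pairing_sint
      by (intro sint_add_fun bdd_borel_continuous OO Dc continuous_on_const)
    also have "pairing (\<Omega> \<times> \<Omega>) (\<lambda>_. \<beta>) G = \<beta> * smeasure G UNIV" by (rule pairing_const[OF OOb onG])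
    also have "pairing (\<Omega> \<times> \<Omega>) ?D G = ?I \<gamma>"
    proof -
      have "pairing (\<Omega> \<times> \<Omega>) ?D G = (LINT w|\<gamma>. indicator (\<Omega> \<times> \<Omega>) w * ?D w)"
        unfolding pairing_sint G_def by (rule sint_signed_of[OF gf(3,1) bdd_borel_continuous[OF OO Dc]])
      also have "\<dots> = ?I \<gamma>"
      proof (rule integral_cong_AE)
        have Dm: "?D \<in> borel_measurable borel" by (rule borel_measurable_continuous_onI[OF Dc])
        then show "?D \<in> borel_measurable \<gamma>" unfolding measurable_cong_sets[OF gf(1) refl] .
        show "(\<lambda>w. indicator (\<Omega> \<times> \<Omega>) w * ?D w) \<in> borel_measurable \<gamma>"
          unfolding measurable_cong_sets[OF gf(1) refl]
          by (rule bdd_borel_measurable[OF bdd_borel_continuous[OF OO Dc]])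
        have CC: "- (\<Omega> \<times> \<Omega>) \<in> sets \<gamma>"
          unfolding gf(1) using OOb by (metis sets.compl_sets space_borel Compl_eq_Diff_UNIV)
        interpret finite_measure \<gamma> by (rule gf(3))
        have "emeasure \<gamma> (- (\<Omega> \<times> \<Omega>)) = 0" using null by (simp add: smG emeasure_eq_measure)
        then have "AE w in \<gamma>. w \<notin> - (\<Omega> \<times> \<Omega>)" using CC by (intro AE_not_in) (simp add: null_sets_def)
        then show "AE w in \<gamma>. indicator (\<Omega> \<times> \<Omega>) w * ?D w = ?D w"
          by eventually_elim simp
      qed
      finally show ?thesis .
    qed
    finally show ?thesis .
  qed
  have c1: "tcost (push (emb 1) a) = \<alpha> * smeasure a \<Omega>" "tcost (push (emb (-1)) b) = \<alpha> * smeasure b \<Omega>"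
  proof -
    have c: "(\<lambda>x. cost (emb s x)) = (\<lambda>_. \<alpha>)" if "s \<noteq> 0" for s
      using that p(1) by (auto simp: cost_def emb_def)
    show "tcost (push (emb 1) a) = \<alpha> * smeasure a \<Omega>"
      using tcost_push[OF emb_meas(2) compact_Om ab(3) emb_params(2)] c[of 1] pairing_const[OF Om_borel ab(3), of \<alpha>]
        measures_onD[OF ab(3), of UNIV] by simp
    show "tcost (push (emb (-1)) b) = \<alpha> * smeasure b \<Omega>"
      using tcost_push[OF emb_meas(2) compact_Om ab(4) emb_params(3)] c[of "-1"] pairing_const[OF Om_borel ab(4), of \<alpha>]
        measures_onD[OF ab(4), of UNIV] by simp
  qed
  have "tcost \<tau> = ?I \<gamma> + \<beta> / 2 * variation \<nu> \<Omega> + \<alpha> * variation (\<mu> - \<nu>) \<Omega>"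
    unfolding \<tau>_def tcost_lin c0 c1 mG jpos_masses(3)[OF nu] variation_jpos[of "\<mu> - \<nu>"] a_def[symmetric] b_def[symmetric]
    by (simp add: algebra_simps)
  also have "\<dots> \<le> kr \<mu> + e" using gI val unfolding kr_val_def by simp
  finally show ?thesis using adm sup by blast
qed

lemma kr_attained:
  assumes mu: "\<mu> \<in> measures_on \<Omega>"
  shows "\<exists>\<tau>. admissible \<tau> \<and> superpose \<tau> = \<mu> \<and> tcost \<tau> \<le> kr \<mu>"
proof -
  have "\<forall>n::nat. \<exists>\<tau>. admissible \<tau> \<and> superpose \<tau> = \<mu> \<and> tcost \<tau> \<le> kr \<mu> + 1 / real (Suc n)"
    using kr_near_attained[OF mu] by simp
  then obtain \<tau> where t: "\<And>n::nat. admissible (\<tau> n)" "\<And>n. superpose (\<tau> n) = \<mu>"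
    "\<And>n. tcost (\<tau> n) \<le> kr \<mu> + 1 / real (Suc n)" by metis
  have "tcost (\<tau> n) \<le> kr \<mu> + 1" for n using t(3)[of n] by (rule order_trans) simp
  from admissible_compact[of \<tau>, OF t(1) this] obtain r \<tau>' where r: "strict_mono (r :: nat \<Rightarrow> nat)"
    and a: "admissible \<tau>'" and c: "(\<lambda>n. tcost (\<tau> (r n))) \<longlonglongrightarrow> tcost \<tau>'"
    and w: "weak_star_converges \<Omega> (\<lambda>n. superpose (\<tau> (r n))) (superpose \<tau>')" by blast
  have "superpose \<tau>' = \<mu>"
  proof (rule signed_measure_eqI_continuous[OF compact_Om superpose_measures_on mu])
    show "\<tau>' \<in> measures_on params" using a by (simp add: admissible_def)
    fix f :: "'a \<Rightarrow> real" assume f: "continuous_on \<Omega> f"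
    have "(\<lambda>n. pairing \<Omega> f (superpose (\<tau> (r n)))) \<longlonglongrightarrow> pairing \<Omega> f (superpose \<tau>')"
      by (rule w[unfolded weak_star_converges_def, rule_format, OF f])
    then show "pairing \<Omega> f (superpose \<tau>') = pairing \<Omega> f \<mu>"
      unfolding t(2) by (simp add: LIMSEQ_const_iff)
  qed
  moreover have "tcost \<tau>' \<le> kr \<mu>"
  proof (rule LIMSEQ_le[OF c])
    have l: "(\<lambda>n. kr \<mu> + 1 / real (Suc n)) \<longlonglongrightarrow> kr \<mu> + 0"
      by (intro tendsto_intros LIMSEQ_Suc[OF lim_1_over_n])
    from LIMSEQ_subseq_LIMSEQ[OF l r] show "(\<lambda>n. kr \<mu> + 1 / real (Suc (r n))) \<longlonglongrightarrow> kr \<mu>" by (simp add: o_def)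
    show "\<exists>N. \<forall>n\<ge>N. tcost (\<tau> (r n)) \<le> kr \<mu> + 1 / real (Suc (r n))" using t(3) by blast
  qed
  ultimately show ?thesis using a by blast
qed

text \<open>
  A superposition is read as a competitor, namely its dipole part \<open>\<nu>\<close>, with the dipoles as a coupling. The
  marginals of this coupling are the Jordan parts of \<open>\<nu>\<close> only if sources and sinks do not cancel; the set \<open>X\<close>,
  which carries the sources and misses the sinks, ensures this.
\<close>

lemma kr_superpose_le:
  assumes adm: "admissible \<tau>" and X: "X \<in> sets borel"
    and sep: "smeasure \<tau> {w. sgnp w = 0 \<and> fst w \<notin> X} = 0" "smeasure \<tau> {w. sgnp w = 0 \<and> midx w \<in> X} = 0"
  shows "kr (superpose \<tau>) \<le> tcost \<tau>"
proof -
  define Z :: "('a \<times> 'a \<times> real) set" where "Z = {w. sgnp w = 0}"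
  have Z: "Z \<in> sets borel" unfolding Z_def by (rule sgn_sets(3))
  have CZ: "- Z \<in> sets borel" using Z by (metis sets.compl_sets space_borel Compl_eq_Diff_UNIV)
  have pos: "positive_measure \<tau>" and on: "\<tau> \<in> measures_on params" using adm by (auto simp: admissible_def)
  define \<tau>0 \<tau>1 where "\<tau>0 = restr Z \<tau>" and "\<tau>1 = restr (- Z) \<tau>"
  have pos0: "positive_measure \<tau>0" and pos1: "positive_measure \<tau>1"
    unfolding \<tau>0_def \<tau>1_def by (rule positive_restr[OF Z pos], rule positive_restr[OF CZ pos])
  have on0: "\<tau>0 \<in> measures_on params" and on1: "\<tau>1 \<in> measures_on params"
    unfolding \<tau>0_def \<tau>1_def by (rule restr_measures_on[OF Z params_borel on], rule restr_measures_on[OF CZ params_borel on])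
  have sum: "\<tau> = \<tau>0 + \<tau>1"
  proof (rule smeasure_eqI)
    fix A :: "('a \<times> 'a \<times> real) set" assume A: "A \<in> sets borel"
    have "A \<inter> - Z = A - Z" by auto
    then show "smeasure \<tau> A = smeasure (\<tau>0 + \<tau>1) A"
      unfolding \<tau>0_def \<tau>1_def smeasure_simps smeasure_restr[OF Z A] smeasure_restr[OF CZ A]
      by (simp only: smeasure_split[OF A Z])
  qed
  have sgn0: "restr {w. 0 \<le> sgnp w} \<tau>0 = \<tau>0" "restr {w. sgnp w \<le> 0} \<tau>0 = \<tau>0"
  proof -
    have e: "smeasure (restr S \<tau>0) A = smeasure \<tau>0 A" if S: "S \<in> sets borel" "Z \<subseteq> S" and A: "A \<in> sets borel" for S A
    proof -
      have "A \<inter> S \<inter> Z = A \<inter> Z" using S(2) by auto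
      then show ?thesis
        unfolding smeasure_restr[OF S(1) A] \<tau>0_def smeasure_restr[OF Z A] smeasure_restr[OF Z sets.Int[OF A S(1)]] by simp
    qed
    show "restr {w. 0 \<le> sgnp w} \<tau>0 = \<tau>0"
      by (rule smeasure_eqI, rule e[OF sgn_sets(1)]) (auto simp: Z_def)
    show "restr {w. sgnp w \<le> 0} \<tau>0 = \<tau>0"
      by (rule smeasure_eqI, rule e[OF sgn_sets(2)]) (auto simp: Z_def)
  qed
  define a b where "a = push fst \<tau>0" and "b = push midx \<tau>0"
  have nu: "superpose \<tau>0 = a - b" unfolding superpose_def sgn0 a_def b_def ..
  have pa: "positive_measure a" "positive_measure b"
    unfolding a_def b_def by (rule positive_push[OF meas_fst pos0], rule positive_push[OF meas_midx pos0])
  have CX: "- X \<in> sets borel" using X by (metis sets.compl_sets space_borel Compl_eq_Diff_UNIV)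
  have vf: "fst -` A \<in> sets (borel :: ('a \<times> 'a \<times> real) measure)" "midx -` A \<in> sets borel" if "A \<in> sets borel" for A
    using measurable_sets[OF meas_fst that] measurable_sets[OF meas_midx that] by simp_all
  have aX: "smeasure a (- X) = 0" and bX: "smeasure b X = 0"
  proof -
    have "fst -` (- X) \<inter> Z = {w. sgnp w = 0 \<and> fst w \<notin> X}" "midx -` X \<inter> Z = {w. sgnp w = 0 \<and> midx w \<in> X}"
      by (auto simp: Z_def)
    then show "smeasure a (- X) = 0" "smeasure b X = 0"
      unfolding a_def b_def smeasure_push[OF meas_fst CX] smeasure_push[OF meas_midx X] \<tau>0_def
        smeasure_restr[OF Z vf(1)[OF CX]] smeasure_restr[OF Z vf(2)[OF X]] using sep by simp_all
  qed
  note j = jpos_of_diff[OF pa X aX bX]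
  define \<nu> where "\<nu> = a - b"
  have nuO: "\<nu> \<in> measures_on \<Omega>" unfolding \<nu>_def nu[symmetric] by (rule superpose_measures_on[OF on0])
  have massa: "smeasure a UNIV = smeasure \<tau>0 UNIV" "smeasure b UNIV = smeasure \<tau>0 UNIV"
    unfolding a_def b_def using smeasure_push[OF meas_fst, of UNIV \<tau>0] smeasure_push[OF meas_midx, of UNIV \<tau>0] by simp_all
  have nu0: "smeasure \<nu> \<Omega> = 0"
    using measures_onD[OF nuO, of UNIV] massa by (simp add: \<nu>_def smeasure_simps)
  define pr :: "'a \<times> 'a \<times> real \<Rightarrow> 'a \<times> 'a" where "pr w = (fst w, midx w)" for w
  have prm: "pr \<in> borel_measurable borel" unfolding pr_def[abs_def]
    by (intro borel_measurable_continuous_onI continuous_intros)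
  define G where "G = push pr \<tau>0"
  have posG: "positive_measure G" unfolding G_def by (rule positive_push[OF prm pos0])
  have OO: "compact (\<Omega> \<times> \<Omega>)" by (intro compact_Times compact_Om)
  have OOb: "\<Omega> \<times> \<Omega> \<in> sets borel" using OO by (rule borel_compact)
  have prP: "pr ` params \<subseteq> \<Omega> \<times> \<Omega>" by (auto simp: pr_def params_def)
  have onG: "G \<in> measures_on (\<Omega> \<times> \<Omega>)" unfolding G_def by (rule push_measures_on[OF prm params_borel OOb on0 prP])
  define \<gamma> where "\<gamma> = pos_part G"
  have fsm: "fst \<in> borel_measurable (borel :: ('a \<times> 'a) measure)" "snd \<in> borel_measurable (borel :: ('a \<times> 'a) measure)"
    by (intro borel_measurable_continuous_onI continuous_intros)+
  have g: "\<gamma> \<in> couplings (pos_part \<nu>) (neg_part \<nu>)"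
    unfolding couplings_def
  proof (intro CollectI conjI)
    show "sets \<gamma> = sets borel" by (simp add: \<gamma>_def)
    have mm: "fst \<in> measurable \<gamma> borel" "snd \<in> measurable \<gamma> borel"
      using fsm by (simp_all add: \<gamma>_def)
    have eG: "emeasure \<gamma> B = ennreal (smeasure \<tau>0 (pr -` B))" if "B \<in> sets borel" for B
      unfolding \<gamma>_def emeasure_pos_part[OF that] jpos_positive[OF posG]
      unfolding G_def smeasure_push[OF prm that] ..
    show "distr \<gamma> borel fst = pos_part \<nu>"
    proof (rule measure_eqI)
      fix A assume "A \<in> sets (distr \<gamma> borel fst)"
      then have A: "A \<in> sets borel" by simp
      have B: "fst -` A \<in> sets (borel :: ('a \<times> 'a) measure)" using measurable_sets[OF fsm(1) A] by simp
      have "pr -` (fst -` A) = fst -` A" by (auto simp: pr_def)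
      then have "emeasure (distr \<gamma> borel fst) A = ennreal (smeasure a A)"
        unfolding emeasure_distr[OF mm(1) A] a_def smeasure_push[OF meas_fst A] using eG[OF B] by (simp add: \<gamma>_def)
      then show "emeasure (distr \<gamma> borel fst) A = emeasure (pos_part \<nu>) A"
        unfolding emeasure_pos_part[OF A] \<nu>_def j .
    qed simp
    show "distr \<gamma> borel snd = neg_part \<nu>"
    proof (rule measure_eqI)
      fix A assume "A \<in> sets (distr \<gamma> borel snd)"
      then have A: "A \<in> sets borel" by simp
      have B: "snd -` A \<in> sets (borel :: ('a \<times> 'a) measure)" using measurable_sets[OF fsm(2) A] by simp
      have "pr -` (snd -` A) = midx -` A" by (auto simp: pr_def)
      then have "emeasure (distr \<gamma> borel snd) A = ennreal (smeasure b A)"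
        unfolding emeasure_distr[OF mm(2) A] b_def smeasure_push[OF meas_midx A] using eG[OF B] by (simp add: \<gamma>_def)
      then show "emeasure (distr \<gamma> borel snd) A = emeasure (neg_part \<nu>) A"
        unfolding emeasure_neg_part[OF A] \<nu>_def j .
    qed simp
  qed
  let ?D = "\<lambda>w :: 'a \<times> 'a. norm (fst w - snd w) powr p"
  have Dc: "continuous_on S ?D" for S by (intro continuous_dist_powr continuous_intros)
  have I: "(LINT w|\<gamma>. ?D w) = pairing params (\<lambda>w. ?D (pr w)) \<tau>0"
  proof -
    have CC: "- (\<Omega> \<times> \<Omega>) \<in> sets borel" using OOb by (metis sets.compl_sets space_borel Compl_eq_Diff_UNIV)
    have "(LINT w|\<gamma>. ?D w) = (LINT w|\<gamma>. indicator (\<Omega> \<times> \<Omega>) w * ?D w)"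
    proof (rule integral_cong_AE)
      show "?D \<in> borel_measurable \<gamma>" using borel_measurable_continuous_onI[OF Dc] by (simp add: \<gamma>_def)
      show "(\<lambda>w. indicator (\<Omega> \<times> \<Omega>) w * ?D w) \<in> borel_measurable \<gamma>"
        using bdd_borel_measurable[OF bdd_borel_continuous[OF OO Dc]] by (simp add: \<gamma>_def)
      have "smeasure G (- (\<Omega> \<times> \<Omega>)) = 0" using measures_onD[OF onG CC] by simp
      then have "emeasure \<gamma> (- (\<Omega> \<times> \<Omega>)) = 0" unfolding \<gamma>_def emeasure_pos_part[OF CC] jpos_positive[OF posG] by simp
      then have "AE w in \<gamma>. w \<notin> - (\<Omega> \<times> \<Omega>)" using CC by (intro AE_not_in) (simp add: null_sets_def \<gamma>_def)
      then show "AE w in \<gamma>. ?D w = indicator (\<Omega> \<times> \<Omega>) w * ?D w" by eventually_elim simp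
    qed
    also have "\<dots> = pairing (\<Omega> \<times> \<Omega>) ?D G"
      unfolding pairing_sint \<gamma>_def by (rule sint_positive[OF posG bdd_borel_continuous[OF OO Dc], symmetric])
    also have "\<dots> = pairing params (\<lambda>w. ?D (pr w)) \<tau>0"
      unfolding G_def by (rule pairing_push[OF prm compact_params OO on0 prP Dc])
    finally show ?thesis .
  qed
  have D'c: "continuous_on params (\<lambda>w. ?D (pr w))" unfolding pr_def by (intro continuous_dist_powr continuous_intros)
  have restr_cong: "pairing params f (restr S \<tau>) = pairing params h (restr S \<tau>)"
    if f: "continuous_on params f" and h: "continuous_on params h" and S: "S \<in> sets borel"
      and eq: "\<And>w. w \<in> params \<Longrightarrow> w \<in> S \<Longrightarrow> f w = h w" for f h S
  proof -
    have "(\<lambda>w. indicator S w * (indicator params w * f w)) = (\<lambda>w. indicator S w * (indicator params w * h w))"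
      using eq by (auto simp: indicator_def)
    then show ?thesis
      unfolding pairing_sint sint_restr[OF bdd_borel_continuous[OF compact_params f] S]
        sint_restr[OF bdd_borel_continuous[OF compact_params h] S] by simp
  qed
  have t0: "tcost \<tau>0 = pairing params (\<lambda>w. ?D (pr w)) \<tau>0 + \<beta> * smeasure \<tau>0 UNIV"
  proof -
    have "tcost \<tau>0 = pairing params (\<lambda>w. ?D (pr w) + \<beta>) \<tau>0"
      unfolding tcost_def \<tau>0_def
      by (rule restr_cong[OF continuous_cost continuous_on_add[OF D'c continuous_on_const] Z])
        (auto simp: Z_def cost_def pr_def)
    also have "\<dots> = sint (\<lambda>w. indicator params w * ?D (pr w) + indicator params w * \<beta>) \<tau>0"
      unfolding pairing_sint distrib_left ..
    also have "\<dots> = pairing params (\<lambda>w. ?D (pr w)) \<tau>0 + pairing params (\<lambda>_. \<beta>) \<tau>0"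
      unfolding pairing_sint
      by (intro sint_add_fun bdd_borel_continuous compact_params D'c continuous_on_const)
    also have "pairing params (\<lambda>_. \<beta>) \<tau>0 = \<beta> * smeasure \<tau>0 UNIV" by (rule pairing_const[OF params_borel on0])
    finally show ?thesis .
  qed
  have t1: "tcost \<tau>1 = \<alpha> * smeasure \<tau>1 UNIV"
  proof -
    have "tcost \<tau>1 = pairing params (\<lambda>_. \<alpha>) \<tau>1"
      unfolding tcost_def \<tau>1_def using p(1)
      by (intro restr_cong[OF continuous_cost _ CZ]) (auto simp: Z_def cost_def params_def)
    then show ?thesis using pairing_const[OF params_borel on1] by simp
  qed
  have v1: "variation (superpose \<tau>1) \<Omega> \<le> smeasure \<tau>1 UNIV"
  proof -
    let ?c = "push fst (restr {w. 0 \<le> sgnp w} \<tau>1)" and ?d = "push midx (restr {w. sgnp w \<le> 0} \<tau>1)"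
    have pc: "positive_measure ?c" "positive_measure ?d"
      by (rule positive_push[OF meas_fst positive_restr[OF sgn_sets(1) pos1]],
          rule positive_push[OF meas_midx positive_restr[OF sgn_sets(2) pos1]])
    have "- superpose \<tau>1 = ?d - ?c" by (simp add: superpose_def)
    then have "variation (superpose \<tau>1) \<Omega> \<le> smeasure ?c \<Omega> + smeasure ?d \<Omega>"
      using jpos_diff_le[OF pc Om_borel] jpos_diff_le[OF pc(2,1) Om_borel]
      unfolding variation_jpos by (simp add: superpose_def)
    also have "\<dots> \<le> smeasure ?c UNIV + smeasure ?d UNIV"
      by (intro add_mono positive_measure_mono pc Om_borel) auto
    also have "smeasure ?c UNIV = smeasure \<tau>1 {w. 0 \<le> sgnp w}"
      using smeasure_push[OF meas_fst, of UNIV] smeasure_restr[OF sgn_sets(1), of UNIV \<tau>1] by simp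
    also have "smeasure ?d UNIV = smeasure \<tau>1 {w. sgnp w \<le> 0}"
      using smeasure_push[OF meas_midx, of UNIV] smeasure_restr[OF sgn_sets(2), of UNIV \<tau>1] by simp
    also have "smeasure \<tau>1 {w. sgnp w \<le> 0} = smeasure \<tau>1 (UNIV - {w. 0 \<le> sgnp w})"
    proof -
      have "{w. sgnp w \<le> 0} \<inter> - Z = (UNIV - {w. 0 \<le> sgnp w}) \<inter> - Z" by (auto simp: Z_def)
      moreover have "UNIV - {w. 0 \<le> sgnp w} \<in> sets borel"
        using sgn_sets(1) by (metis sets.compl_sets space_borel)
      ultimately show ?thesis
        unfolding \<tau>1_def using smeasure_restr[OF CZ] sgn_sets(2) by metis
    qed
    also have "smeasure \<tau>1 {w. 0 \<le> sgnp w} + smeasure \<tau>1 (UNIV - {w. 0 \<le> sgnp w}) = smeasure \<tau>1 UNIV"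
      using smeasure_Diff[OF _ sgn_sets(1), of UNIV \<tau>1] by simp
    finally show ?thesis by simp
  qed
  have "superpose \<tau> = \<nu> + superpose \<tau>1"
    unfolding \<nu>_def nu[symmetric] superpose_plus[symmetric] sum[symmetric] ..
  then have "superpose \<tau> - \<nu> = superpose \<tau>1" by simp
  then have "kr (superpose \<tau>) \<le> (LINT w|\<gamma>. ?D w) + \<beta> / 2 * variation \<nu> \<Omega> + \<alpha> * variation (superpose \<tau>1) \<Omega>"
    using kr_le[OF nuO nu0, of "superpose \<tau>"] wasserstein_le[OF g] unfolding kr_val_def by simp
  also have "\<beta> / 2 * variation \<nu> \<Omega> = \<beta> * smeasure \<tau>0 UNIV"
    unfolding jpos_masses(3)[OF nuO nu0] by (simp add: \<nu>_def j massa)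
  also have "\<alpha> * variation (superpose \<tau>1) \<Omega> \<le> \<alpha> * smeasure \<tau>1 UNIV" using v1 \<alpha> by simp
  finally have "kr (superpose \<tau>) \<le> tcost \<tau>0 + tcost \<tau>1" unfolding t0 t1 I by simp
  also have "tcost \<tau>0 + tcost \<tau>1 = tcost \<tau>" unfolding tcost_lin(1)[symmetric] sum[symmetric] ..
  finally show ?thesis .
qed

section \<open>Duality and existence of minimizers\<close>

text \<open>
  The two conditions \<open>|q| \<le> \<alpha>\<close> and \<open>\<Psi>\<^sub>q \<le> 1\<close> of the stopping test in one, on all of \<open>params\<close>.
\<close>

definition dual_feasible :: "('a \<Rightarrow> real) \<Rightarrow> bool" where
  "dual_feasible q \<longleftrightarrow> continuous_on \<Omega> q \<and> (\<forall>w\<in>params. lift q w \<le> cost w)"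

lemma dist_powr_triangle: "norm (x - z) powr p \<le> norm (x - y) powr p + norm (y - z :: 'a) powr p"
proof -
  have "norm (x - z) powr p \<le> (norm (x - y) + norm (y - z)) powr p"
    using norm_triangle_ineq[of "x - y" "y - z"] p by (intro powr_mono2) auto
  also have "\<dots> \<le> norm (x - y) powr p + norm (y - z) powr p"
    using p by (intro powr_subadditive) auto
  finally show ?thesis .
qed

lemma pairing_superpose_le:
  assumes q: "dual_feasible q" and t: "admissible \<tau>"
  shows "pairing \<Omega> q (superpose \<tau>) \<le> tcost \<tau>"
proof -
  have qc: "continuous_on \<Omega> q" and on: "\<tau> \<in> measures_on params" and pos: "positive_measure \<tau>"
    using q t by (auto simp: dual_feasible_def admissible_def)
  show ?thesis
    unfolding pairing_superpose[OF on qc] tcost_def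
    by (rule pairing_mono[OF compact_params continuous_lift[OF qc] continuous_cost pos])
      (use q in \<open>auto simp: dual_feasible_def\<close>)
qed

lemma weak_duality: "dual_feasible q \<Longrightarrow> \<mu> \<in> measures_on \<Omega> \<Longrightarrow> pairing \<Omega> q \<mu> \<le> kr \<mu>"
  using kr_attained[of \<mu>] pairing_superpose_le by force

text \<open>
  The slack \<open>cost - lift q\<close> is nonnegative on \<open>params\<close>, while its integral against \<open>\<tau>\<close> is at most zero.
\<close>

lemma complementary_null:
  assumes q: "dual_feasible q" and t: "admissible \<tau>" and opt: "tcost \<tau> \<le> pairing \<Omega> q (superpose \<tau>)"
    and A: "A \<in> sets borel" and slack: "\<And>w. w \<in> A \<inter> params \<Longrightarrow> lift q w < cost w"
  shows "smeasure \<tau> A = 0"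
proof -
  have qc: "continuous_on \<Omega> q" and on: "\<tau> \<in> measures_on params" and pos: "positive_measure \<tau>"
    using q t by (auto simp: dual_feasible_def admissible_def)
  let ?f = "\<lambda>w. indicator params w * cost w - indicator params w * lift q w"
  have b1: "bdd_borel (\<lambda>w. indicator params w * cost w)" by (rule bdd_borel_continuous[OF compact_params continuous_cost])
  have b2: "bdd_borel (\<lambda>w. indicator params w * lift q w)"
    by (rule bdd_borel_continuous[OF compact_params continuous_lift[OF qc]])
  have "sint ?f \<tau> = tcost \<tau> - pairing \<Omega> q (superpose \<tau>)"
    unfolding sint_diff_fun[OF b1 b2] pairing_superpose[OF on qc] unfolding tcost_def pairing_sint ..
  then have z: "sint ?f \<tau> \<le> 0" using opt by simp
  show ?thesis
    by (rule sint_eq_0_imp_null[OF pos params_borel on bdd_borel_diff[OF b1 b2] _ z A])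
      (use q slack in \<open>auto simp: dual_feasible_def\<close>)
qed

text \<open>
  By complementarity \<open>\<tau>\<close> only uses tight dipoles. If both \<open>(x, y, 0)\<close> and \<open>(y, z, 0)\<close> were tight, the
  triangle inequality for \<open>|x - y|\<^sup>p\<close> would make \<open>q x - q z\<close> exceed its bound by at least \<open>\<beta>\<close>. Thus the set of
  sources of tight dipoles contains none of their sinks.
\<close>

lemma kr_le_tcost_if_complementary:
  assumes q: "dual_feasible q" and t: "admissible \<tau>" and opt: "tcost \<tau> \<le> pairing \<Omega> q (superpose \<tau>)"
  shows "kr (superpose \<tau>) \<le> tcost \<tau>"
proof -
  have qc: "continuous_on \<Omega> q" using q by (auto simp: dual_feasible_def)
  define T where "T = {w\<in>params. sgnp w = 0 \<and> lift q w = cost w}"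
  have "T = {w\<in>params. sgnp w * 1 = 0} \<inter> {w\<in>params. cost w - lift q w = 0}" by (auto simp: T_def)
  moreover have "closed {w\<in>params. sgnp w * 1 = 0}" "closed {w\<in>params. cost w - lift q w = 0}"
    by (intro continuous_closed_preimage_constant compact_imp_closed compact_params continuous_intros
        continuous_cost continuous_lift qc)+
  ultimately have cT: "closed T" by auto
  have "T \<subseteq> params" by (auto simp: T_def)
  with cT have "compact T" using compact_params by (metis compact_Int_closed inf.absorb_iff2)
  then have "compact (fst ` T)" by (intro compact_continuous_image continuous_intros)
  then have X: "fst ` T \<in> sets borel" by (rule borel_compact)
  then have CX: "- (fst ` T) \<in> sets borel" by (metis sets.compl_sets space_borel Compl_eq_Diff_UNIV)
  have e: "{w. sgnp w = 0 \<and> fst w \<notin> fst ` T} = fst -` (- (fst ` T)) \<inter> {w. sgnp w = 0}"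
    "{w. sgnp w = 0 \<and> midx w \<in> fst ` T} = midx -` (fst ` T) \<inter> {w. sgnp w = 0}" by auto
  have m1: "fst -` (- (fst ` T)) \<in> sets (borel :: ('a \<times> 'a \<times> real) measure)"
    using measurable_sets[OF meas_fst CX] by simp
  have m2: "midx -` (fst ` T) \<in> sets borel" using measurable_sets[OF meas_midx X] by simp
  show ?thesis
  proof (rule kr_superpose_le[OF t X])
    show "smeasure \<tau> {w. sgnp w = 0 \<and> fst w \<notin> fst ` T} = 0"
    proof (rule complementary_null[OF q t opt])
      show "{w. sgnp w = 0 \<and> fst w \<notin> fst ` T} \<in> sets borel" unfolding e by (intro sets.Int m1 sgn_sets)
      fix w assume w: "w \<in> {w. sgnp w = 0 \<and> fst w \<notin> fst ` T} \<inter> params"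
      then have "w \<notin> T" by auto
      then show "lift q w < cost w" using w q by (auto simp: T_def dual_feasible_def less_le)
    qed
    show "smeasure \<tau> {w. sgnp w = 0 \<and> midx w \<in> fst ` T} = 0"
    proof (rule complementary_null[OF q t opt])
      show "{w. sgnp w = 0 \<and> midx w \<in> fst ` T} \<in> sets borel" unfolding e by (intro sets.Int m2 sgn_sets)
      fix w assume w: "w \<in> {w. sgnp w = 0 \<and> midx w \<in> fst ` T} \<inter> params"
      then obtain x y z where wd: "w = (x, y, 0)" "w \<in> params" "(y, z, 0) \<in> T"
        by (cases w) (force simp: T_def)
      have yz: "q y - q z = norm (y - z) powr p + \<beta>" "z \<in> \<Omega>" using wd(3) by (auto simp: T_def lift_def cost_def params_def)
      have "(x, z, 0) \<in> params" using wd yz by (auto simp: params_def)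
      then have "lift q (x, z, 0) \<le> cost (x, z, 0)" using q by (simp add: dual_feasible_def)
      then have "q x - q z \<le> norm (x - z) powr p + \<beta>" by (simp add: lift_def cost_def)
      then have "q x - q y < norm (x - y) powr p + \<beta>"
        using yz(1) dist_powr_triangle[of x z y] \<beta> by linarith
      then show "lift q w < cost w" by (simp add: wd lift_def cost_def)
    qed
  qed
qed

text \<open>
  Elementary measures normalized to cost one; these are the measures that the algorithm inserts.
\<close>

definition atom :: "'a \<times> 'a \<times> real \<Rightarrow> 'a signed_measure" where
  "atom w = (1 / cost w) *\<^sub>R superpose (dirac w)"

lemma atom_measures_on: "w \<in> params \<Longrightarrow> atom w \<in> measures_on \<Omega>"
  unfolding atom_def by (intro measures_on_scaleR superpose_measures_on dirac_measures_on params_borel)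

lemma superpose_dirac_atom: "w \<in> params \<Longrightarrow> superpose (dirac w) = cost w *\<^sub>R atom w"
  using cost_pos[of w] by (simp add: atom_def)

lemma pairing_atom:
  assumes w: "w \<in> params" and q: "continuous_on \<Omega> q" shows "pairing \<Omega> q (atom w) = lift q w / cost w"
  unfolding atom_def pairing_plus(3)[OF compact_Om q]
    pairing_superpose[OF dirac_measures_on[OF params_borel w] q]
    pairing_plus(6)[OF compact_params continuous_lift[OF q] w] by simp

text \<open>
  By complementary slackness \<open>\<tau>\<close> vanishes off the contact set, and a measure on a finite set is a sum of
  point masses.
\<close>

lemma complementary_finite:
  assumes q: "dual_feasible q" and t: "admissible \<tau>" and opt: "tcost \<tau> \<le> pairing \<Omega> q (superpose \<tau>)"
    and fin: "finite {w\<in>params. lift q w = cost w}"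
  shows "\<tau> = (\<Sum>w\<in>{w\<in>params. lift q w = cost w}. smeasure \<tau> {w} *\<^sub>R dirac w)"
    (is "_ = (\<Sum>w\<in>?W. _)")
proof (rule smeasure_eqI)
  fix A :: "('a \<times> 'a \<times> real) set" assume A: "A \<in> sets borel"
  have fb: "S \<in> sets borel" if "finite S" for S :: "('a \<times> 'a \<times> real) set"
    using that by (intro borel_closed finite_imp_closed)
  have "smeasure \<tau> (A - ?W) = 0"
    by (rule complementary_null[OF q t opt]) (use A fb[OF fin] q in \<open>auto simp: dual_feasible_def less_le\<close>)
  then have "smeasure \<tau> A = smeasure \<tau> (A \<inter> ?W)" using smeasure_split[OF A fb[OF fin], of \<tau>] by simp
  also have "\<dots> = (\<Sum>w\<in>A \<inter> ?W. smeasure \<tau> {w})"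
  proof -
    have fs: "finite S \<Longrightarrow> smeasure \<tau> S = (\<Sum>w\<in>S. smeasure \<tau> {w})" for S
    proof (induction S rule: finite_induct)
      case (insert w S)
      have "smeasure \<tau> ({w} \<union> S) = smeasure \<tau> {w} + smeasure \<tau> S"
        using insert by (intro smeasure_Un fb) auto
      then show ?case using insert by simp
    qed simp
    show ?thesis by (rule fs) (use fin in blast)
  qed
  also have "A \<inter> ?W = ?W \<inter> A" by blast
  also have "(\<Sum>w\<in>?W \<inter> A. smeasure \<tau> {w}) = (\<Sum>w\<in>?W. if w \<in> A then smeasure \<tau> {w} else 0)"
    by (rule sum.inter_restrict[OF fin])
  also have "\<dots> = smeasure (\<Sum>w\<in>?W. smeasure \<tau> {w} *\<^sub>R dirac w) A"
    unfolding smeasure_sum smeasure_simps dirac.rep_eq using A by (intro sum.cong) auto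
  finally show "smeasure \<tau> A = smeasure (\<Sum>w\<in>?W. smeasure \<tau> {w} *\<^sub>R dirac w) A" .
qed

end

locale kr_problem = kr_setting \<Omega> p \<alpha> \<beta>
  for \<Omega> :: "'a::euclidean_space set" and p \<alpha> \<beta> :: real +
  fixes K :: "'a signed_measure \<Rightarrow> 'y::real_inner" and Kstar :: "'y \<Rightarrow> 'a \<Rightarrow> real"
    and F :: "'y \<Rightarrow> real" and gradF :: "'y \<Rightarrow> 'y"
  assumes K_lin: "linear_on_measures \<Omega> K" and K_cont: "weak_star_to_strong_continuous \<Omega> K"
    and Kstar: "is_preadjoint \<Omega> K Kstar"
    and F_strict: "strictly_convex F" and F_bdd: "bdd_below (range F)" and F_deriv: "\<And>y. GDERIV F y :> gradF y"
    and F_lip: "\<And>C. compact C \<Longrightarrow> \<exists>L. L-lipschitz_on C gradF"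
begin

lemma K_scaleR: "\<mu> \<in> measures_on \<Omega> \<Longrightarrow> K (c *\<^sub>R \<mu>) = c *\<^sub>R K \<mu>"
  and K_plus: "\<mu> \<in> measures_on \<Omega> \<Longrightarrow> \<nu> \<in> measures_on \<Omega> \<Longrightarrow> K (\<mu> + \<nu>) = K \<mu> + K \<nu>"
  using K_lin by (auto simp: linear_on_measures_def)

lemma K_zero: "K 0 = 0"
  using K_scaleR[OF measures_on_zero, of 0] by simp

lemma K_sum: "(\<And>i. i \<in> I \<Longrightarrow> \<mu> i \<in> measures_on \<Omega>) \<Longrightarrow> K (\<Sum>i\<in>I. \<mu> i) = (\<Sum>i\<in>I. K (\<mu> i))"
  by (induction I rule: infinite_finite_induct) (auto simp: K_zero K_plus measures_on_sum)

lemma K_combination: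
  "(\<And>i. i \<in> I \<Longrightarrow> \<mu> i \<in> measures_on \<Omega>) \<Longrightarrow> K (\<Sum>i\<in>I. c i *\<^sub>R \<mu> i) = (\<Sum>i\<in>I. c i *\<^sub>R K (\<mu> i))"
  by (subst K_sum) (auto simp: K_scaleR measures_on_scaleR)

definition dualvar :: "'y \<Rightarrow> 'a \<Rightarrow> real" where "dualvar y = dual_variable Kstar gradF y"

lemma continuous_Kstar: "continuous_on \<Omega> (Kstar v)"
  using Kstar by (simp add: is_preadjoint_def)

lemma continuous_dualvar: "continuous_on \<Omega> (dualvar y)"
  unfolding dualvar_def dual_variable_def by (intro continuous_intros continuous_Kstar)

lemma pairing_dualvar:
  assumes m: "\<mu> \<in> measures_on \<Omega>" shows "pairing \<Omega> (dualvar y) \<mu> = - gradF y \<bullet> K \<mu>"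
proof -
  have "pairing \<Omega> (dualvar y) \<mu> = sint (\<lambda>x. (-1) * (indicator \<Omega> x * Kstar (gradF y) x)) \<mu>"
    unfolding pairing_sint dualvar_def dual_variable_def by (simp add: mult.commute)
  also have "\<dots> = (-1) * pairing \<Omega> (Kstar (gradF y)) \<mu>"
    unfolding pairing_sint by (rule sint_cmult_fun[OF bdd_borel_continuous[OF compact_Om continuous_Kstar]])
  also have "pairing \<Omega> (Kstar (gradF y)) \<mu> = gradF y \<bullet> K \<mu>"
    using Kstar m by (simp add: is_preadjoint_def)
  finally show ?thesis by simp
qed

lemma F_line_deriv: "((\<lambda>t. F (y + t *\<^sub>R k) + t * c) has_real_derivative gradF y \<bullet> k + c) (at 0)"
proof -
  have f1: "(F has_derivative (\<lambda>h. h \<bullet> gradF y)) (at (y + 0 *\<^sub>R k))"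
    using F_deriv[of y] by (simp add: gderiv_def)
  have "((\<lambda>t. y + t *\<^sub>R k) has_derivative (\<lambda>s. s *\<^sub>R k)) (at 0)"
    by (auto intro!: derivative_eq_intros)
  from has_derivative_compose[OF this f1]
  have "((\<lambda>t. F (y + t *\<^sub>R k)) has_real_derivative (gradF y \<bullet> k)) (at 0)"
    unfolding has_field_derivative_def
    by (rule has_derivative_eq_rhs) (simp add: fun_eq_iff inner_commute)
  then show ?thesis by (auto intro!: derivative_eq_intros)
qed

lemma first_order_ge:
  assumes "0 < d" "\<And>t. 0 < t \<Longrightarrow> t < d \<Longrightarrow> F y \<le> F (y + t *\<^sub>R k) + t * c"
  shows "0 \<le> gradF y \<bullet> k + c"
proof (rule ccontr)
  assume "\<not> ?thesis"
  then have "gradF y \<bullet> k + c < 0" by simp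
  from DERIV_neg_dec_right[OF F_line_deriv this] obtain e where e: "0 < e"
    "\<And>h. 0 < h \<Longrightarrow> h < e \<Longrightarrow> F (y + h *\<^sub>R k) + h * c < F y" by auto
  have "0 < min d e / 2" "min d e / 2 < d" "min d e / 2 < e" using assms(1) e(1) by auto
  then show False using assms(2)[of "min d e / 2"] e(2)[of "min d e / 2"] by linarith
qed

lemma first_order_le:
  assumes "\<And>t. 0 < t \<Longrightarrow> t < 1 \<Longrightarrow> F (y + t *\<^sub>R k) \<le> F y + t * c"
  shows "gradF y \<bullet> k \<le> c"
proof (rule ccontr)
  assume "\<not> ?thesis"
  then have "0 < gradF y \<bullet> k + (- c)" by simp
  from DERIV_pos_inc_right[OF F_line_deriv this] obtain e where e: "0 < e"
    "\<And>h. 0 < h \<Longrightarrow> h < e \<Longrightarrow> F y < F (y + h *\<^sub>R k) + h * (- c)" by auto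
  have "0 < min 1 e / 2" "min 1 e / 2 < 1" "min 1 e / 2 < e" using e(1) by auto
  then show False using assms[of "min 1 e / 2"] e(2)[of "min 1 e / 2"] by linarith
qed

lemma F_gradient_strict:
  assumes "x \<noteq> y" shows "F x + gradF x \<bullet> (y - x) < F y"
proof -
  have conv: "F (x + t *\<^sub>R (z - x)) < F x + t * (F z - F x)" if "z \<noteq> x" "0 < t" "t < 1" for z t
  proof -
    have "F ((1 - t) *\<^sub>R x + t *\<^sub>R z) < (1 - t) * F x + t * F z"
      using F_strict that by (auto simp: strictly_convex_def)
    moreover have "(1 - t) *\<^sub>R x + t *\<^sub>R z = x + t *\<^sub>R (z - x)" by (simp add: algebra_simps)
    ultimately show ?thesis by (simp add: algebra_simps)
  qed
  define m where "m = x + (1/2) *\<^sub>R (y - x)"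
  have mx: "m - x = (1/2) *\<^sub>R (y - x)" by (simp add: m_def)
  then have "m \<noteq> x" using assms by auto
  then have "gradF x \<bullet> (m - x) \<le> F m - F x"
    using conv by (intro first_order_le) (auto intro: less_imp_le)
  moreover have "F m < F x + 1/2 * (F y - F x)" unfolding m_def using assms by (intro conv) auto
  moreover have "gradF x \<bullet> (m - x) = (gradF x \<bullet> (y - x)) / 2" by (simp add: mx)
  moreover have "F m < (F x + F y) / 2" if "F m < F x + 1/2 * (F y - F x)" using that by (simp add: field_simps)
  ultimately show ?thesis by (simp add: field_simps)
qed

lemma F_gradient: "F x + gradF x \<bullet> (y - x) \<le> F y"
  using F_gradient_strict[of x y] by (cases "x = y") auto

lemma F_continuous: "continuous_on UNIV F"
  using F_deriv unfolding gderiv_def by (auto intro!: continuous_at_imp_continuous_on has_derivative_continuous)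

text \<open>
  The problem lifted to superpositions: the norm is replaced by the linear cost, so that the lifted objective
  has one-sided derivatives in all directions \<open>dirac w\<close>.
\<close>

definition val :: "('a \<times> 'a \<times> real) signed_measure \<Rightarrow> real" where
  "val \<tau> = F (K (superpose \<tau>)) + tcost \<tau>"

lemma admissible_superpose: "admissible \<tau> \<Longrightarrow> superpose \<tau> \<in> measures_on \<Omega>"
  by (simp add: admissible_def superpose_measures_on)

lemma K_superpose_conv:
  assumes a: "\<And>n. admissible (\<tau> n)" "admissible \<tau>'"
    and w: "weak_star_converges \<Omega> (\<lambda>n. superpose (\<tau> n)) (superpose \<tau>')"
  shows "(\<lambda>n. K (superpose (\<tau> n))) \<longlonglongrightarrow> K (superpose \<tau>')"
proof -
  have "range (\<lambda>n. superpose (\<tau> n)) \<subseteq> measures_on \<Omega>" using a(1) admissible_superpose by auto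
  then show ?thesis using K_cont w admissible_superpose[OF a(2)]
    unfolding weak_star_to_strong_continuous_def by blast
qed

lemma K_bounded_compact: "compact {K (superpose \<tau>) | \<tau>. admissible \<tau> \<and> tcost \<tau> \<le> R}"
  unfolding compact_def
proof (intro allI impI)
  fix f :: "nat \<Rightarrow> 'y" assume "\<forall>n. f n \<in> {K (superpose \<tau>) | \<tau>. admissible \<tau> \<and> tcost \<tau> \<le> R}"
  then have "\<forall>n. \<exists>\<tau>. f n = K (superpose \<tau>) \<and> admissible \<tau> \<and> tcost \<tau> \<le> R" by blast
  then obtain \<tau> where t: "\<And>n. f n = K (superpose (\<tau> n))" "\<And>n. admissible (\<tau> n)" "\<And>n. tcost (\<tau> n) \<le> R"
    by metis
  from admissible_compact[of \<tau>, OF t(2,3)] obtain r \<tau>' where r: "strict_mono (r :: nat \<Rightarrow> nat)"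
    and a: "admissible \<tau>'" and c: "(\<lambda>n. tcost (\<tau> (r n))) \<longlonglongrightarrow> tcost \<tau>'"
    and w: "weak_star_converges \<Omega> (\<lambda>n. superpose (\<tau> (r n))) (superpose \<tau>')" by blast
  have "tcost \<tau>' \<le> R" by (rule LIMSEQ_le_const2[OF c]) (use t(3) in blast)
  moreover have "(f \<circ> r) \<longlonglongrightarrow> K (superpose \<tau>')"
    using K_superpose_conv[OF t(2) a w] by (simp add: o_def t(1))
  ultimately show "\<exists>l\<in>{K (superpose \<tau>) | \<tau>. admissible \<tau> \<and> tcost \<tau> \<le> R}. \<exists>r. strict_mono r \<and> (f \<circ> r) \<longlonglongrightarrow> l"
    using r a by blast
qed

text \<open>
  Direct method: along a minimizing sequence the costs are bounded, since \<open>F\<close> is bounded below.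
\<close>

lemma relaxed_minimizer: "\<exists>\<tau>. admissible \<tau> \<and> (\<forall>\<tau>'. admissible \<tau>' \<longrightarrow> val \<tau> \<le> val \<tau>')"
proof -
  obtain b where b: "\<And>y. b \<le> F y" using F_bdd by (auto simp: bdd_below_def)
  let ?S = "val ` {\<tau>. admissible \<tau>}"
  have lb: "b \<le> v" if "v \<in> ?S" for v using that b tcost_nonneg by (force simp: val_def intro: add_increasing2)
  have bdd: "bdd_below ?S" using lb by (rule bdd_belowI)
  have ne: "?S \<noteq> {}" using admissible_lin(1) by blast
  have "\<forall>n::nat. \<exists>\<tau>. admissible \<tau> \<and> val \<tau> < Inf ?S + 1 / real (Suc n)"
  proof
    fix n :: nat
    have "Inf ?S < Inf ?S + 1 / real (Suc n)" by simp
    from cInf_lessD[OF ne this] show "\<exists>\<tau>. admissible \<tau> \<and> val \<tau> < Inf ?S + 1 / real (Suc n)" by blast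
  qed
  then obtain \<tau> where t: "\<And>n. admissible (\<tau> n)" "\<And>n::nat. val (\<tau> n) < Inf ?S + 1 / real (Suc n)" by metis
  have bd: "tcost (\<tau> n) \<le> Inf ?S + 1 - b" for n
  proof -
    have "1 / real (Suc n) \<le> 1" by simp
    then show ?thesis using t(2)[of n] b[of "K (superpose (\<tau> n))"] unfolding val_def by linarith
  qed
  from admissible_compact[of \<tau>, OF t(1) bd] obtain r \<tau>' where r: "strict_mono (r :: nat \<Rightarrow> nat)"
    and a: "admissible \<tau>'" and c: "(\<lambda>n. tcost (\<tau> (r n))) \<longlonglongrightarrow> tcost \<tau>'"
    and w: "weak_star_converges \<Omega> (\<lambda>n. superpose (\<tau> (r n))) (superpose \<tau>')" by blast
  have "isCont F (K (superpose \<tau>'))" using F_continuous by (simp add: continuous_on_eq_continuous_at)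
  from isCont_tendsto_compose[OF this K_superpose_conv[OF t(1) a w]]
  have l1: "(\<lambda>n. val (\<tau> (r n))) \<longlonglongrightarrow> val \<tau>'" unfolding val_def by (intro tendsto_add c)
  have "(\<lambda>n. Inf ?S + 1 / real (Suc n)) \<longlonglongrightarrow> Inf ?S + 0"
    by (intro tendsto_intros LIMSEQ_Suc[OF lim_1_over_n])
  from LIMSEQ_subseq_LIMSEQ[OF this r] have l2: "(\<lambda>n. Inf ?S + 1 / real (Suc (r n))) \<longlonglongrightarrow> Inf ?S" by (simp add: o_def)
  have "val \<tau>' \<le> Inf ?S" by (rule LIMSEQ_le[OF l1 l2]) (use t(2) less_imp_le in blast)
  then show ?thesis using a bdd by (intro exI[of _ \<tau>']) (auto intro: order_trans[OF _ cInf_lower])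
qed

text \<open>
  Adding \<open>t\<close> times a point mass at \<open>w\<close> gives the bound at \<open>w\<close>; scaling \<open>\<tau>\<close> by \<open>1 - t\<close> gives
  complementarity.
\<close>

lemma relaxed_optimality:
  assumes a: "admissible \<tau>" and min: "\<And>\<tau>'. admissible \<tau>' \<Longrightarrow> val \<tau> \<le> val \<tau>'"
  defines "q \<equiv> dualvar (K (superpose \<tau>))"
  shows "dual_feasible q" "tcost \<tau> \<le> pairing \<Omega> q (superpose \<tau>)"
proof -
  let ?y = "K (superpose \<tau>)"
  have qc: "continuous_on \<Omega> q" unfolding q_def by (rule continuous_dualvar)
  have "lift q w \<le> cost w" if w: "w \<in> params" for w
  proof -
    have d: "admissible (dirac w)" using w by (rule admissible_lin)
    have "0 \<le> gradF ?y \<bullet> K (superpose (dirac w)) + cost w"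
    proof (rule first_order_ge[of 1])
      fix t :: real assume t: "0 < t" "t < 1"
      then have "admissible (\<tau> + t *\<^sub>R dirac w)" by (intro admissible_lin a w) auto
      from min[OF this] show "F ?y \<le> F (?y + t *\<^sub>R K (superpose (dirac w))) + t * cost w"
        unfolding val_def superpose_plus superpose_scaleR tcost_lin(1,2) tcost_lin(5)[OF w]
        by (simp add: K_plus K_scaleR measures_on_scaleR admissible_superpose a d)
    qed simp
    moreover have "lift q w = - gradF ?y \<bullet> K (superpose (dirac w))"
      unfolding q_def pairing_dualvar[OF admissible_superpose[OF d], symmetric]
      using pairing_superpose[OF dirac_measures_on[OF params_borel w] continuous_dualvar]
        pairing_plus(6)[OF compact_params continuous_lift[OF continuous_dualvar] w] by simp
    ultimately show ?thesis by simp
  qed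
  then show "dual_feasible q" using qc by (simp add: dual_feasible_def)
  have "0 \<le> gradF ?y \<bullet> (- ?y) + (- tcost \<tau>)"
  proof (rule first_order_ge[of 1])
    fix t :: real assume t: "0 < t" "t < 1"
    then have "admissible ((1 - t) *\<^sub>R \<tau>)" by (intro admissible_lin a) auto
    from min[OF this] show "F ?y \<le> F (?y + t *\<^sub>R (- ?y)) + t * (- tcost \<tau>)"
      unfolding val_def superpose_scaleR tcost_lin(2) K_scaleR[OF admissible_superpose[OF a]]
      by (simp add: algebra_simps)
  qed simp
  then show "tcost \<tau> \<le> pairing \<Omega> q (superpose \<tau>)"
    unfolding q_def pairing_dualvar[OF admissible_superpose[OF a]] by simp
qed

abbreviation "J \<equiv> objective \<Omega> p \<alpha> \<beta> K F"
abbreviation "minimizer \<equiv> is_minimizer \<Omega> p \<alpha> \<beta> K F"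

text \<open>
  \<open>J \<nu> - J \<mu>\<close> is the sum of the Bregman distance of \<open>F\<close> between \<open>K \<nu>\<close> and \<open>K \<mu>\<close> and of the duality gap of
  \<open>\<nu>\<close>. Both are nonnegative, and for another minimizer both vanish.
\<close>

lemma certificate:
  assumes m: "\<mu> \<in> measures_on \<Omega>" and q: "dual_feasible (dualvar (K \<mu>))"
    and opt: "kr \<mu> \<le> pairing \<Omega> (dualvar (K \<mu>)) \<mu>"
  shows "minimizer \<mu>"
    and "minimizer \<nu> \<Longrightarrow> K \<nu> = K \<mu>" "minimizer \<nu> \<Longrightarrow> kr \<nu> \<le> pairing \<Omega> (dualvar (K \<mu>)) \<nu>"
    and "minimizer \<nu> \<Longrightarrow> \<nu> \<in> measures_on \<Omega>"
proof -
  let ?q = "dualvar (K \<mu>)"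
  have gap: "J \<nu> - J \<mu> = (F (K \<nu>) - F (K \<mu>) - gradF (K \<mu>) \<bullet> (K \<nu> - K \<mu>)) + (kr \<nu> - pairing \<Omega> ?q \<nu>)"
    if n: "\<nu> \<in> measures_on \<Omega>" for \<nu>
    using weak_duality[OF q m] opt
    by (simp add: objective_def pairing_dualvar[OF m] pairing_dualvar[OF n] inner_diff_right)
  have wd: "0 \<le> kr \<nu> - pairing \<Omega> ?q \<nu>" if "\<nu> \<in> measures_on \<Omega>" for \<nu>
    using weak_duality[OF q that] by simp
  have le: "J \<mu> \<le> J \<nu>" if n: "\<nu> \<in> measures_on \<Omega>" for \<nu>
    using gap[OF n] wd[OF n] F_gradient[of "K \<mu>" "K \<nu>"] by linarith
  then show min: "minimizer \<mu>" using m by (auto simp: is_minimizer_def is_arg_min_def not_less)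
  {
    assume n: "minimizer \<nu>"
    then show on: "\<nu> \<in> measures_on \<Omega>" by (simp add: is_minimizer_def is_arg_min_def)
    have "J \<nu> \<le> J \<mu>" using n m by (auto simp: is_minimizer_def is_arg_min_def not_less)
    then have z: "(F (K \<nu>) - F (K \<mu>) - gradF (K \<mu>) \<bullet> (K \<nu> - K \<mu>)) + (kr \<nu> - pairing \<Omega> ?q \<nu>) \<le> 0"
      using gap[OF on] by simp
    show "K \<nu> = K \<mu>"
      using z wd[OF on] F_gradient_strict[of "K \<mu>" "K \<nu>"] by (cases "K \<nu> = K \<mu>") auto
    show "kr \<nu> \<le> pairing \<Omega> ?q \<nu>"
      using z F_gradient[of "K \<mu>" "K \<nu>"] by linarith
  }
qed

text \<open>
  A minimizer of the lifted problem satisfies the certificate.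
\<close>

lemma minimizer_exists:
  "\<exists>\<mu>. minimizer \<mu> \<and> \<mu> \<in> measures_on \<Omega> \<and> dual_feasible (dualvar (K \<mu>)) \<and>
    kr \<mu> \<le> pairing \<Omega> (dualvar (K \<mu>)) \<mu> \<and> optimal_observation \<Omega> p \<alpha> \<beta> K F = K \<mu>"
proof -
  obtain \<tau> where a: "admissible \<tau>" and min: "\<And>\<tau>'. admissible \<tau>' \<Longrightarrow> val \<tau> \<le> val \<tau>'"
    using relaxed_minimizer by blast
  let ?m = "superpose \<tau>"
  note o = relaxed_optimality[OF a min]
  have m: "?m \<in> measures_on \<Omega>" using a by (rule admissible_superpose)
  have k: "kr ?m \<le> pairing \<Omega> (dualvar (K ?m)) ?m"
    using kr_le_tcost_if_complementary[OF o(1) a o(2)] o(2) by simp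
  note c = certificate[OF m o(1) k]
  have "optimal_observation \<Omega> p \<alpha> \<beta> K F = K ?m"
    unfolding optimal_observation_def
  proof (rule the_equality)
    show "\<exists>\<mu>. minimizer \<mu> \<and> K ?m = K \<mu>" using c(1) by blast
    fix y assume "\<exists>\<mu>. minimizer \<mu> \<and> y = K \<mu>"
    then show "y = K ?m" using c(2) by blast
  qed
  then show ?thesis using c(1) m o(1) k by (intro exI[of _ ?m] conjI)
qed

end

section \<open>One step of the algorithm\<close>

lemma finite_positive_gap:
  fixes f :: "'a \<Rightarrow> real"
  assumes "finite S"
  shows "\<exists>e>0. \<forall>m\<in>S. 0 < f m \<longrightarrow> e < f m"
  using assms
proof (induction S rule: finite_induct)
  case empty
  show ?case by (rule exI[of _ 1]) simp
next
  case (insert a S)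
  obtain e where e: "0 < e" "\<forall>m\<in>S. 0 < f m \<longrightarrow> e < f m" using insert.IH by (elim exE conjE)
  show ?case
  proof (cases "0 < f a")
    case True
    have "min e (f a / 2) < f m" if "m \<in> insert a S" "0 < f m" for m
      using e that True by (cases "m = a") (auto simp: min_less_iff_disj)
    then show ?thesis using e True by (intro exI[of _ "min e (f a / 2)"]) auto
  next
    case False
    then show ?thesis using e by (intro exI[of _ e]) auto
  qed
qed

lemma cSUP_is_arg_max:
  fixes f :: "'a \<Rightarrow> real"
  assumes "is_arg_max f (\<lambda>z. z \<in> S) z"
  shows "z \<in> S" "\<And>z'. z' \<in> S \<Longrightarrow> f z' \<le> f z" "(SUP z\<in>S. f z) = f z"
proof -
  show z: "z \<in> S" and le: "\<And>z'. z' \<in> S \<Longrightarrow> f z' \<le> f z"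
    using assms by (auto simp: is_arg_max_def not_less)
  show "(SUP z\<in>S. f z) = f z" by (rule cSup_eq_maximum) (use z le in auto)
qed

context kr_setting
begin

lemma cost_dipole: "cost (x, y, 0) = norm (x - y) powr p + \<beta>"
  by (simp add: cost_def)

lemma cost_point: "s \<noteq> 0 \<Longrightarrow> cost (x, x, s) = \<alpha>"
  using p by (simp add: cost_def)

lemma atom_point: "s = 1 \<or> s = -1 \<Longrightarrow> atom (x, x, s) = (s / \<alpha>) *\<^sub>R dirac x"
  using cost_point[of s x] by (elim disjE) (simp_all add: atom_def superpose_dirac)

lemma atom_dipole: "atom (x, y, 0) = dipole p \<beta> x y"
  by (simp add: atom_def superpose_dirac cost_dipole dipole_def add.commute)

lemma Psi_lift: "Psi p \<beta> q (x, y) = lift q (x, y, 0) / cost (x, y, 0)"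
  by (simp add: Psi_def lift_def cost_def)

text \<open>
  The two maximizations of the algorithm run over the point masses and over the dipoles. Comparing their
  values picks a maximizer of \<open>lift q / cost\<close> over all of \<open>params\<close>, and the failed stopping test says that
  the maximum exceeds 1.
\<close>

lemma oracle_atom:
  assumes atom: "AGCG_atom \<Omega> p \<alpha> \<beta> q mh" and go: "\<not> AGCG_stops \<Omega> p \<alpha> \<beta> q"
  shows "\<exists>w\<in>params. mh = atom w \<and> 1 < lift q w / cost w \<and>
    (\<forall>w'\<in>params. lift q w' / cost w' \<le> lift q w / cost w)"
proof -
  obtain z x y where zm: "is_arg_max (\<lambda>z. \<bar>q z\<bar>) (\<lambda>z. z \<in> \<Omega>) z"
    and xym: "is_arg_max (Psi p \<beta> q) (\<lambda>w. w \<in> \<Omega> \<times> \<Omega>) (x, y)"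
    and mh: "mh = (if (SUP z\<in>\<Omega>. \<bar>q z\<bar>) / \<alpha> \<ge> (SUP w\<in>\<Omega> \<times> \<Omega>. Psi p \<beta> q w)
                then (sgn (q z) / \<alpha>) *\<^sub>R dirac z else dipole p \<beta> x y)"
    using atom unfolding AGCG_atom_def by (elim exE conjE)
  note z = cSUP_is_arg_max[OF zm] and xy = cSUP_is_arg_max[OF xym]
  define M P where "M = \<bar>q z\<bar>" and "P = Psi p \<beta> q (x, y)"
  have go': "\<not> (M \<le> \<alpha> \<and> P \<le> 1)"
    using go unfolding AGCG_stops_def z(3) xy(3) M_def P_def .
  have ub: "lift q w' / cost w' \<le> max (M / \<alpha>) P" if w': "w' \<in> params" for w'
  proof -
    obtain a b s where ws: "w' = (a, b, s)" by (cases w')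
    have ab: "a \<in> \<Omega>" "b \<in> \<Omega>" using w' by (simp_all add: ws params_def)
    show ?thesis
    proof (cases "s = 0")
      case True
      have "lift q w' / cost w' = Psi p \<beta> q (a, b)" by (simp add: ws True Psi_lift)
      then show ?thesis using xy(2)[of "(a, b)"] ab by (simp add: P_def le_max_iff_disj)
    next
      case False
      then have s: "b = a" "s = 1 \<or> s = -1" using w' by (auto simp: ws params_def)
      have "lift q w' = s * q a" using s(2) by (elim disjE) (simp_all add: ws s(1) lift_def)
      also have "\<dots> \<le> \<bar>q a\<bar>" using s(2) by (elim disjE) simp_all
      also have "\<dots> \<le> M" using z(2)[OF ab(1)] by (simp add: M_def)
      finally have "lift q w' / cost w' \<le> M / \<alpha>"
        using cost_point[OF False, of a] \<alpha> by (simp add: ws s(1) divide_right_mono)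
      then show ?thesis by simp
    qed
  qed
  have gt: "1 < max (M / \<alpha>) P" using go' \<alpha> by (auto simp: less_max_iff_disj)
  have "\<exists>w\<in>params. mh = atom w \<and> lift q w / cost w = max (M / \<alpha>) P"
  proof (cases "M / \<alpha> \<ge> P")
    case True
    then have "0 < M" using gt \<alpha> by (auto simp: max_def zero_less_divide_iff dest!: order.strict_trans[OF zero_less_one])
    then have s: "sgn (q z) = 1 \<or> sgn (q z) = -1" by (auto simp: M_def sgn_if)
    have "(z, z, sgn (q z)) \<in> params" using z(1) s by (simp add: params_def)
    moreover have "mh = atom (z, z, sgn (q z))"
      using True unfolding mh z(3) xy(3) M_def[symmetric] P_def[symmetric] atom_point[OF s] by simp
    moreover have "lift q (z, z, sgn (q z)) = sgn (q z) * q z"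
      using s by (elim disjE) (simp_all add: lift_def)
    then have "lift q (z, z, sgn (q z)) = M" by (simp add: M_def abs_sgn mult.commute)
    ultimately show ?thesis
      using True s cost_point[of "sgn (q z)" z] by (intro bexI[of _ "(z, z, sgn (q z))"]) auto
  next
    case False
    have "(x, y, 0) \<in> params" using xy(1) by (simp add: params_def)
    moreover have "mh = atom (x, y, 0)"
      using False unfolding mh z(3) xy(3) M_def[symmetric] P_def[symmetric] atom_dipole by simp
    ultimately show ?thesis
      using False by (intro bexI[of _ "(x, y, 0)"]) (auto simp: P_def Psi_lift)
  qed
  then show ?thesis using ub gt by force
qed

lemma stopping_feasible:
  assumes q: "continuous_on \<Omega> q" and stop: "AGCG_stops \<Omega> p \<alpha> \<beta> q"
  shows "dual_feasible q"
proof -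
  have "compact ((\<lambda>z. \<bar>q z\<bar>) ` \<Omega>)"
    by (rule compact_continuous_image[OF continuous_on_rabs[OF q] compact_Om])
  then have b1: "bdd_above ((\<lambda>z. \<bar>q z\<bar>) ` \<Omega>)" by (rule bounded_imp_bdd_above[OF compact_imp_bounded])
  have "continuous_on params (\<lambda>w. lift q w / cost w)"
    by (rule continuous_on_divide[OF continuous_lift[OF q] continuous_cost]) (use cost_pos in force)
  then have "compact ((\<lambda>w. lift q w / cost w) ` params)" by (rule compact_continuous_image[OF _ compact_params])
  then have "bdd_above ((\<lambda>w. lift q w / cost w) ` params)" by (rule bounded_imp_bdd_above[OF compact_imp_bounded])
  moreover have "Psi p \<beta> q ` (\<Omega> \<times> \<Omega>) \<subseteq> (\<lambda>w. lift q w / cost w) ` params"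
  proof
    fix t assume "t \<in> Psi p \<beta> q ` (\<Omega> \<times> \<Omega>)"
    then obtain x y where "x \<in> \<Omega>" "y \<in> \<Omega>" "t = Psi p \<beta> q (x, y)" by blast
    then show "t \<in> (\<lambda>w. lift q w / cost w) ` params"
      by (intro image_eqI[of _ _ "(x, y, 0)"]) (simp_all add: Psi_lift params_def)
  qed
  ultimately have b2: "bdd_above (Psi p \<beta> q ` (\<Omega> \<times> \<Omega>))" by (rule bdd_above_mono)
  have s: "(SUP z\<in>\<Omega>. \<bar>q z\<bar>) \<le> \<alpha>" "(SUP w\<in>\<Omega> \<times> \<Omega>. Psi p \<beta> q w) \<le> 1"
    using stop by (simp_all add: AGCG_stops_def)
  have "lift q w \<le> cost w" if w: "w \<in> params" for w
  proof -
    obtain a b s where ws: "w = (a, b, s)" by (cases w)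
    have ab: "a \<in> \<Omega>" "b \<in> \<Omega>" using w by (simp_all add: ws params_def)
    show ?thesis
    proof (cases "s = 0")
      case True
      have "Psi p \<beta> q (a, b) \<le> 1" using cSUP_upper[OF _ b2, of "(a, b)"] ab s(2) by simp
      then show ?thesis using cost_pos[OF w] by (simp add: ws True Psi_lift)
    next
      case False
      then have t: "b = a" "s = 1 \<or> s = -1" using w by (auto simp: ws params_def)
      have "\<bar>q a\<bar> \<le> \<alpha>" using cSUP_upper[OF ab(1) b1] s(1) by simp
      then have "q a \<le> \<alpha>" "- q a \<le> \<alpha>" by (simp_all add: abs_le_iff)
      moreover have "lift q w = s * q a" using t(2) by (elim disjE) (simp_all add: ws t(1) lift_def)
      moreover have "cost w = \<alpha>" using cost_point[OF False, of a] by (simp add: ws t(1))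
      ultimately show ?thesis using t(2) by (elim disjE) simp_all
    qed
  qed
  then show ?thesis using q by (simp add: dual_feasible_def)
qed

text \<open>
  A common home for the extreme points given as input and for the atoms inserted later.
\<close>

definition unit_costs :: "'a signed_measure set" where
  "unit_costs = {m. \<exists>\<tau>. admissible \<tau> \<and> superpose \<tau> = m \<and> tcost \<tau> \<le> 1}"

lemma unit_costs_on: "unit_costs \<subseteq> measures_on \<Omega>"
  by (auto simp: unit_costs_def admissible_def superpose_measures_on)

lemma KR_ball_unit_costs: "KR_ball \<Omega> p \<alpha> \<beta> \<subseteq> unit_costs"
proof
  fix m assume "m \<in> KR_ball \<Omega> p \<alpha> \<beta>"
  then have m: "m \<in> measures_on \<Omega>" "kr m \<le> 1" by (simp_all add: KR_ball_def)
  obtain \<tau> where "admissible \<tau>" "superpose \<tau> = m" "tcost \<tau> \<le> kr m" using kr_attained[OF m(1)] by blast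
  then show "m \<in> unit_costs" unfolding unit_costs_def using m(2) by force
qed

lemma atom_unit_costs: assumes w: "w \<in> params" shows "atom w \<in> unit_costs"
  unfolding unit_costs_def
proof (intro CollectI exI conjI)
  show "admissible ((1 / cost w) *\<^sub>R dirac w)" using cost_pos[OF w] by (intro admissible_lin w) simp
  show "superpose ((1 / cost w) *\<^sub>R dirac w) = atom w" by (simp add: superpose_scaleR atom_def)
  show "tcost ((1 / cost w) *\<^sub>R dirac w) \<le> 1" using cost_pos[OF w] w by (simp add: tcost_lin)
qed

lemma combination_represented:
  assumes S: "S \<subseteq> unit_costs" and c: "\<And>m. m \<in> S \<Longrightarrow> 0 \<le> c m"
  shows "\<exists>\<tau>. admissible \<tau> \<and> superpose \<tau> = (\<Sum>m\<in>S. c m *\<^sub>R m) \<and> tcost \<tau> \<le> sum c S"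
proof -
  have "\<forall>m\<in>S. \<exists>\<tau>. admissible \<tau> \<and> superpose \<tau> = m \<and> tcost \<tau> \<le> 1" using S by (auto simp: unit_costs_def)
  then obtain \<tau> where t: "\<forall>m\<in>S. admissible (\<tau> m) \<and> superpose (\<tau> m) = m \<and> tcost (\<tau> m) \<le> 1"
    by (elim bchoice[elim_format] exE)
  show ?thesis
  proof (intro exI[of _ "\<Sum>m\<in>S. c m *\<^sub>R \<tau> m"] conjI)
    show "admissible (\<Sum>m\<in>S. c m *\<^sub>R \<tau> m)" using t c by (intro admissible_sum admissible_lin(3)) auto
    show "superpose (\<Sum>m\<in>S. c m *\<^sub>R \<tau> m) = (\<Sum>m\<in>S. c m *\<^sub>R m)"
      unfolding superpose_sum superpose_scaleR using t by (intro sum.cong) auto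
    have "tcost (\<Sum>m\<in>S. c m *\<^sub>R \<tau> m) = (\<Sum>m\<in>S. c m * tcost (\<tau> m))" by (simp only: tcost_lin)
    also have "\<dots> \<le> (\<Sum>m\<in>S. c m * 1)" using t c by (intro sum_mono mult_left_mono) auto
    finally show "tcost (\<Sum>m\<in>S. c m *\<^sub>R \<tau> m) \<le> sum c S" by simp
  qed
qed

end

context kr_problem
begin

text \<open>
  A positive weight may be varied in both directions, so that the first-order condition for a measure that
  survives the pruning is an equality.
\<close>

lemma resolve_optimality:
  assumes fin: "finite S" and on: "S \<subseteq> measures_on \<Omega>" and res: "resolve K F S S' \<mu>'"
  shows "\<exists>l. (\<forall>m\<in>S'. 0 < l m) \<and> S' \<subseteq> S \<and> \<mu>' = (\<Sum>m\<in>S'. l m *\<^sub>R m) \<and>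
    K \<mu>' = (\<Sum>m\<in>S'. l m *\<^sub>R K m) \<and> (\<forall>m\<in>S'. - gradF (K \<mu>') \<bullet> K m = 1) \<and>
    (\<forall>c. (\<forall>m\<in>S. 0 \<le> c m) \<longrightarrow> F (K \<mu>') + sum l S' \<le> F (\<Sum>m\<in>S. c m *\<^sub>R K m) + sum c S)"
proof -
  obtain l where sol: "solves_P K F S l" and mu: "\<mu>' = (\<Sum>m\<in>S. l m *\<^sub>R m)" and S': "S' = S - {m \<in> S. l m = 0}"
    using res unfolding resolve_def by (elim exE conjE)
  have l0: "\<forall>m\<in>S. 0 \<le> l m"
    and opt: "\<And>c. \<forall>m\<in>S. 0 \<le> c m \<Longrightarrow>
      F (\<Sum>m\<in>S. l m *\<^sub>R K m) + sum l S \<le> F (\<Sum>m\<in>S. c m *\<^sub>R K m) + sum c S"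
    using sol unfolding solves_P_def is_arg_min_def not_ex de_Morgan_conj not_less by blast+
  have sub: "S' \<subseteq> S" using S' by blast
  have z: "\<forall>m\<in>S - S'. l m = 0" using S' by blast
  have Kmu: "K \<mu>' = (\<Sum>m\<in>S. l m *\<^sub>R K m)" unfolding mu using on by (intro K_combination) auto
  have sums: "(\<Sum>m\<in>S. l m *\<^sub>R m) = (\<Sum>m\<in>S'. l m *\<^sub>R m)" "(\<Sum>m\<in>S. l m *\<^sub>R K m) = (\<Sum>m\<in>S'. l m *\<^sub>R K m)"
    "sum l S = sum l S'"
    using z by (intro sum.mono_neutral_right[OF fin sub]; simp)+
  have var: "F (K \<mu>') \<le> F (K \<mu>' + t *\<^sub>R K m) + t" if m: "m \<in> S" and t: "0 \<le> l m + t" for m t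
  proof -
    let ?c = "l(m := l m + t)"
    have "(\<Sum>m\<in>S. ?c m *\<^sub>R K m) = K \<mu>' + t *\<^sub>R K m"
      unfolding Kmu sum.remove[OF fin m] by (simp add: scaleR_add_left)
    moreover have "sum ?c S = sum l S + t"
      unfolding sum.remove[OF fin m] by simp
    moreover have "\<forall>m\<in>S. 0 \<le> ?c m" using l0 t by simp
    ultimately show ?thesis using opt[of ?c] unfolding Kmu by simp
  qed
  have stat: "- gradF (K \<mu>') \<bullet> K m = 1" if m: "m \<in> S'" for m
  proof -
    have mS: "m \<in> S" and lm: "0 < l m" using m l0 by (auto simp: S' less_le)
    have "0 \<le> gradF (K \<mu>') \<bullet> K m + 1"
    proof (rule first_order_ge[OF zero_less_one])
      fix t :: real assume "0 < t"
      then show "F (K \<mu>') \<le> F (K \<mu>' + t *\<^sub>R K m) + t * 1" using var[OF mS, of t] lm by simp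
    qed
    moreover have "0 \<le> gradF (K \<mu>') \<bullet> (- K m) + (-1)"
    proof (rule first_order_ge[OF lm])
      fix t :: real assume "0 < t" "t < l m"
      then show "F (K \<mu>') \<le> F (K \<mu>' + t *\<^sub>R (- K m)) + t * (-1)" using var[OF mS, of "- t"] by simp
    qed
    ultimately show ?thesis by simp
  qed
  show ?thesis
  proof (intro exI[of _ l] conjI ballI allI impI)
    show "0 < l m" if "m \<in> S'" for m using that l0 by (auto simp: S' less_le)
    show "S' \<subseteq> S" "\<mu>' = (\<Sum>m\<in>S'. l m *\<^sub>R m)" "K \<mu>' = (\<Sum>m\<in>S'. l m *\<^sub>R K m)"
      using sub mu Kmu sums by simp_all
    show "- gradF (K \<mu>') \<bullet> K m = 1" if "m \<in> S'" for m using stat[OF that] .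
    show "F (K \<mu>') + sum l S' \<le> F (\<Sum>m\<in>S. c m *\<^sub>R K m) + sum c S" if "\<forall>m\<in>S. 0 \<le> c m" for c
      using opt[OF that] sums Kmu by simp
  qed
qed

text \<open>
  The first-order conditions of the weights give complementarity, the stopping test gives feasibility.
\<close>

lemma stopping_optimal:
  assumes S: "S \<subseteq> unit_costs" and l: "\<And>m. m \<in> S \<Longrightarrow> 0 < l m" and mu: "\<mu>' = (\<Sum>m\<in>S. l m *\<^sub>R m)"
    and act: "\<And>m. m \<in> S \<Longrightarrow> - gradF (K \<mu>') \<bullet> K m = 1"
    and stop: "AGCG_stops \<Omega> p \<alpha> \<beta> (dual_variable Kstar gradF (K \<mu>'))"
  shows "minimizer \<mu>'"
proof -
  let ?q = "dualvar (K \<mu>')"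
  have q: "dual_feasible ?q"
    using stopping_feasible[OF continuous_dualvar[of "K \<mu>'"]] stop unfolding dualvar_def by blast
  have "\<exists>\<tau>. admissible \<tau> \<and> superpose \<tau> = (\<Sum>m\<in>S. l m *\<^sub>R m) \<and> tcost \<tau> \<le> sum l S"
    by (rule combination_represented[OF S less_imp_le[OF l]])
  then obtain \<tau> where t: "admissible \<tau>" "superpose \<tau> = \<mu>'" "tcost \<tau> \<le> sum l S"
    unfolding mu by (elim exE conjE)
  have on: "\<mu>' \<in> measures_on \<Omega>" using admissible_superpose[OF t(1)] t(2) by simp
  have Kmu: "K \<mu>' = (\<Sum>m\<in>S. l m *\<^sub>R K m)"
    unfolding mu using S unit_costs_on by (intro K_combination) blast
  have "pairing \<Omega> ?q \<mu>' = (\<Sum>m\<in>S. l m * (- gradF (K \<mu>') \<bullet> K m))"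
    unfolding pairing_dualvar[OF on] by (subst (2) Kmu) (simp add: inner_sum_right)
  also have "\<dots> = sum l S" by (rule sum.cong[OF refl]) (simp only: act mult_1_right)
  finally have opt: "tcost \<tau> \<le> pairing \<Omega> ?q (superpose \<tau>)" using t by simp
  have "kr \<mu>' \<le> pairing \<Omega> ?q \<mu>'" using kr_le_tcost_if_complementary[OF q t(1) opt] opt t(2) by simp
  then show ?thesis by (rule certificate(1)[OF on q])
qed

end

section \<open>Quadratic growth at nondegenerate maxima\<close>

text \<open>
  The second derivative is only required at the single point \<open>a\<close>. This suffices for the expansion below, and
  it is inherited by sums, products and compositions, hence by \<open>Psi\<close>.
\<close>

definition twice_diff :: "('a::real_inner \<Rightarrow> real) \<Rightarrow> 'a \<Rightarrow> ('a \<Rightarrow> 'a) \<Rightarrow> ('a \<Rightarrow> 'a) \<Rightarrow> bool" where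
  "twice_diff f a g D \<longleftrightarrow> (\<forall>\<^sub>F x in nhds a. GDERIV f x :> g x) \<and> (g has_derivative D) (at a)"

text \<open>
  Mean value theorem along the segment from \<open>a + h\<close> to \<open>a + h + k\<close>. The additional increment \<open>h\<close> is needed
  for the second differences in the proof of symmetry.
\<close>

lemma second_order_taylor:
  assumes td: "twice_diff f a g D" and e: "0 < e"
  shows "\<exists>d>0. \<forall>h k. norm h < d \<longrightarrow> norm k < d \<longrightarrow>
    \<bar>f (a + h + k) - f (a + h) - g a \<bullet> k - D h \<bullet> k - D k \<bullet> k / 2\<bar> \<le> e * (norm h + norm k) * norm k"
proof -
  have lin: "bounded_linear D" using td by (auto simp: twice_diff_def dest: has_derivative_bounded_linear)
  interpret D: bounded_linear D by fact
  obtain d1 where d1: "0 < d1" "\<And>x. dist x a < d1 \<Longrightarrow> GDERIV f x :> g x"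
    using td by (auto simp: twice_diff_def eventually_nhds_metric)
  obtain d2 where d2: "0 < d2" "\<And>x. norm (x - a) < d2 \<Longrightarrow> norm (g x - g a - D (x - a)) \<le> e * norm (x - a)"
    using td e unfolding twice_diff_def has_derivative_at_alt by blast
  define d where "d = min d1 d2 / 2"
  have d: "0 < d" using d1 d2 by (simp add: d_def)
  have "\<bar>f (a + h + k) - f (a + h) - g a \<bullet> k - D h \<bullet> k - D k \<bullet> k / 2\<bar> \<le> e * (norm h + norm k) * norm k"
    if h: "norm h < d" and k: "norm k < d" for h k
  proof -
    define \<phi> where "\<phi> t = f (a + h + t *\<^sub>R k) - t * (g a \<bullet> k) - t * (D h \<bullet> k) - t\<^sup>2 * (D k \<bullet> k / 2)" for t
    define \<phi>' where "\<phi>' t = (g (a + h + t *\<^sub>R k) - g a - D (h + t *\<^sub>R k)) \<bullet> k" for t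
    have nrm: "norm (h + t *\<^sub>R k) \<le> norm h + norm k" if "0 \<le> t" "t \<le> 1" for t
      using norm_triangle_ineq[of h "t *\<^sub>R k"] that mult_left_le_one_le[of "norm k" t] by simp
    have small: "norm (h + t *\<^sub>R k) < min d1 d2" if "0 \<le> t" "t \<le> 1" for t
      using nrm[OF that] h k by (simp add: d_def)
    have deriv: "(\<phi> has_real_derivative \<phi>' t) (at t)" if t: "0 \<le> t" "t \<le> 1" for t
    proof -
      have "GDERIV f (a + h + t *\<^sub>R k) :> g (a + h + t *\<^sub>R k)"
        using small[OF t] by (intro d1(2)) (simp add: dist_norm add.assoc)
      then have f1: "(f has_derivative (\<lambda>x. x \<bullet> g (a + h + t *\<^sub>R k))) (at (a + h + t *\<^sub>R k))"
        by (simp add: gderiv_def)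
      have "((\<lambda>t. a + h + t *\<^sub>R k) has_derivative (\<lambda>s. s *\<^sub>R k)) (at t)"
        by (auto intro!: derivative_eq_intros)
      from has_derivative_compose[OF this f1]
      have "((\<lambda>t. f (a + h + t *\<^sub>R k)) has_real_derivative (g (a + h + t *\<^sub>R k) \<bullet> k)) (at t)"
        unfolding has_field_derivative_def
        by (rule has_derivative_eq_rhs) (simp add: fun_eq_iff inner_commute)
      then show ?thesis
        unfolding \<phi>_def[abs_def] \<phi>'_def
        by (auto intro!: derivative_eq_intros simp: inner_diff_left inner_add_left D.add D.scaleR)
    qed
    obtain z where z: "0 < z" "z < 1" "\<phi> 1 - \<phi> 0 = (1 - 0) * \<phi>' z"
      using MVT2[of 0 1 \<phi> \<phi>'] deriv by auto
    have "\<bar>\<phi>' z\<bar> \<le> norm (g (a + h + z *\<^sub>R k) - g a - D (h + z *\<^sub>R k)) * norm k"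
      unfolding \<phi>'_def by (rule Cauchy_Schwarz_ineq2)
    also have "\<dots> \<le> (e * norm (h + z *\<^sub>R k)) * norm k"
      using d2(2)[of "a + h + z *\<^sub>R k"] small[of z] z
      by (intro mult_right_mono) (auto simp: algebra_simps)
    also have "\<dots> \<le> e * (norm h + norm k) * norm k"
      using nrm[of z] z e by (intro mult_right_mono mult_left_mono) auto
    finally show ?thesis using z(3) by (simp add: \<phi>_def)
  qed
  then show ?thesis using d by blast
qed

text \<open>
  The second difference of \<open>f\<close> over the parallelogram spanned by \<open>s u\<close> and \<open>s w\<close> is symmetric in \<open>u\<close> and \<open>w\<close>,
  and it is \<open>s\<^sup>2 (D u \<bullet> w)\<close> up to \<open>o(s\<^sup>2)\<close>.
\<close>

lemma second_derivative_symmetric: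
  assumes td: "twice_diff f a g D"
  shows "D u \<bullet> w = D w \<bullet> u"
proof -
  have lin: "bounded_linear D" using td by (auto simp: twice_diff_def dest: has_derivative_bounded_linear)
  interpret D: bounded_linear D by fact
  define N where "N = norm u + norm w + 1"
  have N: "0 < N" "norm u \<le> N" "norm w \<le> N" by (auto simp: N_def add_nonneg_pos)
  have "\<bar>D u \<bullet> w - D w \<bullet> u\<bar> \<le> e * (8 * N\<^sup>2)" if e: "0 < e" for e
  proof -
    obtain d where d: "0 < d" "\<And>h k. norm h < d \<Longrightarrow> norm k < d \<Longrightarrow>
      \<bar>f (a + h + k) - f (a + h) - g a \<bullet> k - D h \<bullet> k - D k \<bullet> k / 2\<bar> \<le> e * (norm h + norm k) * norm k"
      using second_order_taylor[OF td e] by blast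
    define s where "s = d / (2 * N)"
    have s: "0 < s" using d N by (simp add: s_def)
    have sN: "s * N < d" using d N by (simp add: s_def)
    have su: "norm (s *\<^sub>R u) < d" and sw: "norm (s *\<^sub>R w) < d"
      using s sN order.strict_trans1[OF mult_left_mono[OF N(2), of s]]
        order.strict_trans1[OF mult_left_mono[OF N(3), of s]] by simp_all
    have b: "e * (norm x + norm k) * norm k \<le> e * (2 * (s * N)) * (s * N)"
      if "norm x \<le> s * N" "norm k \<le> s * N" for x k :: 'a
      using that e s N by (intro mult_mono) auto
    have nu: "norm (s *\<^sub>R u) \<le> s * N" and nw: "norm (s *\<^sub>R w) \<le> s * N"
      using s N by (auto intro!: mult_left_mono)
    have n0: "norm (0::'a) \<le> s * N" using s N by simp
    note t1 = d(2)[OF su sw] and t2 = d(2)[OF _ sw, of 0] and t3 = d(2)[OF sw su] and t4 = d(2)[OF _ su, of 0]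
    have c: "a + s *\<^sub>R w + s *\<^sub>R u = a + s *\<^sub>R u + s *\<^sub>R w" by simp
    have dist: "\<bar>s\<^sup>2 * (D u \<bullet> w - D w \<bullet> u)\<bar> \<le> 4 * (e * (2 * (s * N)) * (s * N))"
    proof -
      have "s\<^sup>2 * (D u \<bullet> w - D w \<bullet> u) = D (s *\<^sub>R u) \<bullet> (s *\<^sub>R w) - D (s *\<^sub>R w) \<bullet> (s *\<^sub>R u)"
        by (simp add: D.scaleR power2_eq_square algebra_simps)
      then show ?thesis
        using t1 t2 t3 t4 b[OF nu nw] b[OF n0 nw] b[OF nw nu] b[OF n0 nu] d(1) unfolding c
        by (auto simp: D.zero abs_le_iff)
    qed
    moreover have "\<bar>s\<^sup>2 * (D u \<bullet> w - D w \<bullet> u)\<bar> = s\<^sup>2 * \<bar>D u \<bullet> w - D w \<bullet> u\<bar>"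
      by (simp add: abs_mult)
    moreover have "4 * (e * (2 * (s * N)) * (s * N)) = s\<^sup>2 * (8 * e * N\<^sup>2)"
      by (simp add: power2_eq_square)
    ultimately have "s\<^sup>2 * \<bar>D u \<bullet> w - D w \<bullet> u\<bar> \<le> s\<^sup>2 * (8 * e * N\<^sup>2)"
      by simp
    then have "\<bar>D u \<bullet> w - D w \<bullet> u\<bar> \<le> 8 * e * N\<^sup>2" using s by simp
    then show ?thesis by (simp add: mult_ac)
  qed
  then have *: "\<bar>D u \<bullet> w - D w \<bullet> u\<bar> \<le> 8 * N\<^sup>2 * e" if "0 < e" for e using that by (simp add: mult_ac)
  show ?thesis
  proof (rule ccontr)
    assume "D u \<bullet> w \<noteq> D w \<bullet> u"
    then have p: "0 < \<bar>D u \<bullet> w - D w \<bullet> u\<bar>" by simp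
    have "\<bar>D u \<bullet> w - D w \<bullet> u\<bar> \<le> 8 * N\<^sup>2 * (\<bar>D u \<bullet> w - D w \<bullet> u\<bar> / (16 * N\<^sup>2))"
      using p N by (intro *) auto
    then show False using p N by simp
  qed
qed

text \<open>
  At a maximum the gradient vanishes and \<open>D\<close> is negative semidefinite. A symmetric semidefinite form vanishes
  only on its kernel, so that \<open>D\<close> is definite, uniformly on the unit sphere by compactness.
\<close>

lemma nondegenerate_max_growth:
  fixes f :: "'a::euclidean_space \<Rightarrow> real"
  assumes td: "twice_diff f a g D" and inj: "\<And>h. D h = 0 \<Longrightarrow> h = 0"
    and max: "\<forall>\<^sub>F x in nhds a. f x \<le> f a"
  shows "\<exists>c>0. \<forall>\<^sub>F x in nhds a. f x \<le> f a - c * (norm (x - a))\<^sup>2"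
proof -
  have lin: "bounded_linear D" using td by (auto simp: twice_diff_def dest: has_derivative_bounded_linear)
  interpret D: bounded_linear D by fact
  have sym: "D u \<bullet> w = D w \<bullet> u" for u w by (rule second_derivative_symmetric[OF td])
  obtain dm where dm: "0 < dm" "\<And>x. dist x a < dm \<Longrightarrow> f x \<le> f a"
    using max by (auto simp: eventually_nhds_metric)
  have taylor: "\<exists>d>0. \<forall>k. norm k < d \<longrightarrow> \<bar>f (a + k) - f a - g a \<bullet> k - D k \<bullet> k / 2\<bar> \<le> e * (norm k)\<^sup>2"
    if "0 < e" for e
  proof -
    obtain d where d: "0 < d" "\<And>h k. norm h < d \<Longrightarrow> norm k < d \<Longrightarrow>
      \<bar>f (a + h + k) - f (a + h) - g a \<bullet> k - D h \<bullet> k - D k \<bullet> k / 2\<bar> \<le> e * (norm h + norm k) * norm k"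
      using second_order_taylor[OF td \<open>0 < e\<close>] by blast
    show ?thesis using d(1) d(2)[of 0] by (intro exI[of _ d]) (auto simp: D.zero power2_eq_square mult_ac)
  qed
  have ga: "g a = 0"
  proof -
    have "GDERIV f a :> g a" using td by (auto simp: twice_diff_def dest: eventually_nhds_x_imp_x)
    then have fd: "(f has_derivative (\<lambda>h. h \<bullet> g a)) (at a)" by (simp add: gderiv_def)
    have "(\<lambda>h. h \<bullet> g a) = (\<lambda>v. 0)"
      by (rule differential_zero_maxmin[of a "ball a dm", OF _ _ fd]) (use dm in \<open>auto simp: dist_commute\<close>)
    then show ?thesis by (metis inner_eq_zero_iff)
  qed
  have nsd: "D k \<bullet> k \<le> 0" for k
  proof (rule ccontr)
    assume "\<not> D k \<bullet> k \<le> 0"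
    then have p: "0 < D k \<bullet> k" by simp
    then have k0: "0 < norm k" by (auto simp: D.zero)
    define e where "e = D k \<bullet> k / (4 * (norm k)\<^sup>2)"
    have e: "0 < e" using p k0 by (simp add: e_def)
    obtain d where d: "0 < d" "\<And>k. norm k < d \<Longrightarrow> \<bar>f (a + k) - f a - g a \<bullet> k - D k \<bullet> k / 2\<bar> \<le> e * (norm k)\<^sup>2"
      using taylor[OF e] by blast
    define s where "s = min d dm / (2 * norm k)"
    have s: "0 < s" "norm (s *\<^sub>R k) < d" "norm (s *\<^sub>R k) < dm"
      using d(1) dm(1) k0 by (auto simp: s_def)
    have "f (a + s *\<^sub>R k) \<le> f a" using s(3) by (intro dm(2)) (simp add: dist_norm)
    with d(2)[OF s(2)] have "D (s *\<^sub>R k) \<bullet> (s *\<^sub>R k) / 2 \<le> e * (norm (s *\<^sub>R k))\<^sup>2"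
      by (simp add: ga abs_le_iff)
    then have "s\<^sup>2 * (D k \<bullet> k / 2) \<le> s\<^sup>2 * (e * (norm k)\<^sup>2)"
      by (simp add: D.scaleR power2_eq_square mult_ac)
    then have "D k \<bullet> k / 2 \<le> e * (norm k)\<^sup>2" using s(1) by simp
    then show False using p k0 by (simp add: e_def)
  qed
  have nd: "D k \<bullet> k < 0" if "k \<noteq> 0" for k
  proof (rule ccontr)
    assume "\<not> D k \<bullet> k < 0"
    then have z: "D k \<bullet> k = 0" using nsd[of k] by simp
    have q: "2 * (t * (D k \<bullet> w)) + t * t * (D w \<bullet> w) \<le> 0" for t w
      using nsd[of "k + t *\<^sub>R w"] z sym[of w k]
      by (simp add: D.add D.scaleR inner_add_left inner_add_right algebra_simps)
    define w where "w = D k"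
    have ww: "0 < D k \<bullet> w" using that inj[of k] by (auto simp: w_def)
    define b where "b = \<bar>D w \<bullet> w\<bar> + 1"
    have b: "0 < b" "- b \<le> D w \<bullet> w" by (auto simp: b_def)
    have "2 * ((D k \<bullet> w / b) * (D k \<bullet> w)) - (D k \<bullet> w / b) * (D k \<bullet> w / b) * b \<le> 0"
      using q[of "D k \<bullet> w / b" w] mult_left_mono[OF b(2), of "(D k \<bullet> w / b) * (D k \<bullet> w / b)"] by simp
    then have "(D k \<bullet> w) * (D k \<bullet> w) / b \<le> 0" using b(1) by (simp add: field_simps)
    then show False using ww b(1) by (simp add: divide_le_0_iff mult_le_0_iff)
  qed
  obtain c where c: "0 < c" "\<And>k. D k \<bullet> k \<le> - c * (norm k)\<^sup>2"
  proof (cases "sphere (0::'a) 1 = {}")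
    case True
    then have "k = 0" for k :: 'a
    proof (rule_tac ccontr)
      assume "k \<noteq> 0"
      then have "(1 / norm k) *\<^sub>R k \<in> sphere 0 1" by simp
      then show False using True by blast
    qed
    then show ?thesis by (intro that[of 1]) (auto simp: D.zero)
  next
    case False
    have "continuous_on (sphere 0 1) (\<lambda>k. D k \<bullet> k)"
      by (intro continuous_intros D.continuous_on)
    then obtain m where m: "m \<in> sphere 0 1" "\<And>k. k \<in> sphere 0 1 \<Longrightarrow> D k \<bullet> k \<le> D m \<bullet> m"
      using continuous_attains_sup[OF compact_sphere False] by blast
    have "m \<noteq> 0" using m(1) by auto
    then have "D m \<bullet> m < 0" by (rule nd)
    moreover have "D k \<bullet> k \<le> (D m \<bullet> m) * (norm k)\<^sup>2" for k
    proof (cases "k = 0")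
      case False
      then have "(1 / norm k) *\<^sub>R k \<in> sphere 0 1" by simp
      from m(2)[OF this] have "D k \<bullet> k / (norm k * norm k) \<le> D m \<bullet> m" by (simp add: D.scaleR)
      then show ?thesis using False by (simp add: field_simps power2_eq_square)
    qed (simp add: D.zero)
    ultimately show ?thesis by (intro that[of "- (D m \<bullet> m)"]) auto
  qed
  obtain d where d: "0 < d" "\<And>k. norm k < d \<Longrightarrow> \<bar>f (a + k) - f a - g a \<bullet> k - D k \<bullet> k / 2\<bar> \<le> (c / 4) * (norm k)\<^sup>2"
    using taylor[of "c / 4"] c by auto
  have "f x \<le> f a - c / 4 * (norm (x - a))\<^sup>2" if "dist x a < d" for x
    using d(2)[of "x - a"] c(2)[of "x - a"] that by (simp add: dist_norm ga abs_if split: if_splits)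
  then show ?thesis using c d(1) by (intro exI[of _ "c / 4"]) (auto simp: eventually_nhds_metric)
qed

text \<open>
  The outer derivative in \<open>hessian\<close> belongs to the row index, whence the transposition.
\<close>

lemma hessian_twice_diff:
  fixes f :: "real^'n::finite \<Rightarrow> real"
  assumes td: "twice_diff f a g D"
  shows "hessian f a = transpose (matrix D)"
proof -
  have gd: "\<forall>\<^sub>F x in nhds a. GDERIV f x :> g x" and D: "(g has_derivative D) (at a)"
    using td by (auto simp: twice_diff_def)
  have pd: "partial_deriv j f x = g x $ j" if "GDERIV f x :> g x" for j x
  proof -
    have f1: "(f has_derivative (\<lambda>h. h \<bullet> g x)) (at (x + 0 *\<^sub>R axis j 1))"
      using that by (simp add: gderiv_def)
    have "((\<lambda>t. x + t *\<^sub>R axis j 1) has_derivative (\<lambda>s. s *\<^sub>R axis j 1)) (at 0)"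
      by (auto intro!: derivative_eq_intros)
    from has_derivative_compose[OF this f1]
    have "((\<lambda>t. f (x + t *\<^sub>R axis j 1)) has_real_derivative g x $ j) (at 0)"
      unfolding has_field_derivative_def
      by (rule has_derivative_eq_rhs) (simp add: fun_eq_iff inner_axis' mult.commute)
    then show ?thesis by (simp add: partial_deriv_def DERIV_imp_deriv)
  qed
  have "hessian f a $ i $ j = D (axis i 1) $ j" for i j
  proof -
    have lim: "((\<lambda>t. a + t *\<^sub>R axis i 1) \<longlongrightarrow> a) (nhds 0)"
    proof -
      have "isCont (\<lambda>t::real. a + t *\<^sub>R axis i 1) 0" by (intro continuous_intros)
      then show ?thesis by (simp add: isCont_def tendsto_at_iff_tendsto_nhds[of "\<lambda>t. a + t *\<^sub>R axis i 1" 0, simplified])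
    qed
    have ev: "\<forall>\<^sub>F t in nhds 0. partial_deriv j f (a + t *\<^sub>R axis i 1) = g (a + t *\<^sub>R axis i 1) $ j"
      using eventually_compose_filterlim[OF gd lim] by eventually_elim (rule pd)
    have D': "(g has_derivative D) (at (a + 0 *\<^sub>R axis i 1))" using D by simp
    have "((\<lambda>t. a + t *\<^sub>R axis i 1) has_derivative (\<lambda>s. s *\<^sub>R axis i 1)) (at 0)"
      by (auto intro!: derivative_eq_intros)
    from has_derivative_compose[OF this D']
    have "((\<lambda>t. g (a + t *\<^sub>R axis i 1)) has_derivative (\<lambda>s. D (s *\<^sub>R axis i 1))) (at 0)" .
    from bounded_linear.has_derivative[OF bounded_linear_vec_nth this]
    have "((\<lambda>t. g (a + t *\<^sub>R axis i 1) $ j) has_derivative (\<lambda>s. D (s *\<^sub>R axis i 1) $ j)) (at 0)" .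
    then have "((\<lambda>t. g (a + t *\<^sub>R axis i 1) $ j) has_real_derivative (D (axis i 1) $ j)) (at 0)"
      unfolding has_field_derivative_def
      by (rule has_derivative_eq_rhs)
        (simp add: fun_eq_iff linear_scale[OF has_derivative_linear[OF D]] mult.commute)
    then have "deriv (\<lambda>t. g (a + t *\<^sub>R axis i 1) $ j) 0 = D (axis i 1) $ j" by (rule DERIV_imp_deriv)
    then show ?thesis by (simp add: hessian_def partial_deriv_def[of i] deriv_cong_ev[OF ev refl])
  qed
  then show ?thesis by (simp add: vec_eq_iff transpose_def matrix_def)
qed

lemma twice_diff_inj:
  fixes f :: "real^'n::finite \<Rightarrow> real"
  assumes td: "twice_diff f a g D" and det: "det (hessian f a) \<noteq> 0" and h: "D h = 0"
  shows "h = 0"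
proof -
  have lin: "linear D" using td by (auto simp: twice_diff_def dest: has_derivative_linear)
  have "det (matrix D) \<noteq> 0" using det by (simp add: hessian_twice_diff[OF td])
  then have "invertible (matrix D)" by (simp add: invertible_det_nz)
  then have inj: "inj ((*v) (matrix D))" by (simp add: invertible_left_inverse inj_matrix_vector_mult)
  have "matrix D *v h = matrix D *v 0" using h fun_cong[OF matrix_vector_mul(2)[OF lin], of h] by simp
  from injD[OF inj this] show ?thesis .
qed

definition ex_td :: "('a::real_inner \<Rightarrow> real) \<Rightarrow> 'a \<Rightarrow> bool" where
  "ex_td f a \<longleftrightarrow> (\<exists>g D. twice_diff f a g D)"

lemma ex_tdI: "\<forall>\<^sub>F x in nhds a. GDERIV f x :> g x \<Longrightarrow> (g has_derivative D) (at a) \<Longrightarrow> ex_td f a"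
  by (auto simp: ex_td_def twice_diff_def)

lemma ex_tdE:
  assumes "ex_td f a"
  obtains g D where "\<forall>\<^sub>F x in nhds a. GDERIV f x :> g x" "(g has_derivative D) (at a)"
    "GDERIV f a :> g a"
  using assms by (auto simp: ex_td_def twice_diff_def dest: eventually_nhds_x_imp_x)

lemma ex_td_diff: "ex_td f1 a \<Longrightarrow> ex_td f2 a \<Longrightarrow> ex_td (\<lambda>x. f1 x - f2 x) a"
proof -
  assume "ex_td f1 a" "ex_td f2 a"
  obtain g1 D1 where 
    1: "\<forall>\<^sub>F x in nhds a. GDERIV f1 x :> g1 x" "(g1 has_derivative D1) (at a)" "GDERIV f1 a :> g1 a"
    using \<open>ex_td f1 a\<close> by (rule ex_tdE)
  obtain g2 D2 where 
    2: "\<forall>\<^sub>F x in nhds a. GDERIV f2 x :> g2 x" "(g2 has_derivative D2) (at a)" "GDERIV f2 a :> g2 a"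
    using \<open>ex_td f2 a\<close> by (rule ex_tdE)
  show ?thesis
  proof (rule ex_tdI)
    show "\<forall>\<^sub>F x in nhds a. GDERIV (\<lambda>x. f1 x - f2 x) x :> g1 x - g2 x"
      using 1(1) 2(1) by eventually_elim (rule GDERIV_diff)
    show "((\<lambda>x. g1 x - g2 x) has_derivative (\<lambda>h. D1 h - D2 h)) (at a)"
      using 1(2) 2(2) by (rule has_derivative_diff)
  qed
qed

lemma ex_td_mult:
  assumes "ex_td f1 a" "ex_td f2 a" shows "ex_td (\<lambda>x. f1 x * f2 x) a"
proof -
  obtain g1 D1 where 
    1: "\<forall>\<^sub>F x in nhds a. GDERIV f1 x :> g1 x" "(g1 has_derivative D1) (at a)" "GDERIV f1 a :> g1 a"
    using assms(1) by (rule ex_tdE)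
  obtain g2 D2 where 
    2: "\<forall>\<^sub>F x in nhds a. GDERIV f2 x :> g2 x" "(g2 has_derivative D2) (at a)" "GDERIV f2 a :> g2 a"
    using assms(2) by (rule ex_tdE)
  show ?thesis
  proof (rule ex_tdI)
    show "\<forall>\<^sub>F x in nhds a. GDERIV (\<lambda>x. f1 x * f2 x) x :> f1 x *\<^sub>R g2 x + f2 x *\<^sub>R g1 x"
      using 1(1) 2(1) by eventually_elim (rule GDERIV_mult)
    show "((\<lambda>x. f1 x *\<^sub>R g2 x + f2 x *\<^sub>R g1 x) has_derivative
        (\<lambda>h. (f1 a *\<^sub>R D2 h + (h \<bullet> g1 a) *\<^sub>R g2 a) + (f2 a *\<^sub>R D1 h + (h \<bullet> g2 a) *\<^sub>R g1 a))) (at a)"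
      using 1 2 unfolding gderiv_def by (intro has_derivative_add has_derivative_scaleR)
  qed
qed

lemma ex_td_compose:
  assumes f: "ex_td f a" and \<phi>: "\<forall>\<^sub>F t in nhds (f a). (\<phi> has_real_derivative \<phi>' t) (at t)"
    and \<phi>': "(\<phi>' has_real_derivative c) (at (f a))"
  shows "ex_td (\<lambda>x. \<phi> (f x)) a"
proof -
  obtain g D where
    1: "\<forall>\<^sub>F x in nhds a. GDERIV f x :> g x" "(g has_derivative D) (at a)" "GDERIV f a :> g a"
    using f by (rule ex_tdE)
  have fd: "(f has_derivative (\<lambda>h. h \<bullet> g a)) (at a)" using 1(3) by (simp add: gderiv_def)
  then have "isCont f a" using has_derivative_continuous by blast
  then have "(f \<longlongrightarrow> f a) (nhds a)" by (simp add: isCont_def tendsto_at_iff_tendsto_nhds)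
  from eventually_compose_filterlim[OF \<phi> this]
  have ev: "\<forall>\<^sub>F x in nhds a. (\<phi> has_real_derivative \<phi>' (f x)) (at (f x))" .
  show ?thesis
  proof (rule ex_tdI)
    show "\<forall>\<^sub>F x in nhds a. GDERIV (\<lambda>x. \<phi> (f x)) x :> \<phi>' (f x) *\<^sub>R g x"
      using 1(1) ev by eventually_elim (rule GDERIV_DERIV_compose)
    have "((\<lambda>x. \<phi>' (f x)) has_derivative (\<lambda>h. (h \<bullet> g a) * c)) (at a)"
      using has_derivative_compose[OF fd, of \<phi>' "(*) c"] \<phi>' by (simp add: has_field_derivative_def mult.commute)
    then show "((\<lambda>x. \<phi>' (f x) *\<^sub>R g x) has_derivative (\<lambda>h. \<phi>' (f a) *\<^sub>R D h + ((h \<bullet> g a) * c) *\<^sub>R g a)) (at a)"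
      using 1(2) by (rule has_derivative_scaleR)
  qed
qed

text \<open>
  \<open>L'\<close> is the adjoint of \<open>L\<close>; it maps the gradient of \<open>f\<close> to that of \<open>f \<circ> L\<close>.
\<close>

lemma ex_td_linear:
  assumes f: "ex_td f (L a)" and L: "bounded_linear L" and L': "bounded_linear L'"
    and adj: "\<And>h k. L h \<bullet> k = h \<bullet> L' k"
  shows "ex_td (\<lambda>x. f (L x)) a"
proof -
  obtain g D where
    1: "\<forall>\<^sub>F x in nhds (L a). GDERIV f x :> g x" "(g has_derivative D) (at (L a))" "GDERIV f (L a) :> g (L a)"
    using f by (rule ex_tdE)
  have Ld: "(L has_derivative L) (at x)" for x by (rule bounded_linear_imp_has_derivative[OF L])
  then have "isCont L a" using has_derivative_continuous by blast
  then have "(L \<longlongrightarrow> L a) (nhds a)" by (simp add: isCont_def tendsto_at_iff_tendsto_nhds)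
  from eventually_compose_filterlim[OF 1(1) this]
  have ev: "\<forall>\<^sub>F x in nhds a. GDERIV f (L x) :> g (L x)" .
  show ?thesis
  proof (rule ex_tdI)
    show "\<forall>\<^sub>F x in nhds a. GDERIV (\<lambda>x. f (L x)) x :> L' (g (L x))"
      using ev
    proof eventually_elim
      case (elim x)
      then show ?case using has_derivative_compose[OF Ld, of f "\<lambda>h. h \<bullet> g (L x)" x]
        by (simp add: gderiv_def adj)
    qed
    show "((\<lambda>x. L' (g (L x))) has_derivative (\<lambda>h. L' (D (L h)))) (at a)"
      by (rule bounded_linear.has_derivative[OF L' has_derivative_compose[OF Ld 1(2)]])
  qed
qed

lemma C2_on_ex_td:
  assumes "C2_on \<Omega> q" "a \<in> interior \<Omega>" shows "ex_td q a"
proof -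
  obtain g H where gH: "\<forall>x\<in>interior \<Omega>. GDERIV q x :> g x \<and> (g has_derivative (\<lambda>h. H x *v h)) (at x)"
    using assms(1) unfolding C2_on_def by blast
  have "\<forall>\<^sub>F x in nhds a. x \<in> interior \<Omega>" using assms(2) by (intro eventually_nhds_in_open) auto
  then have "\<forall>\<^sub>F x in nhds a. GDERIV q x :> g x" by eventually_elim (use gH in auto)
  then show ?thesis using gH assms(2) by (intro ex_tdI) auto
qed

lemma hessian_max_growth:
  fixes f :: "real^'n::finite \<Rightarrow> real"
  assumes td: "ex_td f a" and det: "det (hessian f a) \<noteq> 0" and s: "s = 1 \<or> s = -1"
    and max: "\<forall>\<^sub>F x in nhds a. s * f x \<le> s * f a"
  shows "\<exists>c>0. \<forall>\<^sub>F x in nhds a. s * f x \<le> s * f a - c * (norm (x - a))\<^sup>2"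
proof -
  obtain g D where td': "twice_diff f a g D" using td by (auto simp: ex_td_def)
  have "twice_diff (\<lambda>x. s * f x) a (\<lambda>x. s *\<^sub>R g x) (\<lambda>h. s *\<^sub>R D h)"
    using td' unfolding twice_diff_def
    by (auto elim!: eventually_mono intro!: derivative_intros simp: gderiv_def)
  then show ?thesis
    by (rule nondegenerate_max_growth) (use s max twice_diff_inj[OF td' det] in auto)
qed

lemma norm_vec_join: "norm (vec_join w) = norm w"
proof -
  have "(norm (vec_join w))\<^sup>2 = (\<Sum>k\<in>UNIV. (vec_join w $ k)\<^sup>2)"
    by (simp add: norm_vec_def L2_set_def sum_nonneg)
  also have "\<dots> = (\<Sum>i\<in>UNIV. (fst w $ i)\<^sup>2) + (\<Sum>i\<in>UNIV. (snd w $ i)\<^sup>2)"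
    by (simp add: UNIV_Plus_UNIV[symmetric] sum.Plus vec_join_def del: UNIV_Plus_UNIV)
  also have "\<dots> = (norm w)\<^sup>2"
    by (cases w) (simp add: norm_Pair norm_vec_def L2_set_def sum_nonneg)
  finally show ?thesis by simp
qed

lemma vec_split_join: "vec_split (vec_join w) = w"
  by (simp add: vec_split_def vec_join_def)

lemma linear_vec_join: "linear vec_join"
  by (rule linearI) (auto simp: vec_join_def vec_eq_iff split: sum.splits)

text \<open>
  Since \<open>x \<noteq> y\<close>, the distance to the power \<open>p\<close> is smooth near \<open>(x, y)\<close>. The identification of pairs of points
  with vectors of twice the dimension is isometric and carries the growth back.
\<close>

lemma Psi_growth:
  fixes q :: "real^'n::finite \<Rightarrow> real"
  assumes q: "ex_td q x" "ex_td q y" and xy: "x \<noteq> y" and \<beta>: "0 < \<beta>"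
    and det: "det (hessian2 (Psi p \<beta> q) (x, y)) \<noteq> 0"
    and max: "\<forall>\<^sub>F w in nhds (x, y). Psi p \<beta> q w \<le> Psi p \<beta> q (x, y)"
  shows "\<exists>c>0. \<forall>\<^sub>F w in nhds (x, y). Psi p \<beta> q w \<le> Psi p \<beta> q (x, y) - c * (norm (w - (x, y)))\<^sup>2"
proof -
  let ?a = "vec_join (x, y)"
  define L1 L2 :: "real^('n+'n) \<Rightarrow> real^'n" where "L1 v = fst (vec_split v)" and "L2 v = snd (vec_split v)" for v
  have L: "linear L1" "linear L2" "linear (\<lambda>v. L1 v - L2 v)"
    by (auto simp: linear_iff L1_def L2_def vec_split_def vec_eq_iff algebra_simps)
  have La: "L1 ?a = x" "L2 ?a = y" by (auto simp: L1_def L2_def vec_split_join)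
  have split: "v \<bullet> vec_join (h, k) = L1 v \<bullet> h + L2 v \<bullet> k" for v h k
    by (simp add: inner_vec_def UNIV_Plus_UNIV[symmetric] sum.Plus vec_join_def L1_def L2_def vec_split_def
      del: UNIV_Plus_UNIV)
  have J: "linear (\<lambda>k. vec_join (k, 0::real^'n))" "linear (\<lambda>k. vec_join (0::real^'n, k))"
    "linear (\<lambda>k. vec_join (k, - k :: real^'n))"
    by (auto intro!: linearI simp: vec_join_def vec_eq_iff split: sum.splits)
  have t1: "ex_td (\<lambda>v. q (L1 v)) ?a"
    by (rule ex_td_linear[where L = L1 and L' = "\<lambda>k. vec_join (k, 0)"])
      (use q La L J in \<open>auto simp: linear_conv_bounded_linear split\<close>)
  have t2: "ex_td (\<lambda>v. q (L2 v)) ?a"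
    by (rule ex_td_linear[where L = L2 and L' = "\<lambda>k. vec_join (0, k)"])
      (use q La L J in \<open>auto simp: linear_conv_bounded_linear split\<close>)
  have sq: "ex_td (\<lambda>z::real^'n. z \<bullet> z) z" for z
  proof (rule ex_tdI)
    show "\<forall>\<^sub>F z in nhds z. GDERIV (\<lambda>z::real^'n. z \<bullet> z) z :> 2 *\<^sub>R z"
      unfolding gderiv_def
      by (auto intro!: always_eventually derivative_eq_intros simp: inner_commute)
  qed (auto intro!: derivative_eq_intros)
  have t3: "ex_td (\<lambda>v. (L1 v - L2 v) \<bullet> (L1 v - L2 v)) ?a"
    by (rule ex_td_linear[where L = "\<lambda>v. L1 v - L2 v" and L' = "\<lambda>k. vec_join (k, -k)" and f = "\<lambda>z. z \<bullet> z"])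
      (use sq L J in \<open>auto simp: linear_conv_bounded_linear split inner_diff_left\<close>)
  define n where "n = (L1 ?a - L2 ?a) \<bullet> (L1 ?a - L2 ?a)"
  have n: "0 < n" using xy by (simp add: n_def La)
  have t4: "ex_td (\<lambda>v. ((L1 v - L2 v) \<bullet> (L1 v - L2 v)) powr (p/2)) ?a"
  proof (rule ex_td_compose[where \<phi> = "\<lambda>s. s powr (p/2)" and \<phi>' = "\<lambda>s. p/2 * s powr (p/2 - 1)", OF t3])
    have "\<forall>\<^sub>F s in nhds n. 0 < s" using n by (intro eventually_nhds_in_open[of "{0<..}", simplified]) auto
    then show "\<forall>\<^sub>F s in nhds ((L1 ?a - L2 ?a) \<bullet> (L1 ?a - L2 ?a)).
        ((\<lambda>s. s powr (p/2)) has_real_derivative p/2 * s powr (p/2 - 1)) (at s)"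
      unfolding n_def[symmetric] by eventually_elim (auto intro!: derivative_eq_intros)
    show "((\<lambda>s. p/2 * s powr (p/2 - 1)) has_real_derivative p/2 * ((p/2-1) * n powr (p/2-1-1)))
        (at ((L1 ?a - L2 ?a) \<bullet> (L1 ?a - L2 ?a)))"
      unfolding n_def[symmetric] using n by (auto intro!: derivative_eq_intros)
  qed
  define m where "m = ((L1 ?a - L2 ?a) \<bullet> (L1 ?a - L2 ?a)) powr (p/2)"
  have m: "0 < m + \<beta>" using \<beta> by (simp add: m_def add_nonneg_pos)
  have t5: "ex_td (\<lambda>v. inverse (((L1 v - L2 v) \<bullet> (L1 v - L2 v)) powr (p/2) + \<beta>)) ?a"
  proof (rule ex_td_compose[where \<phi> = "\<lambda>s. inverse (s + \<beta>)" and \<phi>' = "\<lambda>s. - inverse ((s + \<beta>)\<^sup>2)", OF t4])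
    have "\<forall>\<^sub>F s in nhds m. s \<in> {- \<beta><..}" using m by (intro eventually_nhds_in_open) auto
    then show "\<forall>\<^sub>F s in nhds (((L1 ?a - L2 ?a) \<bullet> (L1 ?a - L2 ?a)) powr (p/2)).
        ((\<lambda>s. inverse (s + \<beta>)) has_real_derivative - inverse ((s + \<beta>)\<^sup>2)) (at s)"
      unfolding m_def[symmetric]
      by eventually_elim (auto intro!: derivative_eq_intros simp: power2_eq_square)
    show "((\<lambda>s. - inverse ((s + \<beta>)\<^sup>2)) has_real_derivative
        inverse ((m + \<beta>)\<^sup>2) * (2 * (m + \<beta>)) * inverse ((m + \<beta>)\<^sup>2))
        (at (((L1 ?a - L2 ?a) \<bullet> (L1 ?a - L2 ?a)) powr (p/2)))"
      unfolding m_def[symmetric] using m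
      by (auto intro!: derivative_eq_intros)
  qed
  have eq: "Psi p \<beta> q (vec_split v) = (q (L1 v) - q (L2 v)) * inverse (((L1 v - L2 v) \<bullet> (L1 v - L2 v)) powr (p/2) + \<beta>)" for v
  proof -
    have "norm (L1 v - L2 v) powr p = ((L1 v - L2 v) \<bullet> (L1 v - L2 v)) powr (p/2)"
      by (simp only: norm_eq_sqrt_inner powr_half_sqrt[OF inner_ge_zero, symmetric] powr_powr) simp
    then show ?thesis
      by (simp only: Psi_def split_beta L1_def[symmetric] L2_def[symmetric] divide_inverse)
  qed
  have td: "ex_td (\<lambda>v. Psi p \<beta> q (vec_split v)) ?a"
    unfolding eq by (intro ex_td_mult ex_td_diff t1 t2 t5)
  have cs: "isCont (vec_split :: real^('n+'n) \<Rightarrow> _) ?a"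
  proof -
    have "linear (vec_split :: real^('n+'n) \<Rightarrow> _)"
      by (auto simp: linear_iff vec_split_def vec_eq_iff)
    then show ?thesis by (intro linear_continuous_at) (simp add: linear_conv_bounded_linear)
  qed
  then have ls: "((vec_split :: real^('n+'n) \<Rightarrow> _) \<longlongrightarrow> (x, y)) (nhds ?a)"
    using tendsto_at_iff_tendsto_nhds[of vec_split ?a] by (simp add: isCont_def vec_split_join)
  have cj: "isCont (vec_join :: _ \<Rightarrow> real^('n+'n)) (x, y)"
    using linear_vec_join by (auto intro!: linear_continuous_at simp: linear_conv_bounded_linear)
  then have lj: "(vec_join \<longlongrightarrow> ?a) (nhds (x, y))"
    using tendsto_at_iff_tendsto_nhds[of vec_join "(x, y)"] by (simp add: isCont_def)
  have "\<exists>c>0. \<forall>\<^sub>F v in nhds ?a. 1 * Psi p \<beta> q (vec_split v) \<le> 1 * Psi p \<beta> q (vec_split ?a) - c * (norm (v - ?a))\<^sup>2"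
    using td by (rule hessian_max_growth)
      (use det eventually_compose_filterlim[OF max ls] in \<open>auto simp: hessian2_def vec_split_join\<close>)
  then obtain c where c: "0 < c" "\<forall>\<^sub>F v in nhds ?a. Psi p \<beta> q (vec_split v) \<le> Psi p \<beta> q (x, y) - c * (norm (v - ?a))\<^sup>2"
    by (auto simp: vec_split_join)
  have "norm (vec_join w - ?a) = norm (w - (x, y))" for w
    by (simp add: linear_diff[OF linear_vec_join, symmetric] norm_vec_join)
  then show ?thesis using eventually_compose_filterlim[OF c(2) lj] c(1)
    by (auto simp: vec_split_join intro!: exI[of _ c])
qed

section \<open>Linear convergence of fully corrective schemes\<close>

lemma weighted_norm_sum_le:
  fixes w :: "'m \<Rightarrow> 'y::real_normed_vector"
  assumes fin: "finite S" and pos: "\<And>m. m \<in> S \<Longrightarrow> 0 \<le> l m"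
    and W: "sum l S \<le> R" and V: "(\<Sum>m\<in>S. l m * (norm (w m))\<^sup>2) \<le> V"
  shows "(\<Sum>m\<in>S. l m * norm (w m)) \<le> sqrt (R * V)"
proof -
  have "(\<Sum>m\<in>S. l m * norm (w m)) = (\<Sum>m\<in>S. sqrt (l m) * (sqrt (l m) * norm (w m)))"
    using pos by (intro sum.cong) (simp_all add: mult.assoc[symmetric])
  also have "\<dots> \<le> L2_set (\<lambda>m. sqrt (l m)) S * L2_set (\<lambda>m. sqrt (l m) * norm (w m)) S"
    using L2_set_mult_ineq[of "\<lambda>m. sqrt (l m)" "\<lambda>m. sqrt (l m) * norm (w m)" S] pos by (simp cong: sum.cong add: abs_mult)
  also have "\<dots> = sqrt (sum l S) * sqrt (\<Sum>m\<in>S. l m * (norm (w m))\<^sup>2)"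
    using pos by (simp add: L2_set_def power_mult_distrib cong: sum.cong)
  also have "\<dots> = sqrt (sum l S * (\<Sum>m\<in>S. l m * (norm (w m))\<^sup>2))"
    by (simp add: real_sqrt_mult)
  also have "\<dots> \<le> sqrt (R * V)"
    using W V pos by (intro real_sqrt_le_mono mult_mono) (auto intro!: sum_nonneg order_trans[OF _ W])
  finally show ?thesis .
qed

text \<open>
  The algorithm seen through the observations \<open>v m\<close> of the measures \<open>m\<close>. The vectors \<open>\<kappa> i\<close> are the
  observations of the contact atoms, with optimal weights \<open>lb i\<close>; \<open>A k\<close> and \<open>l k\<close> are the active measures and
  their weights, and \<open>mh k\<close> is the new measure. The assumption \<open>growth\<close> is the quadratic growth of
  \<open>1 - \<langle>qbar, m\<rangle>\<close> away from the contact atoms, \<open>combos\<close> is the compactness of \<open>K\<close>, and \<open>optimal\<close> says that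
  all weights are re-optimized.
\<close>

locale corrective_scheme =
  fixes F :: "'y::real_inner \<Rightarrow> real" and gradF :: "'y \<Rightarrow> 'y" and ybar :: 'y
    and v :: "'m \<Rightarrow> 'y" and At :: "'m set"
    and I :: "'i set" and \<kappa> :: "'i \<Rightarrow> 'y" and lb :: "'i \<Rightarrow> real" and u :: "'i \<Rightarrow> 'y"
    and A :: "nat \<Rightarrow> 'm set" and l :: "nat \<Rightarrow> 'm \<Rightarrow> real" and mh :: "nat \<Rightarrow> 'm"
  assumes strict: "\<And>x y. x \<noteq> y \<Longrightarrow> F x + gradF x \<bullet> (y - x) < F y"
    and F_cont: "continuous_on UNIV F"
    and F_bdd: "bdd_below (range F)"
    and grad_lip: "\<And>C. compact C \<Longrightarrow> \<exists>L. L-lipschitz_on C gradF"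
    and strong: "\<exists>N \<theta>. open N \<and> ybar \<in> N \<and> 0 < \<theta> \<and>
      (\<forall>y1\<in>N. \<forall>y2\<in>N. (gradF y1 - gradF y2) \<bullet> (y1 - y2) \<ge> \<theta> * (norm (y1 - y2))\<^sup>2)"
    and combos: "\<And>R. \<exists>C. compact C \<and> (\<forall>S c. finite S \<longrightarrow> S \<subseteq> At \<longrightarrow> (\<forall>m\<in>S. 0 \<le> c m) \<longrightarrow>
      sum c S \<le> R \<longrightarrow> (\<Sum>m\<in>S. c m *\<^sub>R v m) \<in> C)"
    and I: "finite I" "I \<noteq> {}"
    and lb_pos: "\<And>i. i \<in> I \<Longrightarrow> 0 < lb i"
    and ybar: "ybar = (\<Sum>i\<in>I. lb i *\<^sub>R \<kappa> i)"
    and dual_basis: "\<And>i j. i \<in> I \<Longrightarrow> j \<in> I \<Longrightarrow> u i \<bullet> \<kappa> j = (if i = j then 1 else 0)"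
    and tight: "\<And>i. i \<in> I \<Longrightarrow> - gradF ybar \<bullet> \<kappa> i = 1"
    and feasible: "\<And>m. m \<in> At \<Longrightarrow> - gradF ybar \<bullet> v m \<le> 1"
    and growth: "\<exists>\<eta> B. 0 < \<eta> \<and> 0 < B \<and> (\<forall>m\<in>At. 1 - (- gradF ybar \<bullet> v m) \<le> \<eta> \<longrightarrow>
      (\<exists>i\<in>I. (norm (v m - \<kappa> i))\<^sup>2 \<le> B * (1 - (- gradF ybar \<bullet> v m))))"
    and A: "\<And>k. finite (A k)" "\<And>k. A k \<subseteq> At"
    and mh: "\<And>k. mh k \<in> At"
    and l_pos: "\<And>k m. m \<in> A k \<Longrightarrow> 0 < l k m"
    and active: "\<And>k m. m \<in> A k \<Longrightarrow> - gradF (\<Sum>m\<in>A k. l k m *\<^sub>R v m) \<bullet> v m = 1"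
    and mh_gt: "\<And>k. 1 < - gradF (\<Sum>m\<in>A k. l k m *\<^sub>R v m) \<bullet> v (mh k)"
    and mh_max: "\<And>k i. i \<in> I \<Longrightarrow>
      - gradF (\<Sum>m\<in>A k. l k m *\<^sub>R v m) \<bullet> \<kappa> i \<le> - gradF (\<Sum>m\<in>A k. l k m *\<^sub>R v m) \<bullet> v (mh k)"
    and optimal: "\<And>k c. (\<And>m. m \<in> insert (mh k) (A k) \<Longrightarrow> 0 \<le> c m) \<Longrightarrow>
      F (\<Sum>m\<in>A (Suc k). l (Suc k) m *\<^sub>R v m) + sum (l (Suc k)) (A (Suc k))
        \<le> F (\<Sum>m\<in>insert (mh k) (A k). c m *\<^sub>R v m) + sum c (insert (mh k) (A k))"
begin

definition y :: "nat \<Rightarrow> 'y" where "y k = (\<Sum>m\<in>A k. l k m *\<^sub>R v m)"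
definition W :: "nat \<Rightarrow> real" where "W k = sum (l k) (A k)"
definition qb :: "'m \<Rightarrow> real" where "qb m = - gradF ybar \<bullet> v m"
text \<open>The violation of dual feasibility at the new atom.\<close>

definition g :: "nat \<Rightarrow> real" where "g k = - gradF (y k) \<bullet> v (mh k) - 1"
text \<open>The optimality gap, with the norm replaced by the sum of the weights.\<close>

definition r :: "nat \<Rightarrow> real" where "r k = F (y k) + W k - (F ybar + sum lb I)"
text \<open>The Bregman distance of \<open>F\<close> to the optimal observation.\<close>

definition breg :: "'y \<Rightarrow> real" where "breg x = F x - F ybar - gradF ybar \<bullet> (x - ybar)"

lemma grad_le: "F x + gradF x \<bullet> (z - x) \<le> F z"
  using strict[of x z] by (cases "x = z") auto

lemma breg_nonneg: "0 \<le> breg x" and breg_eq_0: "breg x = 0 \<Longrightarrow> x = ybar"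
  using grad_le[of ybar x] strict[of ybar x] by (auto simp: breg_def)

lemma smooth:
  assumes "L-lipschitz_on C gradF" "x \<in> C" "x + h \<in> C"
  shows "F (x + h) \<le> F x + gradF x \<bullet> h + L * (norm h)\<^sup>2"
proof -
  have "F (x + h) + gradF (x + h) \<bullet> (- h) \<le> F x"
    using grad_le[of "x + h" x] by simp
  moreover have "(gradF (x + h) - gradF x) \<bullet> h \<le> L * norm h * norm h"
    using norm_cauchy_schwarz[of "gradF (x + h) - gradF x" h]
      mult_right_mono[OF lipschitz_onD[OF assms(1) assms(3,2)], of "norm h"]
    by (simp add: dist_norm) 
  ultimately show ?thesis by (simp add: inner_diff_left power2_eq_square)
qed

text \<open>
  By tightness \<open>\<langle>\<nabla>F(ybar), ybar\<rangle> = - sum lb I\<close>, and the linear terms recombine. Both summands are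
  nonnegative.
\<close>

lemma r_decomp: "r k = breg (y k) + (\<Sum>m\<in>A k. l k m * (1 - qb m))"
proof -
  have "gradF ybar \<bullet> ybar = - sum lb I"
  proof -
    have "gradF ybar \<bullet> ybar = (\<Sum>i\<in>I. lb i * (gradF ybar \<bullet> \<kappa> i))"
      by (subst (2) ybar) (simp add: inner_sum_right)
    also have "\<dots> = (\<Sum>i\<in>I. - lb i)" using tight by (intro sum.cong) force+
    finally show ?thesis by (simp add: sum_negf)
  qed
  moreover have "gradF ybar \<bullet> y k = - (\<Sum>m\<in>A k. l k m * qb m)"
    by (simp add: y_def inner_sum_right qb_def sum_negf)
  ultimately show ?thesis
    by (simp add: r_def breg_def W_def algebra_simps sum_subtractf)
qed

lemma excess_nonneg: "m \<in> A k \<Longrightarrow> 0 \<le> l k m * (1 - qb m)"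
  using feasible[of m] A(2)[of k] l_pos[of m k] by (auto simp: qb_def intro!: mult_nonneg_nonneg)

lemma breg_le_r: "breg (y k) \<le> r k" and excess_le_r: "(\<Sum>m\<in>A k. l k m * (1 - qb m)) \<le> r k"
  and r_nonneg: "0 \<le> r k"
  using r_decomp[of k] breg_nonneg[of "y k"] sum_nonneg[of "A k", OF excess_nonneg] by auto

lemma mh_notin: "mh k \<notin> A k"
  using active[of "mh k" k] mh_gt[of k] by auto

lemma g_pos: "0 < g k"
  using mh_gt[of k] by (simp add: g_def y_def)

text \<open>
  Any reweighting of the old atoms together with a weight for the new one is a competitor for the next step.
\<close>

lemma step:
  assumes c: "\<And>m. m \<in> A k \<Longrightarrow> 0 \<le> c m" and s: "0 \<le> s"
  shows "r (Suc k) \<le> F (s *\<^sub>R v (mh k) + (\<Sum>m\<in>A k. c m *\<^sub>R v m)) + (s + sum c (A k)) - (F ybar + sum lb I)"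
proof -
  let ?c = "c(mh k := s)"
  have "(\<Sum>m\<in>insert (mh k) (A k). ?c m *\<^sub>R v m) = s *\<^sub>R v (mh k) + (\<Sum>m\<in>A k. c m *\<^sub>R v m)"
    using mh_notin[of k] A(1)[of k] by (simp) (intro sum.cong, auto)
  moreover have "sum ?c (insert (mh k) (A k)) = s + sum c (A k)"
    using mh_notin[of k] A(1)[of k] by (simp) (intro sum.cong, auto)
  ultimately show ?thesis
    using optimal[of k ?c] assms unfolding r_def y_def W_def by (smt (verit) fun_upd_apply insert_iff)
qed

lemma r_decreasing: "r (Suc k) \<le> r k"
  using step[of k "l k" 0] l_pos less_imp_le by (force simp: r_def y_def W_def)

lemma decseq_r: "decseq r"
  by (rule decseq_SucI) (rule r_decreasing)

text \<open>
  Convexity bounds the gap by \<open>\<langle>-\<nabla>F(y k), ybar\<rangle> - sum lb I\<close>. Here \<open>ybar\<close> is a combination of the \<open>\<kappa> i\<close>, each of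
  which is beaten by the new atom.
\<close>

lemma gap_le_violation: "r k \<le> sum lb I * g k"
proof -
  have "F (y k) + gradF (y k) \<bullet> (ybar - y k) \<le> F ybar" by (rule grad_le)
  moreover have "gradF (y k) \<bullet> y k = - W k"
  proof -
    have "gradF (y k) \<bullet> y k = (\<Sum>m\<in>A k. l k m * (gradF (y k) \<bullet> v m))"
      by (subst (2) y_def) (simp add: inner_sum_right)
    also have "\<dots> = (\<Sum>m\<in>A k. - l k m)"
      using active[of _ k] by (intro sum.cong) (force simp: y_def[symmetric])+
    finally show ?thesis by (simp add: sum_negf W_def)
  qed
  moreover have "- gradF (y k) \<bullet> ybar \<le> sum lb I * (1 + g k)"
  proof -
    have "- gradF (y k) \<bullet> ybar = (\<Sum>i\<in>I. lb i * (- gradF (y k) \<bullet> \<kappa> i))"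
      by (subst ybar) (simp add: inner_sum_right sum_negf)
    also have "\<dots> \<le> (\<Sum>i\<in>I. lb i * (1 + g k))"
      using mh_max[of _ k] lb_pos by (intro sum_mono mult_left_mono) (auto simp: g_def y_def less_imp_le)
    finally show ?thesis by (simp add: sum_distrib_right)
  qed
  ultimately show ?thesis by (simp add: r_def inner_diff_right algebra_simps)
qed

lemma weights_bounded: obtains R where "0 < R" "\<And>k. W k \<le> R"
proof -
  obtain b where b: "\<And>x. b \<le> F x" using F_bdd by (auto simp: bdd_below_def)
  have "W k \<le> \<bar>r 0 + F ybar + sum lb I - b\<bar> + 1" for k
    using decseqD[OF decseq_r, of 0 k] b[of "y k"] by (simp add: r_def)
  then show thesis by (intro that[of "\<bar>r 0 + F ybar + sum lb I - b\<bar> + 1"]) auto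
qed

lemma atoms_bounded: obtains M where "0 < M" "\<And>m. m \<in> At \<Longrightarrow> norm (v m) \<le> M"
proof -
  obtain C where C: "compact C" "\<forall>S c. finite S \<longrightarrow> S \<subseteq> At \<longrightarrow> (\<forall>m\<in>S. 0 \<le> c m) \<longrightarrow>
      sum c S \<le> 1 \<longrightarrow> (\<Sum>m\<in>S. c m *\<^sub>R v m) \<in> C" using combos[of 1] by blast
  have "v m \<in> C" if "m \<in> At" for m
    using C(2)[rule_format, of "{m}" "\<lambda>_. 1"] that by simp
  moreover obtain M where "0 < M" "\<forall>x\<in>C. norm x \<le> M"
    using compact_imp_bounded[OF C(1)] by (auto simp: bounded_pos)
  ultimately show thesis using that by blast
qed

text \<open>
  Giving the new atom the weight \<open>t\<close> lowers \<open>r\<close> by a multiple of \<open>t r\<close> up to an error of order \<open>t\<^sup>2\<close>. Hence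
  the limit \<open>rs\<close> of the decreasing sequence \<open>r\<close> satisfies \<open>t rs \<le> C t\<^sup>2\<close> for all small \<open>t\<close>.
\<close>

lemma r_tendsto_0: "r \<longlonglongrightarrow> 0"
proof -
  obtain R where R: "0 < R" "\<And>k. W k \<le> R" by (rule weights_bounded, rule that)
  obtain M where M: "0 < M" "\<And>m. m \<in> At \<Longrightarrow> norm (v m) \<le> M" by (rule atoms_bounded, rule that)
  obtain C where C: "compact C" "\<forall>S c. finite S \<longrightarrow> S \<subseteq> At \<longrightarrow> (\<forall>m\<in>S. 0 \<le> c m) \<longrightarrow>
      sum c S \<le> R + 1 \<longrightarrow> (\<Sum>m\<in>S. c m *\<^sub>R v m) \<in> C" using combos[of "R + 1"] by blast
  obtain L where L: "L-lipschitz_on C gradF" using grad_lip[OF C(1)] by blast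
  have L0: "0 \<le> L" using L by (rule lipschitz_on_nonneg)
  have S: "0 < sum lb I" using I lb_pos by (intro sum_pos) auto
  obtain rs where rs: "r \<longlonglongrightarrow> rs"
    using decseq_convergent[OF decseq_r, of 0] r_nonneg by metis
  have main: "t * rs \<le> sum lb I * (L * M\<^sup>2 * t\<^sup>2)" if t: "0 \<le> t" "t \<le> 1" for t
  proof -
    have "r (Suc k) \<le> r k - t * r k / sum lb I + L * M\<^sup>2 * t\<^sup>2" for k
    proof -
      have yC: "y k \<in> C"
        using C(2)[rule_format, of "A k" "l k"] A l_pos R(2)[of k] by (force simp: y_def W_def less_imp_le)
      have "t *\<^sub>R v (mh k) + y k = (\<Sum>m\<in>insert (mh k) (A k). ((l k)(mh k := t)) m *\<^sub>R v m)"
        using mh_notin[of k] A(1)[of k] by (simp add: y_def) (intro sum.cong, auto)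
      also have "\<dots> \<in> C"
      proof (intro C(2)[rule_format])
        have "sum ((l k)(mh k := t)) (insert (mh k) (A k)) = t + W k"
          using mh_notin[of k] A(1)[of k] by (simp add: W_def) (intro sum.cong, auto)
        then show "sum ((l k)(mh k := t)) (insert (mh k) (A k)) \<le> R + 1" using R(2)[of k] t by simp
      qed (use A mh l_pos t in \<open>auto simp: less_imp_le\<close>)
      finally have yC': "y k + t *\<^sub>R v (mh k) \<in> C" by (simp add: add.commute)
      have "r (Suc k) \<le> F (y k + t *\<^sub>R v (mh k)) + (t + W k) - (F ybar + sum lb I)"
        using step[of k "l k" t] l_pos t by (force simp: y_def W_def add.commute less_imp_le)
      also have "F (y k + t *\<^sub>R v (mh k)) \<le> F (y k) + gradF (y k) \<bullet> (t *\<^sub>R v (mh k)) + L * (norm (t *\<^sub>R v (mh k)))\<^sup>2"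
        by (rule smooth[OF L yC yC'])
      also have "gradF (y k) \<bullet> (t *\<^sub>R v (mh k)) = - t * (1 + g k)" by (simp add: g_def)
      also have "L * (norm (t *\<^sub>R v (mh k)))\<^sup>2 \<le> L * (M\<^sup>2 * t\<^sup>2)"
        using M(2)[OF mh[of k]] L0 by (simp add: power_mult_distrib mult.commute[of "M\<^sup>2"] mult_left_mono power_mono)
      finally have "r (Suc k) \<le> r k - t * g k + L * (M\<^sup>2 * t\<^sup>2)"
        by (simp add: r_def algebra_simps)
      moreover have "t * r k / sum lb I \<le> t * g k"
        using gap_le_violation[of k] S t by (simp add: field_simps mult_left_mono)
      ultimately show ?thesis by (simp add: mult.assoc)
    qed
    then have "rs \<le> rs - t * rs / sum lb I + L * M\<^sup>2 * t\<^sup>2"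
      by (intro LIMSEQ_le[OF LIMSEQ_Suc[OF rs], of "\<lambda>k. r k - t * r k / sum lb I + L * M\<^sup>2 * t\<^sup>2"]
          tendsto_intros rs exI[of _ 0]) (use S in auto)
    then show ?thesis using S by (simp add: field_simps)
  qed
  have "0 \<le> rs" using rs r_nonneg by (auto intro: LIMSEQ_le_const)
  moreover have "rs \<le> sum lb I * (L * M\<^sup>2) * t" if t: "0 < t" "t \<le> 1" for t
    using main[of t] t by (simp add: power2_eq_square field_simps)
  then have "rs \<le> 0"
  proof -
    assume *: "\<And>t. 0 < t \<Longrightarrow> t \<le> 1 \<Longrightarrow> rs \<le> sum lb I * (L * M\<^sup>2) * t"
    have lim: "(\<lambda>n. sum lb I * (L * M\<^sup>2) * (1 / real (Suc n))) \<longlonglongrightarrow> sum lb I * (L * M\<^sup>2) * 0"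
      by (intro tendsto_intros LIMSEQ_Suc[OF lim_1_over_n])
    have "rs \<le> sum lb I * (L * M\<^sup>2) * 0"
      by (rule LIMSEQ_le_const[OF lim]) (intro exI[of _ 0] allI impI *, auto)
    then show ?thesis by simp
  qed
  ultimately show ?thesis using rs by simp
qed

lemma y_in_compact: obtains C where "compact C" "\<And>k. y k \<in> C" "ybar \<in> C"
proof -
  obtain R where R: "0 < R" "\<And>k. W k \<le> R" by (rule weights_bounded, rule that)
  obtain C where C: "compact C" "\<forall>S c. finite S \<longrightarrow> S \<subseteq> At \<longrightarrow> (\<forall>m\<in>S. 0 \<le> c m) \<longrightarrow>
      sum c S \<le> R \<longrightarrow> (\<Sum>m\<in>S. c m *\<^sub>R v m) \<in> C" using combos[of R] by blast
  have "y k \<in> C" for k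
    using C(2)[rule_format, of "A k" "l k"] A l_pos R(2)[of k] by (force simp: y_def W_def less_imp_le)
  then show thesis using that[of "insert ybar C"] C(1) by auto
qed

text \<open>
  The iterates stay in a compact set, and \<open>ybar\<close> is the only zero of the Bregman distance.
\<close>

lemma y_tendsto: "y \<longlonglongrightarrow> ybar"
proof -
  obtain C where C: "compact C" "\<And>k. y k \<in> C" "ybar \<in> C" by (rule y_in_compact, rule that)
  have breg0: "(\<lambda>k. breg (y k)) \<longlonglongrightarrow> 0"
    by (rule tendsto_sandwich[OF _ _ tendsto_const r_tendsto_0]) (auto simp: breg_nonneg breg_le_r)
  show ?thesis
  proof (rule ccontr)
    assume "\<not> y \<longlonglongrightarrow> ybar"
    then obtain e where e: "0 < e" "\<exists>\<^sub>F k in sequentially. \<not> dist (y k) ybar < e"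
      by (auto simp: tendsto_iff not_eventually)
    then have "infinite {k. \<not> dist (y k) ybar < e}"
      by (simp add: INFM_iff_infinite cofinite_eq_sequentially[symmetric])
    then obtain s :: "nat \<Rightarrow> nat" where s: "strict_mono s" "\<And>n. s n \<in> {k. \<not> dist (y k) ybar < e}"
      using infinite_enumerate by blast
    from C(1) C(2) obtain x t where xt: "x \<in> C" "strict_mono t" "((\<lambda>n. y (s n)) \<circ> t) \<longlonglongrightarrow> x"
      unfolding compact_def by meson
    have "continuous_on UNIV breg"
      unfolding breg_def by (intro continuous_intros F_cont)
    then have "isCont breg x" by (simp add: continuous_on_eq_continuous_at)
    then have "(\<lambda>n. breg (y (s (t n)))) \<longlonglongrightarrow> breg x"
      using isCont_tendsto_compose[OF _ xt(3)] by (simp add: o_def)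
    moreover have "(\<lambda>n. breg (y (s (t n)))) \<longlonglongrightarrow> 0"
      using LIMSEQ_subseq_LIMSEQ[OF breg0 strict_mono_o[OF s(1) xt(2)]] by (simp add: o_def)
    ultimately have "breg x = 0" by (rule LIMSEQ_unique)
    then have "x = ybar" by (rule breg_eq_0)
    then obtain n where "dist (y (s (t n))) ybar < e"
      using xt(3) e(1) by (auto simp: LIMSEQ_def o_def)
    then show False using s(2)[of "t n"] by simp
  qed
qed

lemma W_tendsto: "W \<longlonglongrightarrow> sum lb I"
proof -
  have "isCont F ybar" using F_cont by (simp add: continuous_on_eq_continuous_at)
  then have "(\<lambda>k. F (y k)) \<longlonglongrightarrow> F ybar" using isCont_tendsto_compose y_tendsto by blast
  then have "(\<lambda>k. r k - F (y k) + (F ybar + sum lb I)) \<longlonglongrightarrow> 0 - F ybar + (F ybar + sum lb I)"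
    by (intro tendsto_intros r_tendsto_0)
  then show ?thesis by (simp add: r_def)
qed

lemma breg_growth: 
  obtains \<theta> where "0 < \<theta>" "\<forall>\<^sub>F k in sequentially. \<theta> * (norm (y k - ybar))\<^sup>2 \<le> breg (y k)"
proof -
  obtain N \<theta> where N: "open N" "ybar \<in> N" "0 < \<theta>"
    "\<And>y1 y2. y1 \<in> N \<Longrightarrow> y2 \<in> N \<Longrightarrow> (gradF y1 - gradF y2) \<bullet> (y1 - y2) \<ge> \<theta> * (norm (y1 - y2))\<^sup>2"
    using strong by blast
  obtain e where e: "0 < e" "ball ybar e \<subseteq> N" using N(1,2) openE by blast
  have "\<theta> / 8 * (norm (x - ybar))\<^sup>2 \<le> breg x" if x: "x \<in> ball ybar e" for x
  proof -
    \<comment> \<open>Half of the segment suffices: the gradient inequality is used at the midpoint.\<close>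
    define z where "z = ybar + (1/2) *\<^sub>R (x - ybar)"
    have zx: "x - z = (1/2) *\<^sub>R (x - ybar)" and zy: "z - ybar = (1/2) *\<^sub>R (x - ybar)"
      by (simp_all add: z_def algebra_simps flip: scaleR_add_left)
    have "dist ybar z \<le> dist ybar x"
      using zy by (simp add: dist_norm norm_minus_commute[of ybar])
    then have zN: "z \<in> N" using x e(2) by (auto simp: subset_eq)
    have "\<theta> * (norm (z - ybar))\<^sup>2 \<le> (gradF z - gradF ybar) \<bullet> (z - ybar)"
      using N(4)[OF zN N(2)] .
    then have "\<theta> / 4 * (norm (x - ybar))\<^sup>2 \<le> (gradF z - gradF ybar) \<bullet> (x - z)"
      by (simp add: zx zy power_divide)
    moreover have "F x \<ge> F z + gradF z \<bullet> (x - z)" "F z \<ge> F ybar + gradF ybar \<bullet> (z - ybar)"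
      by (rule grad_le)+
    ultimately have "\<theta> / 4 * (norm (x - ybar))\<^sup>2 \<le> breg x"
      by (simp add: breg_def inner_diff_left inner_diff_right)
    moreover have "0 \<le> \<theta> * (norm (x - ybar))\<^sup>2" using N(3) by simp
    ultimately show ?thesis by simp
  qed
  moreover have "\<forall>\<^sub>F k in sequentially. y k \<in> ball ybar e"
    using y_tendsto e(1) by (auto simp: tendsto_iff dist_commute)
  ultimately have "\<forall>\<^sub>F k in sequentially. \<theta> / 8 * (norm (y k - ybar))\<^sup>2 \<le> breg (y k)"
    by (auto elim: eventually_mono)
  then show thesis using that[of "\<theta> / 8"] N(3) by auto
qed

lemma near_ybar: obtains D where "0 < D" "\<forall>\<^sub>F k in sequentially. (norm (y k - ybar))\<^sup>2 \<le> D * r k"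
proof -
  obtain \<theta> where t: "0 < \<theta>" "\<forall>\<^sub>F k in sequentially. \<theta> * (norm (y k - ybar))\<^sup>2 \<le> breg (y k)"
    by (rule breg_growth, rule that)
  have "\<forall>\<^sub>F k in sequentially. (norm (y k - ybar))\<^sup>2 \<le> (1 / \<theta>) * r k"
    using t(2)
  proof eventually_elim
    case (elim k)
    then have "\<theta> * (norm (y k - ybar))\<^sup>2 \<le> r k" using breg_le_r[of k] by simp
    then show ?case using t(1) by (simp add: field_simps)
  qed
  then show thesis using that[of "1 / \<theta>"] t(1) by auto
qed

lemma grad_tendsto: "(\<lambda>k. gradF (y k)) \<longlonglongrightarrow> gradF ybar"
proof -
  obtain C where C: "compact C" "\<And>k. y k \<in> C" "ybar \<in> C" by (rule y_in_compact, rule that)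
  obtain L where L: "L-lipschitz_on C gradF" using grad_lip[OF C(1)] by blast
  then have "continuous_on C gradF" by (rule lipschitz_on_continuous_on)
  then show ?thesis using C y_tendsto unfolding continuous_on_sequentially by (auto simp: o_def)
qed

text \<open>
  Active atoms pair to at least 1 with the current dual variable, which converges to the optimal one.
\<close>

lemma active_close:
  assumes \<eta>: "0 < \<eta>"
  shows "\<forall>\<^sub>F k in sequentially. \<forall>m\<in>insert (mh k) (A k). 1 - qb m \<le> \<eta>"
proof -
  obtain M where M: "0 < M" "\<And>m. m \<in> At \<Longrightarrow> norm (v m) \<le> M" by (rule atoms_bounded, rule that)
    have "(\<lambda>k. norm (gradF (y k) - gradF ybar) * M) \<longlonglongrightarrow> 0 * M"
      using grad_tendsto by (intro tendsto_intros) (simp add: tendsto_norm_zero_iff LIM_zero_iff)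
    then have "\<forall>\<^sub>F k in sequentially. norm (gradF (y k) - gradF ybar) * M < \<eta>"
      using \<eta> by (simp add: order_tendstoD(2))
    then show ?thesis
    proof eventually_elim
      case (elim k)
      show ?case
      proof
        fix m assume m: "m \<in> insert (mh k) (A k)"
        then have mAt: "m \<in> At" using A(2) mh by auto
        have "1 \<le> - gradF (y k) \<bullet> v m"
          using m active[of m k] mh_gt[of k] by (auto simp: y_def)
        then have "1 - qb m \<le> (gradF ybar - gradF (y k)) \<bullet> v m"
          by (simp add: qb_def inner_diff_left)
        also have "\<dots> \<le> norm (gradF ybar - gradF (y k)) * norm (v m)" by (rule norm_cauchy_schwarz)
        also have "\<dots> \<le> norm (gradF (y k) - gradF ybar) * M"
          using M(2)[OF mAt] by (simp add: norm_minus_commute mult_left_mono)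
        finally show "1 - qb m \<le> \<eta>" using elim by simp
      qed
    qed
  qed

text \<open>
  Active atoms are grouped by the contact atom \<open>idx m\<close> next to them. The comparison step moves the fraction \<open>s\<close>
  of the mass \<open>\<Lambda> k i\<close> of the cluster of the new atom onto the new atom. It keeps the sum of the weights and
  moves the observation by \<open>s *\<^sub>R h\<close> with \<open>norm h = O(sqrt (r k))\<close>. Its first-order effect
  \<open>- s * \<Lambda> k i * g k\<close> is at most \<open>- s * a * r k\<close>, and for small fixed \<open>s\<close> it dominates the quadratic term.
\<close>

lemma linear_rate:
  obtains B \<zeta> where "0 < B" "0 < \<zeta>" "\<zeta> < 1" "\<forall>\<^sub>F k in sequentially. r k \<le> B * \<zeta> ^ k"
proof -
  obtain \<eta> B where hyp: "0 < \<eta>" "0 < B"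
    "\<And>m. m \<in> At \<Longrightarrow> 1 - qb m \<le> \<eta> \<Longrightarrow> \<exists>i\<in>I. (norm (v m - \<kappa> i))\<^sup>2 \<le> B * (1 - qb m)"
    using growth unfolding qb_def by blast
  obtain R where R: "0 < R" "\<And>k. W k \<le> R" by (rule weights_bounded, rule that)
  obtain M where M: "0 < M" "\<And>m. m \<in> At \<Longrightarrow> norm (v m) \<le> M" by (rule atoms_bounded, rule that)
  obtain C where C: "compact C" "\<forall>S c. finite S \<longrightarrow> S \<subseteq> At \<longrightarrow> (\<forall>m\<in>S. 0 \<le> c m) \<longrightarrow>
      sum c S \<le> R \<longrightarrow> (\<Sum>m\<in>S. c m *\<^sub>R v m) \<in> C" using combos[of R] by blast
  obtain L where L: "L-lipschitz_on (insert ybar C) gradF"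
    using grad_lip[of "insert ybar C"] C(1) by auto
  have L0: "0 \<le> L" using L by (rule lipschitz_on_nonneg)
  obtain D where D: "0 < D" "\<forall>\<^sub>F k in sequentially. (norm (y k - ybar))\<^sup>2 \<le> D * r k"
    by (rule near_ybar, rule that)
  have S: "0 < sum lb I" using I lb_pos by (intro sum_pos) auto
  define idx where "idx m = (SOME i. i \<in> I \<and> (norm (v m - \<kappa> i))\<^sup>2 \<le> B * (1 - qb m))" for m
  have idx: "idx m \<in> I \<and> (norm (v m - \<kappa> (idx m)))\<^sup>2 \<le> B * (1 - qb m)" if "m \<in> At" "1 - qb m \<le> \<eta>" for m
    using someI_ex[of "\<lambda>i. i \<in> I \<and> (norm (v m - \<kappa> i))\<^sup>2 \<le> B * (1 - qb m)"] hyp(3)[OF that]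
    unfolding idx_def by blast
  define \<Lambda> where "\<Lambda> k i = (\<Sum>m\<in>{m\<in>A k. idx m = i}. l k m)" for k i
  define err where "err k = (\<Sum>m\<in>A k. l k m * norm (v m - \<kappa> (idx m)))" for k
  have yC: "y k \<in> C" for k
    using C(2)[rule_format, of "A k" "l k"] A l_pos R(2)[of k] by (force simp: y_def W_def less_imp_le)
  note close = active_close[OF hyp(1)]
  have err_le: "\<forall>\<^sub>F k in sequentially. err k \<le> sqrt (R * (B * r k))"
    using close
  proof eventually_elim
    case (elim k)
    have "(\<Sum>m\<in>A k. l k m * (norm (v m - \<kappa> (idx m)))\<^sup>2) \<le> (\<Sum>m\<in>A k. l k m * (B * (1 - qb m)))"
      using elim idx A(2)[of k] l_pos[of _ k] by (intro sum_mono mult_left_mono) (auto simp: less_imp_le)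
    also have "\<dots> = B * (\<Sum>m\<in>A k. l k m * (1 - qb m))"
      by (simp add: sum_distrib_left mult_ac)
    also have "\<dots> \<le> B * r k" using excess_le_r hyp(2) by simp
    finally show ?case unfolding err_def
      using A(1) l_pos[of _ k] R(2)[of k] by (intro weighted_norm_sum_le) (auto simp: W_def less_imp_le)
  qed
  have err0: "err \<longlonglongrightarrow> 0"
  proof -
    have "(\<lambda>k. sqrt (R * (B * r k))) \<longlonglongrightarrow> sqrt (R * (B * 0))"
      by (intro tendsto_intros r_tendsto_0)
    then have lim: "(\<lambda>k. sqrt (R * (B * r k))) \<longlonglongrightarrow> 0" by simp
    have "\<forall>\<^sub>F k in sequentially. 0 \<le> err k"
      using l_pos by (auto simp: err_def less_imp_le intro!: always_eventually sum_nonneg mult_nonneg_nonneg)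
    then show ?thesis by (intro tendsto_sandwich[OF _ err_le tendsto_const lim])
  qed
  \<comment> \<open>The mass in each cluster converges to the optimal weight, hence stays away from zero.\<close>
  have mass: "\<forall>\<^sub>F k in sequentially. lb i / 2 \<le> \<Lambda> k i" if i: "i \<in> I" for i
  proof -
    have "(\<lambda>k. norm (u i) * (norm (y k - ybar) + err k)) \<longlonglongrightarrow> norm (u i) * (0 + 0)"
      using y_tendsto by (intro tendsto_intros err0) (simp add: tendsto_norm_zero_iff LIM_zero_iff)
    then have "\<forall>\<^sub>F k in sequentially. norm (u i) * (norm (y k - ybar) + err k) < lb i / 2"
      using lb_pos[OF i] by (intro order_tendstoD(2)) auto
    then show ?thesis using close
    proof eventually_elim
      case (elim k)
      have idxI: "idx m \<in> I" if "m \<in> A k" for m using idx elim(2) that A(2) by blast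
      have e: "norm (y k - (\<Sum>m\<in>A k. l k m *\<^sub>R \<kappa> (idx m))) \<le> err k"
      proof -
        have "y k - (\<Sum>m\<in>A k. l k m *\<^sub>R \<kappa> (idx m)) = (\<Sum>m\<in>A k. l k m *\<^sub>R (v m - \<kappa> (idx m)))"
          by (simp add: y_def sum_subtractf scaleR_diff_right)
        also have "norm \<dots> \<le> (\<Sum>m\<in>A k. norm (l k m *\<^sub>R (v m - \<kappa> (idx m))))" by (rule norm_sum)
        also have "\<dots> = err k" using l_pos[of _ k] by (auto simp: err_def less_imp_le intro!: sum.cong)
        finally show ?thesis .
      qed
      have "u i \<bullet> (\<Sum>m\<in>A k. l k m *\<^sub>R \<kappa> (idx m)) = (\<Sum>m\<in>A k. if idx m = i then l k m else 0)"
        using i idxI by (auto simp: inner_sum_right dual_basis intro!: sum.cong)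
      also have "\<dots> = \<Lambda> k i" by (simp add: \<Lambda>_def sum.inter_filter[OF A(1)])
      finally have L1: "u i \<bullet> (\<Sum>m\<in>A k. l k m *\<^sub>R \<kappa> (idx m)) = \<Lambda> k i" .
      have "u i \<bullet> ybar = (\<Sum>j\<in>I. if i = j then lb j else 0)"
        using i by (subst ybar) (auto simp: inner_sum_right dual_basis intro!: sum.cong)
      then have L2: "u i \<bullet> ybar = lb i" using I(1) i by simp
      have "lb i - \<Lambda> k i = u i \<bullet> ((ybar - y k) + (y k - (\<Sum>m\<in>A k. l k m *\<^sub>R \<kappa> (idx m))))"
        by (simp add: L1[symmetric] L2[symmetric] inner_diff_right)
      also have "\<dots> \<le> norm (u i) * norm ((ybar - y k) + (y k - (\<Sum>m\<in>A k. l k m *\<^sub>R \<kappa> (idx m))))"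
        by (rule norm_cauchy_schwarz)
      also have "\<dots> \<le> norm (u i) * (norm (y k - ybar) + err k)"
        using e norm_triangle_ineq[of "ybar - y k" "y k - (\<Sum>m\<in>A k. l k m *\<^sub>R \<kappa> (idx m))"]
        by (intro mult_left_mono) (auto simp: norm_minus_commute)
      finally show ?case using elim(1) by simp
    qed
  qed
  define lmin where "lmin = Min (lb ` I)"
  have lmin: "0 < lmin" "\<And>i. i \<in> I \<Longrightarrow> lmin \<le> lb i"
    using I lb_pos by (auto simp: lmin_def)
  have masses: "\<forall>\<^sub>F k in sequentially. \<forall>i\<in>I. lmin / 2 \<le> \<Lambda> k i"
  proof (rule eventually_ball_finite[OF I(1)], rule ballI)
    fix i assume i: "i \<in> I"
    show "\<forall>\<^sub>F k in sequentially. lmin / 2 \<le> \<Lambda> k i"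
      using mass[OF i] lmin(2)[OF i] by (auto elim!: eventually_mono)
  qed
  define E where "E = (R * (B * L * sqrt D) + sqrt (R * B))\<^sup>2"
  have E0: "0 \<le> E" by (simp add: E_def)
  define a b where "a = lmin / 2 / sum lb I" and "b = L * E + 1"
  have a: "0 < a" and b: "0 < b" using lmin S L0 E0 by (auto simp: a_def b_def add_nonneg_pos)
  \<comment> \<open>This choice makes the quadratic term at most half of the first-order decrease.\<close>
  define s where "s = min 1 (a / (2 * b))"
  have s: "0 < s" "s \<le> 1" using a b by (auto simp: s_def)
  have s2: "b * s\<^sup>2 \<le> s * a / 2"
  proof -
    have "b * s \<le> a / 2" using b by (simp add: s_def min_def field_simps)
    then have "s * (b * s) \<le> s * (a / 2)" using s by (intro mult_left_mono) auto
    then show ?thesis by (simp add: power2_eq_square mult_ac)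
  qed
  have contract: "\<forall>\<^sub>F k in sequentially. r (Suc k) \<le> (1 - s * a / 2) * r k"
    using close err_le masses D(2)
  proof eventually_elim
    case (elim k)
    define i where "i = idx (mh k)"
    have mhb: "i \<in> I" "(norm (v (mh k) - \<kappa> i))\<^sup>2 \<le> B * (1 - qb (mh k))"
      using idx[OF mh[of k]] elim(1) by (auto simp: i_def)
    have r0: "0 \<le> r k" by (rule r_nonneg)
    have nyb: "norm (y k - ybar) \<le> sqrt D * sqrt (r k)"
      using elim(4) by (metis norm_ge_zero real_le_rsqrt real_sqrt_mult)
    \<comment> \<open>The new atom beats \<open>\<kappa> i\<close> for the current dual variable, so it is close to \<open>\<kappa> i\<close>.\<close>
    have nmh: "norm (v (mh k) - \<kappa> i) \<le> B * L * sqrt D * sqrt (r k)"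
    proof -
      let ?d = "v (mh k) - \<kappa> i"
      have "1 - qb (mh k) = - gradF ybar \<bullet> \<kappa> i - (- gradF ybar \<bullet> v (mh k))"
        using tight[OF mhb(1)] by (simp add: qb_def)
      also have "\<dots> = gradF ybar \<bullet> ?d" by (simp add: inner_diff_right)
      also have "\<dots> \<le> (gradF ybar - gradF (y k)) \<bullet> ?d"
        using mh_max[OF mhb(1), of k] by (simp add: y_def[symmetric] inner_diff_left inner_diff_right)
      also have "\<dots> \<le> norm (gradF ybar - gradF (y k)) * norm ?d" by (rule norm_cauchy_schwarz)
      also have "norm (gradF ybar - gradF (y k)) \<le> L * norm (y k - ybar)"
        using lipschitz_onD[OF L, of ybar "y k"] yC by (simp add: dist_norm norm_minus_commute)
      finally have "(norm ?d)\<^sup>2 \<le> B * (L * norm (y k - ybar) * norm ?d)"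
        using mhb(2) hyp(2) by (smt (verit) mult_left_mono mult_right_mono norm_ge_zero)
      then have "norm ?d \<le> B * L * norm (y k - ybar)"
        using hyp(2) L0 by (cases "norm ?d = 0") (auto simp: power2_eq_square mult_ac)
      also have "\<dots> \<le> B * L * (sqrt D * sqrt (r k))"
        using nyb hyp(2) L0 by (intro mult_left_mono) auto
      finally show ?thesis by (simp add: mult_ac)
    qed
    define J where "J = {m\<in>A k. idx m = i}"
    have J: "finite J" "J \<subseteq> A k" using A(1)[of k] by (auto simp: J_def)
    \<comment> \<open>The direction obtained by moving the whole cluster; the terms in \<open>\<kappa> i\<close> cancel.\<close>
    define h where "h = \<Lambda> k i *\<^sub>R v (mh k) - (\<Sum>m\<in>J. l k m *\<^sub>R v m)"
    have LR: "\<Lambda> k i \<le> R"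
      using sum_mono2[OF A(1) J(2), of "l k"] l_pos[of _ k] R(2)[of k]
      by (force simp: \<Lambda>_def J_def[symmetric] W_def less_imp_le)
    have L0': "0 \<le> \<Lambda> k i" using l_pos[of _ k] by (auto simp: \<Lambda>_def less_imp_le intro!: sum_nonneg)
    have hn: "norm h \<le> (R * (B * L * sqrt D) + sqrt (R * B)) * sqrt (r k)"
    proof -
      have "h = \<Lambda> k i *\<^sub>R (v (mh k) - \<kappa> i) - (\<Sum>m\<in>J. l k m *\<^sub>R (v m - \<kappa> i))"
        by (simp add: h_def \<Lambda>_def J_def[symmetric] scaleR_diff_right sum_subtractf scaleR_sum_left)
      also have "norm \<dots> \<le> norm (\<Lambda> k i *\<^sub>R (v (mh k) - \<kappa> i)) + norm (\<Sum>m\<in>J. l k m *\<^sub>R (v m - \<kappa> i))"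
        by (rule norm_triangle_ineq4)
      also have "norm (\<Lambda> k i *\<^sub>R (v (mh k) - \<kappa> i)) \<le> R * (B * L * sqrt D * sqrt (r k))"
        using LR L0' nmh by (simp add: mult_mono)
      also have "norm (\<Sum>m\<in>J. l k m *\<^sub>R (v m - \<kappa> i)) \<le> (\<Sum>m\<in>J. l k m * norm (v m - \<kappa> (idx m)))"
        using J(2) l_pos[of _ k] by (intro sum_norm_le) (auto simp: J_def less_imp_le)
      also have "\<dots> \<le> err k"
        unfolding err_def using J l_pos[of _ k] A(1) by (intro sum_mono2) (auto simp: less_imp_le)
      also have "err k \<le> sqrt (R * B) * sqrt (r k)"
        using elim(2) by (simp add: real_sqrt_mult mult_ac)
      finally show ?thesis by (simp add: algebra_simps)
    qed
    have hn2: "(norm h)\<^sup>2 \<le> E * r k"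
      using power_mono[OF hn norm_ge_zero, of 2] r0 by (simp add: E_def power_mult_distrib)
    define c where "c m = (if m \<in> J then (1 - s) * l k m else l k m)" for m
    have c0: "0 \<le> c m" if "m \<in> A k" for m
      using l_pos[OF that] s by (auto simp: c_def)
    have sumc: "(\<Sum>m\<in>A k. f (c m) m) = (\<Sum>m\<in>A k. f (l k m) m) - (\<Sum>m\<in>J. s *\<^sub>R f (l k m) m)"
      if "\<And>m x t. f (t * x) m = t *\<^sub>R f x m" for f :: "real \<Rightarrow> 'm \<Rightarrow> 'c::real_vector"
    proof -
      have "(\<Sum>m\<in>A k. f (c m) m) = (\<Sum>m\<in>A k. f (l k m) m - (if m \<in> J then s *\<^sub>R f (l k m) m else 0))"
        using that by (intro sum.cong) (auto simp: c_def scaleR_diff_left)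
      also have "\<dots> = (\<Sum>m\<in>A k. f (l k m) m) - (\<Sum>m\<in>J. s *\<^sub>R f (l k m) m)"
        using J A(1)[of k] by (simp add: sum_subtractf sum.inter_restrict[symmetric] Int_absorb1)
      finally show ?thesis .
    qed
    have sumv: "(s * \<Lambda> k i) *\<^sub>R v (mh k) + (\<Sum>m\<in>A k. c m *\<^sub>R v m) = y k + s *\<^sub>R h"
      using sumc[of "\<lambda>x m. x *\<^sub>R v m"]
      by (simp add: y_def h_def scaleR_diff_right scaleR_sum_right)
    have suml: "s * \<Lambda> k i + sum c (A k) = W k"
      using sumc[of "\<lambda>x m. x"]
      by (simp add: W_def \<Lambda>_def J_def[symmetric] sum_distrib_left)
    have yC': "y k + s *\<^sub>R h \<in> C"
    proof -
      let ?c = "c(mh k := s * \<Lambda> k i)"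
      have "(\<Sum>m\<in>insert (mh k) (A k). ?c m *\<^sub>R v m) \<in> C"
      proof (intro C(2)[rule_format])
        have "sum ?c (insert (mh k) (A k)) = s * \<Lambda> k i + sum c (A k)"
          using mh_notin[of k] A(1)[of k] by (simp) (intro sum.cong, auto)
        then show "sum ?c (insert (mh k) (A k)) \<le> R" using R(2)[of k] suml by simp
      qed (use A mh c0 s L0' in auto)
      also have "(\<Sum>m\<in>insert (mh k) (A k). ?c m *\<^sub>R v m) = (s * \<Lambda> k i) *\<^sub>R v (mh k) + (\<Sum>m\<in>A k. c m *\<^sub>R v m)"
        using mh_notin[of k] A(1)[of k] by (simp) (intro sum.cong, auto)
      finally show ?thesis by (simp add: sumv)
    qed
    have gh: "gradF (y k) \<bullet> h = - \<Lambda> k i * g k"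
    proof -
      have "gradF (y k) \<bullet> (\<Sum>m\<in>J. l k m *\<^sub>R v m) = (\<Sum>m\<in>J. - l k m)"
        using active[of _ k] J(2) by (auto simp: inner_sum_right y_def[symmetric] intro!: sum.cong)
      then show ?thesis
        by (simp add: h_def inner_diff_right g_def \<Lambda>_def J_def[symmetric] sum_negf algebra_simps)
    qed
    have "r (Suc k) \<le> F (y k + s *\<^sub>R h) + W k - (F ybar + sum lb I)"
      using step[of k c "s * \<Lambda> k i", OF c0] s L0' by (simp add: sumv suml)
    also have "F (y k + s *\<^sub>R h) \<le> F (y k) + gradF (y k) \<bullet> (s *\<^sub>R h) + L * (norm (s *\<^sub>R h))\<^sup>2"
      using yC yC' by (intro smooth[OF L]) auto
    also have "gradF (y k) \<bullet> (s *\<^sub>R h) = - s * (\<Lambda> k i * g k)" by (simp add: gh)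
    also have "- s * (\<Lambda> k i * g k) \<le> - s * (a * r k)"
    proof -
      have "a * r k \<le> lmin / 2 / sum lb I * (sum lb I * g k)"
        unfolding a_def using gap_le_violation[of k] lmin S by (intro mult_left_mono) auto
      also have "\<dots> = lmin / 2 * g k" using S by simp
      also have "\<dots> \<le> \<Lambda> k i * g k" using elim(3) mhb(1) g_pos[of k] by (intro mult_right_mono) auto
      finally show ?thesis using s by simp
    qed
    also have "L * (norm (s *\<^sub>R h))\<^sup>2 \<le> b * s\<^sup>2 * r k"
    proof -
      have "L * (norm (s *\<^sub>R h))\<^sup>2 = L * (norm h)\<^sup>2 * s\<^sup>2" by (simp add: power_mult_distrib)
      also have "\<dots> \<le> L * (E * r k) * s\<^sup>2" using hn2 L0 by (intro mult_right_mono mult_left_mono) auto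
      also have "\<dots> \<le> b * s\<^sup>2 * r k" using r0 by (simp add: b_def algebra_simps)
      finally show ?thesis .
    qed
    also have "b * s\<^sup>2 * r k \<le> s * a / 2 * r k" using s2 r0 by (rule mult_right_mono)
    finally have "r (Suc k) \<le> (F (y k) + W k - (F ybar + sum lb I)) - s * (a * r k) + s * a / 2 * r k"
      by simp
    then show ?case unfolding r_def[of k, symmetric] by (simp add: algebra_simps)
  qed
  \<comment> \<open>The maximum keeps the rate positive, as \<open>1 - s * a / 2\<close> may fail to be.\<close>
  define \<zeta> where "\<zeta> = max (1 / 2) (1 - s * a / 2)"
  have z: "0 < \<zeta>" "\<zeta> < 1" using s a by (auto simp: \<zeta>_def)
  obtain k0 where k0: "\<And>k. k0 \<le> k \<Longrightarrow> r (Suc k) \<le> (1 - s * a / 2) * r k"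
    using contract by (auto simp: eventually_sequentially)
  have k1: "r (Suc k) \<le> \<zeta> * r k" if "k0 \<le> k" for k
    using k0[OF that] r_nonneg[of k] by (smt (verit) \<zeta>_def max.cobounded2 mult_right_mono)
  have "r k \<le> ((r k0 + 1) / \<zeta> ^ k0) * \<zeta> ^ k" if "k0 \<le> k" for k
    using that
  proof (induction k rule: dec_induct)
    case base then show ?case using z by simp
  next
    case (step k)
    have "r (Suc k) \<le> \<zeta> * r k" using k1 step by auto
    also have "\<dots> \<le> \<zeta> * (((r k0 + 1) / \<zeta> ^ k0) * \<zeta> ^ k)" using step z by (intro mult_left_mono) auto
    finally show ?case by (simp add: mult_ac)
  qed
  then show thesis
    using z r_nonneg[of k0] that[of "(r k0 + 1) / \<zeta> ^ k0" \<zeta>]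
    by (auto simp: eventually_sequentially add_nonneg_pos)
qed

end

section \<open>Uniqueness of the minimizer\<close>

text \<open>
  Orthogonal projection onto the span of \<open>S\<close>, by the Gram--Schmidt step.
\<close>

lemma orthogonal_residual:
  fixes x :: "'y::real_inner"
  assumes "finite S"
  shows "\<exists>p\<in>span S. \<forall>b\<in>S. (x - p) \<bullet> b = 0"
  using assms
proof (induction S arbitrary: x rule: finite_induct)
  case empty
  then show ?case by (intro bexI[of _ 0]) auto
next
  case (insert c S)
  obtain pc where pc: "pc \<in> span S" "\<And>b. b \<in> S \<Longrightarrow> (c - pc) \<bullet> b = 0" using insert.IH[of c] by blast
  obtain px where px: "px \<in> span S" "\<And>b. b \<in> S \<Longrightarrow> (x - px) \<bullet> b = 0" using insert.IH[of x] by blast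
  define d where "d = c - pc"
  define t where "t = (x - px) \<bullet> d / (d \<bullet> d)"
  define p where "p = px + t *\<^sub>R d"
  have orth: "(x - p) \<bullet> b = 0" if "b \<in> S" for b
    using pc(2)[OF that] px(2)[OF that] by (simp add: p_def d_def[symmetric] inner_diff_left inner_add_left)
  have osp: "(x - p) \<bullet> b = 0" if "b \<in> span S" for b
    using that
  proof (induction rule: span_induct_alt)
    case (step a b c) then show ?case using orth by (simp add: inner_add_right)
  qed simp
  have "(x - p) \<bullet> d = 0"
    by (cases "d = 0") (simp_all add: p_def t_def inner_diff_left inner_add_left)
  moreover have "c = d + pc" by (simp add: d_def)
  ultimately have "(x - p) \<bullet> c = 0" using osp[OF pc(1)] by (simp add: inner_add_right)
  moreover have "p \<in> span (insert c S)"
    unfolding p_def d_def using px(1) pc(1) span_mono[of S "insert c S"]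
    by (intro span_add span_scale span_diff) (auto intro: span_base)
  ultimately show ?case using orth by (intro bexI[of _ p]) auto
qed

text \<open>
  \<open>u i\<close> is the normalized residual of \<open>v i\<close> after projection onto the span of the other vectors.
\<close>

lemma dual_vectors:
  fixes v :: "'i \<Rightarrow> 'y::real_inner"
  assumes I: "finite I" and ind: "independent_family I v"
  shows "\<exists>u. \<forall>i\<in>I. \<forall>j\<in>I. u i \<bullet> v j = (if i = j then 1 else 0)"
proof -
  have "\<exists>u. \<forall>j\<in>I. u \<bullet> v j = (if i = j then 1 else 0)" if i: "i \<in> I" for i
  proof -
    let ?S = "v ` (I - {i})"
    obtain p where p: "p \<in> span ?S" "\<And>b. b \<in> ?S \<Longrightarrow> (v i - p) \<bullet> b = 0"
      using orthogonal_residual[of ?S "v i"] I by auto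
    have inj: "inj_on v I" and indep: "independent (v ` I)" using ind by (auto simp: independent_family_def)
    have "v ` I - {v i} = ?S" using inj i by (auto simp: inj_on_def)
    then have "v i \<notin> span ?S" using indep i by (auto simp: dependent_def)
    define w where "w = v i - p"
    have w0: "w \<noteq> 0" using \<open>v i \<notin> span ?S\<close> p(1) by (auto simp: w_def)
    have osp: "w \<bullet> b = 0" if "b \<in> span ?S" for b
      using that
    proof (induction rule: span_induct_alt)
      case (step a b c) then show ?case using p(2) by (simp add: inner_add_right w_def)
    qed simp
    have "w \<bullet> v i = w \<bullet> w" using osp[OF p(1)] by (simp add: w_def inner_diff_right)
    moreover have "w \<bullet> v j = 0" if "j \<in> I" "j \<noteq> i" for j using p(2)[of "v j"] that by (auto simp: w_def)
    ultimately show ?thesis using w0 by (intro exI[of _ "(1 / (w \<bullet> w)) *\<^sub>R w"]) auto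
  qed
  then show ?thesis by metis
qed

locale agcg = kr_problem \<Omega> p \<alpha> \<beta> K Kstar F gradF
  for \<Omega> :: "(real^'n) set" and p \<alpha> \<beta> :: real
    and K :: "(real^'n) signed_measure \<Rightarrow> 'y::real_inner" and Kstar F gradF +
  fixes ybar :: 'y and qbar :: "real^'n \<Rightarrow> real" and N1 N2 :: nat and zs xs ys :: "nat \<Rightarrow> real^'n"
  assumes ybar: "ybar = optimal_observation \<Omega> p \<alpha> \<beta> K F"
    and qbar: "qbar = dual_variable Kstar gradF ybar"
    and B1: "\<exists>N \<theta>. open N \<and> ybar \<in> N \<and> 0 < \<theta> \<and>
      (\<forall>y1\<in>N. \<forall>y2\<in>N. (gradF y1 - gradF y2) \<bullet> (y1 - y2) \<ge> \<theta> * (norm (y1 - y2))\<^sup>2)"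
    and N_pos: "N1 + N2 > 0"
    and zs_inj: "inj_on zs {1..N1}" and xys_inj: "inj_on (\<lambda>j. (xs j, ys j)) {1..N2}"
    and zs_int: "\<And>i. i \<in> {1..N1} \<Longrightarrow> zs i \<in> interior \<Omega>"
    and xys_int: "\<And>j. j \<in> {1..N2} \<Longrightarrow> xs j \<in> interior \<Omega> \<and> ys j \<in> interior \<Omega>"
    and zs_contact: "{z \<in> \<Omega>. \<bar>qbar z\<bar> = \<alpha>} = zs ` {1..N1}"
    and xys_contact: "{w \<in> \<Omega> \<times> \<Omega>. Psi p \<beta> qbar w = 1} = (\<lambda>j. (xs j, ys j)) ` {1..N2}"
    and xys_ne: "\<And>j. j \<in> {1..N2} \<Longrightarrow> xs j \<noteq> ys j"
    and Lip: "continuous_into_Lip \<Omega> Kstar" and C2: "C2_on \<Omega> qbar"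
    and hess_z: "\<And>i. i \<in> {1..N1} \<Longrightarrow> det (hessian qbar (zs i)) \<noteq> 0"
    and hess_xy: "\<And>j. j \<in> {1..N2} \<Longrightarrow> det (hessian2 (Psi p \<beta> qbar) (xs j, ys j)) \<noteq> 0"
    and B4: "independent_family ({1..N1} <+> {1..N2})
      (case_sum (\<lambda>i. K (dirac (zs i))) (\<lambda>j. K (dipole p \<beta> (xs j) (ys j))))"
    and B5: "\<And>\<mu>bar \<zeta> lam.
      \<lbrakk>is_minimizer \<Omega> p \<alpha> \<beta> K F \<mu>bar;
       \<forall>i\<in>{1..N1}. 0 \<le> \<zeta> i; \<forall>j\<in>{1..N2}. 0 \<le> lam j;
       \<mu>bar = (\<Sum>i=1..N1. (qbar (zs i) / \<alpha> * \<zeta> i) *\<^sub>R dirac (zs i)) +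
              (\<Sum>j=1..N2. lam j *\<^sub>R dipole p \<beta> (xs j) (ys j))\<rbrakk>
      \<Longrightarrow> (\<forall>i\<in>{1..N1}. 0 < \<zeta> i) \<and> (\<forall>j\<in>{1..N2}. 0 < lam j)"
begin

lemma qbar_dualvar: "qbar = dualvar ybar"
  by (simp add: qbar dualvar_def)

lemma qbar_cont: "continuous_on \<Omega> qbar"
  unfolding qbar_dualvar by (rule continuous_dualvar)

lemma qbar_feasible: "dual_feasible qbar"
  and pairing_qbar: "\<mu> \<in> measures_on \<Omega> \<Longrightarrow> pairing \<Omega> qbar \<mu> = - gradF ybar \<bullet> K \<mu>"
  using minimizer_exists unfolding qbar_dualvar ybar[symmetric] by (auto simp: pairing_dualvar)

definition Idx :: "(nat + nat) set" where "Idx = {1..N1} <+> {1..N2}"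

definition wb :: "nat + nat \<Rightarrow> (real^'n) \<times> (real^'n) \<times> real" where
  "wb = case_sum (\<lambda>i. (zs i, zs i, sgn (qbar (zs i)))) (\<lambda>j. (xs j, ys j, 0))"

definition \<kappa> :: "nat + nat \<Rightarrow> 'y" where "\<kappa> i = K (atom (wb i))"

lemma finite_Idx: "finite Idx" and Idx_ne: "Idx \<noteq> {}"
  using N_pos by (auto simp: Idx_def)

lemma zs_Om: "i \<in> {1..N1} \<Longrightarrow> zs i \<in> \<Omega>" and xs_Om: "j \<in> {1..N2} \<Longrightarrow> xs j \<in> \<Omega>" and ys_Om: "j \<in> {1..N2} \<Longrightarrow> ys j \<in> \<Omega>"
  using zs_int[of i] xys_int[of j] interior_subset[of \<Omega>] by auto

lemma abs_qbar_zs: "i \<in> {1..N1} \<Longrightarrow> \<bar>qbar (zs i)\<bar> = \<alpha>"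
  using zs_contact by blast

lemma sgn_zs: "i \<in> {1..N1} \<Longrightarrow> sgn (qbar (zs i)) = 1 \<or> sgn (qbar (zs i)) = -1"
  and sgn_zs_eq: "i \<in> {1..N1} \<Longrightarrow> sgn (qbar (zs i)) = qbar (zs i) / \<alpha>"
  using abs_qbar_zs[of i] \<alpha> by (auto simp: sgn_if abs_if split: if_splits)

lemma contact_iff_tight:
  "w \<in> params \<Longrightarrow> lift qbar w = cost w \<longleftrightarrow> lift qbar w / cost w = 1"
  using cost_pos[of w] by auto

lemma contact_set: "{w \<in> params. lift qbar w = cost w} = wb ` Idx"
proof (intro set_eqI iffI)
  fix w assume "w \<in> {w \<in> params. lift qbar w = cost w}"
  then have w: "w \<in> params" "lift qbar w = cost w" by auto
  obtain x y s where ws: "w = (x, y, s)" by (cases w)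
  show "w \<in> wb ` Idx"
  proof (cases "s = 0")
    case True
    then have "Psi p \<beta> qbar (x, y) = 1" using w cost_pos[OF w(1)] by (simp add: Psi_lift ws)
    moreover have "(x, y) \<in> \<Omega> \<times> \<Omega>" using w(1) by (simp add: ws params_def)
    ultimately obtain j where "j \<in> {1..N2}" "(x, y) = (xs j, ys j)" using xys_contact by blast
    then have "w = wb (Inr j)" "Inr j \<in> Idx" using True by (auto simp: ws wb_def Idx_def)
    then show ?thesis by blast
  next
    case False
    then have xs: "x = y" "x \<in> \<Omega>" "s = 1 \<or> s = -1" using w(1) by (auto simp: ws params_def)
    then have q: "s * qbar x = \<alpha>" using w(2) cost_point[OF False, of x] by (auto simp: ws lift_def)
    then have "\<bar>qbar x\<bar> = \<alpha>" using xs(3) \<alpha> by (auto simp: abs_if)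
    then obtain i where i: "i \<in> {1..N1}" "x = zs i" using zs_contact xs(2) by blast
    have "sgn (qbar x) = s" using q xs(3) \<alpha> by (auto simp: sgn_if)
    then have "w = wb (Inl i)" "Inl i \<in> Idx" using i xs by (auto simp: ws wb_def Idx_def)
    then show ?thesis by blast
  qed
next
  fix w assume "w \<in> wb ` Idx"
  then consider (z) i where "i \<in> {1..N1}" "w = (zs i, zs i, sgn (qbar (zs i)))"
    | (d) j where "j \<in> {1..N2}" "w = (xs j, ys j, 0)"
    by (auto simp: Idx_def wb_def)
  then show "w \<in> {w \<in> params. lift qbar w = cost w}"
  proof cases
    case z
    have "w \<in> params" using z zs_Om[OF z(1)] sgn_zs[OF z(1)] by (auto simp: params_def)
    moreover have "lift qbar w = cost w"
      using z sgn_zs[OF z(1)] abs_qbar_zs[OF z(1)] \<alpha> cost_point[of "sgn (qbar (zs i))" "zs i"]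
      by (auto simp: lift_def sgn_if abs_if split: if_splits)
    ultimately show ?thesis by simp
  next
    case d
    have "w \<in> params" using d xs_Om[OF d(1)] ys_Om[OF d(1)] by (auto simp: params_def)
    moreover have "Psi p \<beta> qbar (xs j, ys j) = 1" using xys_contact d(1) by blast
    ultimately show ?thesis using contact_iff_tight by (simp add: Psi_lift d(2))
  qed
qed

lemma wb_params: "i \<in> Idx \<Longrightarrow> wb i \<in> params" and wb_tight: "i \<in> Idx \<Longrightarrow> lift qbar (wb i) = cost (wb i)"
  using contact_set by blast+

lemma wb_inj: "inj_on wb Idx"
proof (rule inj_onI)
  fix i j assume ij: "i \<in> Idx" "j \<in> Idx" "wb i = wb j"
  show "i = j"
  proof (cases i; cases j)
    fix a b assume "i = Inl a" "j = Inl b"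
    then show ?thesis using ij zs_inj by (auto simp: Idx_def wb_def inj_on_def)
  next
    fix a b assume "i = Inl a" "j = Inr b"
    then show ?thesis using ij sgn_zs[of a] by (auto simp: Idx_def wb_def)
  next
    fix a b assume "i = Inr a" "j = Inl b"
    then show ?thesis using ij sgn_zs[of b] by (auto simp: Idx_def wb_def)
  next
    fix a b assume "i = Inr a" "j = Inr b"
    then show ?thesis using ij xys_inj by (auto simp: Idx_def wb_def inj_on_def)
  qed
qed

lemma atom_z: "i \<in> {1..N1} \<Longrightarrow> atom (wb (Inl i)) = (qbar (zs i) / \<alpha> / \<alpha>) *\<^sub>R dirac (zs i)"
proof -
  assume i: "i \<in> {1..N1}"
  define s where "s = sgn (qbar (zs i))"
  have s: "s = 1 \<or> s = -1" "s = qbar (zs i) / \<alpha>" using sgn_zs[OF i] sgn_zs_eq[OF i] by (simp_all add: s_def)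
  have "atom (wb (Inl i)) = (1 / \<alpha>) *\<^sub>R superpose (dirac (zs i, zs i, s))"
    using s(1) cost_point[of s "zs i"] by (auto simp: atom_def wb_def s_def[symmetric])
  also have "superpose (dirac (zs i, zs i, s)) = s *\<^sub>R dirac (zs i)"
    using s(1) by (auto simp: superpose_dirac)
  finally show ?thesis unfolding s(2) by simp
qed

lemma dual_basis: "\<exists>u. \<forall>i\<in>Idx. \<forall>j\<in>Idx. u i \<bullet> \<kappa> j = (if i = j then 1 else 0)"
proof -
  let ?v = "case_sum (\<lambda>i. K (dirac (zs i))) (\<lambda>j. K (dipole p \<beta> (xs j) (ys j)))"
  have "\<exists>u. \<forall>i\<in>Idx. \<forall>j\<in>Idx. u i \<bullet> ?v j = (if i = j then 1 else 0)"
    by (rule dual_vectors[OF finite_Idx B4[folded Idx_def]])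
  then obtain u where u: "\<And>i j. i \<in> Idx \<Longrightarrow> j \<in> Idx \<Longrightarrow> u i \<bullet> ?v j = (if i = j then 1 else 0)"
    by (elim exE) (rule that, blast)
  define c :: "nat + nat \<Rightarrow> real" where "c = case_sum (\<lambda>i. qbar (zs i) / \<alpha> / \<alpha>) (\<lambda>j. 1)"
  have kv: "\<kappa> i = c i *\<^sub>R ?v i" "c i \<noteq> 0" if "i \<in> Idx" for i
  proof -
    have "\<kappa> i = c i *\<^sub>R ?v i \<and> c i \<noteq> 0"
    proof (cases i)
      case (Inl a)
      then have a: "a \<in> {1..N1}" using that by (auto simp: Idx_def)
      have "\<kappa> i = (qbar (zs a) / \<alpha> / \<alpha>) *\<^sub>R K (dirac (zs a))"
        unfolding \<kappa>_def Inl atom_z[OF a] by (rule K_scaleR[OF dirac_measures_on[OF Om_borel zs_Om[OF a]]])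
      moreover have "qbar (zs a) \<noteq> 0" using abs_qbar_zs[OF a] \<alpha> by auto
      ultimately show ?thesis using \<alpha> by (simp add: Inl c_def)
    next
      case (Inr b)
      then show ?thesis by (simp add: \<kappa>_def wb_def atom_dipole c_def)
    qed
    then show "\<kappa> i = c i *\<^sub>R ?v i" "c i \<noteq> 0" by auto
  qed
  show ?thesis
  proof (intro exI[of _ "\<lambda>i. (1 / c i) *\<^sub>R u i"] ballI)
    fix i j assume "i \<in> Idx" "j \<in> Idx"
    then show "(1 / c i) *\<^sub>R u i \<bullet> \<kappa> j = (if i = j then 1 else 0)"
      using u[of i j] kv[of i] kv[of j] by auto
  qed
qed

definition u :: "nat + nat \<Rightarrow> 'y" where
  "u = (SOME u. \<forall>i\<in>Idx. \<forall>j\<in>Idx. u i \<bullet> \<kappa> j = (if i = j then 1 else 0))"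

lemma u: "i \<in> Idx \<Longrightarrow> j \<in> Idx \<Longrightarrow> u i \<bullet> \<kappa> j = (if i = j then 1 else 0)"
  using someI_ex[OF dual_basis] unfolding u_def[symmetric] by blast

definition comb :: "(nat + nat \<Rightarrow> real) \<Rightarrow> (real^'n) signed_measure" where
  "comb c = (\<Sum>i\<in>Idx. c i *\<^sub>R atom (wb i))"

lemma atom_wb_on: "i \<in> Idx \<Longrightarrow> atom (wb i) \<in> measures_on \<Omega>"
  by (intro atom_measures_on wb_params)

lemma comb_on: "comb c \<in> measures_on \<Omega>"
  unfolding comb_def by (intro measures_on_sum measures_on_scaleR atom_wb_on)

lemma K_comb: "K (comb c) = (\<Sum>i\<in>Idx. c i *\<^sub>R \<kappa> i)"
  unfolding comb_def \<kappa>_def by (rule K_combination) (rule atom_wb_on)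

lemma u_comb: "i \<in> Idx \<Longrightarrow> u i \<bullet> K (comb c) = c i"
proof -
  assume i: "i \<in> Idx"
  have "u i \<bullet> K (comb c) = (\<Sum>j\<in>Idx. if i = j then c j else 0)"
    unfolding K_comb inner_sum_right using i by (intro sum.cong) (auto simp: u)
  then show ?thesis using i finite_Idx by simp
qed

lemma tight_kappa:
  assumes i: "i \<in> Idx" shows "- gradF ybar \<bullet> \<kappa> i = 1"
proof -
  have "- gradF ybar \<bullet> \<kappa> i = lift qbar (wb i) / cost (wb i)"
    unfolding \<kappa>_def pairing_qbar[OF atom_wb_on[OF i], symmetric] by (rule pairing_atom[OF wb_params[OF i] qbar_cont])
  then show ?thesis using wb_tight[OF i] cost_pos[OF wb_params[OF i]] by simp
qed

lemma pairing_comb: "pairing \<Omega> qbar (comb c) = sum c Idx"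
proof -
  have "pairing \<Omega> qbar (comb c) = (\<Sum>i\<in>Idx. c i * (- gradF ybar \<bullet> \<kappa> i))"
    unfolding pairing_qbar[OF comb_on] K_comb inner_sum_right by simp
  also have "\<dots> = sum c Idx" by (rule sum.cong[OF refl]) (simp only: tight_kappa mult_1_right)
  finally show ?thesis .
qed

lemma complementary_comb:
  assumes t: "admissible \<tau>" and opt: "tcost \<tau> \<le> pairing \<Omega> qbar (superpose \<tau>)"
  shows "\<exists>c. (\<forall>i\<in>Idx. 0 \<le> c i) \<and> superpose \<tau> = comb c \<and> sum c Idx = tcost \<tau>"
proof -
  have fin: "finite {w \<in> params. lift qbar w = cost w}" unfolding contact_set using finite_Idx by simp
  define c where "c i = smeasure \<tau> {wb i} * cost (wb i)" for i
  have tau: "\<tau> = (\<Sum>i\<in>Idx. smeasure \<tau> {wb i} *\<^sub>R dirac (wb i))"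
    using complementary_finite[OF qbar_feasible t opt fin] unfolding contact_set
    by (simp only: sum.reindex[OF wb_inj] comp_def)
  have "superpose \<tau> = (\<Sum>i\<in>Idx. smeasure \<tau> {wb i} *\<^sub>R superpose (dirac (wb i)))"
    by (subst tau) (simp only: superpose_sum superpose_scaleR)
  also have "\<dots> = comb c"
    unfolding comb_def c_def using wb_params by (intro sum.cong) (auto simp: superpose_dirac_atom)
  finally have s: "superpose \<tau> = comb c" .
  have "tcost \<tau> = (\<Sum>i\<in>Idx. smeasure \<tau> {wb i} * tcost (dirac (wb i)))"
    by (subst tau) (simp only: tcost_lin(2,4))
  also have "\<dots> = sum c Idx" unfolding c_def using wb_params by (intro sum.cong) (auto simp: tcost_lin(5))
  finally have "sum c Idx = tcost \<tau>" ..
  moreover have "0 \<le> c i" if "i \<in> Idx" for i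
    using t cost_pos[OF wb_params[OF that]] by (simp add: c_def admissible_def positive_measure_def)
  ultimately show ?thesis using s by blast
qed

lemma tight_measure_comb:
  assumes m: "\<mu> \<in> measures_on \<Omega>" and opt: "kr \<mu> \<le> pairing \<Omega> qbar \<mu>"
  shows "\<exists>c. (\<forall>i\<in>Idx. 0 \<le> c i) \<and> \<mu> = comb c"
proof -
  obtain \<tau> where t: "admissible \<tau>" "superpose \<tau> = \<mu>" "tcost \<tau> \<le> kr \<mu>" using kr_attained[OF m] by blast
  then show ?thesis using complementary_comb[OF t(1)] opt by force
qed

lemma kr_comb_le: assumes "\<And>i. i \<in> Idx \<Longrightarrow> 0 \<le> c i" shows "kr (comb c) \<le> sum c Idx"
proof -
  define \<tau> where "\<tau> = (\<Sum>i\<in>Idx. (c i / cost (wb i)) *\<^sub>R dirac (wb i))"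
  have a: "admissible \<tau>" unfolding \<tau>_def
    using assms cost_pos[OF wb_params] by (intro admissible_sum admissible_lin wb_params) (auto simp: less_imp_le)
  have s: "superpose \<tau> = comb c"
    unfolding \<tau>_def superpose_sum superpose_scaleR comb_def
    using cost_pos[OF wb_params] wb_params by (intro sum.cong) (auto simp: superpose_dirac_atom less_imp_neq[THEN not_sym])
  have c: "tcost \<tau> = sum c Idx"
    unfolding \<tau>_def tcost_lin(2,4) using cost_pos[OF wb_params] wb_params
    by (intro sum.cong) (auto simp: tcost_lin(5) less_imp_neq[THEN not_sym])
  show ?thesis
    using kr_le_tcost_if_complementary[OF qbar_feasible a] unfolding s c pairing_comb by simp
qed

definition lb :: "nat + nat \<Rightarrow> real" where "lb i = u i \<bullet> ybar"
definition mubar :: "(real^'n) signed_measure" where "mubar = comb lb"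

text \<open>
  The dual basis recovers the weights from the observation.
\<close>

lemma comb_eq_mubar: "K (comb c) = ybar \<Longrightarrow> comb c = mubar"
proof -
  assume k: "K (comb c) = ybar"
  have "c i = lb i" if "i \<in> Idx" for i using u_comb[OF that, of c] by (simp add: k lb_def)
  then show ?thesis unfolding mubar_def comb_def by (intro sum.cong) auto
qed

lemma minimizer_iff: "minimizer \<nu> \<longleftrightarrow> \<nu> = mubar" and K_mubar: "K mubar = ybar"
  and lb_nonneg: "i \<in> Idx \<Longrightarrow> 0 \<le> lb i"
proof -
  obtain \<mu>0 where m0: "minimizer \<mu>0" "\<mu>0 \<in> measures_on \<Omega>" "dual_feasible (dualvar (K \<mu>0))"
    "kr \<mu>0 \<le> pairing \<Omega> (dualvar (K \<mu>0)) \<mu>0" "K \<mu>0 = ybar"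
    using minimizer_exists unfolding ybar[symmetric] by (elim exE conjE) (rule that, auto)
  note cert = certificate[OF m0(2,3,4), unfolded m0(5) qbar_dualvar[symmetric]]
  have eq: "\<nu> = mubar \<and> (\<exists>c. (\<forall>i\<in>Idx. 0 \<le> c i) \<and> \<nu> = comb c)" if mn: "minimizer \<nu>" for \<nu>
  proof -
    obtain c where c: "\<forall>i\<in>Idx. 0 \<le> c i" "\<nu> = comb c"
      using tight_measure_comb[OF cert(4)[OF mn] cert(3)[OF mn]] by blast
    have "K (comb c) = ybar" using cert(2)[OF mn] c(2) by simp
    then show ?thesis using comb_eq_mubar c by blast
  qed
  then have "\<mu>0 = mubar" using m0(1) by blast
  then show "minimizer \<nu> \<longleftrightarrow> \<nu> = mubar" "K mubar = ybar" using m0(1,5) eq by blast+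
  obtain c where c: "\<forall>i\<in>Idx. 0 \<le> c i" "mubar = comb c" using eq[OF m0(1)] by auto
  then show "0 \<le> lb i" if "i \<in> Idx" for i
    using u_comb[OF that, of c] m0(5) \<open>\<mu>0 = mubar\<close> that by (simp add: lb_def)
qed

lemma ybar_sum: "ybar = (\<Sum>i\<in>Idx. lb i *\<^sub>R \<kappa> i)"
  using K_mubar unfolding mubar_def K_comb by simp

lemma J_mubar: "J mubar = F ybar + sum lb Idx"
proof -
  have "kr mubar = sum lb Idx"
    using kr_comb_le[of lb] lb_nonneg weak_duality[OF qbar_feasible comb_on, of lb] pairing_comb[of lb]
    by (simp add: mubar_def antisym)
  then show ?thesis by (simp add: objective_def K_mubar)
qed

lemma lb_pos: assumes "i \<in> Idx" shows "0 < lb i"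
proof -
  define \<zeta> where "\<zeta> i = lb (Inl i) / \<alpha>" for i
  define lam where "lam j = lb (Inr j)" for j
  have "mubar = (\<Sum>i\<in>{1..N1}. lb (Inl i) *\<^sub>R atom (wb (Inl i))) + (\<Sum>j\<in>{1..N2}. lb (Inr j) *\<^sub>R atom (wb (Inr j)))"
    unfolding mubar_def comb_def Idx_def by (subst sum.Plus) auto
  also have "(\<Sum>i\<in>{1..N1}. lb (Inl i) *\<^sub>R atom (wb (Inl i))) = (\<Sum>i=1..N1. (qbar (zs i) / \<alpha> * \<zeta> i) *\<^sub>R dirac (zs i))"
    by (intro sum.cong refl) (simp add: atom_z \<zeta>_def mult.commute)
  also have "(\<Sum>j\<in>{1..N2}. lb (Inr j) *\<^sub>R atom (wb (Inr j))) = (\<Sum>j=1..N2. lam j *\<^sub>R dipole p \<beta> (xs j) (ys j))"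
    by (intro sum.cong refl) (simp add: wb_def atom_dipole lam_def)
  finally have rep: "mubar = (\<Sum>i=1..N1. (qbar (zs i) / \<alpha> * \<zeta> i) *\<^sub>R dirac (zs i)) +
      (\<Sum>j=1..N2. lam j *\<^sub>R dipole p \<beta> (xs j) (ys j))" .
  have "(\<forall>i\<in>{1..N1}. 0 < \<zeta> i) \<and> (\<forall>j\<in>{1..N2}. 0 < lam j)"
  proof (rule B5[OF _ _ _ rep])
    show "minimizer mubar" by (simp add: minimizer_iff)
    show "\<forall>i\<in>{1..N1}. 0 \<le> \<zeta> i" unfolding \<zeta>_def
      using \<alpha> by (intro ballI divide_nonneg_pos lb_nonneg) (auto simp: Idx_def)
    show "\<forall>j\<in>{1..N2}. 0 \<le> lam j" unfolding lam_def by (intro ballI lb_nonneg) (auto simp: Idx_def)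
  qed
  then show ?thesis using assms \<alpha> by (auto simp: Idx_def \<zeta>_def lam_def zero_less_divide_iff)
qed

text \<open>
  By complementarity such a measure is a convex combination of contact atoms, all of which lie in the ball.
  Unless it is one of them, it splits into a contact atom and a remainder, against extremality.
\<close>

lemma extreme_tight_atom:
  assumes ext: "m extreme_point_of KR_ball \<Omega> p \<alpha> \<beta>" and t: "1 \<le> pairing \<Omega> qbar m"
  shows "\<exists>i\<in>Idx. m = atom (wb i)"
proof -
  have m: "m \<in> measures_on \<Omega>" "kr m \<le> 1" using ext by (auto simp: extreme_point_of_def KR_ball_def)
  have ball: "comb c \<in> KR_ball \<Omega> p \<alpha> \<beta>" if "\<And>i. i \<in> Idx \<Longrightarrow> 0 \<le> c i" "sum c Idx = 1" for c
  proof -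
    have "kr (comb c) \<le> sum c Idx" by (rule kr_comb_le) (rule that(1))
    then show ?thesis using that(2) comb_on by (simp add: KR_ball_def)
  qed
  obtain c where c: "\<And>i. i \<in> Idx \<Longrightarrow> 0 \<le> c i" "m = comb c"
    using tight_measure_comb[OF m(1)] m(2) t by force
  have s1: "sum c Idx = 1"
    using t weak_duality[OF qbar_feasible m(1)] m(2) pairing_comb[of c] c(2) by simp
  then obtain i where i: "i \<in> Idx" "c i \<noteq> 0" by (metis sum.neutral zero_neq_one)
  then have ci: "0 < c i" using c(1)[OF i(1)] by simp
  have split: "comb d = d i *\<^sub>R atom (wb i) + (\<Sum>j\<in>Idx - {i}. d j *\<^sub>R atom (wb j))" for d
    unfolding comb_def using sum.remove[OF finite_Idx i(1)] .
  have rest: "sum c (Idx - {i}) = 1 - c i" using s1 sum.remove[OF finite_Idx i(1), of c] by simp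
  show ?thesis
  proof (cases "c i = 1")
    case True
    then have "sum c (Idx - {i}) = 0" using rest by simp
    then have "\<forall>j\<in>Idx - {i}. c j = 0" using finite_Idx c(1) by (subst (asm) sum_nonneg_eq_0_iff) auto
    then have "m = atom (wb i)" unfolding c(2) split using True by simp
    then show ?thesis using i(1) by blast
  next
    case False
    have "0 \<le> sum c (Idx - {i})" using c(1) by (intro sum_nonneg) auto
    then have c1: "c i < 1" using False rest by simp
    define d where "d j = (if j = i then 0 else c j / (1 - c i))" for j
    define e where "e j = (if j = i then 1 else 0 :: real)" for j
    have d1: "sum d Idx = 1"
    proof -
      have "sum d Idx = (\<Sum>j\<in>Idx - {i}. c j / (1 - c i))"
        unfolding sum.remove[OF finite_Idx i(1)] by (simp add: d_def)
      also have "\<dots> = 1" using c1 rest by (simp add: sum_divide_distrib[symmetric])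
      finally show ?thesis .
    qed
    have e1: "sum e Idx = 1" using finite_Idx i(1) by (simp add: e_def)
    have db: "comb d \<in> KR_ball \<Omega> p \<alpha> \<beta>" and eb: "comb e \<in> KR_ball \<Omega> p \<alpha> \<beta>"
      using c(1) c1 by (auto intro!: ball d1 e1 simp: d_def e_def)
    have ne: "comb e \<noteq> comb d" using u_comb[OF i(1), of e] u_comb[OF i(1), of d] by (auto simp: e_def d_def)
    have "m = (1 - (1 - c i)) *\<^sub>R comb e + (1 - c i) *\<^sub>R comb d"
    proof -
      have "(\<Sum>j\<in>Idx - {i}. c j *\<^sub>R atom (wb j)) = (1 - c i) *\<^sub>R (\<Sum>j\<in>Idx - {i}. d j *\<^sub>R atom (wb j))"
        unfolding scaleR_sum_right using c1 by (intro sum.cong) (auto simp: d_def)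
      moreover have "(\<Sum>j\<in>Idx - {i}. e j *\<^sub>R atom (wb j)) = 0" by (intro sum.neutral) (auto simp: e_def)
      ultimately show ?thesis unfolding c(2) split[of c] split[of d] split[of e] by (simp add: d_def e_def)
    qed
    then have "m \<in> open_segment (comb e) (comb d)"
      using ne ci c1 unfolding in_segment by (intro conjI exI[of _ "1 - c i"]) auto
    then show ?thesis using ext db eb by (auto simp: extreme_point_of_def)
  qed
qed

end

section \<open>Quadratic growth near the contact atoms\<close>

lemma powr_locally_lipschitz:
  fixes t0 p :: real assumes "0 < t0"
  shows "\<exists>L>0. \<forall>\<^sub>F t in nhds t0. \<bar>t powr p - t0 powr p\<bar> \<le> L * \<bar>t - t0\<bar>"
proof -
  define D where "D = p * t0 powr (p - 1)"
  have "((\<lambda>t. t powr p) has_real_derivative D) (at t0)"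
    unfolding D_def using assms by (auto intro!: derivative_eq_intros)
  then have d: "((\<lambda>t. t powr p) has_derivative (\<lambda>h. D * h)) (at t0)" by (simp add: has_field_derivative_def)
  then obtain \<delta> where \<delta>: "0 < \<delta>"
    "\<And>y. norm (y - t0) < \<delta> \<Longrightarrow> norm (y powr p - t0 powr p - D * (y - t0)) \<le> 1 * norm (y - t0)"
    unfolding has_derivative_at_alt using zero_less_one by blast
  have "\<bar>t powr p - t0 powr p\<bar> \<le> (\<bar>D\<bar> + 1) * \<bar>t - t0\<bar>" if "dist t t0 < \<delta>" for t
  proof -
    have "\<bar>t powr p - t0 powr p\<bar> \<le> \<bar>t powr p - t0 powr p - D * (t - t0)\<bar> + \<bar>D * (t - t0)\<bar>" by linarith
    also have "\<dots> \<le> 1 * \<bar>t - t0\<bar> + \<bar>D\<bar> * \<bar>t - t0\<bar>"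
      using \<delta>(2)[of t] that by (intro add_mono) (auto simp: dist_real_def abs_mult)
    finally show ?thesis by (simp add: algebra_simps)
  qed
  then show ?thesis using \<delta>(1) by (intro exI[of _ "\<bar>D\<bar> + 1"]) (auto simp: eventually_nhds_metric)
qed

context agcg
begin

lemma Om_nonempty: "\<Omega> \<noteq> {}"
proof (cases "N1 = 0")
  case True
  then have "xs 1 \<in> \<Omega>" using N_pos by (intro xs_Om) simp
  then show ?thesis by blast
next
  case False
  then have "zs 1 \<in> \<Omega>" by (intro zs_Om) simp
  then show ?thesis by blast
qed

lemma Kstar_eval: assumes x: "x \<in> \<Omega>" shows "Kstar v x = v \<bullet> K (dirac x)"
proof -
  have "pairing \<Omega> (Kstar v) (dirac x) = v \<bullet> K (dirac x)"
    using Kstar dirac_measures_on[OF Om_borel x] unfolding is_preadjoint_def by blast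
  then show ?thesis using pairing_plus(6)[OF compact_Om continuous_Kstar x] by simp
qed

lemma Lip_norm_less_imp:
  assumes f: "continuous_on \<Omega> f" and L: "L0-lipschitz_on \<Omega> f" and less: "Lip_norm \<Omega> f < 1"
  shows "1-lipschitz_on \<Omega> f"
proof -
  obtain x0 where x0: "x0 \<in> \<Omega>" using Om_nonempty by blast
  have "compact ((\<lambda>x. \<bar>f x\<bar>) ` \<Omega>)"
    by (rule compact_continuous_image[OF continuous_on_rabs[OF f] compact_Om])
  then have bdd: "bdd_above ((\<lambda>x. \<bar>f x\<bar>) ` \<Omega>)" by (rule bounded_imp_bdd_above[OF compact_imp_bounded])
  have "\<bar>f x0\<bar> \<le> (SUP x\<in>\<Omega>. \<bar>f x\<bar>)" by (rule cSUP_upper[OF x0 bdd])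
  then have "Inf {L. L-lipschitz_on \<Omega> f} < 1" using less unfolding Lip_norm_def by linarith
  moreover have "{L. L-lipschitz_on \<Omega> f} \<noteq> {}" using L by (intro notI) simp
  ultimately obtain L1 where "L1 \<in> {L. L-lipschitz_on \<Omega> f}" "L1 < 1" by (rule cInf_lessD[rotated, THEN bexE])
  then have "L1-lipschitz_on \<Omega> f" "L1 \<le> 1" by simp_all
  then show ?thesis by (rule lipschitz_on_le)
qed

text \<open>
  Continuity of \<open>K\<^sub>*\<close> at 0 gives \<open>\<bar>v \<bullet> (K (dirac x) - K (dirac y))\<bar> \<le> norm (x - y)\<close> for all small \<open>v\<close>; then
  choose \<open>v\<close> parallel to the difference.
\<close>

lemma K_dirac_lipschitz: "\<exists>C>0. \<forall>x\<in>\<Omega>. \<forall>y\<in>\<Omega>. norm (K (dirac x) - K (dirac y)) \<le> C * norm (x - y)"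
proof -
  have "((\<lambda>v. Lip_norm \<Omega> (\<lambda>x. Kstar v x - Kstar 0 x)) \<longlongrightarrow> 0) (at 0)"
    using Lip by (simp add: continuous_into_Lip_def)
  then have "\<forall>\<^sub>F v in at 0. Lip_norm \<Omega> (\<lambda>x. Kstar v x - Kstar 0 x) < 1"
    by (rule order_tendstoD(2)) simp
  then obtain d where d: "0 < d" "\<And>v. v \<noteq> 0 \<Longrightarrow> norm v < d \<Longrightarrow> Lip_norm \<Omega> (\<lambda>x. Kstar v x - Kstar 0 x) < 1"
    unfolding eventually_at by (elim exE conjE) (rule that, assumption, simp add: dist_norm)
  have lip: "\<bar>v \<bullet> (K (dirac x) - K (dirac y))\<bar> \<le> norm (x - y)"
    if v: "v \<noteq> 0" "norm v < d" and xy: "x \<in> \<Omega>" "y \<in> \<Omega>" for v x y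
  proof -
    have ex: "\<exists>L. L-lipschitz_on \<Omega> (Kstar w)" for w using Lip by (simp add: continuous_into_Lip_def)
    obtain L1 where L1: "L1-lipschitz_on \<Omega> (Kstar v)" using ex[of v] by (elim exE)
    obtain L2 where L2: "L2-lipschitz_on \<Omega> (Kstar 0)" using ex[of 0] by (elim exE)
    note L = lipschitz_on_diff[OF L1 L2]
    have "1-lipschitz_on \<Omega> (\<lambda>x. Kstar v x - Kstar 0 x)"
      by (rule Lip_norm_less_imp[OF _ L d(2)[OF v]]) (intro continuous_intros continuous_Kstar)
    from lipschitz_onD[OF this xy] show ?thesis
      by (simp add: dist_norm Kstar_eval xy inner_diff_right)
  qed
  show ?thesis
  proof (intro exI[of _ "2 / d"] conjI ballI)
    show "0 < 2 / d" using d(1) by simp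
    fix x y assume xy: "x \<in> \<Omega>" "y \<in> \<Omega>"
    define k where "k = K (dirac x) - K (dirac y)"
    show "norm (K (dirac x) - K (dirac y)) \<le> 2 / d * norm (x - y)"
    proof (cases "k = 0")
      case True then show ?thesis using d(1) by (simp add: k_def)
    next
      case False
      then have nk: "0 < norm k" by simp
      define v where "v = (d / 2 / norm k) *\<^sub>R k"
      have "v \<noteq> 0" "norm v < d" using False d(1) by (auto simp: v_def)
      from lip[OF this xy] have "\<bar>v \<bullet> k\<bar> \<le> norm (x - y)" by (simp add: k_def)
      moreover have "v \<bullet> k = d / 2 * norm k"
        using nk by (simp add: v_def power2_norm_eq_inner[symmetric] power2_eq_square)
      ultimately have "d / 2 * norm k \<le> norm (x - y)" by linarith
      then show ?thesis using d(1) unfolding k_def[symmetric] by (simp add: field_simps)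
    qed
  qed
qed

text \<open>
  The pairing of \<open>qbar\<close> with an atom, as a function of its parameter.
\<close>

definition G :: "(real^'n) \<times> (real^'n) \<times> real \<Rightarrow> real" where "G w = lift qbar w / cost w"

lemma G_atom: "w \<in> params \<Longrightarrow> - gradF ybar \<bullet> K (atom w) = G w"
  using pairing_qbar[OF atom_measures_on] pairing_atom[OF _ qbar_cont] unfolding G_def by simp

lemma G_le_1: "w \<in> params \<Longrightarrow> G w \<le> 1"
proof -
  assume w: "w \<in> params"
  then have "lift qbar w \<le> cost w" using qbar_feasible unfolding dual_feasible_def by blast
  then show "G w \<le> 1" using cost_pos[OF w] by (simp add: G_def)
qed

lemma G_less_1: "w \<in> params \<Longrightarrow> w \<notin> wb ` Idx \<Longrightarrow> G w < 1"
proof -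
  assume w: "w \<in> params" "w \<notin> wb ` Idx"
  then have "lift qbar w \<noteq> cost w" unfolding contact_set[symmetric] by simp
  moreover have "lift qbar w \<le> cost w" using qbar_feasible w(1) unfolding dual_feasible_def by blast
  ultimately show "G w < 1" using cost_pos[OF w(1)] by (simp add: G_def)
qed

lemma abs_qbar_le: "x \<in> \<Omega> \<Longrightarrow> \<bar>qbar x\<bar> \<le> \<alpha>"
proof -
  assume x: "x \<in> \<Omega>"
  then have "(x, x, 1) \<in> params" "(x, x, -1) \<in> params" by (auto simp: params_def)
  then have "lift qbar (x, x, 1) \<le> cost (x, x, 1)" "lift qbar (x, x, -1) \<le> cost (x, x, -1)"
    using qbar_feasible by (auto simp: dual_feasible_def)
  then show ?thesis using cost_point[of 1 x] cost_point[of "-1" x] by (simp add: lift_def abs_le_iff)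
qed

lemma Psi_le_1: "x \<in> \<Omega> \<Longrightarrow> y \<in> \<Omega> \<Longrightarrow> Psi p \<beta> qbar (x, y) \<le> 1"
  using G_le_1[of "(x, y, 0)"] by (simp add: Psi_lift G_def params_def)

text \<open>
  Parameters near a point mass are point masses of the same sign, since the third entry is discrete. For
  these \<open>1 - G\<close> grows quadratically in the distance, while the observation is Lipschitz in it.
\<close>

lemma growth_point:
  assumes i: "i \<in> {1..N1}"
  shows "\<exists>\<rho>>0. \<exists>B>0. \<forall>w\<in>params. dist w (wb (Inl i)) < \<rho> \<longrightarrow>
    (norm (K (atom w) - \<kappa> (Inl i)))\<^sup>2 \<le> B * (1 - G w)"
proof -
  define s z where "s = sgn (qbar (zs i))" and "z = zs i"
  have s: "s = 1 \<or> s = -1" using sgn_zs[OF i] unfolding s_def .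
  have sz: "s * qbar z = \<alpha>"
    unfolding s_def z_def abs_qbar_zs[OF i, symmetric] abs_sgn by (rule mult.commute)
  have zO: "z \<in> \<Omega>" using zs_Om[OF i] by (simp add: z_def)
  have "\<forall>\<^sub>F x in nhds z. x \<in> interior \<Omega>"
    using zs_int[OF i] by (intro eventually_nhds_in_open) (auto simp: z_def)
  then have "\<forall>\<^sub>F x in nhds z. s * qbar x \<le> s * qbar z"
  proof eventually_elim
    case (elim x)
    then have "\<bar>qbar x\<bar> \<le> \<alpha>" using interior_subset by (intro abs_qbar_le) auto
    then have "qbar x \<le> \<alpha>" "- qbar x \<le> \<alpha>" by (simp_all add: abs_le_iff)
    then show ?case unfolding sz using s by (elim disjE) simp_all
  qed
  then obtain c where c: "0 < c" "\<forall>\<^sub>F x in nhds z. s * qbar x \<le> s * qbar z - c * (norm (x - z))\<^sup>2"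
    using hessian_max_growth[OF C2_on_ex_td[OF C2], of z s] zs_int[OF i] hess_z[OF i] s unfolding z_def by blast
  then obtain \<rho> where \<rho>: "0 < \<rho>" "\<And>x. dist x z < \<rho> \<Longrightarrow> s * qbar x \<le> \<alpha> - c * (norm (x - z))\<^sup>2"
    by (auto simp: eventually_nhds_metric sz)
  obtain C where C: "0 < C" "\<And>x y. x \<in> \<Omega> \<Longrightarrow> y \<in> \<Omega> \<Longrightarrow> norm (K (dirac x) - K (dirac y)) \<le> C * norm (x - y)"
    using K_dirac_lipschitz by blast
  show ?thesis
  proof (rule exI[of _ "min 1 \<rho>"], rule conjI[rotated],
      rule exI[of _ "(C / \<alpha>)\<^sup>2 * (\<alpha> / c)"], intro conjI ballI impI)
    show "0 < min 1 \<rho>" "0 < (C / \<alpha>)\<^sup>2 * (\<alpha> / c)" using \<rho> C c \<alpha> by auto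
    fix w assume w: "w \<in> params" "dist w (wb (Inl i)) < min 1 \<rho>"
    obtain x y t where wd: "w = (x, y, t)" by (cases w)
    have wbi: "wb (Inl i) = (z, z, s)" by (simp add: wb_def z_def s_def)
    have "dist t s \<le> dist (y, t) (z, s)" using dist_snd_le[of "(y, t)" "(z, s)"] by simp
    also have "\<dots> \<le> dist w (wb (Inl i))" using dist_snd_le[of w "(z, z, s)"] by (simp add: wbi wd)
    finally have ts: "dist t s < 1" using w(2) by simp
    have "t = s"
      using w(1) s ts by (auto simp: wd params_def dist_real_def)
    moreover have "x = y" "x \<in> \<Omega>" using w(1) s \<open>t = s\<close> by (auto simp: wd params_def)
    ultimately have wx: "w = (x, x, s)" by (simp add: wd)
    have xz: "dist x z < \<rho>" using dist_fst_le[of w "(z, z, s)"] w(2) by (simp add: wbi wd)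
    have at: "K (atom (x', x', s)) = (s / \<alpha>) *\<^sub>R K (dirac x')" if "x' \<in> \<Omega>" for x'
    proof -
      have "atom (x', x', s) = (s / \<alpha>) *\<^sub>R dirac x'"
        using s cost_point[of s x'] by (auto simp: atom_def superpose_dirac)
      then show ?thesis using K_scaleR[OF dirac_measures_on[OF Om_borel that]] by simp
    qed
    have diff: "K (atom w) - \<kappa> (Inl i) = (s / \<alpha>) *\<^sub>R (K (dirac x) - K (dirac z))"
      unfolding \<kappa>_def wbi wx at[OF \<open>x \<in> \<Omega>\<close>] at[OF zO] by (simp add: scaleR_diff_right)
    have "\<bar>s / \<alpha>\<bar> = 1 / \<alpha>" using s \<alpha> by (elim disjE) simp_all
    then have "norm (K (atom w) - \<kappa> (Inl i)) = norm (K (dirac x) - K (dirac z)) / \<alpha>"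
      unfolding diff norm_scaleR by simp
    then have "norm (K (atom w) - \<kappa> (Inl i)) \<le> C / \<alpha> * norm (x - z)"
      using divide_right_mono[OF C(2)[OF \<open>x \<in> \<Omega>\<close> zO], of \<alpha>] \<alpha> by simp
    then have "(norm (K (atom w) - \<kappa> (Inl i)))\<^sup>2 \<le> (C / \<alpha>)\<^sup>2 * (norm (x - z))\<^sup>2"
      unfolding power_mult_distrib[symmetric] by (intro power_mono) auto
    also have "(norm (x - z))\<^sup>2 \<le> \<alpha> / c * (1 - G w)"
    proof -
      have "G w = s * qbar x / \<alpha>" using s cost_point[of s x] by (auto simp: G_def wx lift_def)
      moreover have "s * qbar x \<le> \<alpha> - c * (norm (x - z))\<^sup>2" using \<rho>(2)[OF xz] .
      ultimately show ?thesis using c(1) \<alpha> by (simp add: field_simps)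
    qed
    finally show "(norm (K (atom w) - \<kappa> (Inl i)))\<^sup>2 \<le> (C / \<alpha>)\<^sup>2 * (\<alpha> / c) * (1 - G w)"
      by (simp add: mult_left_mono mult.assoc)
  qed
qed

text \<open>
  Parameters near a dipole are dipoles. Here the observation depends on the points also through the
  normalizing factor, which is Lipschitz because the two points of a contact dipole are distinct.
\<close>

lemma growth_dipole:
  assumes j: "j \<in> {1..N2}"
  shows "\<exists>\<rho>>0. \<exists>B>0. \<forall>w\<in>params. dist w (wb (Inr j)) < \<rho> \<longrightarrow>
    (norm (K (atom w) - \<kappa> (Inr j)))\<^sup>2 \<le> B * (1 - G w)"
proof -
  define x0 y0 where "x0 = xs j" and "y0 = ys j"
  have O0: "x0 \<in> \<Omega>" "y0 \<in> \<Omega>" using xs_Om[OF j] ys_Om[OF j] by (simp_all add: x0_def y0_def)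
  have ne: "x0 \<noteq> y0" using xys_ne[OF j] by (simp add: x0_def y0_def)
  have P1: "Psi p \<beta> qbar (x0, y0) = 1" using xys_contact j unfolding x0_def y0_def by blast
  have "\<forall>\<^sub>F w in nhds (x0, y0). w \<in> interior \<Omega> \<times> interior \<Omega>"
    using xys_int[OF j] by (intro eventually_nhds_in_open open_Times) (auto simp: x0_def y0_def)
  then have "\<forall>\<^sub>F w in nhds (x0, y0). Psi p \<beta> qbar w \<le> Psi p \<beta> qbar (x0, y0)"
  proof eventually_elim
    case (elim w)
    then show ?case unfolding P1 using interior_subset[of \<Omega>] by (cases w) (auto intro!: Psi_le_1)
  qed
  then obtain c where c: "0 < c"
    "\<forall>\<^sub>F w in nhds (x0, y0). Psi p \<beta> qbar w \<le> 1 - c * (norm (w - (x0, y0)))\<^sup>2"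
    using Psi_growth[of qbar x0 y0 \<beta> p] C2_on_ex_td[OF C2] xys_int[OF j] ne \<beta> hess_xy[OF j] P1
    unfolding x0_def y0_def by auto
  then obtain \<rho> where \<rho>: "0 < \<rho>" "\<And>w. dist w (x0, y0) < \<rho> \<Longrightarrow> Psi p \<beta> qbar w \<le> 1 - c * (norm (w - (x0, y0)))\<^sup>2"
    by (auto simp: eventually_nhds_metric)
  obtain C where C: "0 < C" "\<And>x y. x \<in> \<Omega> \<Longrightarrow> y \<in> \<Omega> \<Longrightarrow> norm (K (dirac x) - K (dirac y)) \<le> C * norm (x - y)"
    using K_dirac_lipschitz by blast
  define t0 where "t0 = norm (x0 - y0)"
  have t0: "0 < t0" using ne by (simp add: t0_def)
  obtain L \<delta> where L: "0 < L" "0 < \<delta>" "\<And>t. dist t t0 < \<delta> \<Longrightarrow> \<bar>t powr p - t0 powr p\<bar> \<le> L * \<bar>t - t0\<bar>"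
    using powr_locally_lipschitz[OF t0, of p] by (auto simp: eventually_nhds_metric)
  define E where "E = 2 * C / \<beta> + C * t0 * (2 * L) / (\<beta> * \<beta>)"
  have E: "0 < E" using C(1) \<beta> t0 L(1) by (auto simp: E_def intro!: add_pos_nonneg)
  show ?thesis
  proof (rule exI[of _ "min 1 (min \<rho> (\<delta> / 2))"], rule conjI[rotated],
      rule exI[of _ "E\<^sup>2 / c"], intro conjI ballI impI)
    show "0 < min 1 (min \<rho> (\<delta> / 2))" "0 < E\<^sup>2 / c" using \<rho> L c E by auto
    fix w assume w: "w \<in> params" "dist w (wb (Inr j)) < min 1 (min \<rho> (\<delta> / 2))"
    obtain x y s where wd: "w = (x, y, s)" by (cases w)
    have wbj: "wb (Inr j) = (x0, y0, 0)" by (simp add: wb_def x0_def y0_def)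
    have "dist s 0 \<le> dist (y, s) (y0, 0)" using dist_snd_le[of "(y, s)" "(y0, 0)"] by simp
    also have "\<dots> \<le> dist w (wb (Inr j))" using dist_snd_le[of w "(x0, y0, 0)"] by (simp add: wbj wd)
    finally have "\<bar>s\<bar> < 1" using w(2) by simp
    then have s0: "s = 0" using w(1) by (auto simp: wd params_def)
    have O: "x \<in> \<Omega>" "y \<in> \<Omega>" using w(1) by (auto simp: wd params_def)
    define n where "n = norm ((x, y) - (x0, y0))"
    have n0: "0 \<le> n" by (simp add: n_def)
    have dn: "dist w (wb (Inr j)) = n"
      by (simp add: wd wbj s0 n_def dist_prod_def norm_prod_def dist_norm)
    have nx: "norm (x - x0) \<le> n" and ny: "norm (y - y0) \<le> n"
      using norm_fst_le[of "x - x0" "y - y0"] norm_snd_le[of "y - y0" "x - x0"] by (simp_all add: n_def)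
    define t where "t = norm (x - y)"
    have tt: "\<bar>t - t0\<bar> \<le> 2 * n"
    proof -
      have "\<bar>t - t0\<bar> \<le> norm ((x - y) - (x0 - y0))" unfolding t_def t0_def by (rule norm_triangle_ineq3)
      also have "(x - y) - (x0 - y0) = (x - x0) - (y - y0)" by simp
      also have "norm \<dots> \<le> norm (x - x0) + norm (y - y0)" by (rule norm_triangle_ineq4)
      finally show ?thesis using nx ny by simp
    qed
    then have "dist t t0 < \<delta>" using w(2) dn by (simp add: dist_real_def)
    from L(3)[OF this] have pp: "\<bar>t powr p - t0 powr p\<bar> \<le> L * (2 * n)"
      using tt L(1) by (meson less_imp_le mult_left_mono order_trans)
    define D D0 where "D = t powr p + \<beta>" and "D0 = t0 powr p + \<beta>"
    have D: "\<beta> \<le> D" "\<beta> \<le> D0" "0 < D" "0 < D0" using \<beta> by (auto simp: D_def D0_def add_nonneg_pos)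
    define a a0 where "a = K (dirac x) - K (dirac y)" and "a0 = K (dirac x0) - K (dirac y0)"
    have at: "K (atom (x', y', 0)) = (1 / (norm (x' - y') powr p + \<beta>)) *\<^sub>R (K (dirac x') - K (dirac y'))"
      if "x' \<in> \<Omega>" "y' \<in> \<Omega>" for x' y'
    proof -
      have on: "dirac x' \<in> measures_on \<Omega>" "dirac y' \<in> measures_on \<Omega>"
        using that by (auto intro: dirac_measures_on Om_borel)
      have "dirac x' - dirac y' = dirac x' + (-1) *\<^sub>R dirac y'" by simp
      then have "K (dirac x' - dirac y') = K (dirac x') - K (dirac y')"
        using K_plus[OF on(1) measures_on_scaleR[OF on(2), of "-1"]] K_scaleR[OF on(2), of "-1"] by simp
      moreover have "atom (x', y', 0) = (1 / (norm (x' - y') powr p + \<beta>)) *\<^sub>R (dirac x' - dirac y')"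
        by (simp add: atom_dipole dipole_def add.commute)
      ultimately show ?thesis using K_scaleR[OF measures_on_minus[OF on]] by simp
    qed
    have "K (atom w) - \<kappa> (Inr j) = (1 / D) *\<^sub>R a - (1 / D0) *\<^sub>R a0"
      unfolding \<kappa>_def wbj wd s0 at[OF O] at[OF O0] D_def D0_def t_def t0_def a_def a0_def ..
    also have "\<dots> = (1 / D) *\<^sub>R (a - a0) + (1 / D - 1 / D0) *\<^sub>R a0"
      by (simp add: algebra_simps)
    also have "norm \<dots> \<le> norm ((1 / D) *\<^sub>R (a - a0)) + norm ((1 / D - 1 / D0) *\<^sub>R a0)" by (rule norm_triangle_ineq)
    also have "norm ((1 / D) *\<^sub>R (a - a0)) \<le> 2 * C / \<beta> * n"
    proof -
      have "a - a0 = (K (dirac x) - K (dirac x0)) - (K (dirac y) - K (dirac y0))" by (simp add: a_def a0_def)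
      then have "norm (a - a0) \<le> norm (K (dirac x) - K (dirac x0)) + norm (K (dirac y) - K (dirac y0))"
        by (simp only: norm_triangle_ineq4)
      also have "\<dots> \<le> C * n + C * n"
        using C(2)[OF O(1) O0(1)] C(2)[OF O(2) O0(2)] mult_left_mono[OF nx, of C] mult_left_mono[OF ny, of C] C(1)
        by (intro add_mono) linarith+
      finally have "norm (a - a0) \<le> 2 * C * n" by simp
      then have "norm (a - a0) / D \<le> (2 * C * n) / \<beta>" using D \<beta> C(1) n0 by (intro frac_le) auto
      then show ?thesis using D by simp
    qed
    also have "norm ((1 / D - 1 / D0) *\<^sub>R a0) \<le> C * t0 * (2 * L) / (\<beta> * \<beta>) * n"
    proof -
      have "\<bar>1 / D - 1 / D0\<bar> = \<bar>D0 - D\<bar> / (D * D0)" using D by (simp add: divide_simps abs_mult)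
      also have "\<dots> \<le> (L * (2 * n)) / (\<beta> * \<beta>)"
        using D \<beta> pp by (intro frac_le mult_mono) (auto simp: D_def D0_def abs_minus_commute)
      finally have "\<bar>1 / D - 1 / D0\<bar> * norm a0 \<le> (L * (2 * n)) / (\<beta> * \<beta>) * (C * t0)"
        using C(2)[OF O0] L(1) n0 \<beta> unfolding a0_def t0_def by (intro mult_mono) auto
      then show ?thesis by (simp add: mult_ac)
    qed
    finally have "norm (K (atom w) - \<kappa> (Inr j)) \<le> E * n" by (simp add: E_def algebra_simps)
    then have "(norm (K (atom w) - \<kappa> (Inr j)))\<^sup>2 \<le> E\<^sup>2 * n\<^sup>2"
      unfolding power_mult_distrib[symmetric] by (intro power_mono) auto
    also have "n\<^sup>2 \<le> (1 - G w) / c"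
    proof -
      have "dist (x, y) (x0, y0) < \<rho>" using w(2) dn by (simp add: n_def dist_norm)
      from \<rho>(2)[OF this] have "G w \<le> 1 - c * n\<^sup>2" by (simp add: G_def wd s0 Psi_lift n_def)
      then show ?thesis using c(1) by (simp add: field_simps)
    qed
    finally show "(norm (K (atom w) - \<kappa> (Inr j)))\<^sup>2 \<le> E\<^sup>2 / c * (1 - G w)"
      by (simp add: mult_left_mono)
  qed
qed

text \<open>
  Away from the finitely many contact parameters \<open>1 - G\<close> is bounded below by compactness.
\<close>

lemma growth_params:
  "\<exists>\<eta> B. 0 < \<eta> \<and> 0 < B \<and> (\<forall>w\<in>params. 1 - G w \<le> \<eta> \<longrightarrow>
     (\<exists>i\<in>Idx. (norm (K (atom w) - \<kappa> i))\<^sup>2 \<le> B * (1 - G w)))"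
proof -
  have "\<exists>\<rho>>0. \<exists>B>0. \<forall>w\<in>params. dist w (wb i) < \<rho> \<longrightarrow> (norm (K (atom w) - \<kappa> i))\<^sup>2 \<le> B * (1 - G w)"
    if "i \<in> Idx" for i
    using that growth_point growth_dipole by (auto simp: Idx_def)
  then obtain \<rho> B where rB: "\<And>i. i \<in> Idx \<Longrightarrow> 0 < \<rho> i" "\<And>i. i \<in> Idx \<Longrightarrow> 0 < B i"
    "\<And>i w. i \<in> Idx \<Longrightarrow> w \<in> params \<Longrightarrow> dist w (wb i) < \<rho> i \<Longrightarrow> (norm (K (atom w) - \<kappa> i))\<^sup>2 \<le> B i * (1 - G w)"
    by metis
  define Bm where "Bm = sum B Idx"
  have Bm: "0 < Bm" unfolding Bm_def using finite_Idx Idx_ne rB(2) by (intro sum_pos) auto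
  have Bi: "B i \<le> Bm" if "i \<in> Idx" for i
    unfolding Bm_def using that finite_Idx rB(2) by (intro member_le_sum) (auto intro: less_imp_le)
  define S where "S = params - (\<Union>i\<in>Idx. ball (wb i) (\<rho> i))"
  have "compact S" unfolding S_def by (intro compact_diff compact_params open_UN ballI open_ball)
  have "continuous_on params G"
    unfolding G_def using cost_pos by (intro continuous_on_divide continuous_lift qbar_cont continuous_cost) fastforce
  then have Gc: "continuous_on S G" by (rule continuous_on_subset) (auto simp: S_def)
  have "\<exists>\<eta>>0. \<forall>w\<in>S. \<eta> < 1 - G w"
  proof (cases "S = {}")
    case True then show ?thesis by (intro exI[of _ 1]) auto
  next
    case False
    obtain m where m: "m \<in> S" "\<And>w. w \<in> S \<Longrightarrow> G w \<le> G m"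
      using continuous_attains_sup[OF \<open>compact S\<close> False Gc] by blast
    have "m \<notin> wb ` Idx" using m(1) rB(1) by (auto simp: S_def)
    then have "G m < 1" using m(1) by (intro G_less_1) (auto simp: S_def)
    then show ?thesis using m(2) by (intro exI[of _ "(1 - G m) / 2"]) (auto simp: field_simps, fastforce)
  qed
  then obtain \<eta> where \<eta>: "0 < \<eta>" "\<And>w. w \<in> S \<Longrightarrow> \<eta> < 1 - G w" by blast
  show ?thesis
  proof (intro exI conjI ballI impI)
    show "0 < \<eta>" "0 < Bm" by fact+
    fix w assume w: "w \<in> params" "1 - G w \<le> \<eta>"
    then have "w \<notin> S" using \<eta>(2)[of w] by auto
    then obtain i where i: "i \<in> Idx" "dist w (wb i) < \<rho> i" using w(1) by (auto simp: S_def dist_commute)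
    have "(norm (K (atom w) - \<kappa> i))\<^sup>2 \<le> B i * (1 - G w)" by (rule rB(3)[OF i(1) w(1) i(2)])
    also have "\<dots> \<le> Bm * (1 - G w)" using Bi[OF i(1)] G_le_1[OF w(1)] by (intro mult_right_mono) auto
    finally show "\<exists>i\<in>Idx. (norm (K (atom w) - \<kappa> i))\<^sup>2 \<le> Bm * (1 - G w)" using i(1) by blast
  qed
qed

end

section \<open>Convergence of the algorithm\<close>

locale agcg_run = agcg \<Omega> p \<alpha> \<beta> K Kstar F gradF ybar qbar N1 N2 zs xs ys
  for \<Omega> :: "(real^'n) set" and p \<alpha> \<beta> :: real
    and K :: "(real^'n) signed_measure \<Rightarrow> 'y::real_inner" and Kstar F gradF
    and ybar :: 'y and qbar N1 N2 zs xs ys +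
  fixes A :: "nat \<Rightarrow> (real^'n) signed_measure set" and \<mu> :: "nat \<Rightarrow> (real^'n) signed_measure"
  assumes run: "AGCG_run \<Omega> p \<alpha> \<beta> K Kstar F gradF A \<mu>"
begin

definition stop :: "nat \<Rightarrow> bool" where "stop k \<longleftrightarrow> AGCG_stops \<Omega> p \<alpha> \<beta> (dualvar (K (\<mu> k)))"

text \<open>
  All measures that can ever become active.
\<close>

definition At :: "(real^'n) signed_measure set" where "At = A 0 \<union> atom ` params"

lemma A0: "finite (A 0)" "m \<in> A 0 \<Longrightarrow> m extreme_point_of KR_ball \<Omega> p \<alpha> \<beta>"
  and first: "resolve K F (A 0) (A 1) (\<mu> 1)"
  and iterate: "1 \<le> k \<Longrightarrow> \<forall>j\<in>{1..k}. \<not> stop j \<Longrightarrow>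
    \<exists>mh. AGCG_atom \<Omega> p \<alpha> \<beta> (dualvar (K (\<mu> k))) mh \<and> resolve K F (A k \<union> {mh}) (A (k + 1)) (\<mu> (k + 1))"
  using run unfolding AGCG_run_def stop_def dualvar_def by blast+

lemma At_unit_costs: "At \<subseteq> unit_costs"
proof
  fix m assume "m \<in> At"
  then consider "m \<in> A 0" | w where "w \<in> params" "m = atom w" by (auto simp: At_def)
  then show "m \<in> unit_costs"
  proof cases
    case 1
    then have "m \<in> KR_ball \<Omega> p \<alpha> \<beta>" using A0(2) by (simp add: extreme_point_of_def)
    then show ?thesis using KR_ball_unit_costs by blast
  next
    case 2
    then show ?thesis by (simp add: atom_unit_costs)
  qed
qed

lemma At_on: "At \<subseteq> measures_on \<Omega>"
  using At_unit_costs unit_costs_on by blast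

definition weights :: "nat \<Rightarrow> ((real^'n) signed_measure \<Rightarrow> real) \<Rightarrow> bool" where
  "weights k l \<longleftrightarrow> (\<forall>m\<in>A k. 0 < l m) \<and> \<mu> k = (\<Sum>m\<in>A k. l m *\<^sub>R m) \<and>
    K (\<mu> k) = (\<Sum>m\<in>A k. l m *\<^sub>R K m) \<and> (\<forall>m\<in>A k. - gradF (K (\<mu> k)) \<bullet> K m = 1)"

lemma first_weights: "finite (A 1) \<and> A 1 \<subseteq> At \<and> (\<exists>l. weights 1 l)"
proof -
  have "A 0 \<subseteq> At" by (simp add: At_def)
  then have "A 0 \<subseteq> measures_on \<Omega>" using At_on by (rule subset_trans)
  from resolve_optimality[OF A0(1) this first] show ?thesis
    unfolding weights_def using A0(1) \<open>A 0 \<subseteq> At\<close> by (meson finite_subset subset_trans)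
qed

lemma next_weights:
  assumes k: "1 \<le> k" and A: "finite (A k)" "A k \<subseteq> At" and go: "\<forall>j\<in>{1..k}. \<not> stop j"
  shows "\<exists>mh l. mh \<in> At \<and> AGCG_atom \<Omega> p \<alpha> \<beta> (dualvar (K (\<mu> k))) mh \<and> weights (Suc k) l \<and>
    finite (A (Suc k)) \<and> A (Suc k) \<subseteq> At \<and>
    (\<forall>c. (\<forall>m\<in>insert mh (A k). 0 \<le> c m) \<longrightarrow> F (K (\<mu> (Suc k))) + sum l (A (Suc k))
      \<le> F (\<Sum>m\<in>insert mh (A k). c m *\<^sub>R K m) + sum c (insert mh (A k)))"
proof -
  obtain mh where at: "AGCG_atom \<Omega> p \<alpha> \<beta> (dualvar (K (\<mu> k))) mh"
    and res: "resolve K F (insert mh (A k)) (A (Suc k)) (\<mu> (Suc k))"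
    using iterate[OF k go] by auto
  have "\<not> AGCG_stops \<Omega> p \<alpha> \<beta> (dualvar (K (\<mu> k)))" using go k by (simp add: stop_def)
  from oracle_atom[OF at this] have mh: "mh \<in> At" by (auto simp: At_def)
  then have sub: "insert mh (A k) \<subseteq> At" using A(2) by simp
  have fin: "finite (insert mh (A k))" using A(1) by simp
  from resolve_optimality[OF fin subset_trans[OF sub At_on] res]
  obtain l where l: "\<forall>m\<in>A (Suc k). 0 < l m" "A (Suc k) \<subseteq> insert mh (A k)"
    "\<mu> (Suc k) = (\<Sum>m\<in>A (Suc k). l m *\<^sub>R m)" "K (\<mu> (Suc k)) = (\<Sum>m\<in>A (Suc k). l m *\<^sub>R K m)"
    "\<forall>m\<in>A (Suc k). - gradF (K (\<mu> (Suc k))) \<bullet> K m = 1"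
    "\<forall>c. (\<forall>m\<in>insert mh (A k). 0 \<le> c m) \<longrightarrow> F (K (\<mu> (Suc k))) + sum l (A (Suc k))
      \<le> F (\<Sum>m\<in>insert mh (A k). c m *\<^sub>R K m) + sum c (insert mh (A k))"
    by (elim exE conjE) (rule that)
  have w: "weights (Suc k) l" unfolding weights_def by (intro conjI l(1,3,4,5))
  show ?thesis
    by (intro exI[of _ mh] exI[of _ l] conjI mh at w l(6) finite_subset[OF l(2) fin] subset_trans[OF l(2) sub])
qed

lemma iterates:
  assumes "1 \<le> k" "\<forall>j\<in>{1..<k}. \<not> stop j"
  shows "finite (A k) \<and> A k \<subseteq> At \<and> (\<exists>l. weights k l)"
  using assms
proof (induction k rule: nat_induct_at_least)
  case base
  show ?case by (rule first_weights)
next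
  case (Suc k)
  have go: "\<forall>j\<in>{1..k}. \<not> stop j" using Suc.prems by auto
  then have "finite (A k)" "A k \<subseteq> At" using Suc.IH by auto
  from next_weights[OF Suc.hyps this go] show ?case by (elim exE conjE) (intro conjI exI; assumption)
qed

lemma terminates_minimizer:
  assumes "AGCG_terminates_at \<Omega> p \<alpha> \<beta> K Kstar gradF \<mu> k"
  shows "minimizer (\<mu> k)"
proof -
  have k: "1 \<le> k" "stop k" "\<forall>j\<in>{1..<k}. \<not> stop j"
    using assms by (simp_all add: AGCG_terminates_at_def stop_def dualvar_def)
  obtain l where l: "weights k l" and sub: "A k \<subseteq> At" using iterates[OF k(1,3)] by blast
  show ?thesis
  proof (rule stopping_optimal[OF subset_trans[OF sub At_unit_costs]])
    show "0 < l m" if "m \<in> A k" for m using l that by (simp add: weights_def)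
    show "\<mu> k = (\<Sum>m\<in>A k. l m *\<^sub>R m)" using l unfolding weights_def by blast
    show "- gradF (K (\<mu> k)) \<bullet> K m = 1" if "m \<in> A k" for m using l that unfolding weights_def by blast
    show "AGCG_stops \<Omega> p \<alpha> \<beta> (dual_variable Kstar gradF (K (\<mu> k)))"
      using k(2) by (simp add: stop_def dualvar_def)
  qed
qed

lemma At_feasible: assumes m: "m \<in> At" shows "- gradF ybar \<bullet> K m \<le> 1"
proof -
  obtain \<tau> where t: "admissible \<tau>" "superpose \<tau> = m" "tcost \<tau> \<le> 1"
    using m At_unit_costs by (auto simp: unit_costs_def)
  have "pairing \<Omega> qbar m \<le> 1" using pairing_superpose_le[OF qbar_feasible t(1)] t(2,3) by simp
  then show ?thesis using pairing_qbar[OF subsetD[OF At_on m]] by simp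
qed

text \<open>
  An extreme point of the ball whose pairing with \<open>qbar\<close> is 1 is a contact atom; the finitely many others
  among the initial measures have a common gap.
\<close>

lemma initial_gap: "\<exists>e>0. \<forall>m\<in>At. 1 - (- gradF ybar \<bullet> K m) \<le> e \<longrightarrow> m \<in> atom ` params"
proof -
  obtain e where e: "0 < e"
    "\<forall>m\<in>A 0. 0 < 1 - (- gradF ybar \<bullet> K m) \<longrightarrow> e < 1 - (- gradF ybar \<bullet> K m)"
    using finite_positive_gap[OF A0(1), of "\<lambda>m. 1 - (- gradF ybar \<bullet> K m)"] by (elim exE conjE)
  have "m \<in> atom ` params" if m: "m \<in> At" "1 - (- gradF ybar \<bullet> K m) \<le> e" for m
  proof (cases "m \<in> A 0")
    case True
    then have "\<not> 0 < 1 - (- gradF ybar \<bullet> K m)" using e(2) m(2) by (meson not_less)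
    then have "1 \<le> pairing \<Omega> qbar m" unfolding pairing_qbar[OF subsetD[OF At_on m(1)]] by linarith
    then obtain i where "i \<in> Idx" "m = atom (wb i)" using extreme_tight_atom[OF A0(2)[OF True]] by blast
    then show ?thesis using wb_params by blast
  next
    case False
    then show ?thesis using m(1) by (simp add: At_def)
  qed
  then show ?thesis using e(1) by blast
qed

lemma growth_At: "\<exists>\<eta> B. 0 < \<eta> \<and> 0 < B \<and> (\<forall>m\<in>At. 1 - (- gradF ybar \<bullet> K m) \<le> \<eta> \<longrightarrow>
    (\<exists>i\<in>Idx. (norm (K m - \<kappa> i))\<^sup>2 \<le> B * (1 - (- gradF ybar \<bullet> K m))))"
proof -
  obtain e where e: "0 < e" "\<forall>m\<in>At. 1 - (- gradF ybar \<bullet> K m) \<le> e \<longrightarrow> m \<in> atom ` params"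
    using initial_gap by (elim exE conjE)
  obtain \<eta> B where g: "0 < \<eta>" "0 < B" "\<forall>w\<in>params. 1 - G w \<le> \<eta> \<longrightarrow>
     (\<exists>i\<in>Idx. (norm (K (atom w) - \<kappa> i))\<^sup>2 \<le> B * (1 - G w))"
    using growth_params by (elim exE conjE)
  show ?thesis
  proof (rule exI[of _ "min e \<eta>"], rule exI[of _ B], intro conjI ballI impI)
    show "0 < min e \<eta>" "0 < B" using e(1) g(1,2) by simp_all
    fix m assume m: "m \<in> At" "1 - (- gradF ybar \<bullet> K m) \<le> min e \<eta>"
    then obtain w where w: "w \<in> params" "m = atom w" using e(2) by auto
    then show "\<exists>i\<in>Idx. (norm (K m - \<kappa> i))\<^sup>2 \<le> B * (1 - (- gradF ybar \<bullet> K m))"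
      using g(3) m(2) G_atom[OF w(1)] by simp
  qed
qed

lemma combos_At: "\<exists>C. compact C \<and> (\<forall>S c. finite S \<longrightarrow> S \<subseteq> At \<longrightarrow> (\<forall>m\<in>S. 0 \<le> c m) \<longrightarrow>
    sum c S \<le> R \<longrightarrow> (\<Sum>m\<in>S. c m *\<^sub>R K m) \<in> C)"
proof (intro exI conjI allI impI, rule K_bounded_compact[of R])
  fix S c assume S: "finite S" "S \<subseteq> At" "\<forall>m\<in>S. 0 \<le> c m" "sum c S \<le> R"
  have "\<exists>\<tau>. admissible \<tau> \<and> superpose \<tau> = (\<Sum>m\<in>S. c m *\<^sub>R m) \<and> tcost \<tau> \<le> sum c S"
    using S(3) by (intro combination_represented subset_trans[OF S(2) At_unit_costs]) blast
  then obtain \<tau> where t: "admissible \<tau>" "superpose \<tau> = (\<Sum>m\<in>S. c m *\<^sub>R m)" "tcost \<tau> \<le> sum c S"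
    by (elim exE conjE)
  have "K (superpose \<tau>) = (\<Sum>m\<in>S. c m *\<^sub>R K m)"
    unfolding t(2) using S(2) At_on by (intro K_combination) blast
  then show "(\<Sum>m\<in>S. c m *\<^sub>R K m) \<in> {K (superpose \<tau>) |\<tau>. admissible \<tau> \<and> tcost \<tau> \<le> R}"
    using t S(4) by (intro CollectI exI[of _ \<tau>]) auto
qed

text \<open>
  The weights of step \<open>k + 1\<close> and the atom inserted at step \<open>k\<close> are chosen together, because optimality of the
  former refers to the latter.
\<close>

lemma infinite_run:
  assumes go: "\<forall>k\<ge>1. \<not> stop k"
  shows "\<exists>l mh. (\<forall>k. weights (Suc k) (l k) \<and> mh k \<in> At \<and>
      AGCG_atom \<Omega> p \<alpha> \<beta> (dualvar (K (\<mu> (Suc k)))) (mh k) \<and>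
      (\<forall>c. (\<forall>m\<in>insert (mh k) (A (Suc k)). 0 \<le> c m) \<longrightarrow>
        F (K (\<mu> (Suc (Suc k)))) + sum (l (Suc k)) (A (Suc (Suc k)))
        \<le> F (\<Sum>m\<in>insert (mh k) (A (Suc k)). c m *\<^sub>R K m) + sum c (insert (mh k) (A (Suc k)))))"
proof -
  have A: "finite (A (Suc k))" "A (Suc k) \<subseteq> At" for k using iterates[of "Suc k"] go by simp_all
  let ?Q = "\<lambda>k mh l. mh \<in> At \<and> AGCG_atom \<Omega> p \<alpha> \<beta> (dualvar (K (\<mu> (Suc k)))) mh \<and> weights (Suc (Suc k)) l \<and>
    (\<forall>c. (\<forall>m\<in>insert mh (A (Suc k)). 0 \<le> c m) \<longrightarrow> F (K (\<mu> (Suc (Suc k)))) + sum l (A (Suc (Suc k)))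
      \<le> F (\<Sum>m\<in>insert mh (A (Suc k)). c m *\<^sub>R K m) + sum c (insert mh (A (Suc k))))"
  have "\<forall>k. \<exists>ml. ?Q k (fst ml) (snd ml)"
  proof
    fix k
    have "1 \<le> Suc k" "\<forall>j\<in>{1..Suc k}. \<not> stop j" using go by simp_all
    from next_weights[OF this(1) A[of k] this(2)] obtain mh l where "?Q k mh l"
      by (elim exE conjE) (rule that, intro conjI)
    then show "\<exists>ml. ?Q k (fst ml) (snd ml)" by (intro exI[of _ "(mh, l)"]) simp
  qed
  then obtain ml where ml: "\<forall>k. ?Q k (fst (ml k)) (snd (ml k))" by (elim choice[elim_format] exE)
  obtain l0 where l0: "weights (Suc 0) l0" using first_weights by auto
  define l where "l k = (case k of 0 \<Rightarrow> l0 | Suc j \<Rightarrow> snd (ml j))" for k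
  show ?thesis
  proof (intro exI[of _ l] exI[of _ "\<lambda>k. fst (ml k)"] allI)
    fix k
    have "weights (Suc k) (l k)" using l0 ml by (cases k) (simp_all add: l_def)
    moreover have "l (Suc k) = snd (ml k)" by (simp add: l_def)
    ultimately show "weights (Suc k) (l k) \<and> fst (ml k) \<in> At \<and>
      AGCG_atom \<Omega> p \<alpha> \<beta> (dualvar (K (\<mu> (Suc k)))) (fst (ml k)) \<and>
      (\<forall>c. (\<forall>m\<in>insert (fst (ml k)) (A (Suc k)). 0 \<le> c m) \<longrightarrow>
        F (K (\<mu> (Suc (Suc k)))) + sum (l (Suc k)) (A (Suc (Suc k)))
        \<le> F (\<Sum>m\<in>insert (fst (ml k)) (A (Suc k)). c m *\<^sub>R K m) + sum c (insert (fst (ml k)) (A (Suc k))))"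
      using ml by simp
  qed
qed

end

locale agcg_infinite = agcg_run \<Omega> p \<alpha> \<beta> K Kstar F gradF ybar qbar N1 N2 zs xs ys A \<mu>
  for \<Omega> :: "(real^'n) set" and p \<alpha> \<beta> :: real
    and K :: "(real^'n) signed_measure \<Rightarrow> 'y::real_inner" and Kstar F gradF
    and ybar :: 'y and qbar N1 N2 zs xs ys A \<mu> +
  fixes l :: "nat \<Rightarrow> (real^'n) signed_measure \<Rightarrow> real" and mh :: "nat \<Rightarrow> (real^'n) signed_measure"
  assumes go: "\<And>k. 1 \<le> k \<Longrightarrow> \<not> stop k"
    and weights_l: "\<And>k. weights (Suc k) (l k)"
    and mh_At: "\<And>k. mh k \<in> At"
    and mh_atom: "\<And>k. AGCG_atom \<Omega> p \<alpha> \<beta> (dualvar (K (\<mu> (Suc k)))) (mh k)"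
    and l_opt: "\<And>k c. (\<And>m. m \<in> insert (mh k) (A (Suc k)) \<Longrightarrow> 0 \<le> c m) \<Longrightarrow>
        F (K (\<mu> (Suc (Suc k)))) + sum (l (Suc k)) (A (Suc (Suc k)))
        \<le> F (\<Sum>m\<in>insert (mh k) (A (Suc k)). c m *\<^sub>R K m) + sum c (insert (mh k) (A (Suc k)))"
begin

lemma A_sub: "finite (A (Suc k))" "A (Suc k) \<subseteq> At"
  using iterates[of "Suc k"] go by simp_all

lemma l_facts: "m \<in> A (Suc k) \<Longrightarrow> 0 < l k m" "\<mu> (Suc k) = (\<Sum>m\<in>A (Suc k). l k m *\<^sub>R m)"
    "(\<Sum>m\<in>A (Suc k). l k m *\<^sub>R K m) = K (\<mu> (Suc k))"
    "m \<in> A (Suc k) \<Longrightarrow> - gradF (K (\<mu> (Suc k))) \<bullet> K m = 1"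
  using weights_l[of k] unfolding weights_def by auto

lemma ratio_dualvar: "w \<in> params \<Longrightarrow> lift (dualvar y) w / cost w = - gradF y \<bullet> K (atom w)"
  using pairing_atom[OF _ continuous_dualvar, of w y] pairing_dualvar[OF atom_measures_on, of w y] by simp

lemma mh_facts: "1 < - gradF (K (\<mu> (Suc k))) \<bullet> K (mh k)"
    "w \<in> params \<Longrightarrow> - gradF (K (\<mu> (Suc k))) \<bullet> K (atom w) \<le> - gradF (K (\<mu> (Suc k))) \<bullet> K (mh k)"
proof -
  have "\<not> AGCG_stops \<Omega> p \<alpha> \<beta> (dualvar (K (\<mu> (Suc k))))" using go[of "Suc k"] by (simp add: stop_def)
  from oracle_atom[OF mh_atom this] obtain v where v: "v \<in> params" "mh k = atom v"
    "1 < lift (dualvar (K (\<mu> (Suc k)))) v / cost v"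
    "\<forall>w'\<in>params. lift (dualvar (K (\<mu> (Suc k)))) w' / cost w' \<le> lift (dualvar (K (\<mu> (Suc k)))) v / cost v"
    by (elim bexE conjE)
  show "1 < - gradF (K (\<mu> (Suc k))) \<bullet> K (mh k)" using v(3) unfolding ratio_dualvar[OF v(1)] v(2) .
  show "- gradF (K (\<mu> (Suc k))) \<bullet> K (atom w) \<le> - gradF (K (\<mu> (Suc k))) \<bullet> K (mh k)" if w: "w \<in> params"
    using v(4)[rule_format, OF w] unfolding ratio_dualvar[OF v(1)] ratio_dualvar[OF w] v(2) .
qed

sublocale scheme: corrective_scheme F gradF ybar K At Idx \<kappa> lb u "\<lambda>k. A (Suc k)" l mh
proof (unfold_locales, goal_cases)
  case 1 then show ?case by (rule F_gradient_strict)
next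
  case 2 show ?case by (rule F_continuous)
next
  case 3 show ?case by (rule F_bdd)
next
  case 4 then show ?case by (rule F_lip)
next
  case 5 show ?case by (rule B1)
next
  case 6 show ?case by (rule combos_At)
next
  case 7 show ?case by (rule finite_Idx)
next
  case 8 show ?case by (rule Idx_ne)
next
  case 9 then show ?case by (rule lb_pos)
next
  case 10 show ?case by (rule ybar_sum)
next
  case 11 then show ?case by (rule u)
next
  case 12 then show ?case by (rule tight_kappa)
next
  case 13 then show ?case by (rule At_feasible)
next
  case 14 show ?case by (rule growth_At)
next
  case 15 show ?case by (rule A_sub)
next
  case 16 show ?case by (rule A_sub)
next
  case 17 show ?case by (rule mh_At)
next
  case 18 then show ?case by (rule l_facts)
next
  case 19 then show ?case unfolding l_facts(3) by (rule l_facts(4))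
next
  case 20 show ?case unfolding l_facts(3) by (rule mh_facts)
next
  case (21 k i) then show ?case unfolding l_facts(3) \<kappa>_def by (intro mh_facts(2) wb_params)
next
  case (22 k c) show ?case unfolding l_facts(3) by (rule l_opt) (rule 22)
qed

lemma y_eq: "scheme.y k = K (\<mu> (Suc k))"
  unfolding scheme.y_def by (rule l_facts(3))

end

context agcg_infinite
begin

lemma atoms_eventually: "\<forall>\<^sub>F k in sequentially. A (Suc k) \<subseteq> atom ` params"
proof -
  obtain e where e: "0 < e" "\<forall>m\<in>At. 1 - (- gradF ybar \<bullet> K m) \<le> e \<longrightarrow> m \<in> atom ` params"
    using initial_gap by (elim exE conjE)
  show ?thesis
    using scheme.active_close[OF e(1)]
  proof eventually_elim
    case (elim k)
    show ?case
    proof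
      fix m assume m: "m \<in> A (Suc k)"
      then have "1 - (- gradF ybar \<bullet> K m) \<le> e" using elim unfolding scheme.qb_def by blast
      then show "m \<in> atom ` params" using e(2) m A_sub(2) by blast
    qed
  qed
qed

text \<open>
  Suppose \<open>(x, y, 0)\<close> and \<open>(y, z, 0)\<close> are active, hence tight for the current dual variable \<open>q\<close>. Then
  \<open>q x - q z\<close> exceeds \<open>cost (x, z, 0)\<close> by at least \<open>\<beta>\<close>. The dual variables converge uniformly on the
  atoms, and the limit \<open>qbar\<close> is feasible, so that this is impossible for large \<open>k\<close>.
\<close>

lemma no_chains:
  "\<forall>\<^sub>F k in sequentially. \<forall>x y z. (x, y, 0) \<in> params \<longrightarrow> (y, z, 0) \<in> params \<longrightarrow>
     atom (x, y, 0) \<in> A (Suc k) \<longrightarrow> atom (y, z, 0) \<notin> A (Suc k)"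
proof -
  obtain M where M: "0 < M" "\<And>m. m \<in> At \<Longrightarrow> norm (K m) \<le> M" by (rule scheme.atoms_bounded, rule that)
  have "bounded (cost ` params)"
    by (rule compact_imp_bounded[OF compact_continuous_image[OF continuous_cost compact_params]])
  then obtain Cm where Cm: "0 < Cm" "\<And>w. w \<in> params \<Longrightarrow> cost w \<le> Cm"
    unfolding bounded_pos by (elim exE conjE) (rule that, assumption, fastforce)
  have "(\<lambda>k. Cm * (norm (gradF (scheme.y k) - gradF ybar) * M)) \<longlonglongrightarrow> Cm * (0 * M)"
    using scheme.grad_tendsto by (intro tendsto_intros) (simp add: tendsto_norm_zero_iff LIM_zero_iff)
  then have "\<forall>\<^sub>F k in sequentially. Cm * (norm (gradF (scheme.y k) - gradF ybar) * M) < \<beta>"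
    by (rule order_tendstoD(2)) (simp add: \<beta>)
  then show ?thesis
  proof eventually_elim
    case (elim k)
    define g where "g = gradF (K (\<mu> (Suc k)))"
    define q where "q = dualvar (K (\<mu> (Suc k)))"
    have small: "Cm * (norm (g - gradF ybar) * M) < \<beta>" using elim by (simp add: y_eq g_def)
    have tight: "lift q w = cost w" if w: "w \<in> params" "atom w \<in> A (Suc k)" for w
      using ratio_dualvar[OF w(1), of "K (\<mu> (Suc k))"] l_facts(4)[OF w(2)] cost_pos[OF w(1)]
      by (simp add: q_def)
    show ?case
    proof (intro allI impI notI)
      fix x y z assume xy: "(x, y, 0) \<in> params" "atom (x, y, 0) \<in> A (Suc k)"
        and yz: "(y, z, 0) \<in> params" "atom (y, z, 0) \<in> A (Suc k)"
      have xz: "(x, z, 0) \<in> params" using xy(1) yz(1) by (simp add: params_def)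
      have "lift q (x, z, 0) = lift q (x, y, 0) + lift q (y, z, 0)" by (simp add: lift_def)
      also have "\<dots> \<ge> cost (x, z, 0) + \<beta>"
        using dist_powr_triangle[of x z y] tight[OF xy] tight[OF yz] by (simp add: cost_dipole)
      finally have lower: "cost (x, z, 0) + \<beta> \<le> lift q (x, z, 0)" .
      define c where "c = cost (x, z, 0)"
      have c: "0 < c" "c \<le> Cm" using cost_pos[OF xz] Cm(2)[OF xz] by (simp_all add: c_def)
      have at: "atom (x, z, 0) \<in> At" using xz by (simp add: At_def)
      have "lift q (x, z, 0) / c = (gradF ybar - g) \<bullet> K (atom (x, z, 0)) + - gradF ybar \<bullet> K (atom (x, z, 0))"
        unfolding c_def q_def ratio_dualvar[OF xz] g_def by (simp add: inner_diff_left)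
      also have "\<dots> \<le> norm (g - gradF ybar) * M + 1"
      proof (intro add_mono At_feasible[OF at])
        have "(gradF ybar - g) \<bullet> K (atom (x, z, 0)) \<le> norm (gradF ybar - g) * norm (K (atom (x, z, 0)))"
          by (rule norm_cauchy_schwarz)
        also have "\<dots> \<le> norm (g - gradF ybar) * M"
          unfolding norm_minus_commute[of "gradF ybar"] by (rule mult_left_mono[OF M(2)[OF at]]) simp
        finally show "(gradF ybar - g) \<bullet> K (atom (x, z, 0)) \<le> norm (g - gradF ybar) * M" .
      qed
      finally have "lift q (x, z, 0) \<le> (norm (g - gradF ybar) * M + 1) * c"
        using c(1) by (simp add: pos_divide_le_eq)
      also have "\<dots> \<le> Cm * (norm (g - gradF ybar) * M) + c"
        using mult_right_mono[OF c(2), of "norm (g - gradF ybar) * M"] M(1) by (simp add: algebra_simps)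
      finally show False using lower small by (simp add: c_def)
    qed
  qed
qed

text \<open>
  For large \<open>k\<close> all active measures are atoms, and the set \<open>X\<close> of sources of active dipoles contains no sink.
\<close>

lemma kr_le_W: "\<forall>\<^sub>F k in sequentially. kr (\<mu> (Suc k)) \<le> scheme.W k"
  using atoms_eventually no_chains
proof eventually_elim
  case (elim k)
  define wof where "wof m = (SOME w. w \<in> params \<and> m = atom w)" for m
  have wof: "wof m \<in> params" "atom (wof m) = m" if "m \<in> A (Suc k)" for m
  proof -
    have "\<exists>w. w \<in> params \<and> m = atom w" using elim(1) that by blast
    then have "wof m \<in> params \<and> m = atom (wof m)" unfolding wof_def by (rule someI_ex)
    then show "wof m \<in> params" "atom (wof m) = m" by simp_all
  qed
  define c where "c m = l k m / cost (wof m)" for m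
  define \<tau> where "\<tau> = (\<Sum>m\<in>A (Suc k). c m *\<^sub>R dirac (wof m))"
  have cw: "cost (wof m) \<noteq> 0" if "m \<in> A (Suc k)" for m using cost_pos[OF wof(1)[OF that]] by simp
  have c0: "0 \<le> c m" if "m \<in> A (Suc k)" for m
    using cost_pos[OF wof(1)[OF that]] l_facts(1)[OF that] by (simp add: c_def)
  have adm: "admissible \<tau>" unfolding \<tau>_def by (intro admissible_sum admissible_lin wof c0)
  have "superpose \<tau> = (\<Sum>m\<in>A (Suc k). l k m *\<^sub>R m)"
    unfolding \<tau>_def superpose_sum superpose_scaleR
    by (intro sum.cong refl) (simp add: superpose_dirac_atom wof cw c_def)
  then have sup: "superpose \<tau> = \<mu> (Suc k)" by (simp add: l_facts(2))
  have "tcost \<tau> = (\<Sum>m\<in>A (Suc k). l k m)"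
    unfolding \<tau>_def tcost_lin(2,4) by (intro sum.cong refl) (simp add: tcost_lin(5) wof cw c_def)
  then have tc: "tcost \<tau> = scheme.W k" by (simp add: scheme.W_def)
  define X where "X = (\<lambda>m. fst (wof m)) ` {m \<in> A (Suc k). sgnp (wof m) = 0}"
  have X: "X \<in> sets borel"
    unfolding X_def using A_sub(1)[of k] by (intro borel_closed finite_imp_closed finite_imageI) simp
  have null: "smeasure \<tau> S = 0" if "\<And>m. m \<in> A (Suc k) \<Longrightarrow> wof m \<notin> S" for S
  proof -
    have "smeasure \<tau> S = (\<Sum>m\<in>A (Suc k). c m * smeasure (dirac (wof m)) S)"
      by (simp add: \<tau>_def smeasure_sum scaleR_signed_measure.rep_eq)
    also have "\<dots> = 0" using that by (intro sum.neutral) (simp add: dirac.rep_eq)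
    finally show ?thesis .
  qed
  have "kr (superpose \<tau>) \<le> tcost \<tau>"
  proof (rule kr_superpose_le[OF adm X])
    show "smeasure \<tau> {w. sgnp w = 0 \<and> fst w \<notin> X} = 0"
      by (rule null) (auto simp: X_def)
    show "smeasure \<tau> {w. sgnp w = 0 \<and> midx w \<in> X} = 0"
    proof (rule null, rule notI)
      fix m assume m: "m \<in> A (Suc k)" "wof m \<in> {w. sgnp w = 0 \<and> midx w \<in> X}"
      then obtain m' where m': "m' \<in> A (Suc k)" "sgnp (wof m') = 0" "midx (wof m) = fst (wof m')"
        by (auto simp: X_def)
      obtain x y s where w: "wof m = (x, y, s)" by (cases "wof m")
      obtain y' z s' where w': "wof m' = (y', z, s')" by (cases "wof m'")
      have eqs: "s = 0" "s' = 0" "y' = y" using m(2) m'(2,3) by (simp_all add: w w')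
      show False
        using elim(2)[rule_format, of x y z] wof[OF m(1)] wof[OF m'(1)] m(1) m'(1)
        by (simp add: w w' eqs)
    qed
  qed
  then show ?case using sup tc by simp
qed

lemma objective_rate:
  "\<exists>C \<zeta>. C > 0 \<and> 0 < \<zeta> \<and> \<zeta> < 1 \<and> (\<forall>\<^sub>F k in sequentially. J (\<mu> k) - J mubar \<le> C * \<zeta> ^ k)"
proof -
  obtain B \<zeta> where B: "0 < B" "0 < \<zeta>" "\<zeta> < 1" "\<forall>\<^sub>F k in sequentially. scheme.r k \<le> B * \<zeta> ^ k"
    by (rule scheme.linear_rate, rule that)
  have "\<forall>\<^sub>F k in sequentially. J (\<mu> (Suc k)) - J mubar \<le> B / \<zeta> * \<zeta> ^ Suc k"
    using B(4) kr_le_W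
  proof eventually_elim
    case (elim k)
    have "J (\<mu> (Suc k)) - J mubar \<le> scheme.r k"
      using elim(2) by (simp add: objective_def[of _ _ _ _ K F "\<mu> (Suc k)"] J_mubar scheme.r_def y_eq)
    also have "\<dots> \<le> B / \<zeta> * \<zeta> ^ Suc k" using elim(1) B(2) by simp
    finally show ?case .
  qed
  then have "\<forall>\<^sub>F k in sequentially. J (\<mu> k) - J mubar \<le> B / \<zeta> * \<zeta> ^ k"
    by (subst (asm) eventually_sequentially_Suc)
  then show ?thesis using B(1-3) by (intro exI[of _ "B / \<zeta>"] exI[of _ \<zeta>] conjI) simp_all
qed

text \<open>
  Every subsequence has a further one along which superpositions representing the iterates converge. The
  limit has observation \<open>ybar\<close> and satisfies complementarity with \<open>qbar\<close>, so that it is a combination of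
  contact atoms and equals \<open>mubar\<close>.
\<close>

lemma weak_star_limit: "weak_star_converges \<Omega> \<mu> mubar"
  unfolding weak_star_converges_def
proof (intro allI impI)
  fix f :: "real^'n \<Rightarrow> real" assume f: "continuous_on \<Omega> f"
  have "\<exists>\<tau>. admissible \<tau> \<and> superpose \<tau> = \<mu> (Suc k) \<and> tcost \<tau> \<le> scheme.W k" for k
    unfolding l_facts(2) scheme.W_def
    by (rule combination_represented[OF subset_trans[OF A_sub(2) At_unit_costs] less_imp_le[OF l_facts(1)]])
  then have "\<forall>k. \<exists>\<tau>. admissible \<tau> \<and> superpose \<tau> = \<mu> (Suc k) \<and> tcost \<tau> \<le> scheme.W k" by (rule allI)
  then obtain \<tau> where t: "\<forall>k. admissible (\<tau> k) \<and> superpose (\<tau> k) = \<mu> (Suc k) \<and> tcost (\<tau> k) \<le> scheme.W k"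
    by (elim choice[elim_format] exE)
  obtain R where R: "0 < R" "\<And>k. scheme.W k \<le> R" by (rule scheme.weights_bounded, rule that)
  let ?X = "\<lambda>k. pairing \<Omega> f (\<mu> (Suc k))"
  have "?X \<longlonglongrightarrow> pairing \<Omega> f mubar"
  proof (rule ccontr)
    assume "\<not> ?X \<longlonglongrightarrow> pairing \<Omega> f mubar"
    then obtain e where e: "0 < e" "\<exists>\<^sub>F k in sequentially. \<not> dist (?X k) (pairing \<Omega> f mubar) < e"
      by (auto simp: tendsto_iff not_eventually)
    then have "infinite {k. \<not> dist (?X k) (pairing \<Omega> f mubar) < e}"
      by (simp add: INFM_iff_infinite cofinite_eq_sequentially[symmetric])
    then obtain s :: "nat \<Rightarrow> nat" where s: "strict_mono s"
      "\<And>n. s n \<in> {k. \<not> dist (?X k) (pairing \<Omega> f mubar) < e}"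
      using infinite_enumerate by blast
    have adm: "admissible (\<tau> (s n))" and bd: "tcost (\<tau> (s n)) \<le> R" for n
      using t R(2)[of "s n"] by (auto intro: order_trans)
    obtain r \<tau>' where r: "strict_mono r" "admissible \<tau>'" "(\<lambda>n. tcost (\<tau> (s (r n)))) \<longlonglongrightarrow> tcost \<tau>'"
      "weak_star_converges \<Omega> (\<lambda>n. superpose (\<tau> (s (r n)))) (superpose \<tau>')"
      using admissible_compact[of "\<lambda>n. \<tau> (s n)", OF adm bd] by (elim exE conjE) (rule that)
    have sr: "strict_mono (\<lambda>n. s (r n))" using strict_mono_o[OF s(1) r(1)] by (simp add: o_def)
    have "(\<lambda>n. K (superpose (\<tau> (s (r n))))) \<longlonglongrightarrow> K (superpose \<tau>')"
      by (rule K_superpose_conv[OF _ r(2,4)]) (use t in blast)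
    moreover have "(\<lambda>n. K (superpose (\<tau> (s (r n))))) \<longlonglongrightarrow> ybar"
      using LIMSEQ_subseq_LIMSEQ[OF scheme.y_tendsto sr] t by (simp add: o_def y_eq)
    ultimately have Kt: "K (superpose \<tau>') = ybar" by (rule LIMSEQ_unique)
    have "(\<lambda>n. scheme.W (s (r n))) \<longlonglongrightarrow> sum lb Idx"
      using LIMSEQ_subseq_LIMSEQ[OF scheme.W_tendsto sr] by (simp add: o_def)
    then have "tcost \<tau>' \<le> sum lb Idx" using t by (intro LIMSEQ_le[OF r(3)] exI[of _ 0]) auto
    also have "sum lb Idx = pairing \<Omega> qbar mubar" unfolding mubar_def pairing_comb ..
    also have "\<dots> = pairing \<Omega> qbar (superpose \<tau>')"
      unfolding pairing_qbar[OF admissible_superpose[OF r(2)]] Kt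
        mubar_def pairing_qbar[OF comb_on] K_mubar[unfolded mubar_def] ..
    finally obtain c where c: "superpose \<tau>' = comb c" using complementary_comb[OF r(2)] by blast
    then have lim: "superpose \<tau>' = mubar" using comb_eq_mubar Kt by simp
    have "(\<lambda>n. ?X (s (r n))) \<longlonglongrightarrow> pairing \<Omega> f mubar"
      using r(4)[unfolded weak_star_converges_def, rule_format, OF f] t by (simp add: lim)
    then obtain n where "dist (?X (s (r n))) (pairing \<Omega> f mubar) < e"
      using e(1) by (auto simp: LIMSEQ_def)
    then show False using s(2)[of "r n"] by simp
  qed
  then show "(\<lambda>k. pairing \<Omega> f (\<mu> k)) \<longlonglongrightarrow> pairing \<Omega> f mubar" by (rule LIMSEQ_imp_Suc)
qed

end

context agcg_run
begin

lemma infinite_run_converges: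
  assumes "\<And>k. \<not> AGCG_terminates_at \<Omega> p \<alpha> \<beta> K Kstar gradF \<mu> k"
  shows "(\<exists>C \<zeta>. C > 0 \<and> 0 < \<zeta> \<and> \<zeta> < 1 \<and> (\<forall>\<^sub>F k in sequentially. J (\<mu> k) - J mubar \<le> C * \<zeta> ^ k)) \<and>
    weak_star_converges \<Omega> \<mu> mubar"
proof -
  have go: "\<not> stop k" if "1 \<le> k" for k
    using that
  proof (induction k rule: less_induct)
    case (less k)
    then have "\<forall>j\<in>{1..<k}. \<not> stop j" by simp
    then show ?case
      using assms[of k] less.prems unfolding AGCG_terminates_at_def stop_def dualvar_def by blast
  qed
  then have go': "\<forall>k\<ge>1. \<not> stop k" by blast
  obtain l mh where lm: "\<forall>k. weights (Suc k) (l k) \<and> mh k \<in> At \<and>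
      AGCG_atom \<Omega> p \<alpha> \<beta> (dualvar (K (\<mu> (Suc k)))) (mh k) \<and>
      (\<forall>c. (\<forall>m\<in>insert (mh k) (A (Suc k)). 0 \<le> c m) \<longrightarrow>
        F (K (\<mu> (Suc (Suc k)))) + sum (l (Suc k)) (A (Suc (Suc k)))
        \<le> F (\<Sum>m\<in>insert (mh k) (A (Suc k)). c m *\<^sub>R K m) + sum c (insert (mh k) (A (Suc k))))"
    using infinite_run[OF go'] by (elim exE)
  interpret agcg_infinite \<Omega> p \<alpha> \<beta> K Kstar F gradF ybar qbar N1 N2 zs xs ys A \<mu> l mh
  proof (unfold_locales, goal_cases)
    case (1 k) then show ?case by (rule go)
  next
    case (2 k) show ?case using lm by blast
  next
    case (3 k) show ?case using lm by blast
  next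
    case (4 k) show ?case using lm by blast
  next
    case (5 k c)
    have "\<forall>c. (\<forall>m\<in>insert (mh k) (A (Suc k)). 0 \<le> c m) \<longrightarrow>
        F (K (\<mu> (Suc (Suc k)))) + sum (l (Suc k)) (A (Suc (Suc k)))
        \<le> F (\<Sum>m\<in>insert (mh k) (A (Suc k)). c m *\<^sub>R K m) + sum c (insert (mh k) (A (Suc k)))"
      by (rule lm[rule_format, THEN conjunct2, THEN conjunct2, THEN conjunct2])
    then show ?case by (rule allE[of _ c]) (erule mp, intro ballI 5)
  qed
  show ?thesis by (intro conjI objective_rate weak_star_limit)
qed

end

theorem theorem3p14:
  fixes \<Omega> :: "(real^'n) set" and p \<alpha> \<beta> :: real
    and K :: "(real^'n) signed_measure \<Rightarrow> 'y::{real_inner, complete_space}"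
    and Kstar :: "'y \<Rightarrow> real^'n \<Rightarrow> real"
    and F :: "'y \<Rightarrow> real" and gradF :: "'y \<Rightarrow> 'y"
    and ybar :: 'y and qbar :: "real^'n \<Rightarrow> real"
    and N1 N2 :: nat and zs xs ys :: "nat \<Rightarrow> real^'n"
    and A :: "nat \<Rightarrow> (real^'n) signed_measure set" and \<mu> :: "nat \<Rightarrow> (real^'n) signed_measure"
  assumes Omega: "convex \<Omega>" "compact \<Omega>"
    and params: "0 < p" "p \<le> 1" "0 < \<alpha>" "0 < \<beta>" "0 < 2 * \<alpha> - \<beta>"
    and K: "linear_on_measures \<Omega> K" "weak_star_to_strong_continuous \<Omega> K"
    and Kstar: "is_preadjoint \<Omega> K Kstar"
    and F: "strictly_convex F" "bdd_below (range F)" "\<And>y. GDERIV F y :> gradF y"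
      "\<And>C. compact C \<Longrightarrow> \<exists>L. L-lipschitz_on C gradF"
    and ybar: "ybar = optimal_observation \<Omega> p \<alpha> \<beta> K F"
    and qbar: "qbar = dual_variable Kstar gradF ybar"
    and B1: "\<exists>N \<theta>. open N \<and> ybar \<in> N \<and> 0 < \<theta> \<and>
      (\<forall>y1\<in>N. \<forall>y2\<in>N. (gradF y1 - gradF y2) \<bullet> (y1 - y2) \<ge> \<theta> * (norm (y1 - y2))\<^sup>2)"
    and B2: "N1 + N2 > 0"
      "inj_on zs {1..N1}" "inj_on (\<lambda>j. (xs j, ys j)) {1..N2}"
      "\<And>i. i \<in> {1..N1} \<Longrightarrow> zs i \<in> interior \<Omega>"
      "\<And>j. j \<in> {1..N2} \<Longrightarrow> xs j \<in> interior \<Omega> \<and> ys j \<in> interior \<Omega>"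
      "{z \<in> \<Omega>. \<bar>qbar z\<bar> = \<alpha>} = zs ` {1..N1}"
      "{w \<in> \<Omega> \<times> \<Omega>. Psi p \<beta> qbar w = 1} = (\<lambda>j. (xs j, ys j)) ` {1..N2}"
      "\<And>j. j \<in> {1..N2} \<Longrightarrow>
         0 < norm (xs j - ys j) powr p \<and> norm (xs j - ys j) powr p < 2 * \<alpha> - \<beta>"
    and B3: "continuous_into_Lip \<Omega> Kstar" "C2_on \<Omega> qbar"
      "\<And>i. i \<in> {1..N1} \<Longrightarrow> det (hessian qbar (zs i)) \<noteq> 0"
      "\<And>j. j \<in> {1..N2} \<Longrightarrow> det (hessian2 (Psi p \<beta> qbar) (xs j, ys j)) \<noteq> 0"
    and B4: "independent_family ({1..N1} <+> {1..N2})
      (case_sum (\<lambda>i. K (dirac (zs i))) (\<lambda>j. K (dipole p \<beta> (xs j) (ys j))))"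
    and B5: "\<And>\<mu>bar \<zeta> lam.
      \<lbrakk>is_minimizer \<Omega> p \<alpha> \<beta> K F \<mu>bar;
       \<forall>i\<in>{1..N1}. 0 \<le> \<zeta> i; \<forall>j\<in>{1..N2}. 0 \<le> lam j;
       \<mu>bar = (\<Sum>i=1..N1. (qbar (zs i) / \<alpha> * \<zeta> i) *\<^sub>R dirac (zs i)) +
              (\<Sum>j=1..N2. lam j *\<^sub>R dipole p \<beta> (xs j) (ys j))\<rbrakk>
      \<Longrightarrow> (\<forall>i\<in>{1..N1}. 0 < \<zeta> i) \<and> (\<forall>j\<in>{1..N2}. 0 < lam j)"
    and run: "AGCG_run \<Omega> p \<alpha> \<beta> K Kstar F gradF A \<mu>"
  shows "\<exists>\<mu>bar. (\<forall>\<nu>. is_minimizer \<Omega> p \<alpha> \<beta> K F \<nu> \<longleftrightarrow> \<nu> = \<mu>bar) \<and>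
    ((\<exists>k. AGCG_terminates_at \<Omega> p \<alpha> \<beta> K Kstar gradF \<mu> k \<and> is_minimizer \<Omega> p \<alpha> \<beta> K F (\<mu> k)) \<or>
     ((\<forall>k. \<not> AGCG_terminates_at \<Omega> p \<alpha> \<beta> K Kstar gradF \<mu> k) \<and>
      (\<exists>C \<zeta>. C > 0 \<and> 0 < \<zeta> \<and> \<zeta> < 1 \<and>
        (\<forall>\<^sub>F k in sequentially.
           objective \<Omega> p \<alpha> \<beta> K F (\<mu> k) - objective \<Omega> p \<alpha> \<beta> K F \<mu>bar \<le> C * \<zeta> ^ k)) \<and>
      weak_star_converges \<Omega> \<mu> \<mu>bar))"
proof -
  interpret agcg_run \<Omega> p \<alpha> \<beta> K Kstar F gradF ybar qbar N1 N2 zs xs ys A \<mu>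
  proof (unfold_locales, goal_cases)
    case 1 show ?case by (rule Omega(2))
  next
    case 2 show ?case by (rule params(1))
  next
    case 3 show ?case by (rule params(2))
  next
    case 4 show ?case by (rule params(3))
  next
    case 5 show ?case by (rule params(4))
  next
    case 6 show ?case by (rule K(1))
  next
    case 7 show ?case by (rule K(2))
  next
    case 8 show ?case by (rule Kstar)
  next
    case 9 show ?case by (rule F(1))
  next
    case 10 show ?case by (rule F(2))
  next
    case 11 show ?case by (rule F(3))
  next
    case 12 then show ?case by (rule F(4))
  next
    case 13 show ?case by (rule ybar)
  next
    case 14 show ?case by (rule qbar)
  next
    case 15 show ?case by (rule B1)
  next
    case 16 show ?case by (rule B2(1))
  next
    case 17 show ?case by (rule B2(2))
  next
    case 18 show ?case by (rule B2(3))
  next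
    case (19 i) then show ?case by (rule B2(4))
  next
    case (20 j) then show ?case by (rule B2(5))
  next
    case 21 show ?case by (rule B2(6))
  next
    case 22 show ?case by (rule B2(7))
  next
    case (23 j) then show ?case using B2(8)[of j] params(1) by auto
  next
    case 24 show ?case by (rule B3(1))
  next
    case 25 show ?case by (rule B3(2))
  next
    case (26 i) then show ?case by (rule B3(3))
  next
    case (27 j) then show ?case by (rule B3(4))
  next
    case 28 show ?case by (rule B4)
  next
    case (29 \<mu>bar \<zeta> lam) then show ?case by (rule B5)
  next
    case 30 show ?case by (rule run)
  qed
  show ?thesis
  proof (intro exI[of _ mubar] conjI allI)
    show "minimizer \<nu> \<longleftrightarrow> \<nu> = mubar" for \<nu> by (rule minimizer_iff)
    show "(\<exists>k. AGCG_terminates_at \<Omega> p \<alpha> \<beta> K Kstar gradF \<mu> k \<and> minimizer (\<mu> k)) \<or>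
     ((\<forall>k. \<not> AGCG_terminates_at \<Omega> p \<alpha> \<beta> K Kstar gradF \<mu> k) \<and>
      (\<exists>C \<zeta>. C > 0 \<and> 0 < \<zeta> \<and> \<zeta> < 1 \<and>
        (\<forall>\<^sub>F k in sequentially. J (\<mu> k) - J mubar \<le> C * \<zeta> ^ k)) \<and> weak_star_converges \<Omega> \<mu> mubar)"
    proof (cases "\<exists>k. AGCG_terminates_at \<Omega> p \<alpha> \<beta> K Kstar gradF \<mu> k")
      case True
      then show ?thesis using terminates_minimizer by blast
    next
      case False
      then have never: "\<not> AGCG_terminates_at \<Omega> p \<alpha> \<beta> K Kstar gradF \<mu> k" for k by blast
      show ?thesis by (intro disjI2 conjI allI never infinite_run_converges[THEN conjunct1] infinite_run_converges[THEN conjunct2])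
    qed
  qed
qed

end
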